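(* Let $d\ge 2$, let $C\subset\mathbb{R}^d$ be a closed strictly convex cone with apex at $0$ and nonempty interior, and let $\beta=(\mathcal V,\Omega,g)$ be a linear family of $C$-coconvex bodies with $d-2$ marked points $v_1,\dots,v_{d-2}\in\Omega$ (with $\Omega$ nonempty). Let $\mathrm{Vol}_\beta$ be its volume polynomial, a homogeneous polynomial of degree $d$ on $\mathcal V$, and put $$B^C_\beta(u_1,u_2)=\frac1{d!}L_{u_1}L_{u_2}L_{v_1}\cdots L_{v_{d-2}}(\mathrm{Vol}_\beta),\qquad Q^C_\beta(u)=B^C_\beta(u,u)\qquad(u_1,u_2,u\in\mathcal V).$$ Then the quadratic form $Q^C_\beta$ is non-negative, i.e. $Q^C_\beta(u)\ge 0$ for all $u\in\mathcal V$. In particular, for all $u_1,u_2\in\mathcal V$, $$B^C_\beta(u_1,u_2)^2\le B^C_\beta(u_1,u_1)\,B^C_\beta(u_2,u_2).$$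
   Context: A cone is strictly convex if it is convex and contains no line. For a closed convex subset $\Delta\subset C$ such that $C\setminus\Delta$ is bounded and nonempty, the set $A=C\setminus(\Delta\cup\{0\})$ is called a $C$-coconvex body; $\Delta$ is recovered from $A$ as the unbounded component of $C\setminus A$ and is denoted $\Delta_A$. For $C$-coconvex bodies $A,B$, define $A\oplus B=C\setminus((\Delta_A+\Delta_B)\cup\{0\})$, where $+$ is the Minkowski sum; for $\lambda>0$, $\lambda A=\{\lambda a: a\in A\}$. A linear family of $C$-coconvex bodies $\beta=(\mathcal V,\Omega,g)$ consists of a real vector space $\mathcal V$, an open subset $\Omega\subset\mathcal V$ (for infinite-dimensional $\mathcal V$, open means that the intersection with every finite-dimensional affine subspace is open in that subspace), and a map $g$ from $\Omega$ to the set of all $C$-coconvex bodies such that $g(\lambda_1v_1+\dots+\lambda_nv_n)=\lambda_1g(v_1)\oplus\dots\oplus\lambda_ng(v_n)$ whenever all $v_i\in\Omega$, all $\lambda_i>0$ and $\lambda_1v_1+\dots+\lambda_nv_n\in\Omega$. A linear family with $m$ marked points is a linear family together with a choice of $m$ elements of $\Omega$ (not necessarily distinct). The volume function $\mathrm{Vol}_\beta$ is defined on $\Omega$ by letting $\mathrm{Vol}_\beta(v)$ be the $d$-dimensional volume (Lebesgue measure) of $g(v)$; it extends uniquely to a homogeneous polynomial of degree $d$ on $\mathcal V$, also denoted $\mathrm{Vol}_\beta$. For $v\in\mathcal V$, $L_v$ is the directional derivative along $v$, acting on polynomials on $\mathcal V$. Thus $B_\beta^C(u_1,u_2)$ is a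 real number, since a homogeneous differential operator of order $d$ with constant coefficients is applied to a homogeneous polynomial of degree $d$. *)

theory Defs
  imports "HOL-Analysis.Analysis" "HOL-Library.Set_Algebras"
begin

definition contains_line :: "'a::real_vector set \<Rightarrow> bool" where
  "contains_line S \<longleftrightarrow> (\<exists>p v. v \<noteq> 0 \<and> (\<forall>t. p + t *\<^sub>R v \<in> S))"

definition strictly_convex_cone :: "'a::real_vector set \<Rightarrow> bool" where
  "strictly_convex_cone C \<longleftrightarrow> cone C \<and> convex C \<and> \<not> contains_line C"

definition coconvex_body :: "'a::euclidean_space set \<Rightarrow> 'a set \<Rightarrow> bool" where
  "coconvex_body C A \<longleftrightarrow>
     (\<exists>\<Delta>. closed \<Delta> \<and> convex \<Delta> \<and> \<Delta> \<subseteq> C \<and> bounded (C - \<Delta>) \<and> C - \<Delta> \<noteq> {} \<and>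
          A = C - (\<Delta> \<union> {0}))"

definition coconvex_delta :: "'a::euclidean_space set \<Rightarrow> 'a set \<Rightarrow> 'a set" where
  "coconvex_delta C A = (THE D. D \<in> components (C - A) \<and> \<not> bounded D)"

text \<open>The sum of sets below is the Minkowski sum.\<close>

definition coconvex_add :: "'a::euclidean_space set \<Rightarrow> 'a set \<Rightarrow> 'a set \<Rightarrow> 'a set" where
  "coconvex_add C A B = C - ((coconvex_delta C A + coconvex_delta C B) \<union> {0})"

text \<open>The sum \<open>F 0 \<oplus> \<dots> \<oplus> F n\<close> of \<open>n + 1\<close> coconvex bodies. There is no empty sum,
  since \<open>\<oplus>\<close> has no neutral element among coconvex bodies.\<close>

primrec coconvex_sum :: "'a::euclidean_space set \<Rightarrow> (nat \<Rightarrow> 'a set) \<Rightarrow> nat \<Rightarrow> 'a set" where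
  "coconvex_sum C F 0 = F 0"
| "coconvex_sum C F (Suc n) = coconvex_add C (coconvex_sum C F n) (F (Suc n))"

text \<open>The intersection of \<open>\<Omega>\<close> with every finite-dimensional affine subspace is open in that
  subspace. The subspace is written as \<open>p + span B\<close> with \<open>B\<close> finite and linearly independent,
  and carries the topology given by the coordinates with respect to \<open>p\<close> and \<open>B\<close>.\<close>

definition finitely_open :: "'v::real_vector set \<Rightarrow> bool" where
  "finitely_open \<Omega> \<longleftrightarrow>
     (\<forall>p B. finite B \<and> independent B \<longrightarrow>
        openin (product_topology (\<lambda>_. euclideanreal) B)
          {t \<in> B \<rightarrow>\<^sub>E UNIV. p + (\<Sum>b\<in>B. t b *\<^sub>R b) \<in> \<Omega>})"

definition linear_family ::
  "'a::euclidean_space set \<Rightarrow> 'v::real_vector set \<Rightarrow> ('v \<Rightarrow> 'a set) \<Rightarrow> bool" where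
  "linear_family C \<Omega> g \<longleftrightarrow>
     finitely_open \<Omega> \<and>
     (\<forall>v\<in>\<Omega>. coconvex_body C (g v)) \<and>
     (\<forall>n v c. (\<forall>i\<le>n. v i \<in> \<Omega> \<and> c i > 0) \<and> (\<Sum>i\<le>n. c i *\<^sub>R v i) \<in> \<Omega> \<longrightarrow>
        g (\<Sum>i\<le>n. c i *\<^sub>R v i) = coconvex_sum C (\<lambda>i. (\<lambda>x. c i *\<^sub>R x) ` g (v i)) n)"

text \<open>A function on a possibly infinite-dimensional space is a homogeneous polynomial of
  degree \<open>d\<close> if its restriction to every finite-dimensional subspace is one in linear coordinates.
  The functions \<open>\<alpha>\<close> are the exponents of the monomials of total degree \<open>d\<close>.\<close>

definition homogeneous_polynomial :: "nat \<Rightarrow> ('v::real_vector \<Rightarrow> real) \<Rightarrow> bool" where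
  "homogeneous_polynomial d P \<longleftrightarrow>
     (\<forall>B. finite B \<and> independent B \<longrightarrow>
        (\<exists>a :: ('v \<Rightarrow> nat) \<Rightarrow> real. \<forall>t :: 'v \<Rightarrow> real.
           P (\<Sum>b\<in>B. t b *\<^sub>R b) =
             (\<Sum>\<alpha> | \<alpha> \<in> B \<rightarrow>\<^sub>E {..d} \<and> sum \<alpha> B = d. a \<alpha> * (\<Prod>b\<in>B. t b ^ \<alpha> b))))"

definition vol_poly :: "'v::real_vector set \<Rightarrow> ('v \<Rightarrow> 'a::euclidean_space set) \<Rightarrow> 'v \<Rightarrow> real" where
  "vol_poly \<Omega> g = (THE P. homogeneous_polynomial DIM('a) P \<and>
                         (\<forall>v\<in>\<Omega>. P v = measure lebesgue (g v)))"

definition dir_deriv :: "'v::real_vector \<Rightarrow> ('v \<Rightarrow> real) \<Rightarrow> 'v \<Rightarrow> real" where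
  "dir_deriv v f x = deriv (\<lambda>t::real. f (x + t *\<^sub>R v)) 0"

text \<open>The list \<open>vs\<close> consists of the marked points. The \<open>d\<close>-fold derivative is a constant
  function on the parameter space; its value is read off at \<open>0\<close>.\<close>

definition coconvex_B ::
  "'v::real_vector set \<Rightarrow> ('v \<Rightarrow> 'a::euclidean_space set) \<Rightarrow> 'v list \<Rightarrow> 'v \<Rightarrow> 'v \<Rightarrow> real" where
  "coconvex_B \<Omega> g vs u\<^sub>1 u\<^sub>2 =
     1 / fact DIM('a) * (dir_deriv u\<^sub>1 (dir_deriv u\<^sub>2 (foldr dir_deriv vs (vol_poly \<Omega> g)))) 0"

definition coconvex_Q ::
  "'v::real_vector set \<Rightarrow> ('v \<Rightarrow> 'a::euclidean_space set) \<Rightarrow> 'v list \<Rightarrow> 'v \<Rightarrow> real" where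
  "coconvex_Q \<Omega> g vs u = coconvex_B \<Omega> g vs u u"

end

theory Submission
  imports Defs "HOL-Library.Option_ord"
begin

text \<open>
  The inequality is obtained without the Alexandrov-Fenchel inequality, by exhibiting the second
  variation of the covolume as a Dirichlet integral. Choose linear coordinates
  \<open>(z, t) \<in> \<real>\<^sup>n \<times> \<real>\<close>, \<open>n = d - 1\<close>, in which \<open>C\<close> lies between two round cones around the \<open>t\<close>-axis.
  Then \<open>\<Delta>\<close> is the epigraph of the conjugate of its concave support function
  \<open>v y = inf {t - z \<bullet> y | (z, t) \<in> \<Delta>}\<close>, Minkowski combinations become linear combinations of support
  functions, and outside a fixed box all these functions agree, because the sets \<open>\<Delta>\<close> agree far out.

  For smooth strictly concave \<open>v\<close> the covolume differs by a constant from the integral of the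
  conjugate, and the change of variables \<open>z = - \<nabla>v\<close> turns its derivative in a direction \<open>f\<close> vanishing outside
  the box into the integral of \<open>f det (- D\<^sup>2v)\<close>, up to sign. Hence it is a polynomial of degree
  \<open>n + 1 = d\<close>, and polarizing gives, for \<open>f = v\<^sub>i - v\<^sub>j\<close>, a positive multiple of the integral of
  \<open>f D (D\<^sup>2f, - D\<^sup>2v\<^sub>1, \<dots>)\<close> up to sign, with \<open>D\<close> the mixed discriminant. Since
  \<open>D\<^sup>2 (f\<^sup>2 / 2) = f D\<^sup>2f + \<nabla>f \<otimes> \<nabla>f\<close> and the mixed Hessian integral of a function that is constant near
  the boundary vanishes, it equals the integral of
  \<open>D (\<nabla>f \<otimes> \<nabla>f, - D\<^sup>2v\<^sub>1, \<dots>)\<close>, a mixed discriminant of positive semidefinite matrices and therefore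
  non-negative. Smoothing the support functions and passing to the limit removes the regularity
  assumption. Finally, \<open>\<Omega>\<close> being open, every \<open>u\<close> is a multiple of a difference of two elements of \<open>\<Omega>\<close>.
\<close>

text \<open>The obstacle is the boundary. A single conjugate is not integrable, and smoothing would
  disturb the values near the edge of the box, so all smoothed functions are made to coincide there
  exactly with one reference: each is lifted by a small constant and then cut off by a smoothed
  minimum with the reference, which approximates the largest of the support functions. Conjugates
  are taken over a closed ball, so that maximizers exist for every \<open>z\<close>; slopes of norm
  at most \<open>L\<close> already determine the bodies. Derivatives of the volume come from
  inequalities alone: the maximizer of one function competes in the conjugate of another, and
  continuity squeezes the difference quotient. The vanishing of the mixed Hessian integral is
  geometric as well: the set of \<open>z\<close> whose maximizer lies in the box depends only on the
  gradient on the boundary of the box. The volume is at first controlled only for weights in a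
  simplex. Sums of unit vectors are multiples of simplex points, and values there determine all
  coefficients of a form; this carries both the limit and the polarization.\<close>

section \<open>Alternating sums over subsets and Ryser's formula\<close>

lemma alternating_sum_supersets:
  fixes S A :: "'a set"
  assumes "finite S" "A \<subseteq> S"
  shows "(\<Sum>I\<in>Pow S. (-1) ^ card (S - I) * (if A \<subseteq> I then 1 else 0)) = (if A = S then 1 else (0::real))"
proof -
  \<comment> \<open>Each term is one summand in the expansion of the product over \<open>S\<close>
    of \<open>1 + a i\<close>, where \<open>a i = 0\<close> on \<open>A\<close> and
    \<open>a i = -1\<close> off \<open>A\<close>; a point of \<open>S - A\<close> makes a factor
    vanish.\<close>
  have "(\<Sum>I\<in>Pow S. (-1) ^ card (S - I) * (if A \<subseteq> I then 1 else 0))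
      = (\<Sum>I\<in>Pow S. (\<Prod>i\<in>I. 1) * (\<Prod>i\<in>S - I. if i \<in> A then 0 else (-1::real)))"
  proof (rule sum.cong[OF refl])
    fix I assume I: "I \<in> Pow S"
    have fin: "finite (S - I)" using assms by auto
    show "(-1) ^ card (S - I) * (if A \<subseteq> I then 1 else 0)
      = (\<Prod>i\<in>I. 1) * (\<Prod>i\<in>S - I. if i \<in> A then 0 else (-1::real))"
    proof (cases "A \<subseteq> I")
      case True
      then have "(\<Prod>i\<in>S - I. if i \<in> A then 0 else (-1::real)) = (\<Prod>i\<in>S - I. -1)"
        by (intro prod.cong) auto
      with True show ?thesis by simp
    next
      case False
      then obtain i where "i \<in> A" "i \<in> S - I" using assms by auto
      then have "(\<Prod>i\<in>S - I. if i \<in> A then 0 else (-1::real)) = 0"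
        using fin by (intro prod_zero) auto
      with False show ?thesis by simp
    qed
  qed
  also have "\<dots> = (\<Prod>i\<in>S. 1 + (if i \<in> A then 0 else (-1::real)))"
    using prod_add[OF assms(1), of "\<lambda>_. 1" "\<lambda>i. if i \<in> A then 0 else (-1::real)"] by simp
  also have "\<dots> = (if A = S then 1 else 0)"
  proof (cases "A = S")
    case False
    then obtain i where "i \<in> S" "i \<notin> A" using assms by auto
    with False show ?thesis using assms(1) by (auto intro!: prod_zero)
  qed auto
  finally show ?thesis .
qed

text \<open>Expanding the product sums over maps of \<open>S\<close> into \<open>I\<close>; by
  inclusion-exclusion only the maps with image all of \<open>S\<close> survive, and on a finite set
  these are the permutations. This is why alternating sums over subsets polarize.\<close>

lemma ryser_formula:
  fixes a :: "'a \<Rightarrow> 'a \<Rightarrow> real"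
  assumes "finite S"
  shows "(\<Sum>I\<in>Pow S. (-1) ^ card (S - I) * (\<Prod>i\<in>S. \<Sum>k\<in>I. a i k))
       = (\<Sum>\<pi> | \<pi> permutes S. \<Prod>i\<in>S. a i (\<pi> i))"
proof -
  let ?F = "S \<rightarrow>\<^sub>E S"
  have fin: "finite ?F" using assms by (intro finite_PiE) auto
  have "(\<Sum>I\<in>Pow S. (-1) ^ card (S - I) * (\<Prod>i\<in>S. \<Sum>k\<in>I. a i k))
     = (\<Sum>I\<in>Pow S. \<Sum>f\<in>?F. (\<Prod>i\<in>S. a i (f i)) * ((-1) ^ card (S - I) * (if f ` S \<subseteq> I then 1 else 0)))"
  proof (rule sum.cong[OF refl])
    fix I assume I: "I \<in> Pow S"
    then have fI: "finite I" using assms finite_subset by auto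
    have "(\<Prod>i\<in>S. \<Sum>k\<in>I. a i k) = (\<Sum>f\<in>S \<rightarrow>\<^sub>E I. \<Prod>i\<in>S. a i (f i))"
      using prod_sum_PiE[OF assms, of "\<lambda>_. I" a] fI by auto
    also have "\<dots> = (\<Sum>f\<in>?F. if f ` S \<subseteq> I then \<Prod>i\<in>S. a i (f i) else 0)"
      using I by (intro sum.mono_neutral_cong_left fin) (auto simp: PiE_iff image_subset_iff)
    finally have e: "(\<Prod>i\<in>S. \<Sum>k\<in>I. a i k) = (\<Sum>f\<in>?F. if f ` S \<subseteq> I then \<Prod>i\<in>S. a i (f i) else 0)" .
    show "(-1) ^ card (S - I) * (\<Prod>i\<in>S. \<Sum>k\<in>I. a i k)
      = (\<Sum>f\<in>?F. (\<Prod>i\<in>S. a i (f i)) * ((-1) ^ card (S - I) * (if f ` S \<subseteq> I then 1 else 0)))"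
      unfolding e sum_distrib_left by (intro sum.cong refl) auto
  qed
  also have "\<dots> = (\<Sum>f\<in>?F. (\<Prod>i\<in>S. a i (f i)) * (\<Sum>I\<in>Pow S. (-1) ^ card (S - I) * (if f ` S \<subseteq> I then 1 else 0)))"
    by (subst sum.swap) (simp add: sum_distrib_left)
  also have "\<dots> = (\<Sum>f\<in>?F. (\<Prod>i\<in>S. a i (f i)) * (if f ` S = S then 1 else 0))"
    by (intro sum.cong refl, subst alternating_sum_supersets[OF assms]) auto
  also have "\<dots> = (\<Sum>f\<in>{f\<in>?F. f ` S = S}. \<Prod>i\<in>S. a i (f i))"
    using fin by (intro sum.mono_neutral_cong_right) auto
  also have "\<dots> = (\<Sum>\<pi> | \<pi> permutes S. \<Prod>i\<in>S. a i (\<pi> i))"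
  proof (rule sum.reindex_bij_witness[where i = "\<lambda>\<pi>. restrict \<pi> S" and j = "\<lambda>f x. if x \<in> S then f x else x"])
    fix f assume f: "f \<in> {f\<in>?F. f ` S = S}"
    show "restrict (\<lambda>x. if x \<in> S then f x else x) S = f" using f by (auto simp: fun_eq_iff PiE_def extensional_def)
    have "bij_betw f S S" using f assms by (simp add: bij_betw_def eq_card_imp_inj_on)
    then have "bij_betw (\<lambda>x. if x \<in> S then f x else x) S S" by (subst bij_betw_cong[where g=f]) auto
    then show "(\<lambda>x. if x \<in> S then f x else x) \<in> {\<pi>. \<pi> permutes S}"
      by (auto intro: bij_imp_permutes)
  next
    fix \<pi> assume "\<pi> \<in> {\<pi>. \<pi> permutes S}"
    then have p: "\<pi> permutes S" by simp
    show "(\<lambda>x. if x \<in> S then restrict \<pi> S x else x) = \<pi>"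
      using permutes_not_in[OF p] by (auto simp: fun_eq_iff)
    show "restrict \<pi> S \<in> {f\<in>?F. f ` S = S}" using permutes_image[OF p] p by (auto simp: permutes_in_image)
  next
    fix f assume "f \<in> {f\<in>?F. f ` S = S}"
    then show "(\<Prod>i\<in>S. a i (if i \<in> S then f i else i)) = (\<Prod>i\<in>S. a i (f i))" by (intro prod.cong) auto
  qed
  finally show ?thesis .
qed

section \<open>Homogeneous forms and polarization\<close>

text \<open>Coefficients are attached to words of length \<open>d\<close> over \<open>J\<close>
  rather than to exponents. They are not unique, but products of linear forms then expand without
  counting multiplicities.\<close>

definition hform :: "nat \<Rightarrow> 'j set \<Rightarrow> (('j \<Rightarrow> real) \<Rightarrow> real) \<Rightarrow> bool" where
  "hform d J p \<longleftrightarrow> (\<exists>c. \<forall>s. p s = (\<Sum>\<kappa>\<in>{..<d} \<rightarrow>\<^sub>E J. c \<kappa> * (\<Prod>i<d. s (\<kappa> i))))"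

text \<open>On the diagonal this is \<open>d!\<close> times \<open>p\<close>: the polarization is not normalized.\<close>

definition polar :: "nat \<Rightarrow> (('j \<Rightarrow> real) \<Rightarrow> real) \<Rightarrow> (nat \<Rightarrow> 'j \<Rightarrow> real) \<Rightarrow> real" where
  "polar d p x = (\<Sum>I\<in>Pow {..<d}. (-1) ^ card ({..<d} - I) * p (\<lambda>j. \<Sum>i\<in>I. x i j))"

definition unit_coord :: "'j \<Rightarrow> 'j \<Rightarrow> real" where
  "unit_coord j k = (if j = k then 1 else 0)"

lemma polar_eq_permutation_sum:
  assumes J: "finite J"
    and p: "\<And>s. p s = (\<Sum>\<kappa>\<in>{..<d} \<rightarrow>\<^sub>E J. c \<kappa> * (\<Prod>i<d. s (\<kappa> i)))"
  shows "polar d p x = (\<Sum>\<kappa>\<in>{..<d} \<rightarrow>\<^sub>E J. c \<kappa> * (\<Sum>\<pi> | \<pi> permutes {..<d}. \<Prod>i<d. x (\<pi> i) (\<kappa> i)))"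
proof -
  have "polar d p x = (\<Sum>\<kappa>\<in>{..<d} \<rightarrow>\<^sub>E J. c \<kappa> * (\<Sum>I\<in>Pow {..<d}. (-1) ^ card ({..<d} - I) * (\<Prod>i<d. \<Sum>k\<in>I. x k (\<kappa> i))))"
    unfolding polar_def p sum_distrib_left
    by (subst sum.swap) (simp add: mult.left_commute)
  also have "\<dots> = (\<Sum>\<kappa>\<in>{..<d} \<rightarrow>\<^sub>E J. c \<kappa> * (\<Sum>\<pi> | \<pi> permutes {..<d}. \<Prod>i<d. x (\<pi> i) (\<kappa> i)))"
    by (subst ryser_formula) auto
  finally show ?thesis .
qed

lemma hformI_monomial:
  assumes "card R = d" "finite R" "\<And>r. r \<in> R \<Longrightarrow> \<kappa> r \<in> J" "finite J"
  shows "hform d J (\<lambda>s. \<Prod>r\<in>R. s (\<kappa> r))"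
proof -
  obtain h where h: "bij_betw h {..<d} R"
    using assms ex_bij_betw_nat_finite[of R] by (auto simp: atLeast0LessThan)
  let ?k = "restrict (\<kappa> \<circ> h) {..<d}"
  have k: "?k \<in> {..<d} \<rightarrow>\<^sub>E J" using bij_betwE[OF h] assms by auto
  have "(\<Prod>r\<in>R. s (\<kappa> r)) = (\<Sum>\<kappa>'\<in>{..<d} \<rightarrow>\<^sub>E J. (if \<kappa>' = ?k then 1 else 0) * (\<Prod>i<d. s (\<kappa>' i)))" for s :: "'b \<Rightarrow> real"
  proof -
    have "(\<Sum>\<kappa>'\<in>{..<d} \<rightarrow>\<^sub>E J. (if \<kappa>' = ?k then 1 else 0) * (\<Prod>i<d. s (\<kappa>' i)))
      = (\<Sum>\<kappa>'\<in>{..<d} \<rightarrow>\<^sub>E J. (if \<kappa>' = ?k then (\<Prod>i<d. s (?k i)) else 0))"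
      by (intro sum.cong) auto
    also have "\<dots> = (\<Prod>i<d. s (?k i))"
      using k assms(4) by (subst sum.delta) (auto intro!: finite_PiE)
    also have "\<dots> = (\<Prod>i<d. s (\<kappa> (h i)))" by (intro prod.cong) auto
    also have "\<dots> = (\<Prod>r\<in>R. s (\<kappa> r))"
      using prod.reindex_bij_betw[OF h, of "\<lambda>r. s (\<kappa> r)"] by simp
    finally show ?thesis by simp
  qed
  then show ?thesis unfolding hform_def by (intro exI[of _ "\<lambda>\<kappa>'. if \<kappa>' = ?k then 1 else 0"]) auto
qed

lemma hform_zero: "hform d J (\<lambda>s. 0)"
  unfolding hform_def by (intro exI[of _ "\<lambda>_. 0"]) auto

lemma hform_add:
  assumes "hform d J p" "hform d J q"
  shows "hform d J (\<lambda>s. p s + q s)"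
proof -
  obtain c c' where c: "\<And>s. p s = (\<Sum>\<kappa>\<in>{..<d} \<rightarrow>\<^sub>E J. c \<kappa> * (\<Prod>i<d. s (\<kappa> i)))"
    "\<And>s. q s = (\<Sum>\<kappa>\<in>{..<d} \<rightarrow>\<^sub>E J. c' \<kappa> * (\<Prod>i<d. s (\<kappa> i)))"
    using assms unfolding hform_def by auto
  then show ?thesis unfolding hform_def
    by (intro exI[of _ "\<lambda>\<kappa>. c \<kappa> + c' \<kappa>"]) (auto simp: sum.distrib ring_distribs)
qed

lemma hform_cmult:
  assumes "hform d J p" shows "hform d J (\<lambda>s. a * p s)"
proof -
  obtain c where c: "\<And>s. p s = (\<Sum>\<kappa>\<in>{..<d} \<rightarrow>\<^sub>E J. c \<kappa> * (\<Prod>i<d. s (\<kappa> i)))"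
    using assms unfolding hform_def by auto
  then show ?thesis unfolding hform_def
    by (intro exI[of _ "\<lambda>\<kappa>. a * c \<kappa>"]) (auto simp: sum_distrib_left mult.assoc)
qed

lemma hform_sum:
  assumes "\<And>a. a \<in> A \<Longrightarrow> hform d J (p a)"
  shows "hform d J (\<lambda>s. \<Sum>a\<in>A. p a s)"
  using assms by (induction A rule: infinite_finite_induct) (auto intro: hform_zero hform_add)

lemma hform_scale:
  assumes "hform d J p" shows "p (\<lambda>j. a * s j) = a ^ d * p s"
proof -
  obtain c where c: "\<And>s. p s = (\<Sum>\<kappa>\<in>{..<d} \<rightarrow>\<^sub>E J. c \<kappa> * (\<Prod>i<d. s (\<kappa> i)))"
    using assms unfolding hform_def by auto
  show ?thesis unfolding c by (simp add: prod.distrib sum_distrib_left mult.left_commute)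
qed

lemma polar_perm:
  assumes "\<pi> permutes {..<d}"
  shows "polar d p (x \<circ> \<pi>) = polar d p x"
proof -
  have inj: "inj_on \<pi> A" for A using permutes_inj[OF assms] by (auto simp: inj_on_def)
  have "polar d p x = (\<Sum>I\<in>Pow {..<d}. (-1) ^ card ({..<d} - \<pi> ` I) * p (\<lambda>j. \<Sum>i\<in>\<pi> ` I. x i j))"
    unfolding polar_def
  proof (rule sum.reindex_bij_betw[symmetric])
    show "bij_betw (image \<pi>) (Pow {..<d}) (Pow {..<d})"
      using bij_betw_Pow[OF permutes_imp_bij[OF assms]] .
  qed
  also have "\<dots> = polar d p (x \<circ> \<pi>)"
    unfolding polar_def
  proof (rule sum.cong[OF refl])
    fix I assume "I \<in> Pow {..<d}"
    then have "I \<subseteq> {..<d}" by auto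
    have "{..<d} - \<pi> ` I = \<pi> ` ({..<d} - I)"
      using permutes_image[OF assms] inj by (subst image_set_diff) (auto simp: permutes_inj[OF assms])
    then have "card ({..<d} - \<pi> ` I) = card ({..<d} - I)" using inj by (simp add: card_image)
    moreover have "(\<lambda>j. \<Sum>i\<in>\<pi> ` I. x i j) = (\<lambda>j. \<Sum>i\<in>I. (x \<circ> \<pi>) i j)"
      using inj by (simp add: sum.reindex)
    ultimately show "(-1) ^ card ({..<d} - \<pi> ` I) * p (\<lambda>j. \<Sum>i\<in>\<pi> ` I. x i j) =
      (-1) ^ card ({..<d} - I) * p (\<lambda>j. \<Sum>i\<in>I. (x \<circ> \<pi>) i j)" by simp
  qed
  finally show ?thesis by simp
qed

lemma polar_diag:
  assumes "hform d J p" "finite J"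
  shows "polar d p (\<lambda>_. s) = fact d * p s"
proof -
  obtain c where c: "\<And>s. p s = (\<Sum>\<kappa>\<in>{..<d} \<rightarrow>\<^sub>E J. c \<kappa> * (\<Prod>i<d. s (\<kappa> i)))"
    using assms unfolding hform_def by auto
  show ?thesis
    by (subst polar_eq_permutation_sum[OF assms(2) c], subst c)
      (simp add: sum_distrib_left card_permutations mult.left_commute)
qed

lemma polar_linear_slot:
  assumes "hform d J p" "finite J" "k < d" "finite A"
  shows "polar d p (x(k := (\<lambda>j. \<Sum>a\<in>A. t a * y a j))) = (\<Sum>a\<in>A. t a * polar d p (x(k := y a)))"
proof -
  obtain c where c: "\<And>s. p s = (\<Sum>\<kappa>\<in>{..<d} \<rightarrow>\<^sub>E J. c \<kappa> * (\<Prod>i<d. s (\<kappa> i)))"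
    using assms unfolding hform_def by auto
  have *: "(\<Prod>i<d. (x(k := z)) (\<pi> i) (\<kappa> i)) = z (\<kappa> (inv \<pi> k)) * (\<Prod>i\<in>{..<d} - {inv \<pi> k}. x (\<pi> i) (\<kappa> i))"
    if "\<pi> permutes {..<d}" for \<pi> \<kappa> z
  proof -
    have k: "inv \<pi> k \<in> {..<d}" using permutes_in_image[OF permutes_inv[OF that]] assms by simp
    have "(\<Prod>i<d. (x(k := z)) (\<pi> i) (\<kappa> i)) = (x(k := z)) (\<pi> (inv \<pi> k)) (\<kappa> (inv \<pi> k)) * (\<Prod>i\<in>{..<d} - {inv \<pi> k}. (x(k := z)) (\<pi> i) (\<kappa> i))"
      using k by (subst prod.remove[of _ "inv \<pi> k"]) auto
    also have "(\<Prod>i\<in>{..<d} - {inv \<pi> k}. (x(k := z)) (\<pi> i) (\<kappa> i)) = (\<Prod>i\<in>{..<d} - {inv \<pi> k}. x (\<pi> i) (\<kappa> i))"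
      by (intro prod.cong) (auto simp: permutes_inverses[OF that])
    finally show ?thesis using permutes_inverses[OF that] by simp
  qed
  show ?thesis
  proof -
    let ?R = "\<lambda>\<pi> \<kappa>. \<Prod>i\<in>{..<d} - {inv \<pi> k}. x (\<pi> i) (\<kappa> i)"
    let ?P = "{\<pi>. \<pi> permutes {..<d}}" and ?E = "{..<d} \<rightarrow>\<^sub>E J"
    have "polar d p (x(k := (\<lambda>j. \<Sum>a\<in>A. t a * y a j)))
      = (\<Sum>\<kappa>\<in>?E. c \<kappa> * (\<Sum>\<pi>\<in>?P. (\<Sum>a\<in>A. t a * y a (\<kappa> (inv \<pi> k))) * ?R \<pi> \<kappa>))"
      unfolding polar_eq_permutation_sum[OF assms(2) c] by (intro sum.cong refl arg_cong2[where f="(*)"]) (use * in auto)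
    also have "\<dots> = (\<Sum>\<kappa>\<in>?E. \<Sum>\<pi>\<in>?P. \<Sum>a\<in>A. t a * (c \<kappa> * (y a (\<kappa> (inv \<pi> k)) * ?R \<pi> \<kappa>)))"
      by (simp add: sum_distrib_left sum_distrib_right mult_ac)
    also have "\<dots> = (\<Sum>\<kappa>\<in>?E. \<Sum>a\<in>A. \<Sum>\<pi>\<in>?P. t a * (c \<kappa> * (y a (\<kappa> (inv \<pi> k)) * ?R \<pi> \<kappa>)))"
      by (intro sum.cong refl sum.swap)
    also have "\<dots> = (\<Sum>a\<in>A. \<Sum>\<kappa>\<in>?E. \<Sum>\<pi>\<in>?P. t a * (c \<kappa> * (y a (\<kappa> (inv \<pi> k)) * ?R \<pi> \<kappa>)))"
      by (rule sum.swap)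
    also have "\<dots> = (\<Sum>a\<in>A. t a * (\<Sum>\<kappa>\<in>?E. c \<kappa> * (\<Sum>\<pi>\<in>?P. y a (\<kappa> (inv \<pi> k)) * ?R \<pi> \<kappa>)))"
      by (simp add: sum_distrib_left)
    also have "\<dots> = (\<Sum>a\<in>A. t a * polar d p (x(k := y a)))"
      unfolding polar_eq_permutation_sum[OF assms(2) c] by (intro sum.cong refl arg_cong2[where f="(*)"]) (use * in auto)
    finally show ?thesis .
  qed
qed

text \<open>The polar values at unit vectors are a canonical choice of coefficients: symmetric under
  reordering of the word, and determined by finitely many values of \<open>p\<close>. The second
  property makes coefficients converge when values do.\<close>

lemma hform_eq_polar:
  assumes "hform d J p" "finite J"
  shows "p s = (\<Sum>\<kappa>\<in>{..<d} \<rightarrow>\<^sub>E J. polar d p (\<lambda>i. unit_coord (\<kappa> i)) / fact d * (\<Prod>i<d. s (\<kappa> i)))"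
proof -
  obtain c where c: "\<And>s. p s = (\<Sum>\<kappa>\<in>{..<d} \<rightarrow>\<^sub>E J. c \<kappa> * (\<Prod>i<d. s (\<kappa> i)))"
    using assms unfolding hform_def by auto
  let ?E = "{..<d} \<rightarrow>\<^sub>E J"
  have finE: "finite ?E" using assms by (intro finite_PiE) auto
  \<comment> \<open>Only the word with \<open>\<kappa> (\<pi> i) = \<kappa>' i\<close> for all
    \<open>i\<close> contributes, and its monomial is that of \<open>\<kappa>'\<close> with the
    factors reordered.\<close>
  have 1: "(\<Sum>\<kappa>\<in>?E. (\<Prod>i<d. unit_coord (\<kappa> (\<pi> i)) (\<kappa>' i)) * (\<Prod>i<d. s (\<kappa> i))) = (\<Prod>i<d. s (\<kappa>' i))"
    if "\<pi> permutes {..<d}" "\<kappa>' \<in> ?E" for \<pi> \<kappa>'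
  proof -
    have inv: "inv \<pi> permutes {..<d}" by (rule permutes_inv[OF that(1)])
    let ?k = "restrict (\<kappa>' \<circ> inv \<pi>) {..<d}"
    have k: "?k \<in> ?E" using PiE_mem[OF that(2)] permutes_in_image[OF inv] by (intro restrict_PiE_iff[THEN iffD2] ballI) simp
    have "(\<Prod>i<d. unit_coord (\<kappa> (\<pi> i)) (\<kappa>' i)) = (if \<kappa> = ?k then 1 else 0)" if "\<kappa> \<in> ?E" for \<kappa>
    proof (cases "\<kappa> = ?k")
      case True
      have "unit_coord (\<kappa> (\<pi> i)) (\<kappa>' i) = 1" if "i < d" for i
        using that \<open>\<pi> permutes {..<d}\<close> permutes_in_image[OF \<open>\<pi> permutes {..<d}\<close>, of i]
        by (simp add: True unit_coord_def permutes_inverses[OF \<open>\<pi> permutes {..<d}\<close>])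
      then have "(\<Prod>i<d. unit_coord (\<kappa> (\<pi> i)) (\<kappa>' i)) = 1" by (intro prod.neutral) auto
      then show ?thesis unfolding if_P[OF True] .
    next
      case False
      have "\<exists>l<d. \<kappa> l \<noteq> ?k l"
      proof (rule ccontr)
        assume "\<not> ?thesis"
        then have "\<kappa> = ?k" by (intro PiE_ext[OF that k]) auto
        with False show False ..
      qed
      then obtain l where l: "l < d" "\<kappa> l \<noteq> \<kappa>' (inv \<pi> l)" by auto
      have "inv \<pi> l < d" using permutes_in_image[OF inv, of l] l by simp
      moreover have "unit_coord (\<kappa> (\<pi> (inv \<pi> l))) (\<kappa>' (inv \<pi> l)) = 0"
        using l by (simp add: unit_coord_def permutes_inverses[OF \<open>\<pi> permutes {..<d}\<close>])
      ultimately have "(\<Prod>i<d. unit_coord (\<kappa> (\<pi> i)) (\<kappa>' i)) = 0" by (intro prod_zero) auto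
      with False show ?thesis by simp
    qed
    then have "(\<Sum>\<kappa>\<in>?E. (\<Prod>i<d. unit_coord (\<kappa> (\<pi> i)) (\<kappa>' i)) * (\<Prod>i<d. s (\<kappa> i)))
       = (\<Sum>\<kappa>\<in>?E. if \<kappa> = ?k then (\<Prod>i<d. s (\<kappa> i)) else 0)" by (intro sum.cong) auto
    also have "\<dots> = (\<Prod>i<d. s (?k i))" using k finE by (subst sum.delta) auto
    also have "\<dots> = (\<Prod>i<d. s (\<kappa>' (inv \<pi> i)))" by (intro prod.cong) auto
    also have "\<dots> = (\<Prod>i<d. s (\<kappa>' i))"
      using prod.permute[OF inv, of "\<lambda>i. s (\<kappa>' i)"] unfolding comp_def ..
    finally show ?thesis .
  qed
  have "(\<Sum>\<kappa>\<in>?E. polar d p (\<lambda>i. unit_coord (\<kappa> i)) * (\<Prod>i<d. s (\<kappa> i)))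
      = (\<Sum>\<kappa>\<in>?E. \<Sum>\<kappa>'\<in>?E. \<Sum>\<pi> | \<pi> permutes {..<d}. c \<kappa>' * ((\<Prod>i<d. unit_coord (\<kappa> (\<pi> i)) (\<kappa>' i)) * (\<Prod>i<d. s (\<kappa> i))))"
    unfolding polar_eq_permutation_sum[OF assms(2) c] by (simp add: sum_distrib_right sum_distrib_left mult.assoc)
  also have "\<dots> = (\<Sum>\<kappa>'\<in>?E. \<Sum>\<kappa>\<in>?E. \<Sum>\<pi> | \<pi> permutes {..<d}. c \<kappa>' * ((\<Prod>i<d. unit_coord (\<kappa> (\<pi> i)) (\<kappa>' i)) * (\<Prod>i<d. s (\<kappa> i))))"
    by (rule sum.swap)
  also have "\<dots> = (\<Sum>\<kappa>'\<in>?E. \<Sum>\<pi> | \<pi> permutes {..<d}. \<Sum>\<kappa>\<in>?E. c \<kappa>' * ((\<Prod>i<d. unit_coord (\<kappa> (\<pi> i)) (\<kappa>' i)) * (\<Prod>i<d. s (\<kappa> i))))"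
    by (rule sum.cong[OF refl], rule sum.swap)
  also have "\<dots> = (\<Sum>\<kappa>'\<in>?E. \<Sum>\<pi> | \<pi> permutes {..<d}. c \<kappa>' * (\<Prod>i<d. s (\<kappa>' i)))"
    by (rule sum.cong[OF refl], rule sum.cong[OF refl]) (simp only: mem_Collect_eq 1 flip: sum_distrib_left)
  also have "\<dots> = fact d * p s" by (simp add: c sum_distrib_left card_permutations mult.left_commute)
  finally have "(\<Sum>\<kappa>\<in>?E. polar d p (\<lambda>i. unit_coord (\<kappa> i)) * (\<Prod>i<d. s (\<kappa> i))) / fact d = p s" by simp
  then show ?thesis by (simp add: sum_divide_distrib)
qed

section \<open>Discriminants of sums of rank one matrices\<close>

definition outer :: "real^'n \<Rightarrow> real^'n^'n" where
  "outer a = (\<chi> i j. a$i * a$j)"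

text \<open>A certificate in place of an inequality: the determinant of a sum of rank one squares
  expands explicitly, and certificates for sums and nonnegative multiples can be written down
  directly.\<close>

definition psd :: "real^'n^'n \<Rightarrow> bool" where
  "psd A \<longleftrightarrow> (\<exists>(N::nat) a. A = (\<Sum>l<N. outer (a l)))"

lemma outer_scale: "outer (c *\<^sub>R a) = c\<^sup>2 *\<^sub>R outer a"
  by (simp add: outer_def vec_eq_iff power2_eq_square)

lemma psd_outer: "psd (outer a)"
  unfolding psd_def by (rule exI[of _ 1]) auto

lemma psd_zero: "psd 0"
  unfolding psd_def by (rule exI[of _ 0]) auto

lemma psd_add:
  assumes "psd A" "psd B" shows "psd (A + B)"
proof -
  obtain N M :: nat and a b where *: "A = (\<Sum>l<N. outer (a l))" "B = (\<Sum>l<M. outer (b l))"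
    using assms unfolding psd_def by auto
  let ?c = "\<lambda>l. if l < N then a l else b (l - N)"
  have "(\<Sum>l<N+M. outer (?c l)) = (\<Sum>l<N. outer (?c l)) + (\<Sum>l<M. outer (?c (N + l)))"
    by (induction M) auto
  also have "\<dots> = A + B" unfolding * by simp
  finally show ?thesis unfolding psd_def by metis
qed

lemma psd_scale:
  assumes "psd A" "c \<ge> 0" shows "psd (c *\<^sub>R A)"
proof -
  obtain N :: nat and a where *: "A = (\<Sum>l<N. outer (a l))"
    using assms unfolding psd_def by auto
  have "c *\<^sub>R A = (\<Sum>l<N. outer (sqrt c *\<^sub>R a l))"
    using assms by (simp add: * outer_scale scaleR_sum_right)
  then show ?thesis unfolding psd_def by metis
qed

lemma psd_sum:
  assumes "\<And>i. i \<in> I \<Longrightarrow> psd (A i)" shows "psd (\<Sum>i\<in>I. A i)"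
  using assms by (induction I rule: infinite_finite_induct) (auto intro: psd_zero psd_add)

lemma psd_mat: "c \<ge> 0 \<Longrightarrow> psd (mat c)"
proof -
  assume "c \<ge> 0"
  have "(mat c :: real^'n^'n) = c *\<^sub>R (\<Sum>k\<in>UNIV. outer (axis k 1))"
    by (simp add: vec_eq_iff mat_def outer_def axis_def if_distrib[of "\<lambda>x. x * _"] cong: if_cong)
  also have "psd \<dots>" using \<open>c \<ge> 0\<close> by (intro psd_scale psd_sum psd_outer)
  finally show ?thesis .
qed

lemma inner_outer: "x \<bullet> (outer a *v x) = (a \<bullet> x)\<^sup>2"
  by (simp add: outer_def inner_vec_def matrix_vector_mult_def power2_eq_square sum_distrib_left sum_distrib_right mult_ac)

lemma psd_inner_nonneg:
  fixes A :: "real^'n^'n"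
  shows "psd A \<Longrightarrow> x \<bullet> (A *v x) \<ge> 0"
proof -
  have *: "x \<bullet> ((\<Sum>l<N. outer (a l)) *v x) \<ge> 0" for N :: nat and a :: "nat \<Rightarrow> real^'n"
    by (induction N) (auto simp: matrix_vector_mult_add_rdistrib inner_add_right inner_outer)
  assume "psd A" then show ?thesis unfolding psd_def using * by auto
qed

lemma det_rows_sum:
  fixes a :: "'n \<Rightarrow> 'k \<Rightarrow> real^'n"
  assumes "finite K"
  shows "det (\<chi> r. \<Sum>k\<in>K. a r k) = (\<Sum>f | \<forall>r. f r \<in> K. det (\<chi> r. a r (f r)))"
proof -
  have "(\<Prod>r\<in>UNIV. \<Sum>k\<in>K. a r k $ \<sigma> r) = (\<Sum>f | \<forall>r. f r \<in> K. \<Prod>r\<in>UNIV. a r (f r) $ \<sigma> r)" for \<sigma>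
    using prod_sum_PiE[of UNIV "\<lambda>_. K" "\<lambda>r k. a r k $ \<sigma> r"] assms by (simp add: PiE_def Pi_def)
  then show ?thesis
    unfolding det_def by (simp add: sum_component sum_distrib_left) (rule sum.swap)
qed

lemma det_sum_outer:
  fixes a :: "'k \<Rightarrow> real^'n"
  assumes "finite K"
  shows "det (\<Sum>k\<in>K. outer (a k)) = (\<Sum>f | \<forall>r. f r \<in> K. (\<Prod>r\<in>UNIV. a (f r) $ r) * det (\<chi> r. a (f r)))"
proof -
  have "(\<Sum>k\<in>K. outer (a k)) = (\<chi> r. \<Sum>k\<in>K. (a k $ r) *s a k)"
    by (simp add: vec_eq_iff outer_def)
  then show ?thesis by (simp only: det_rows_sum[OF assms] det_rows_mul)
qed

lemma finite_funs_into: "finite K \<Longrightarrow> finite {f :: 'n::finite \<Rightarrow> 'k. \<forall>r. f r \<in> K}"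
  using finite_PiE[of "UNIV::'n set" "\<lambda>_. K"] by (simp add: PiE_def Pi_def)

text \<open>Reordering rows multiplies a determinant by the sign of the permutation, so the sum
  assembles to the square of the determinant of the matrix with rows \<open>b r\<close>.\<close>

lemma sum_perm_outer_nonneg:
  fixes b :: "'n::finite \<Rightarrow> real^'n"
  shows "(\<Sum>\<sigma> | \<sigma> permutes UNIV. (\<Prod>r\<in>UNIV. b (\<sigma> r) $ r) * det (\<chi> r. b (\<sigma> r))) \<ge> 0"
proof -
  let ?B = "(\<chi> r. b r) :: real^'n^'n"
  have "(\<Sum>\<sigma> | \<sigma> permutes UNIV. (\<Prod>r\<in>UNIV. b (\<sigma> r) $ r) * det (\<chi> r. b (\<sigma> r)))
      = (\<Sum>\<sigma> | \<sigma> permutes UNIV. (of_int (sign \<sigma>) * (\<Prod>r\<in>UNIV. transpose ?B $ r $ \<sigma> r)) * det ?B)"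
  proof (rule sum.cong[OF refl])
    fix \<sigma> :: "'n \<Rightarrow> 'n" assume "\<sigma> \<in> {\<sigma>. \<sigma> permutes UNIV}"
    then show "(\<Prod>r\<in>UNIV. b (\<sigma> r) $ r) * det (\<chi> r. b (\<sigma> r)) =
      (of_int (sign \<sigma>) * (\<Prod>r\<in>UNIV. transpose ?B $ r $ \<sigma> r)) * det ?B"
      using det_permute_rows[of \<sigma> ?B] by (simp add: transpose_def)
  qed
  also have "\<dots> = det (transpose ?B) * det ?B"
    unfolding det_def[of "transpose ?B"] by (simp add: sum_distrib_right)
  finally show ?thesis by (simp add: det_transpose)
qed

text \<open>The alternating sum is \<open>n!\<close> times the mixed discriminant of the \<open>n\<close> matrices.\<close>

lemma alternating_det_nonneg:
  fixes B :: "'i \<Rightarrow> real^'n^'n"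
  assumes psd: "\<And>i. i \<in> S \<Longrightarrow> psd (B i)" and S: "finite S" "card S = CARD('n)"
  shows "(\<Sum>I\<in>Pow S. (-1) ^ card (S - I) * det (\<Sum>i\<in>I. B i)) \<ge> 0"
proof -
  have "\<forall>i\<in>S. \<exists>N a. B i = (\<Sum>l<(N::nat). outer (a l))" using psd unfolding psd_def by auto
  then obtain N a where B: "\<And>i. i \<in> S \<Longrightarrow> B i = (\<Sum>l<(N i::nat). outer (a i l))"
    by (auto simp: bchoice_iff choice_iff)
  define K where "K = (\<lambda>I. SIGMA i:I. {..<N i})"
  define A where "A = (\<lambda>k::'i \<times> nat. a (fst k) (snd k))"
  define w where "w = (\<lambda>f. (\<Prod>r\<in>UNIV. A (f r) $ r) * det (\<chi> r. A (f r)))"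
  define F where "F = {f::'n \<Rightarrow> 'i \<times> nat. \<forall>r. f r \<in> K S}"
  have finK: "finite (K I)" if "I \<subseteq> S" for I
    unfolding K_def using that S finite_subset by auto
  have finF: "finite F" unfolding F_def using finite_funs_into[OF finK[OF subset_refl]] .
  have 1: "det (\<Sum>i\<in>I. B i) = (\<Sum>f\<in>F. if range (fst \<circ> f) \<subseteq> I then w f else 0)" if "I \<subseteq> S" for I
  proof -
    have "(\<Sum>i\<in>I. B i) = (\<Sum>i\<in>I. \<Sum>l<N i. outer (a i l))"
      using that B by (intro sum.cong) auto
    also have "\<dots> = (\<Sum>k\<in>K I. outer (A k))"
      unfolding K_def A_def using that S finite_subset by (subst sum.Sigma) (auto simp: case_prod_unfold)
    finally have "det (\<Sum>i\<in>I. B i) = (\<Sum>f | \<forall>r. f r \<in> K I. w f)"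
      using det_sum_outer[OF finK[OF that], of A] unfolding w_def by simp
    also have "{f. \<forall>r. f r \<in> K I} = {f\<in>F. range (fst \<circ> f) \<subseteq> I}"
    proof -
      have "k \<in> K I \<longleftrightarrow> k \<in> K S \<and> fst k \<in> I" for k
        using that by (cases k) (auto simp: K_def)
      then show ?thesis by (auto simp: F_def image_subset_iff)
    qed
    also have "(\<Sum>f\<in>\<dots>. w f) = (\<Sum>f\<in>F. if range (fst \<circ> f) \<subseteq> I then w f else 0)"
      by (rule sum.inter_filter[OF finF])
    finally show ?thesis .
  qed
  \<comment> \<open>Each \<open>f\<close> assigns to every row a rank one summand of some matrix.
    The alternating sum keeps the \<open>f\<close> in which every matrix occurs, hence exactly once,
    as there are as many rows as matrices.\<close>
  have "(\<Sum>I\<in>Pow S. (-1) ^ card (S - I) * det (\<Sum>i\<in>I. B i))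
     = (\<Sum>I\<in>Pow S. \<Sum>f\<in>F. w f * ((-1) ^ card (S - I) * (if range (fst \<circ> f) \<subseteq> I then 1 else 0)))"
  proof (rule sum.cong[OF refl])
    fix I assume "I \<in> Pow S"
    then have e: "det (\<Sum>i\<in>I. B i) = (\<Sum>f\<in>F. if range (fst \<circ> f) \<subseteq> I then w f else 0)" using 1 by auto
    show "(-1) ^ card (S - I) * det (\<Sum>i\<in>I. B i) = (\<Sum>f\<in>F. w f * ((-1) ^ card (S - I) * (if range (fst \<circ> f) \<subseteq> I then 1 else 0)))"
      unfolding e sum_distrib_left by (intro sum.cong refl) auto
  qed
  also have "\<dots> = (\<Sum>f\<in>F. w f * (\<Sum>I\<in>Pow S. (-1) ^ card (S - I) * (if range (fst \<circ> f) \<subseteq> I then 1 else 0)))"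
    by (subst sum.swap) (simp add: sum_distrib_left)
  also have "\<dots> = (\<Sum>f\<in>F. w f * (if range (fst \<circ> f) = S then 1 else 0))"
  proof (rule sum.cong[OF refl])
    fix f assume "f \<in> F"
    then have "f r \<in> K S" for r by (auto simp: F_def)
    then have "fst (f r) \<in> S" for r unfolding K_def by (metis SigmaD1 prod.collapse)
    then have "range (fst \<circ> f) \<subseteq> S" by auto
    then show "w f * (\<Sum>I\<in>Pow S. (-1) ^ card (S - I) * (if range (fst \<circ> f) \<subseteq> I then 1 else 0))
       = w f * (if range (fst \<circ> f) = S then 1 else 0)"
      by (subst alternating_sum_supersets[OF S(1)]) auto
  qed
  also have "\<dots> = (\<Sum>f\<in>{f\<in>F. range (fst \<circ> f) = S}. w f)"
    using finF by (intro sum.mono_neutral_cong_right) auto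
  also have "\<dots> \<ge> 0"
  proof -
    \<comment> \<open>\<open>\<beta>\<close> labels the matrices by row indices. A surviving
      \<open>f\<close> splits into a choice \<open>\<mu>\<close> of one summand per matrix and a
      permutation \<open>\<sigma>\<close>; for fixed \<open>\<mu>\<close> the sum over
      \<open>\<sigma>\<close> is a square.\<close>
    obtain \<beta> where \<beta>: "bij_betw \<beta> (UNIV::'n set) S"
      using finite_same_card_bij[of "UNIV::'n set" S] S by auto
    define M where "M = {\<mu>::'n \<Rightarrow> nat. \<forall>r. \<mu> r < N (\<beta> r)}"
    have \<beta>S: "\<beta> r \<in> S" for r using \<beta> by (auto simp: bij_betw_def)
    have \<beta>inj: "inj \<beta>" using \<beta> by (auto simp: bij_betw_def)
    have inv\<beta>: "\<beta> (inv \<beta> i) = i" if "i \<in> S" for i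
      using \<beta> that by (auto simp: bij_betw_def f_inv_into_f)
    have "(\<Sum>f\<in>{f\<in>F. range (fst \<circ> f) = S}. w f)
      = (\<Sum>(\<mu>,\<sigma>)\<in>M \<times> {\<sigma>. \<sigma> permutes UNIV}. w (\<lambda>r. (\<beta> (\<sigma> r), \<mu> (\<sigma> r))))"
    proof (rule sum.reindex_bij_witness[where
        j = "\<lambda>f. (\<lambda>r. snd (f (inv (inv \<beta> \<circ> fst \<circ> f) r)), inv \<beta> \<circ> fst \<circ> f)" and
        i = "\<lambda>(\<mu>,\<sigma>) r. (\<beta> (\<sigma> r), \<mu> (\<sigma> r))"])
      fix f assume f: "f \<in> {f\<in>F. range (fst \<circ> f) = S}"
      let ?\<sigma> = "inv \<beta> \<circ> fst \<circ> f"
      have "range ?\<sigma> = inv \<beta> ` S" using f by (auto simp: image_comp[symmetric])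
      also have "\<dots> = UNIV" using \<beta> bij_betw_inv_into[OF \<beta>] by (auto simp: bij_betw_def)
      finally have surj: "surj ?\<sigma>" .
      then have bij: "bij ?\<sigma>" by (simp add: bij_def finite_UNIV_surj_inj)
      have fK: "f r \<in> K S" for r using f by (auto simp: F_def)
      have fst: "fst (f r) \<in> S" and snd: "snd (f r) < N (fst (f r))" for r
        using fK[of r] by (auto simp: K_def elim!: SigmaE)
      show "(\<lambda>(\<mu>,\<sigma>) r. (\<beta> (\<sigma> r), \<mu> (\<sigma> r))) (\<lambda>r. snd (f (inv ?\<sigma> r)), ?\<sigma>) = f"
        using fst inv\<beta> inv_f_f[OF bij_is_inj[OF bij]] by (auto simp: fun_eq_iff prod_eq_iff)
      have "\<beta> (?\<sigma> (inv ?\<sigma> r)) = \<beta> r" for r using surj_f_inv_f[OF surj] by simp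
      then have "fst (f (inv ?\<sigma> r)) = \<beta> r" for r using inv\<beta>[OF fst, of "inv ?\<sigma> r"] by simp
      then have "snd (f (inv ?\<sigma> r)) < N (\<beta> r)" for r using snd[of "inv ?\<sigma> r"] by simp
      then show "(\<lambda>r. snd (f (inv ?\<sigma> r)), ?\<sigma>) \<in> M \<times> {\<sigma>. \<sigma> permutes UNIV}"
        using bij by (auto simp: M_def intro: bij_imp_permutes)
    next
      fix ms assume "ms \<in> M \<times> {\<sigma>::'n\<Rightarrow>'n. \<sigma> permutes UNIV}"
      then obtain \<mu> \<sigma> where ms: "ms = (\<mu>, \<sigma>)" "\<mu> \<in> M" "\<sigma> permutes UNIV" by auto
      let ?f = "\<lambda>r. (\<beta> (\<sigma> r), \<mu> (\<sigma> r))"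
      have "inv \<beta> \<circ> fst \<circ> ?f = \<sigma>" by (auto simp: fun_eq_iff inv_f_f[OF \<beta>inj])
      then show "(\<lambda>f. (\<lambda>r. snd (f (inv (inv \<beta> \<circ> fst \<circ> f) r)), inv \<beta> \<circ> fst \<circ> f)) ((\<lambda>(\<mu>,\<sigma>) r. (\<beta> (\<sigma> r), \<mu> (\<sigma> r))) ms) = ms"
        using permutes_inverses[OF ms(3)] by (simp add: ms(1))
      have "range (fst \<circ> ?f) = \<beta> ` range \<sigma>" by auto
      also have "\<dots> = S" using \<beta> permutes_surj[OF ms(3)] by (simp add: bij_betw_def)
      finally show "(\<lambda>(\<mu>,\<sigma>) r. (\<beta> (\<sigma> r), \<mu> (\<sigma> r))) ms \<in> {f\<in>F. range (fst \<circ> f) = S}"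
        using ms \<beta>S by (auto simp: F_def K_def M_def)
    next
      fix f assume f: "f \<in> {f\<in>F. range (fst \<circ> f) = S}"
      let ?\<sigma> = "inv \<beta> \<circ> fst \<circ> f"
      have "range ?\<sigma> = inv \<beta> ` S" using f by (auto simp: image_comp[symmetric])
      also have "\<dots> = UNIV" using \<beta> bij_betw_inv_into[OF \<beta>] by (auto simp: bij_betw_def)
      finally have surj: "surj ?\<sigma>" .
      then have bij: "bij ?\<sigma>" by (simp add: bij_def finite_UNIV_surj_inj)
      have fst: "fst (f r) \<in> S" for r using f by auto
      have "(\<lambda>r. (\<beta> (?\<sigma> r), snd (f (inv ?\<sigma> (?\<sigma> r))))) = f"
        using fst inv\<beta> inv_f_f[OF bij_is_inj[OF bij]] by (auto simp: fun_eq_iff prod_eq_iff)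
      then show "(case (\<lambda>r. snd (f (inv ?\<sigma> r)), ?\<sigma>) of (\<mu>,\<sigma>) \<Rightarrow> w (\<lambda>r. (\<beta> (\<sigma> r), \<mu> (\<sigma> r)))) = w f"
        by simp
    qed
    also have "\<dots> = (\<Sum>\<mu>\<in>M. \<Sum>\<sigma> | \<sigma> permutes UNIV. w (\<lambda>r. (\<beta> (\<sigma> r), \<mu> (\<sigma> r))))"
      by (simp add: sum.cartesian_product)
    also have "\<dots> \<ge> 0"
      unfolding w_def A_def fst_conv snd_conv
      by (intro sum_nonneg[of M], rule sum_perm_outer_nonneg)
    finally show ?thesis .
  qed
  finally show ?thesis by linarith
qed

lemma det_sum_expand:
  fixes A :: "'j \<Rightarrow> real^'n^'n"
  assumes "finite J"
  shows "det (\<Sum>j\<in>J. s j *\<^sub>R A j) = (\<Sum>\<kappa> | \<forall>r. \<kappa> r \<in> J. (\<Prod>r\<in>UNIV. s (\<kappa> r)) * det (\<chi> r. A (\<kappa> r) $ r))"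
proof -
  have "(\<Sum>j\<in>J. s j *\<^sub>R A j) = (\<chi> r. \<Sum>j\<in>J. s j *s (A j $ r))"
    by (simp add: vec_eq_iff)
  then show ?thesis by (simp only: det_rows_sum[OF assms] det_rows_mul)
qed

section \<open>Smooth concave functions\<close>

definition C2_with :: "(real^'n \<Rightarrow> real) \<Rightarrow> (real^'n \<Rightarrow> real^'n) \<Rightarrow> (real^'n \<Rightarrow> real^'n^'n) \<Rightarrow> bool" where
  "C2_with f G H \<longleftrightarrow> (\<forall>x. (f has_derivative (\<lambda>h. G x \<bullet> h)) (at x)) \<and>
     (\<forall>x. (G has_derivative (\<lambda>h. H x *v h)) (at x)) \<and> continuous_on UNIV H"

lemma C2_withD:
  assumes "C2_with f G H"
  shows "(f has_derivative (\<lambda>h. G x \<bullet> h)) (at x within S)"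
    and "(G has_derivative (\<lambda>h. H x *v h)) (at x within S)"
    and "continuous_on S H" "continuous_on S G" "continuous_on S f"
proof -
  have f: "(f has_derivative (\<lambda>h. G x \<bullet> h)) (at x)" and G: "(G has_derivative (\<lambda>h. H x *v h)) (at x)" for x
    using assms unfolding C2_with_def by auto
  show "(f has_derivative (\<lambda>h. G x \<bullet> h)) (at x within S)"
    "(G has_derivative (\<lambda>h. H x *v h)) (at x within S)"
    using f G by (auto intro: has_derivative_at_withinI)
  show "continuous_on S H" using assms unfolding C2_with_def by (auto intro: continuous_on_subset)
  show "continuous_on S G" using G by (meson continuous_at_imp_continuous_on has_derivative_continuous)
  show "continuous_on S f" using f by (meson continuous_at_imp_continuous_on has_derivative_continuous)
qed

lemma C2_with_add:
  assumes "C2_with f G H" "C2_with f' G' H'"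
  shows "C2_with (\<lambda>x. f x + f' x) (\<lambda>x. G x + G' x) (\<lambda>x. H x + H' x)"
  using assms unfolding C2_with_def
  by (auto intro!: continuous_intros derivative_eq_intros ext
      simp: inner_add_left matrix_vector_mult_add_rdistrib)

lemma scaleR_matrix_vector: "(c *\<^sub>R A) *v x = c *\<^sub>R (A *v x)" for A :: "real^'n^'m"
  by (simp add: matrix_vector_mult_def vec_eq_iff sum_distrib_left mult.assoc)

lemma minus_matrix_vector: "(- A) *v x = - (A *v x)" for A :: "real^'n^'m"
  by (simp add: matrix_vector_mult_def vec_eq_iff sum_negf)

lemma mat_vector: "mat c *v x = c *\<^sub>R x" for x :: "real^'n"
  by (simp add: matrix_vector_mult_def vec_eq_iff mat_def if_distrib[of "\<lambda>y. y * _"] cong: if_cong)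

lemma C2_with_scale:
  assumes "C2_with f G H"
  shows "C2_with (\<lambda>x. c * f x) (\<lambda>x. c *\<^sub>R G x) (\<lambda>x. c *\<^sub>R H x)"
  using assms unfolding C2_with_def
  by (auto intro!: continuous_intros derivative_eq_intros ext simp: scaleR_matrix_vector)

lemma C2_with_const: "C2_with (\<lambda>x. c) (\<lambda>x. 0) (\<lambda>x. 0)"
  unfolding C2_with_def by (auto intro!: derivative_eq_intros)

lemma C2_with_sum:
  assumes "\<And>j. j \<in> J \<Longrightarrow> C2_with (f j) (G j) (H j)"
  shows "C2_with (\<lambda>x. \<Sum>j\<in>J. s j * f j x) (\<lambda>x. \<Sum>j\<in>J. s j *\<^sub>R G j x) (\<lambda>x. \<Sum>j\<in>J. s j *\<^sub>R H j x)"
  using assms by (induction J rule: infinite_finite_induct)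
    (auto intro!: C2_with_const C2_with_add C2_with_scale)

lemma outer_vector: "outer a *v h = (a \<bullet> h) *\<^sub>R a"
  by (simp add: outer_def vec_eq_iff matrix_vector_mult_def inner_vec_def sum_distrib_left sum_distrib_right mult_ac)

lemma continuous_on_outer:
  assumes "continuous_on S a" shows "continuous_on S (\<lambda>x. outer (a x))"
  unfolding outer_def by (intro continuous_intros assms)

lemma C2_with_mult:
  assumes f: "C2_with f G H"
  shows "C2_with (\<lambda>x. (f x)\<^sup>2 / 2) (\<lambda>x. f x *\<^sub>R G x) (\<lambda>x. f x *\<^sub>R H x + outer (G x))"
  using f unfolding C2_with_def
  by (auto intro!: continuous_intros derivative_eq_intros ext continuous_on_outer C2_withD[OF f]
      simp: outer_vector scaleR_matrix_vector matrix_vector_mult_add_rdistrib power2_eq_square)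

subsection \<open>A twice differentiable approximation of the minimum\<close>

text \<open>A cubic spline that equals \<open>max 0 t\<close> for \<open>\<bar>t\<bar> \<ge> 1\<close>, with its first two derivatives.\<close>

definition spos :: "real \<Rightarrow> real" where
  "spos t = ((max 0 (t + 1))^3 - 2 * (max 0 t)^3 + (max 0 (t - 1))^3) / 6"

definition spos' :: "real \<Rightarrow> real" where
  "spos' t = ((max 0 (t + 1))^2 - 2 * (max 0 t)^2 + (max 0 (t - 1))^2) / 2"

definition spos'' :: "real \<Rightarrow> real" where
  "spos'' t = max 0 (t + 1) - 2 * max 0 t + max 0 (t - 1)"

lemma max0_power_deriv:
  fixes t :: real
  assumes "n \<ge> 1"
  shows "((\<lambda>t. (max 0 t) ^ Suc n) has_real_derivative (real (Suc n) * (max 0 t)^n)) (at t)"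
proof -
  consider "t > 0" | "t < 0" | "t = 0" by linarith
  then show ?thesis
  proof cases
    case 1
    have "((\<lambda>t. t ^ Suc n) has_real_derivative (real (Suc n) * (max 0 t)^n)) (at t)"
      using 1 DERIV_pow[of "Suc n" t] by simp
    then show ?thesis
      by (rule DERIV_cong_ev[THEN iffD1, rotated -1])
        (use 1 in \<open>auto intro!: eventually_mono[OF eventually_nhds_in_open[of "{0<..}" t]]\<close>)
  next
    case 2
    have "((\<lambda>t. 0) has_real_derivative (real (Suc n) * (max 0 t)^n)) (at t)"
      using 2 assms by (auto intro!: derivative_eq_intros)
    then show ?thesis
      by (rule DERIV_cong_ev[THEN iffD1, rotated -1])
        (use 2 in \<open>auto intro!: eventually_mono[OF eventually_nhds_in_open[of "{..<0}" t]]\<close>)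
  next
    case 3
    have "((\<lambda>h::real. (max 0 h) ^ Suc n / h) \<longlongrightarrow> 0) (at 0)"
    proof (rule Lim_null_comparison)
      show "\<forall>\<^sub>F h in at 0. norm ((max 0 h) ^ Suc n / h) \<le> \<bar>h\<bar> ^ n"
        by (intro always_eventually allI) (auto simp: max_def power_abs abs_mult)
      show "((\<lambda>h::real. \<bar>h\<bar> ^ n) \<longlongrightarrow> 0) (at 0)"
        using assms by (auto intro!: tendsto_eq_intros)
    qed
    moreover have z: "real (Suc n) * (max 0 t) ^ n = 0" using 3 assms by simp
    ultimately show ?thesis unfolding z DERIV_def using 3 by simp
  qed
qed

lemma max0_shift_power_deriv:
  fixes t c :: real
  assumes "n \<ge> 1"
  shows "((\<lambda>t. (max 0 (t + c)) ^ Suc n) has_real_derivative (real (Suc n) * (max 0 (t + c))^n)) (at t)"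
proof -
  have "((\<lambda>t. t + c) has_real_derivative 1) (at t)" by (auto intro!: derivative_eq_intros)
  from DERIV_chain2[OF max0_power_deriv[OF assms] this] show ?thesis by simp
qed

lemma spos_deriv: "(spos has_real_derivative spos' t) (at t)"
proof -
  have d: "((\<lambda>t. (max 0 (t + c)) ^ 3) has_real_derivative (3 * (max 0 (t + c))\<^sup>2)) (at t)" for c
    using max0_shift_power_deriv[of 2 c t] by (simp add: eval_nat_numeral)
  show ?thesis unfolding spos_def[abs_def]
    by (rule DERIV_cong[OF DERIV_cdivide[OF DERIV_add[OF DERIV_diff[OF d[of 1] DERIV_cmult[OF d[of 0, simplified]]] d[of "-1", simplified]]]])
      (simp add: spos'_def)
qed

lemma spos'_deriv: "(spos' has_real_derivative spos'' t) (at t)"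
proof -
  have d: "((\<lambda>t. (max 0 (t + c))\<^sup>2) has_real_derivative (2 * (max 0 (t + c)))) (at t)" for c
    using max0_shift_power_deriv[of 1 c t] by (simp add: eval_nat_numeral)
  show ?thesis unfolding spos'_def[abs_def]
    by (rule DERIV_cong[OF DERIV_cdivide[OF DERIV_add[OF DERIV_diff[OF d[of 1] DERIV_cmult[OF d[of 0, simplified]]] d[of "-1", simplified]]]])
      (simp add: spos''_def)
qed

lemma spos''_nonneg: "spos'' t \<ge> 0"
  unfolding spos''_def by (auto simp: max_def)

lemma spos'_bounds: "0 \<le> spos' t" "spos' t \<le> 1"
proof -
  consider "t \<le> -1" | "-1 < t" "t < 0" | "0 \<le> t" "t \<le> 1" | "1 < t" by linarith
  then have "0 \<le> spos' t \<and> spos' t \<le> 1"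
  proof cases
    case 1 then show ?thesis by (simp add: spos'_def)
  next
    case 2
    then have "2 * spos' t = (t+1)\<^sup>2" by (simp add: spos'_def)
    moreover have "(t+1)\<^sup>2 \<le> 1" using 2 by (intro power_le_one) auto
    ultimately show ?thesis using zero_le_power2[of "t+1"] by linarith
  next
    case 3
    then have "2 * spos' t = (t + 1)\<^sup>2 - 2 * t\<^sup>2" by (simp add: spos'_def)
    then have "2 * spos' t = 2 - (1 - t)\<^sup>2" by (simp add: field_simps power2_eq_square)
    moreover have "(1-t)\<^sup>2 \<le> 1" using 3 by (intro power_le_one) auto
    ultimately show ?thesis using zero_le_power2[of "1-t"] by linarith
  next
    case 4
    then have "2 * spos' t = (t + 1)\<^sup>2 - 2 * t\<^sup>2 + (t - 1)\<^sup>2" by (simp add: spos'_def)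
    then have "2 * spos' t = 2" by (simp add: field_simps power2_eq_square)
    then show ?thesis by simp
  qed
  then show "0 \<le> spos' t" "spos' t \<le> 1" by auto
qed

lemma spos_ge_1: "t \<ge> 1 \<Longrightarrow> spos t = t"
  by (simp add: spos_def max_def field_simps power3_eq_cube)

lemma spos_bounds: "max 0 t \<le> spos t" "spos t \<le> max 0 t + 1"
proof -
  consider "t \<le> -1" | "-1 < t" "t < 0" | "0 \<le> t" "t < 1" | "1 \<le> t" by linarith
  then have "max 0 t \<le> spos t \<and> spos t \<le> max 0 t + 1"
  proof cases
    case 2
    then have "6 * spos t = (t+1)^3" by (simp add: spos_def)
    moreover have "(t+1)^3 \<le> 1" "(t+1)^3 \<ge> 0" using 2 by (auto intro: power_le_one)
    ultimately have "0 \<le> spos t" "spos t \<le> 1" by linarith+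
    then show ?thesis using 2 by simp
  next
    case 3
    then have "6 * spos t = (t + 1)^3 - 2 * t^3" by (simp add: spos_def)
    then have "6 * spos t = 6 * t + (1 - t)^3" by (simp add: field_simps power3_eq_cube)
    moreover have "(1-t)^3 \<le> 1" "(1-t)^3 \<ge> 0" using 3 by (auto intro: power_le_one)
    ultimately have "t \<le> spos t" "spos t \<le> t + 1" by linarith+
    then show ?thesis using 3 by simp
  next
    case 1 then show ?thesis by (simp add: spos_def)
  next
    case 4 then show ?thesis by (simp add: spos_ge_1)
  qed
  then show "max 0 t \<le> spos t" "spos t \<le> max 0 t + 1" by auto
qed

text \<open>From \<open>min a b = a - max 0 (a - b)\<close>, with the positive part replaced by the
  spline at scale \<open>\<eta>\<close>. It equals the minimum exactly once \<open>a\<close> and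
  \<open>b\<close> differ by at least \<open>\<eta>\<close>; this is what preserves prescribed
  values near the edge of the box.\<close>

definition softmin :: "real \<Rightarrow> real \<Rightarrow> real \<Rightarrow> real" where
  "softmin \<eta> a b = a - \<eta> * spos ((a - b) / \<eta>)"

lemma softmin_bounds:
  assumes "\<eta> > 0"
  shows "softmin \<eta> a b \<le> min a b" "min a b - \<eta> \<le> softmin \<eta> a b"
proof -
  have "\<eta> * max 0 ((a - b) / \<eta>) = max 0 (a - b)" using assms by (auto simp: max_def field_simps)
  moreover have "\<eta> * max 0 ((a - b) / \<eta>) \<le> \<eta> * spos ((a - b) / \<eta>)" "\<eta> * spos ((a - b) / \<eta>) \<le> \<eta> * (max 0 ((a - b) / \<eta>) + 1)"
    using spos_bounds assms by (auto intro!: mult_left_mono)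
  ultimately have "max 0 (a - b) \<le> \<eta> * spos ((a - b) / \<eta>)" "\<eta> * spos ((a - b) / \<eta>) \<le> max 0 (a - b) + \<eta>"
    by (simp_all add: distrib_left)
  then obtain X where "max 0 (a - b) \<le> X" "X \<le> max 0 (a - b) + \<eta>" "softmin \<eta> a b = a - X"
    unfolding softmin_def by blast
  then show "softmin \<eta> a b \<le> min a b" "min a b - \<eta> \<le> softmin \<eta> a b"
    by (auto simp: max_def min_def split: if_splits)
qed

lemma softmin_eq_right: "\<eta> > 0 \<Longrightarrow> a - b \<ge> \<eta> \<Longrightarrow> softmin \<eta> a b = b"
  unfolding softmin_def by (subst spos_ge_1) (auto simp: field_simps)

lemma C2_with_softmin:
  assumes a: "C2_with a Ga Ha" and b: "C2_with b Gb Hb" and "\<eta> > 0"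
  defines "p \<equiv> \<lambda>x. spos' ((a x - b x) / \<eta>)" and "q \<equiv> \<lambda>x. spos'' ((a x - b x) / \<eta>) / \<eta>"
  shows "C2_with (\<lambda>x. softmin \<eta> (a x) (b x)) (\<lambda>x. (1 - p x) *\<^sub>R Ga x + p x *\<^sub>R Gb x)
     (\<lambda>x. (1 - p x) *\<^sub>R Ha x + p x *\<^sub>R Hb x - q x *\<^sub>R outer (Ga x - Gb x))"
proof -
  have 0: "((\<lambda>x. (a x - b x) / \<eta>) has_derivative (\<lambda>h. (Ga x \<bullet> h - Gb x \<bullet> h) / \<eta>)) (at x)" for x
    using has_derivative_mult_right[OF has_derivative_diff[OF C2_withD(1)[OF a] C2_withD(1)[OF b]], of "inverse \<eta>" x UNIV]
    by (simp add: divide_inverse mult.commute)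
  have 1: "((\<lambda>x. spos ((a x - b x) / \<eta>)) has_derivative (\<lambda>h. spos' ((a x - b x) / \<eta>) * ((Ga x \<bullet> h - Gb x \<bullet> h) / \<eta>))) (at x)" for x
    by (rule has_derivative_eq_rhs, rule DERIV_compose_FDERIV[OF spos_deriv 0]) (simp add: mult.commute)
  have 2: "(p has_derivative (\<lambda>h. q x * (Ga x \<bullet> h - Gb x \<bullet> h))) (at x)" for x
    unfolding p_def q_def
    by (rule has_derivative_eq_rhs, rule DERIV_compose_FDERIV[OF spos'_deriv 0]) (simp add: mult.commute)
  have cp: "continuous_on UNIV p" using 2 by (meson continuous_at_imp_continuous_on has_derivative_continuous)
  have cq: "continuous_on UNIV q" unfolding q_def spos''_def using assms(3)
    by (intro continuous_intros C2_withD(5)[OF a] C2_withD(5)[OF b]) auto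
  show ?thesis unfolding C2_with_def
  proof (intro conjI allI)
    fix x
    show "((\<lambda>x. softmin \<eta> (a x) (b x)) has_derivative (\<lambda>h. ((1 - p x) *\<^sub>R Ga x + p x *\<^sub>R Gb x) \<bullet> h)) (at x)"
      unfolding softmin_def
    proof (intro has_derivative_eq_rhs[OF has_derivative_diff[OF C2_withD(1)[OF a] has_derivative_mult_right[OF 1]]] ext)
      fix h
      have "\<eta> * (spos' ((a x - b x) / \<eta>) * ((Ga x \<bullet> h - Gb x \<bullet> h) / \<eta>)) = p x * (Ga x \<bullet> h - Gb x \<bullet> h)"
        using assms(3) by (simp add: p_def)
      then show "Ga x \<bullet> h - \<eta> * (spos' ((a x - b x) / \<eta>) * ((Ga x \<bullet> h - Gb x \<bullet> h) / \<eta>)) = ((1 - p x) *\<^sub>R Ga x + p x *\<^sub>R Gb x) \<bullet> h"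
        by (simp add: inner_add_left algebra_simps)
    qed
    have "((\<lambda>x. (1 - p x) *\<^sub>R Ga x + p x *\<^sub>R Gb x) has_derivative
      (\<lambda>h. ((1 - p x) *\<^sub>R (Ha x *v h) + (- (q x * (Ga x \<bullet> h - Gb x \<bullet> h))) *\<^sub>R Ga x) + (p x *\<^sub>R (Hb x *v h) + (q x * (Ga x \<bullet> h - Gb x \<bullet> h)) *\<^sub>R Gb x))) (at x)"
      by (auto intro!: derivative_eq_intros 2 C2_withD(2)[OF a] C2_withD(2)[OF b])
    then show "((\<lambda>x. (1 - p x) *\<^sub>R Ga x + p x *\<^sub>R Gb x) has_derivative
      (\<lambda>h. ((1 - p x) *\<^sub>R Ha x + p x *\<^sub>R Hb x - q x *\<^sub>R outer (Ga x - Gb x)) *v h)) (at x)"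
      by (rule has_derivative_eq_rhs)
        (auto simp: fun_eq_iff matrix_vector_mult_add_rdistrib matrix_vector_mult_diff_rdistrib scaleR_matrix_vector
          outer_vector algebra_simps inner_diff_left)
  next
    show "continuous_on UNIV (\<lambda>x. (1 - p x) *\<^sub>R Ha x + p x *\<^sub>R Hb x - q x *\<^sub>R outer (Ga x - Gb x))"
      by (intro continuous_intros cp cq continuous_on_outer C2_withD[OF a] C2_withD[OF b])
  qed
qed

text \<open>\<open>\<kappa>\<close> is a modulus of strong concavity and \<open>L\<close> a bound on
  gradients. The bound is required on the ball only, because the quadratic term that provides
  \<open>\<kappa>\<close> has unbounded gradient.\<close>

definition smooth_conc :: "real \<Rightarrow> real \<Rightarrow> real \<Rightarrow> (real^'n \<Rightarrow> real) \<Rightarrow> (real^'n \<Rightarrow> real^'n) \<Rightarrow> (real^'n \<Rightarrow> real^'n^'n) \<Rightarrow> bool" where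
  "smooth_conc \<kappa> L \<rho> f G H \<longleftrightarrow> C2_with f G H \<and> (\<forall>x. psd (- H x - mat \<kappa>)) \<and> (\<forall>x\<in>cball 0 \<rho>. norm (G x) \<le> L)"

text \<open>The gradient of the smoothed minimum is a convex combination of the two gradients, and
  its Hessian is the same combination minus a nonnegative rank one term. Hence both
  \<open>\<kappa>\<close> and \<open>L\<close> survive unchanged.\<close>

lemma smooth_conc_softmin:
  assumes a: "smooth_conc \<kappa> L \<rho> a Ga Ha" and b: "smooth_conc \<kappa> L \<rho> b Gb Hb" and "\<eta> > 0"
  shows "\<exists>G H. smooth_conc \<kappa> L \<rho> (\<lambda>x. softmin \<eta> (a x) (b x)) G H"
proof -
  let ?p = "\<lambda>x. spos' ((a x - b x) / \<eta>)" and ?q = "\<lambda>x. spos'' ((a x - b x) / \<eta>) / \<eta>"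
  let ?G = "\<lambda>x. (1 - ?p x) *\<^sub>R Ga x + ?p x *\<^sub>R Gb x"
  let ?H = "\<lambda>x. (1 - ?p x) *\<^sub>R Ha x + ?p x *\<^sub>R Hb x - ?q x *\<^sub>R outer (Ga x - Gb x)"
  have "psd (- ?H x - mat \<kappa>)" for x
  proof -
    have "- ?H x - mat \<kappa> = (1 - ?p x) *\<^sub>R (- Ha x - mat \<kappa>) + ?p x *\<^sub>R (- Hb x - mat \<kappa>) + ?q x *\<^sub>R outer (Ga x - Gb x)"
      by (simp add: vec_eq_iff algebra_simps)
    also have "psd \<dots>"
      using a b spos'_bounds[of "(a x - b x) / \<eta>"] spos''_nonneg assms(3) unfolding smooth_conc_def
      by (intro psd_add psd_scale psd_outer) auto
    finally show ?thesis .
  qed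
  moreover have "norm (?G x) \<le> L" if "x \<in> cball 0 \<rho>" for x
  proof -
    have "?G x \<in> cball 0 L"
      using convex_cball[of "0::real^'a" L] spos'_bounds[of "(a x - b x) / \<eta>"] a b that
      unfolding convex_alt smooth_conc_def by auto
    then show ?thesis by simp
  qed
  ultimately show ?thesis
    using C2_with_softmin[of a Ga Ha b Gb Hb \<eta>] assms unfolding smooth_conc_def by (intro exI[of _ ?G] exI[of _ ?H]) auto
qed

lemma smooth_conc_affine:
  assumes "norm z \<le> R" "\<kappa> \<ge> 0"
  shows "smooth_conc \<kappa> (R + \<kappa> * \<rho>) \<rho> (\<lambda>y. t - z \<bullet> y - \<kappa> / 2 * (y \<bullet> y)) (\<lambda>y. - z - \<kappa> *\<^sub>R y) (\<lambda>y. - mat \<kappa>)"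
  unfolding smooth_conc_def C2_with_def
proof (intro conjI allI ballI)
  fix x :: "real^'a"
  show "((\<lambda>y. t - z \<bullet> y - \<kappa> / 2 * (y \<bullet> y)) has_derivative (\<lambda>h. (- z - \<kappa> *\<^sub>R x) \<bullet> h)) (at x)"
    by (auto intro!: derivative_eq_intros simp: inner_diff_left inner_diff_right inner_commute fun_eq_iff)
  show "((\<lambda>y. - z - \<kappa> *\<^sub>R y) has_derivative (*v) (- mat \<kappa>)) (at x)"
    by (rule has_derivative_eq_rhs) (auto intro!: derivative_eq_intros simp: fun_eq_iff minus_matrix_vector mat_vector)
  show "psd (- (- mat \<kappa>) - mat \<kappa> :: real^'a^'a)" using psd_zero by simp
  assume "x \<in> cball 0 \<rho>"
  then have "norm (\<kappa> *\<^sub>R x) \<le> \<kappa> * \<rho>" using assms by (simp add: mult_left_mono)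
  moreover have "norm (- z - \<kappa> *\<^sub>R x) \<le> norm z + norm (\<kappa> *\<^sub>R x)"
    by (metis norm_minus_cancel norm_triangle_ineq4)
  ultimately show "norm (- z - \<kappa> *\<^sub>R x) \<le> R + \<kappa> * \<rho>" using assms by linarith
qed auto

lemma smooth_conc_shift:
  assumes "smooth_conc \<kappa> L \<rho> f G H" shows "smooth_conc \<kappa> L \<rho> (\<lambda>x. f x + c) G H"
  using assms C2_with_add[OF _ C2_with_const, of f G H c] unfolding smooth_conc_def by auto

text \<open>One quadratic term is common to all affine pieces, so it commutes with the minimum; each
  added piece costs half of the allowed error, the rest going to the induction hypothesis.\<close>

lemma smooth_approx_finite_min:
  fixes Z :: "((real^'n) \<times> real) set"
  assumes "finite Z" "Z \<noteq> {}" "\<And>z t. (z,t) \<in> Z \<Longrightarrow> norm z \<le> R" "\<kappa> \<ge> 0" "\<epsilon> > 0"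
  shows "\<exists>f G H. smooth_conc \<kappa> (R + \<kappa> * \<rho>) \<rho> f G H \<and>
    (\<forall>y. \<bar>f y - (Min ((\<lambda>(z,t). t - z \<bullet> y) ` Z) - \<kappa> / 2 * (y \<bullet> y))\<bar> \<le> \<epsilon>)"
  using assms
proof (induction arbitrary: \<epsilon> rule: finite_ne_induct)
  case (singleton x)
  obtain z t where [simp]: "x = (z,t)" by fastforce
  show ?case using smooth_conc_affine[of z R \<kappa> \<rho> t] singleton
    by (intro exI[of _ "\<lambda>y. t - z \<bullet> y - \<kappa> / 2 * (y \<bullet> y)"]) auto
next
  case (insert x F)
  obtain z t where [simp]: "x = (z,t)" by fastforce
  obtain f G H where f: "smooth_conc \<kappa> (R + \<kappa> * \<rho>) \<rho> f G H"
    "\<And>y. \<bar>f y - (Min ((\<lambda>(z,t). t - z \<bullet> y) ` F) - \<kappa> / 2 * (y \<bullet> y))\<bar> \<le> \<epsilon>/2"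
    using insert.IH[of "\<epsilon>/2"] insert.prems by force
  let ?a = "\<lambda>y. t - z \<bullet> y - \<kappa> / 2 * (y \<bullet> y)"
  obtain G' H' where g: "smooth_conc \<kappa> (R + \<kappa> * \<rho>) \<rho> (\<lambda>y. softmin (\<epsilon>/2) (?a y) (f y)) G' H'"
    using smooth_conc_softmin[OF smooth_conc_affine[of z R \<kappa> \<rho> t] f(1), of "\<epsilon>/2"] insert.prems by auto
  have "\<bar>softmin (\<epsilon>/2) (?a y) (f y) - (Min ((\<lambda>(z,t). t - z \<bullet> y) ` insert x F) - \<kappa> / 2 * (y \<bullet> y))\<bar> \<le> \<epsilon>" for y
  proof -
    have "Min ((\<lambda>(z,t). t - z \<bullet> y) ` insert x F) = min (t - z \<bullet> y) (Min ((\<lambda>(z,t). t - z \<bullet> y) ` F))"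
      using insert.hyps by simp
    then have "\<bar>min (?a y) (f y) - (Min ((\<lambda>(z,t). t - z \<bullet> y) ` insert x F) - \<kappa> / 2 * (y \<bullet> y))\<bar> \<le> \<epsilon> / 2"
      using f(2)[of y] insert.prems(3) by (auto simp: min_def abs_le_iff)
    then show ?thesis
      using softmin_bounds[of "\<epsilon>/2" "?a y" "f y"] insert.prems by linarith
  qed
  then show ?case using g by blast
qed

section \<open>Concave support functions and their smooth approximation\<close>

definition supp_fun :: "((real^'n) \<times> real) set \<Rightarrow> real^'n \<Rightarrow> real" where
  "supp_fun S y = (INF (z,t)\<in>S. t - z \<bullet> y)"

lemma supp_fun_attained:
  assumes "compact S" "S \<noteq> {}"
  obtains z t where "(z,t) \<in> S" "supp_fun S y = t - z \<bullet> y" "\<And>z' t'. (z',t') \<in> S \<Longrightarrow> t - z \<bullet> y \<le> t' - z' \<bullet> y"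
proof -
  have "continuous_on S (\<lambda>(z,t). t - z \<bullet> y)"
    by (auto simp: case_prod_unfold intro!: continuous_intros)
  then obtain p where p: "p \<in> S" "\<And>q. q \<in> S \<Longrightarrow> (\<lambda>(z,t). t - z \<bullet> y) p \<le> (\<lambda>(z,t). t - z \<bullet> y) q"
    using continuous_attains_inf[OF assms] by blast
  have "supp_fun S y = (\<lambda>(z,t). t - z \<bullet> y) p"
    unfolding supp_fun_def using p by (intro cInf_eq_minimum) auto
  with p that[of "fst p" "snd p"] show ?thesis by (auto simp: case_prod_unfold)
qed

lemma smooth_approx_supp_fun:
  fixes S :: "((real^'n) \<times> real) set"
  assumes S: "compact S" "S \<noteq> {}" "\<And>z t. (z,t) \<in> S \<Longrightarrow> norm z \<le> R"
    and "\<kappa> \<ge> 0" "\<epsilon> > 0" "\<rho> \<ge> 0" "\<kappa> * \<rho>\<^sup>2 \<le> \<epsilon>"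
  shows "\<exists>f G H. smooth_conc \<kappa> (R + \<kappa> * \<rho>) \<rho> f G H \<and> (\<forall>y\<in>cball 0 \<rho>. \<bar>f y - supp_fun S y\<bar> \<le> 2 * \<epsilon>)"
proof -
  \<comment> \<open>Moving \<open>(z, t)\<close> by \<open>e\<close> changes
    \<open>t - z \<bullet> y\<close> by at most \<open>e + e * \<rho>\<close> on the ball, which
    this choice makes \<open>\<epsilon> / 2\<close>. The finite net, the quadratic term and the
    smoothing each contribute at most that much.\<close>
  define e where "e = \<epsilon> / 2 / (1 + \<rho>)"
  have e: "e > 0" using assms by (simp add: e_def)
  obtain Z where Z: "finite Z" "Z \<subseteq> S" "S \<subseteq> (\<Union>x\<in>Z. ball x e)"
    using seq_compact_imp_totally_bounded[OF compact_imp_seq_compact[OF S(1)], rule_format, OF e] by auto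
  then have "Z \<noteq> {}" using S by auto
  have R: "\<And>z t. (z,t) \<in> Z \<Longrightarrow> norm z \<le> R" using Z S by auto
  from \<open>\<epsilon> > 0\<close> have "\<epsilon> / 2 > 0" by simp
  then have "\<exists>f G H. smooth_conc \<kappa> (R + \<kappa> * \<rho>) \<rho> f G H \<and>
    (\<forall>y. \<bar>f y - (Min ((\<lambda>(z,t). t - z \<bullet> y) ` Z) - \<kappa> / 2 * (y \<bullet> y))\<bar> \<le> \<epsilon>/2)"
    using R by (intro smooth_approx_finite_min[OF Z(1) \<open>Z \<noteq> {}\<close> _ \<open>\<kappa> \<ge> 0\<close>]) auto
  then obtain f G H where f: "smooth_conc \<kappa> (R + \<kappa> * \<rho>) \<rho> f G H"
    "\<And>y. \<bar>f y - (Min ((\<lambda>(z,t). t - z \<bullet> y) ` Z) - \<kappa> / 2 * (y \<bullet> y))\<bar> \<le> \<epsilon>/2"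
    by blast
  have "\<bar>f y - supp_fun S y\<bar> \<le> 2 * \<epsilon>" if y: "y \<in> cball 0 \<rho>" for y
  proof -
    let ?M = "Min ((\<lambda>(z,t). t - z \<bullet> y) ` Z)"
    obtain z t where zt: "(z,t) \<in> S" "supp_fun S y = t - z \<bullet> y" "\<And>z' t'. (z',t') \<in> S \<Longrightarrow> t - z \<bullet> y \<le> t' - z' \<bullet> y"
      by (rule supp_fun_attained[OF S(1,2), of y], rule that, assumption, assumption, blast)
    have 1: "supp_fun S y \<le> ?M"
      unfolding zt(2) using Z(1,2) zt(3) \<open>Z \<noteq> {}\<close> by (subst Min_ge_iff) auto
    obtain z' t' where z': "(z',t') \<in> Z" "dist (z',t') (z,t) < e" using subsetD[OF Z(3) zt(1)] by (auto simp: mem_ball)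
    have "?M \<le> t' - z' \<bullet> y" using z' Z by (intro Min_le) (auto intro!: image_eqI[of _ _ "(z',t')"])
    also have "\<dots> = (t - z \<bullet> y) + (t' - t) - (z' - z) \<bullet> y" by (simp add: inner_diff_left)
    also have "\<dots> \<le> supp_fun S y + e + e * \<rho>"
    proof -
      have "dist t' t \<le> e" "dist z' z \<le> e" using z' dist_snd_le[of "(z',t')" "(z,t)"] dist_fst_le[of "(z',t')" "(z,t)"] by auto
      moreover have "\<bar>(z' - z) \<bullet> y\<bar> \<le> norm (z' - z) * norm y" by (rule Cauchy_Schwarz_ineq2)
      moreover have "norm (z' - z) * norm y \<le> e * \<rho>" using \<open>dist z' z \<le> e\<close> y e unfolding dist_norm by (intro mult_mono) auto
      ultimately have "t' - t \<le> e" "\<bar>(z' - z) \<bullet> y\<bar> \<le> e * \<rho>" by (simp_all add: dist_real_def)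
      then show ?thesis unfolding zt(2) by linarith
    qed
    finally have "?M \<le> supp_fun S y + e + e * \<rho>" .
    moreover have "e + e * \<rho> = \<epsilon> / 2"
    proof -
      have "e + e * \<rho> = e * (1 + \<rho>)" by (simp add: distrib_left)
      also have "\<dots> = \<epsilon> / 2" using assms e_def nonzero_eq_divide_eq[of "1 + \<rho>" e "\<epsilon> / 2"] by simp
      finally show ?thesis .
    qed
    ultimately have 2: "?M \<le> supp_fun S y + \<epsilon> / 2" by linarith
    have "y \<bullet> y \<le> \<rho>\<^sup>2" unfolding power2_norm_eq_inner[symmetric] using y by (intro power_mono) auto
    then have "\<kappa> * (y \<bullet> y) \<le> \<kappa> * \<rho>\<^sup>2" using assms by (intro mult_left_mono) auto
    then have "\<kappa> * (y \<bullet> y) \<le> \<epsilon>" "\<kappa> * (y \<bullet> y) \<ge> 0" using assms by auto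
    then have "0 \<le> \<kappa> / 2 * (y \<bullet> y)" "\<kappa> / 2 * (y \<bullet> y) \<le> \<epsilon> / 2" by simp_all
    then obtain q where q: "q = \<kappa> / 2 * (y \<bullet> y)" "0 \<le> q" "q \<le> \<epsilon> / 2" by blast
    obtain m where m: "m = ?M" by simp
    show ?thesis using f(2)[of y] 1 2 assms(5) q(2,3) unfolding q(1)[symmetric] m[symmetric] by linarith
  qed
  then show ?thesis using f by blast
qed

section \<open>Conjugates of smooth concave functions on a ball\<close>

text \<open>A condition on the ball alone, weaker than \<open>smooth_conc\<close> for positive
  \<open>\<kappa>\<close>: unlike a fixed modulus \<open>\<kappa>\<close>, it survives small
  perturbations in both directions.\<close>

definition strictly_conc :: "real \<Rightarrow> (real^'n \<Rightarrow> real) \<Rightarrow> (real^'n \<Rightarrow> real^'n) \<Rightarrow> (real^'n \<Rightarrow> real^'n^'n) \<Rightarrow> bool" where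
  "strictly_conc \<rho> v G H \<longleftrightarrow> C2_with v G H \<and> (\<forall>x\<in>cball 0 \<rho>. \<forall>h. h \<noteq> 0 \<longrightarrow> h \<bullet> (H x *v h) < 0)"

text \<open>The conjugate of the convex function \<open>- v\<close> restricted to the ball. By
  compactness it is attained for every \<open>z\<close> whenever \<open>v\<close> is continuous,
  with no condition at infinity.\<close>

definition conj_on :: "real \<Rightarrow> (real^'n \<Rightarrow> real) \<Rightarrow> real^'n \<Rightarrow> real" where
  "conj_on \<rho> v z = (SUP y\<in>cball 0 \<rho>. z \<bullet> y + v y)"

definition maximizer :: "real \<Rightarrow> (real^'n \<Rightarrow> real) \<Rightarrow> real^'n \<Rightarrow> real^'n" where
  "maximizer \<rho> v z = (SOME y. y \<in> cball 0 \<rho> \<and> (\<forall>x\<in>cball 0 \<rho>. z \<bullet> x + v x \<le> z \<bullet> y + v y))"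

lemma strictly_conc_tangent:
  assumes v: "strictly_conc \<rho> v G H" and x: "x \<in> cball 0 \<rho>" and y: "y \<in> cball 0 \<rho>" and "x \<noteq> y"
  shows "v x < v y + G y \<bullet> (x - y)"
proof -
  define h where "h = x - y"
  have h: "h \<noteq> 0" using assms by (simp add: h_def)
  have C2: "C2_with v G H" using v by (simp add: strictly_conc_def)
  have seg: "y + t *\<^sub>R h \<in> cball 0 \<rho>" if "0 \<le> t" "t \<le> 1" for t
  proof -
    have "y + t *\<^sub>R h = (1 - t) *\<^sub>R y + t *\<^sub>R x" by (simp add: h_def algebra_simps)
    then show ?thesis using convex_cball[of "0::real^'a" \<rho>] x y that unfolding convex_alt by auto
  qed
  have d: "((\<lambda>t. y + t *\<^sub>R h) has_derivative (\<lambda>u. u *\<^sub>R h)) (at t within S)" for t S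
    by (auto intro!: derivative_eq_intros)
  have "((\<lambda>t. v (y + t *\<^sub>R h)) has_derivative (\<lambda>u. G (y + t *\<^sub>R h) \<bullet> (u *\<^sub>R h))) (at t within S)" for t S
    by (rule has_derivative_compose[OF d C2_withD(1)[OF C2]])
  then obtain \<xi> where \<xi>: "\<xi> \<in> {0<..<1}" "v (y + 1 *\<^sub>R h) - v (y + 0 *\<^sub>R h) = G (y + \<xi> *\<^sub>R h) \<bullet> ((1 - 0) *\<^sub>R h)"
    using mvt_simple[of 0 1 "\<lambda>t. v (y + t *\<^sub>R h)" "\<lambda>t u. G (y + t *\<^sub>R h) \<bullet> (u *\<^sub>R h)"] by fastforce
  have "((\<lambda>t. G (y + t *\<^sub>R h)) has_derivative (\<lambda>u. H (y + t *\<^sub>R h) *v (u *\<^sub>R h))) (at t within S)" for t S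
    by (rule has_derivative_compose[OF d C2_withD(2)[OF C2]])
  then have "((\<lambda>t. G (y + t *\<^sub>R h) \<bullet> h) has_derivative (\<lambda>u. (H (y + t *\<^sub>R h) *v (u *\<^sub>R h)) \<bullet> h)) (at t within S)" for t S
    by (rule has_derivative_inner_left)
  then obtain \<zeta> where \<zeta>: "\<zeta> \<in> {0<..<\<xi>}" "G (y + \<xi> *\<^sub>R h) \<bullet> h - G (y + 0 *\<^sub>R h) \<bullet> h = (H (y + \<zeta> *\<^sub>R h) *v ((\<xi> - 0) *\<^sub>R h)) \<bullet> h"
    using mvt_simple[of 0 \<xi> "\<lambda>t. G (y + t *\<^sub>R h) \<bullet> h" "\<lambda>t u. (H (y + t *\<^sub>R h) *v (u *\<^sub>R h)) \<bullet> h"] \<xi> by fastforce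
  have "h \<bullet> (H (y + \<zeta> *\<^sub>R h) *v h) < 0"
    using v seg[of \<zeta>] \<xi> \<zeta> h unfolding strictly_conc_def by auto
  then have "(H (y + \<zeta> *\<^sub>R h) *v ((\<xi> - 0) *\<^sub>R h)) \<bullet> h < 0"
    using \<xi> by (simp add: matrix_vector_mult_scaleR inner_commute mult_pos_neg)
  then have "G (y + \<xi> *\<^sub>R h) \<bullet> h < G y \<bullet> h" using \<zeta> by simp
  then show ?thesis using \<xi> by (simp add: h_def)
qed

lemma maximizer_props:
  fixes v :: "real^'n \<Rightarrow> real"
  assumes "continuous_on (cball 0 \<rho>) v" "\<rho> \<ge> 0"
  shows "maximizer \<rho> v z \<in> cball 0 \<rho>"
    and "\<And>x. x \<in> cball 0 \<rho> \<Longrightarrow> z \<bullet> x + v x \<le> z \<bullet> maximizer \<rho> v z + v (maximizer \<rho> v z)"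
    and "conj_on \<rho> v z = z \<bullet> maximizer \<rho> v z + v (maximizer \<rho> v z)"
    and "\<And>x. x \<in> cball 0 \<rho> \<Longrightarrow> z \<bullet> x + v x \<le> conj_on \<rho> v z"
proof -
  have "continuous_on (cball 0 \<rho>) (\<lambda>y. z \<bullet> y + v y)" by (intro continuous_intros assms)
  then have "\<exists>y. y \<in> cball 0 \<rho> \<and> (\<forall>x\<in>cball 0 \<rho>. z \<bullet> x + v x \<le> z \<bullet> y + v y)"
    using continuous_attains_sup[of "cball (0::real^'n) \<rho>" "\<lambda>y. z \<bullet> y + v y"] assms by auto
  from someI_ex[OF this, folded maximizer_def]
  show 1: "maximizer \<rho> v z \<in> cball 0 \<rho>" and 2: "\<And>x. x \<in> cball 0 \<rho> \<Longrightarrow> z \<bullet> x + v x \<le> z \<bullet> maximizer \<rho> v z + v (maximizer \<rho> v z)"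
    by auto
  show 3: "conj_on \<rho> v z = z \<bullet> maximizer \<rho> v z + v (maximizer \<rho> v z)"
    unfolding conj_on_def using 1 2 by (intro cSup_eq_maximum) auto
  show "\<And>x. x \<in> cball 0 \<rho> \<Longrightarrow> z \<bullet> x + v x \<le> conj_on \<rho> v z" using 2 3 by simp
qed

lemma maximizer_eqI:
  assumes v: "strictly_conc \<rho> v G H" and "\<rho> \<ge> 0" and y: "y \<in> cball 0 \<rho>" and z: "z = - G y"
  shows "maximizer \<rho> v z = y"
proof (rule ccontr)
  assume ne: "maximizer \<rho> v z \<noteq> y"
  have cont: "continuous_on (cball 0 \<rho>) v" using v C2_withD(5) unfolding strictly_conc_def by blast
  note m = maximizer_props[OF cont \<open>\<rho> \<ge> 0\<close>, where z=z]
  have "v (maximizer \<rho> v z) < v y + G y \<bullet> (maximizer \<rho> v z - y)"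
    using strictly_conc_tangent[OF v m(1) y ne] .
  moreover have "z \<bullet> y + v y \<le> z \<bullet> maximizer \<rho> v z + v (maximizer \<rho> v z)" using m(2)[OF y] .
  ultimately show False by (simp add: z inner_diff_right)
qed

lemma maximizer_interior:
  assumes v: "C2_with v G H" and "\<rho> \<ge> 0" and "maximizer \<rho> v z \<in> ball 0 \<rho>"
  shows "z = - G (maximizer \<rho> v z)"
proof -
  let ?y = "maximizer \<rho> v z"
  have cont: "continuous_on (cball 0 \<rho>) v" using v C2_withD(5) by blast
  have "((\<lambda>x. z \<bullet> x + v x) has_derivative (\<lambda>h. z \<bullet> h + G ?y \<bullet> h)) (at ?y)"
    by (auto intro!: derivative_eq_intros C2_withD(1)[OF v])
  then have "(\<lambda>h. z \<bullet> h + G ?y \<bullet> h) = (\<lambda>h. 0)"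
    by (rule differential_zero_maxmin[OF assms(3) open_ball])
      (use maximizer_props(2)[OF cont \<open>\<rho> \<ge> 0\<close>] in auto)
  then have "(z + G ?y) \<bullet> (z + G ?y) = 0" unfolding inner_add_left by (rule fun_cong)
  then show ?thesis by (simp add: eq_neg_iff_add_eq_0)
qed

text \<open>On the segment from the identity to \<open>A\<close> the quadratic form stays positive,
  so the determinant has no zero there, and it starts at 1.\<close>

lemma det_posdef:
  fixes A :: "real^'n^'n"
  assumes "\<And>h. h \<noteq> 0 \<Longrightarrow> h \<bullet> (A *v h) > 0"
  shows "det A > 0"
proof (rule ccontr)
  assume "\<not> det A > 0"
  let ?f = "\<lambda>t. det ((1 - t) *\<^sub>R mat 1 + t *\<^sub>R A)"
  have "continuous_on {0..1} ?f"
    unfolding det_def by (intro continuous_intros)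
  moreover have "?f 1 \<le> 0" "0 \<le> ?f 0" using \<open>\<not> det A > 0\<close> by auto
  ultimately obtain t where t: "0 \<le> t" "t \<le> 1" "?f t = 0"
    using IVT2'[of ?f 1 0 0] by auto
  let ?M = "(1 - t) *\<^sub>R mat 1 + t *\<^sub>R A"
  have "\<not> inj ((*v) ?M)" using t(3) det_nz_iff_inj[of "(*v) ?M"] by simp
  then obtain h where h: "h \<noteq> 0" "?M *v h = 0"
    using linear_injective_0[of "(*v) ?M"] by auto
  then have "h \<bullet> (((1 - t) *\<^sub>R mat 1 + t *\<^sub>R A) *v h) = 0" by simp
  then have "(1 - t) * (h \<bullet> h) + t * (h \<bullet> (A *v h)) = 0"
    by (simp add: matrix_vector_mult_add_rdistrib scaleR_matrix_vector inner_add_right)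
  moreover have "h \<bullet> h > 0" "h \<bullet> (A *v h) > 0" using h assms by auto
  moreover have "(1 - t) * (h \<bullet> h) + t * (h \<bullet> (A *v h)) > 0"
  proof (cases "t = 0")
    case True then show ?thesis using calculation by simp
  next
    case False
    then have "t * (h \<bullet> (A *v h)) > 0" using t calculation by (intro mult_pos_pos) auto
    moreover have "(1 - t) * (h \<bullet> h) \<ge> 0" using t by simp
    ultimately show ?thesis by linarith
  qed
  ultimately show False by simp
qed

lemma has_absolute_integral_change_of_variables_scalar:
  fixes f :: "real^'m::{finite,wellorder} \<Rightarrow> real" and g :: "real^'m::_ \<Rightarrow> real^'m::_"
  assumes "S \<in> sets lebesgue"
    and "\<And>x. x \<in> S \<Longrightarrow> (g has_derivative g' x) (at x within S)" and "inj_on g S"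
  shows "(\<lambda>x. \<bar>det (matrix (g' x))\<bar> * f (g x)) absolutely_integrable_on S \<and>
      integral S (\<lambda>x. \<bar>det (matrix (g' x))\<bar> * f (g x)) = b \<longleftrightarrow>
    f absolutely_integrable_on (g ` S) \<and> integral (g ` S) f = b"
  using has_absolute_integral_change_of_variables[OF assms, of "\<lambda>x. vec (f x) :: real^1" "vec b"]
  by (simp add: absolutely_integrable_on_1_iff integral_on_1_eq vec_eq_iff)

context
  fixes \<rho> :: real and a b :: "real^'n::{finite,wellorder}"
  assumes \<rho>: "\<rho> > 0" and box: "cbox a b \<subseteq> ball 0 \<rho>"
begin

text \<open>Substitution \<open>z = - G y\<close>, inverted on the box by the maximizer. If the
  maximizer lies in the box, it is interior to the ball and \<open>z\<close> is in the image;
  otherwise \<open>f\<close> vanishes there. Hence the integral may run over the whole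
  space.\<close>

lemma gradient_image_integral:
  assumes v: "strictly_conc \<rho> v G H" and f: "continuous_on (cbox a b) f"
    and f0: "\<And>y. y \<in> cball 0 \<rho> - cbox a b \<Longrightarrow> f y = 0"
  shows "(\<lambda>z. f (maximizer \<rho> v z)) absolutely_integrable_on UNIV"
    and "integral UNIV (\<lambda>z. f (maximizer \<rho> v z)) = integral (cbox a b) (\<lambda>y. det (- H y) * f y)"
proof -
  have C2: "C2_with v G H" using v by (simp add: strictly_conc_def)
  have cont: "continuous_on (cball 0 \<rho>) v" using C2_withD(5)[OF C2] .
  let ?T = "\<lambda>y. - G y"
  have max: "maximizer \<rho> v (?T y) = y" if "y \<in> cbox a b" for y
  proof -
    have "y \<in> cball 0 \<rho>" using that box by (auto simp: subset_iff)
    from maximizer_eqI[OF v less_imp_le[OF \<rho>] this refl] show ?thesis .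
  qed
  have inj: "inj_on ?T (cbox a b)" by (rule inj_on_inverseI[of _ "maximizer \<rho> v"]) (rule max)
  have der: "(?T has_derivative (\<lambda>h. (- H y) *v h)) (at y within cbox a b)" for y
    using has_derivative_minus[OF C2_withD(2)[OF C2]] by (simp add: minus_matrix_vector)
  have det: "\<bar>det (matrix (\<lambda>h. (- H y) *v h))\<bar> = det (- H y)" if "y \<in> cbox a b" for y
  proof -
    have "y \<in> cball 0 \<rho>" using that box by (auto simp: subset_iff)
    then have "det (- H y) > 0"
      using v by (intro det_posdef) (auto simp: strictly_conc_def minus_matrix_vector)
    then show ?thesis by (simp add: matrix_of_matrix_vector_mul)
  qed
  have "continuous_on (cbox a b) (\<lambda>y. det (- H y) * f y)"
    unfolding det_def by (intro continuous_intros f C2_withD(3)[OF C2])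
  then have ai: "(\<lambda>y. det (- H y) * f y) absolutely_integrable_on cbox a b"
    by (rule absolutely_integrable_continuous)
  have e: "\<bar>det (matrix (\<lambda>h. (- H y) *v h))\<bar> * f (maximizer \<rho> v (?T y)) = det (- H y) * f y" if "y \<in> cbox a b" for y
    unfolding det[OF that] max[OF that] ..
  have "(\<lambda>y. \<bar>det (matrix (\<lambda>h. (- H y) *v h))\<bar> * f (maximizer \<rho> v (?T y))) absolutely_integrable_on cbox a b"
    by (subst set_integrable_cong[OF refl refl e]) (use ai in simp_all)
  moreover have "integral (cbox a b) (\<lambda>y. \<bar>det (matrix (\<lambda>h. (- H y) *v h))\<bar> * f (maximizer \<rho> v (?T y))) = integral (cbox a b) (\<lambda>y. det (- H y) * f y)"
    by (rule integral_cong[OF e])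
  ultimately have *: "(\<lambda>z. f (maximizer \<rho> v z)) absolutely_integrable_on (?T ` cbox a b)"
    "integral (?T ` cbox a b) (\<lambda>z. f (maximizer \<rho> v z)) = integral (cbox a b) (\<lambda>y. det (- H y) * f y)"
    using has_absolute_integral_change_of_variables_scalar[OF lmeasurable_cbox[THEN fmeasurableD] der inj, of "\<lambda>z. f (maximizer \<rho> v z)"]
    by auto
  have e: "(\<lambda>z. if z \<in> ?T ` cbox a b then f (maximizer \<rho> v z) else 0) = (\<lambda>z. f (maximizer \<rho> v z))"
  proof
    fix z
    show "(if z \<in> ?T ` cbox a b then f (maximizer \<rho> v z) else 0) = f (maximizer \<rho> v z)"
    proof (cases "maximizer \<rho> v z \<in> cbox a b")
      case True
      then have "z = ?T (maximizer \<rho> v z)"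
        using box \<rho> by (intro maximizer_interior[OF C2]) auto
      then show ?thesis using True by (auto simp: image_iff)
    next
      case False
      then show ?thesis using f0[of "maximizer \<rho> v z"] maximizer_props(1)[OF cont, of z] \<rho> by auto
    qed
  qed
  show "(\<lambda>z. f (maximizer \<rho> v z)) absolutely_integrable_on UNIV"
    using *(1) absolutely_integrable_restrict_UNIV[of "?T ` cbox a b" "\<lambda>z. f (maximizer \<rho> v z)"] unfolding e by simp
  show "integral UNIV (\<lambda>z. f (maximizer \<rho> v z)) = integral (cbox a b) (\<lambda>y. det (- H y) * f y)"
    using *(2) integral_restrict_UNIV[of "?T ` cbox a b" "\<lambda>z. f (maximizer \<rho> v z)"] unfolding e by simp
qed

lemma conj_on_Lipschitz:
  assumes "continuous_on (cball 0 \<rho>) v"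
  shows "conj_on \<rho> v z \<le> conj_on \<rho> v z' + \<rho> * norm (z - z')"
proof -
  let ?y = "maximizer \<rho> v z"
  have "conj_on \<rho> v z = z' \<bullet> ?y + v ?y + (z - z') \<bullet> ?y"
    using maximizer_props(3)[OF assms, of z] \<rho> by (simp add: inner_diff_left)
  also have "z' \<bullet> ?y + v ?y \<le> conj_on \<rho> v z'"
    using maximizer_props(1,4)[OF assms] \<rho> by auto
  also have "(z - z') \<bullet> ?y \<le> norm (z - z') * norm ?y" by (rule norm_cauchy_schwarz)
  also have "\<dots> \<le> norm (z - z') * \<rho>"
    using maximizer_props(1)[OF assms, of z] \<rho> by (intro mult_left_mono) auto
  finally show ?thesis by (simp add: mult.commute)
qed

lemma continuous_conj_on:
  assumes "continuous_on (cball 0 \<rho>) v"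
  shows "continuous_on S (conj_on \<rho> v)"
proof (rule continuous_on_subset[OF _ subset_UNIV], rule lipschitz_on_continuous_on, rule lipschitz_onI)
  show "dist (conj_on \<rho> v x) (conj_on \<rho> v y) \<le> \<rho> * dist x y" for x y
    using conj_on_Lipschitz[OF assms, of x y] conj_on_Lipschitz[OF assms, of y x]
    by (simp add: dist_real_def dist_norm norm_minus_commute abs_le_iff)
qed (use \<rho> in auto)

text \<open>The maximizer for one function is a competitor for the other, which bounds the
  difference of the conjugates pointwise by \<open>v1 - v0\<close> at the two maximizers;
  substitution turns these bounds into integrals over the box.\<close>

lemma conj_diff_bounds:
  assumes v0: "strictly_conc \<rho> v0 G0 H0" and v1: "strictly_conc \<rho> v1 G1 H1"
    and eq: "\<And>y. y \<in> cball 0 \<rho> - cbox a b \<Longrightarrow> v1 y = v0 y"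
  shows "(\<lambda>z. conj_on \<rho> v1 z - conj_on \<rho> v0 z) absolutely_integrable_on UNIV"
    and "integral (cbox a b) (\<lambda>y. det (- H0 y) * (v1 y - v0 y)) \<le> integral UNIV (\<lambda>z. conj_on \<rho> v1 z - conj_on \<rho> v0 z)"
    and "integral UNIV (\<lambda>z. conj_on \<rho> v1 z - conj_on \<rho> v0 z) \<le> integral (cbox a b) (\<lambda>y. det (- H1 y) * (v1 y - v0 y))"
proof -
  let ?f = "\<lambda>y. v1 y - v0 y" and ?g = "\<lambda>z. conj_on \<rho> v1 z - conj_on \<rho> v0 z"
  have C: "C2_with v0 G0 H0" "C2_with v1 G1 H1" using v0 v1 by (auto simp: strictly_conc_def)
  have c0: "continuous_on S v0" and c1: "continuous_on S v1" for S using C2_withD(5)[OF C(1)] C2_withD(5)[OF C(2)] .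
  have cf: "continuous_on (cbox a b) ?f" by (intro continuous_intros c0 c1)
  have f0: "\<And>y. y \<in> cball 0 \<rho> - cbox a b \<Longrightarrow> ?f y = 0" using eq by simp
  have I0: "(\<lambda>z. ?f (maximizer \<rho> v0 z)) absolutely_integrable_on UNIV"
    "integral UNIV (\<lambda>z. ?f (maximizer \<rho> v0 z)) = integral (cbox a b) (\<lambda>y. det (- H0 y) * ?f y)"
    by (rule gradient_image_integral[OF v0 cf], erule f0)+
  have I1: "(\<lambda>z. ?f (maximizer \<rho> v1 z)) absolutely_integrable_on UNIV"
    "integral UNIV (\<lambda>z. ?f (maximizer \<rho> v1 z)) = integral (cbox a b) (\<lambda>y. det (- H1 y) * ?f y)"
    by (rule gradient_image_integral[OF v1 cf], erule f0)+
  have lo: "?f (maximizer \<rho> v0 z) \<le> ?g z" for z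
  proof -
    have "conj_on \<rho> v0 z = z \<bullet> maximizer \<rho> v0 z + v0 (maximizer \<rho> v0 z)" using maximizer_props(3)[OF c0] \<rho> by simp
    moreover have "z \<bullet> maximizer \<rho> v0 z + v1 (maximizer \<rho> v0 z) \<le> conj_on \<rho> v1 z"
      using maximizer_props(1)[OF c0] maximizer_props(4)[OF c1] \<rho> by simp
    ultimately show ?thesis by simp
  qed
  have hi: "?g z \<le> ?f (maximizer \<rho> v1 z)" for z
  proof -
    have "conj_on \<rho> v1 z = z \<bullet> maximizer \<rho> v1 z + v1 (maximizer \<rho> v1 z)" using maximizer_props(3)[OF c1] \<rho> by simp
    moreover have "z \<bullet> maximizer \<rho> v1 z + v0 (maximizer \<rho> v1 z) \<le> conj_on \<rho> v0 z"
      using maximizer_props(1)[OF c1] maximizer_props(4)[OF c0] \<rho> by simp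
    ultimately show ?thesis by simp
  qed
  have "continuous_on UNIV ?g" by (intro continuous_intros continuous_conj_on c0 c1)
  then have meas: "?g \<in> borel_measurable (lebesgue_on UNIV)"
    by (intro continuous_imp_measurable_on_sets_lebesgue) auto
  show ai: "?g absolutely_integrable_on UNIV"
  proof (rule measurable_bounded_by_integrable_imp_absolutely_integrable[OF meas])
    show "(\<lambda>z. norm (?f (maximizer \<rho> v0 z)) + norm (?f (maximizer \<rho> v1 z))) integrable_on UNIV"
      using I0(1) I1(1) by (intro integrable_add) (auto simp: absolutely_integrable_on_def)
    show "norm (?g z) \<le> norm (?f (maximizer \<rho> v0 z)) + norm (?f (maximizer \<rho> v1 z))" if "z \<in> UNIV" for z
      using lo[of z] hi[of z] unfolding real_norm_def by linarith
  qed auto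
  show "integral (cbox a b) (\<lambda>y. det (- H0 y) * ?f y) \<le> integral UNIV ?g"
    unfolding I0(2)[symmetric] using I0(1) ai lo by (intro integral_le) (auto simp: absolutely_integrable_on_def)
  show "integral UNIV ?g \<le> integral (cbox a b) (\<lambda>y. det (- H1 y) * ?f y)"
    unfolding I1(2)[symmetric] using I1(1) ai hi by (intro integral_le) (auto simp: absolutely_integrable_on_def)
qed

end

section \<open>The derivative of the determinant\<close>

text \<open>The derivative of \<open>det\<close> at \<open>S\<close> in direction \<open>X\<close>,
  that is the trace of the adjugate of \<open>S\<close> times \<open>X\<close>, written with one row
  of \<open>X\<close> at a time.\<close>

definition ddet :: "real^'n^'n \<Rightarrow> real^'n^'n \<Rightarrow> real" where
  "ddet S X = (\<Sum>\<sigma> | \<sigma> permutes UNIV. of_int (sign \<sigma>) *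
     (\<Sum>k\<in>UNIV. X $ k $ \<sigma> k * (\<Prod>r\<in>UNIV - {k}. S $ r $ \<sigma> r)))"

lemma ddet_add: "ddet S (X + Y) = ddet S X + ddet S Y"
  unfolding ddet_def by (simp add: distrib_right distrib_left sum.distrib)

lemma ddet_scale: "ddet S (c *\<^sub>R X) = c * ddet S X"
  unfolding ddet_def by (simp add: sum_distrib_left mult_ac)

lemma ddet_minus: "ddet S (- X) = - ddet S X"
  using ddet_scale[of S "-1" X] by simp

lemma ddet_scale_left: "ddet (c *\<^sub>R S) X = c ^ (CARD('n) - 1) * ddet S X" for S :: "real^'n^'n"
  unfolding ddet_def by (simp add: prod.distrib sum_distrib_left mult_ac)

lemma continuous_on_ddet:
  assumes "continuous_on A S" "continuous_on A X" shows "continuous_on A (\<lambda>x. ddet (S x) (X x))"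
  unfolding ddet_def by (intro continuous_intros assms)

lemma continuous_on_det:
  assumes "continuous_on A S" shows "continuous_on A (\<lambda>x. det (S x :: real^'n^'n))"
  unfolding det_def by (intro continuous_intros assms)

lemma det_has_derivative_line:
  "((\<lambda>t. det (S + t *\<^sub>R X)) has_real_derivative ddet (S + t *\<^sub>R X) X) (at t within A)"
proof -
  have "((\<lambda>t. \<Prod>r\<in>UNIV. (S + t *\<^sub>R X) $ r $ \<sigma> r) has_real_derivative
    (\<Sum>k\<in>UNIV. X $ k $ \<sigma> k * (\<Prod>r\<in>UNIV - {k}. (S + t *\<^sub>R X) $ r $ \<sigma> r))) (at t)" for \<sigma>
    by (rule has_field_derivative_prod) (auto intro!: derivative_eq_intros)
  then have "((\<lambda>t. det (S + t *\<^sub>R X)) has_real_derivative ddet (S + t *\<^sub>R X) X) (at t)"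
    unfolding det_def ddet_def by (intro DERIV_sum DERIV_cmult)
  then show ?thesis by (rule has_field_derivative_at_within)
qed

lemma ddet_rows: "ddet S X = (\<Sum>k\<in>UNIV. det (\<chi> r. if r = k then X $ r else S $ r))"
proof -
  have "(\<Prod>r\<in>UNIV. (\<chi> r. if r = k then X $ r else S $ r) $ r $ \<sigma> r) = X $ k $ \<sigma> k * (\<Prod>r\<in>UNIV - {k}. S $ r $ \<sigma> r)" for k \<sigma>
    by (subst prod.remove[of _ k]) (auto intro!: arg_cong2[where f="(*)"] prod.cong)
  then show ?thesis unfolding ddet_def det_def sum_distrib_left by (subst sum.swap) simp
qed

text \<open>All rows of \<open>outer c\<close> are proportional, so a term of the row expansion that
  takes two of them vanishes: along a rank one direction the determinant is affine.\<close>

lemma ddet_outer: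
  fixes S :: "real^'n^'n"
  shows "ddet S (outer c) = det (S + outer c) - det S"
proof -
  define D where "D = (\<lambda>f::'n \<Rightarrow> bool. det (\<chi> r. if f r then c $ r *s c else S $ r))"
  have "S + outer c = (\<chi> r. \<Sum>b\<in>UNIV. if b then c $ r *s c else S $ r)"
    by (simp add: vec_eq_iff outer_def UNIV_bool)
  then have "det (S + outer c) = (\<Sum>f\<in>UNIV. D f)"
    using det_rows_sum[of "UNIV :: bool set" "\<lambda>r b. if b then c $ r *s c else S $ r"] by (simp add: D_def)
  also have "\<dots> = (\<Sum>f\<in>insert (\<lambda>_. False) (range (\<lambda>k r. r = k)). D f)"
  proof (rule sum.mono_neutral_right)
    show "\<forall>f\<in>UNIV - insert (\<lambda>_. False) (range (\<lambda>k r. r = k)). D f = 0"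
    proof
      fix f :: "'n \<Rightarrow> bool" assume f: "f \<in> UNIV - insert (\<lambda>_. False) (range (\<lambda>k r. r = k))"
      then obtain i where i: "f i" by (auto simp: fun_eq_iff)
      with f obtain j where j: "f j" "i \<noteq> j" by (auto simp: fun_eq_iff image_iff)
      have "D f = det (\<chi> r. (if f r then c $ r else 1) *s (if f r then c else S $ r))"
        unfolding D_def by (intro arg_cong[where f=det]) (auto simp: vec_eq_iff)
      also have "\<dots> = (\<Prod>r\<in>UNIV. if f r then c $ r else 1) * det (\<chi> r. if f r then c else S $ r)"
        by (rule det_rows_mul)
      also have "det (\<chi> r. if f r then c else S $ r) = 0"
        using i j by (intro det_identical_rows[OF j(2)]) (simp add: row_def)
      finally show "D f = 0" by simp
    qed
  qed auto
  also have "\<dots> = D (\<lambda>_. False) + (\<Sum>f\<in>range (\<lambda>k r. r = k). D f)"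
    by (subst sum.insert) (auto simp: fun_eq_iff)
  also have "(\<Sum>f\<in>range (\<lambda>k r::'n. r = k). D f) = (\<Sum>k\<in>UNIV. D (\<lambda>r. r = k))"
    by (subst sum.reindex) (auto simp: inj_on_def fun_eq_iff)
  also have "D (\<lambda>_. False) = det S" by (simp add: D_def)
  also have "(\<Sum>k\<in>UNIV. D (\<lambda>r. r = k)) = ddet S (outer c)"
    unfolding ddet_rows D_def by (intro sum.cong refl arg_cong[where f=det]) (auto simp: vec_eq_iff outer_def)
  finally show ?thesis by simp
qed

lemma integral_det_deriv:
  fixes S X :: "real^'n::finite \<Rightarrow> real^'n^'n"
  assumes "continuous_on (cbox a b) S" "continuous_on (cbox a b) X" "continuous_on (cbox a b) g"
  shows "((\<lambda>t. integral (cbox a b) (\<lambda>y. det (S y + t *\<^sub>R X y) * g y)) has_real_derivative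
     integral (cbox a b) (\<lambda>y. ddet (S y + t *\<^sub>R X y) (X y) * g y)) (at t)"
proof -
  have "((\<lambda>t. integral (cbox a b) (\<lambda>y. det (S y + t *\<^sub>R X y) * g y)) has_real_derivative
     integral (cbox a b) (\<lambda>y. ddet (S y + t *\<^sub>R X y) (X y) * g y)) (at t within UNIV)"
  proof (rule leibniz_rule_field_derivative)
    show "((\<lambda>t. det (S y + t *\<^sub>R X y) * g y) has_real_derivative ddet (S y + t *\<^sub>R X y) (X y) * g y) (at t within UNIV)" for t y
      by (intro DERIV_cmult_right det_has_derivative_line)
    show "(\<lambda>y. det (S y + t *\<^sub>R X y) * g y) integrable_on cbox a b" for t
      by (intro integrable_continuous continuous_intros continuous_on_det assms)
    have c: "continuous_on (UNIV \<times> cbox a b) (\<lambda>x. h (snd x))" if "continuous_on (cbox a b) h" for h :: "real^'n \<Rightarrow> 'z::topological_space"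
      by (rule continuous_on_compose2[OF that]) (auto intro!: continuous_intros)
    show "continuous_on (UNIV \<times> cbox a b) (\<lambda>(t, y). ddet (S y + t *\<^sub>R X y) (X y) * g y)"
      unfolding case_prod_unfold by (intro continuous_intros continuous_on_ddet c assms)
  qed auto
  then show ?thesis by simp
qed

section \<open>Derivatives along segments of concave functions\<close>

text \<open>The bounds say that \<open>I\<close> is a slope from either end point, as for a convex
  function; its continuity squeezes the difference quotient. Thus the conjugate gap is
  differentiated although maximizers are not.\<close>

lemma deriv_from_sandwich:
  fixes e I :: "real \<Rightarrow> real"
  assumes bnd: "\<And>s t. s \<in> A \<Longrightarrow> t \<in> A \<Longrightarrow> (t - s) * I s \<le> e t - e s \<and> e t - e s \<le> (t - s) * I t"
    and I: "continuous_on A I" and "t \<in> A"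
  shows "(e has_real_derivative I t) (at t within A)"
  unfolding has_field_derivative_iff
proof (rule LIM_zero_cancel, rule Lim_null_comparison)
  have "(I \<longlongrightarrow> I t) (at t within A)" using I \<open>t \<in> A\<close> unfolding continuous_on_def by blast
  then show "((\<lambda>s. \<bar>I s - I t\<bar>) \<longlongrightarrow> 0) (at t within A)" by (intro tendsto_rabs_zero LIM_zero)
  have "norm ((e s - e t) / (s - t) - I t) \<le> \<bar>I s - I t\<bar>" if "s \<in> A" "s \<noteq> t" for s
  proof -
    have b: "(s - t) * I t \<le> e s - e t" "e s - e t \<le> (s - t) * I s" using bnd[OF \<open>t \<in> A\<close> \<open>s \<in> A\<close>] by auto
    show ?thesis
    proof (cases "s > t")
      case True
      then have "I t \<le> (e s - e t) / (s - t)" "(e s - e t) / (s - t) \<le> I s"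
        using b by (simp_all add: pos_le_divide_eq pos_divide_le_eq mult.commute)
      then show ?thesis unfolding real_norm_def by linarith
    next
      case False
      then have "s < t" using that by simp
      then have "(e s - e t) / (s - t) \<le> I t" "I s \<le> (e s - e t) / (s - t)"
        using b by (simp_all only: neg_le_divide_eq neg_divide_le_eq diff_less_0_iff_less mult.commute)
      then show ?thesis unfolding real_norm_def by linarith
    qed
  qed
  then show "\<forall>\<^sub>F s in at t within A. norm ((e s - e t) / (s - t) - I t) \<le> \<bar>I s - I t\<bar>"
    unfolding eventually_at_filter by (intro always_eventually) blast
qed

text \<open>Difference of two covolumes. Only the difference of conjugates is integrable: a single
  one grows like \<open>\<rho> * norm z\<close>.\<close>

definition conj_gap :: "real \<Rightarrow> (real^'n \<Rightarrow> real) \<Rightarrow> (real^'n \<Rightarrow> real) \<Rightarrow> real" where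
  "conj_gap \<rho> v w = integral UNIV (\<lambda>z. conj_on \<rho> v z - conj_on \<rho> w z)"

context
  fixes \<rho> :: real and a b :: "real^'n::{finite,wellorder}"
  assumes \<rho>: "\<rho> > 0" and box: "cbox a b \<subseteq> ball 0 \<rho>"
begin

lemma conj_gap_deriv:
  assumes v: "C2_with v G H" and f: "C2_with f g F"
    and conc: "\<And>t. t \<in> A \<Longrightarrow> strictly_conc \<rho> (\<lambda>x. v x + t * f x) (\<lambda>x. G x + t *\<^sub>R g x) (\<lambda>x. H x + t *\<^sub>R F x)"
    and f0: "\<And>y. y \<in> cball 0 \<rho> - cbox a b \<Longrightarrow> f y = 0" and "t \<in> A" "t0 \<in> A"
  shows "((\<lambda>t. conj_gap \<rho> (\<lambda>x. v x + t * f x) (\<lambda>x. v x + t0 * f x)) has_real_derivative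
     integral (cbox a b) (\<lambda>y. det (- H y + t *\<^sub>R (- F y)) * f y)) (at t within A)"
proof (rule deriv_from_sandwich[OF _ _ \<open>t \<in> A\<close>])
  let ?v = "\<lambda>t x. v x + t * f x"
  let ?I = "\<lambda>t. integral (cbox a b) (\<lambda>y. det (- H y + t *\<^sub>R (- F y)) * f y)"
  have gap: "conj_gap \<rho> (?v t) (?v t0) - conj_gap \<rho> (?v s) (?v t0) = conj_gap \<rho> (?v t) (?v s)"
    and lo: "(t - s) * ?I s \<le> conj_gap \<rho> (?v t) (?v s)" and hi: "conj_gap \<rho> (?v t) (?v s) \<le> (t - s) * ?I t"
    if "s \<in> A" "t \<in> A" for s t
  proof -
    have eq: "?v x y = ?v x' y" if "y \<in> cball 0 \<rho> - cbox a b" for x x' y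
      using f0[OF that] by simp
    have ai: "(\<lambda>z. conj_on \<rho> (?v x) z - conj_on \<rho> (?v t0) z) integrable_on UNIV" if "x \<in> A" for x
      using conj_diff_bounds(1)[OF \<rho> box conc[OF \<open>t0 \<in> A\<close>] conc[OF that] eq]
      by (auto simp: absolutely_integrable_on_def)
    show "conj_gap \<rho> (?v t) (?v t0) - conj_gap \<rho> (?v s) (?v t0) = conj_gap \<rho> (?v t) (?v s)"
      unfolding conj_gap_def using ai[OF that(1)] ai[OF that(2)]
      by (subst integral_diff[symmetric]) auto
    have *: "integral (cbox a b) (\<lambda>y. det (- (H y + x *\<^sub>R F y)) * (?v t y - ?v s y)) = (t - s) * ?I x" for x
    proof -
      have "(\<lambda>y. det (- (H y + x *\<^sub>R F y)) * (?v t y - ?v s y)) = (\<lambda>y. (t - s) * (det (- H y + x *\<^sub>R (- F y)) * f y))"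
        by (simp add: fun_eq_iff algebra_simps)
      then show ?thesis by simp
    qed
    show "(t - s) * ?I s \<le> conj_gap \<rho> (?v t) (?v s)"
      using conj_diff_bounds(2)[OF \<rho> box conc[OF that(1)] conc[OF that(2)] eq] unfolding * conj_gap_def by simp
    show "conj_gap \<rho> (?v t) (?v s) \<le> (t - s) * ?I t"
      using conj_diff_bounds(3)[OF \<rho> box conc[OF that(1)] conc[OF that(2)] eq] unfolding * conj_gap_def by simp
  qed
  show "(t - s) * ?I s \<le> conj_gap \<rho> (?v t) (?v t0) - conj_gap \<rho> (?v s) (?v t0) \<and>
     conj_gap \<rho> (?v t) (?v t0) - conj_gap \<rho> (?v s) (?v t0) \<le> (t - s) * ?I t" if "s \<in> A" "t \<in> A" for s t
    using gap[OF that] lo[OF that] hi[OF that] by simp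
  have "isCont ?I t" for t
    by (rule DERIV_isCont[OF integral_det_deriv])
      (intro continuous_intros C2_withD[OF v] C2_withD[OF f])+
  then show "continuous_on A ?I" by (simp add: continuous_at_imp_continuous_on)
qed

text \<open>Let \<open>x\<close> maximize \<open>z \<bullet> u + w u\<close> over the box. An
  interior \<open>x\<close> satisfies \<open>z = - G' x\<close>. For \<open>x\<close> on the
  boundary the gradients of \<open>v\<close> and \<open>w\<close> agree, and the one-sided condition
  in the direction of the maximizer of \<open>v\<close> contradicts the strict concavity of
  \<open>v\<close> unless \<open>x\<close> is that maximizer. In both cases \<open>x\<close> is also
  the maximizer of \<open>w\<close> over the ball.\<close>

lemma maximizer_in_box_perturb:
  assumes v: "strictly_conc \<rho> v G H" and w: "strictly_conc \<rho> w G' H'"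
    and eqG: "\<And>y. y \<in> cbox a b - box a b \<Longrightarrow> G' y = G y"
    and m: "maximizer \<rho> v z \<in> cbox a b"
  shows "maximizer \<rho> w z \<in> cbox a b"
proof -
  let ?y = "maximizer \<rho> v z"
  have C2: "C2_with v G H" "C2_with w G' H'" using v w by (auto simp: strictly_conc_def)
  have cv: "continuous_on S v" and cw: "continuous_on S w" for S using C2_withD(5)[OF C2(1)] C2_withD(5)[OF C2(2)] .
  have sub: "x \<in> cball 0 \<rho>" if "x \<in> cbox a b" for x using that box by (auto simp: subset_iff)
  have zy: "z = - G ?y" using m box by (intro maximizer_interior[OF C2(1)]) (use \<rho> in auto)
  have "continuous_on (cbox a b) (\<lambda>x. z \<bullet> x + w x)" by (intro continuous_intros cw)
  then obtain x where x: "x \<in> cbox a b" "\<And>u. u \<in> cbox a b \<Longrightarrow> z \<bullet> u + w u \<le> z \<bullet> x + w x"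
    using continuous_attains_sup[of "cbox a b" "\<lambda>x. z \<bullet> x + w x"] m by auto
  have d: "((\<lambda>u. z \<bullet> u + w u) has_derivative (\<lambda>h. (z + G' x) \<bullet> h)) (at x)"
    by (auto intro!: derivative_eq_intros C2_withD(1)[OF C2(2)] simp: inner_add_left)
  have "z = - G' x"
  proof (cases "x \<in> box a b")
    case True
    have "(\<lambda>h. (z + G' x) \<bullet> h) = (\<lambda>h. 0)"
      by (rule differential_zero_maxmin[OF True open_box d]) (use x(2) box_subset_cbox in blast)
    then have "(z + G' x) \<bullet> (z + G' x) = 0" by (rule fun_cong)
    then show ?thesis by (simp add: eq_neg_iff_add_eq_0)
  next
    case False
    then have G: "G' x = G x" using eqG x by auto
    \<comment> \<open>The segment from \<open>x\<close> to \<open>?y\<close> stays in the box, so a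
      positive slope at its start would contradict the choice of \<open>x\<close>.\<close>
    have le: "(z + G' x) \<bullet> (?y - x) \<le> 0"
    proof (rule ccontr)
      assume "\<not> ?thesis"
      then have pos: "(z + G' x) \<bullet> (?y - x) > 0" by simp
      let ?\<phi> = "\<lambda>t. z \<bullet> (x + t *\<^sub>R (?y - x)) + w (x + t *\<^sub>R (?y - x))"
      have "((\<lambda>t. x + t *\<^sub>R (?y - x)) has_derivative (\<lambda>t. t *\<^sub>R (?y - x))) (at 0)"
        by (auto intro!: derivative_eq_intros)
      then have "(?\<phi> has_derivative (\<lambda>t. (z + G' x) \<bullet> (t *\<^sub>R (?y - x)))) (at 0)"
        by (rule has_derivative_compose) (use d in simp)
      then have "DERIV ?\<phi> 0 :> (z + G' x) \<bullet> (?y - x)"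
        by (simp add: has_field_derivative_def mult_commute_abs)
      from DERIV_pos_inc_right[OF this pos]
      obtain e where e: "e > 0" "\<And>h. h > 0 \<Longrightarrow> h < e \<Longrightarrow> ?\<phi> 0 < ?\<phi> (0 + h)" by auto
      define h where "h = min (e/2) 1"
      have h: "0 < h" "h < e" "h \<le> 1" using e by (auto simp: h_def)
      have "x + h *\<^sub>R (?y - x) = (1 - h) *\<^sub>R x + h *\<^sub>R ?y" by (simp add: algebra_simps)
      also have "\<dots> \<in> cbox a b" using convex_box(1)[of a b] x(1) m h unfolding convex_alt by auto
      finally have "?\<phi> h \<le> ?\<phi> 0" using x(2) by simp
      with e(2)[of h] h show False by simp
    qed
    have "x = ?y"
    proof (rule ccontr)
      assume "x \<noteq> ?y"
      then have "v ?y < v x + G x \<bullet> (?y - x)"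
        using strictly_conc_tangent[OF v sub[OF m] sub[OF x(1)]] by auto
      moreover have "z \<bullet> x + v x \<le> z \<bullet> ?y + v ?y"
        using maximizer_props(2)[OF cv] sub[OF x(1)] \<rho> by auto
      ultimately show False using le G by (simp add: inner_add_left inner_diff_right)
    qed
    then show ?thesis using zy G by simp
  qed
  then have "maximizer \<rho> w z = x" using maximizer_eqI[OF w _ sub[OF x(1)]] \<rho> by auto
  then show ?thesis using x by simp
qed

text \<open>Applied to the indicator of the box, the substitution measures the set of
  \<open>z\<close> whose maximizer lies in the box, and this set depends only on the gradient on the
  boundary. This takes the place of a divergence theorem.\<close>

lemma integral_det_perturb:
  assumes v: "strictly_conc \<rho> v G H" and w: "strictly_conc \<rho> w G' H'"
    and eqG: "\<And>y. y \<in> cbox a b - box a b \<Longrightarrow> G' y = G y"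
  shows "integral (cbox a b) (\<lambda>y. det (- H y)) = integral (cbox a b) (\<lambda>y. det (- H' y))"
proof -
  let ?f = "\<lambda>y. if y \<in> cbox a b then 1 else (0::real)"
  have f: "continuous_on (cbox a b) ?f" by (subst continuous_on_cong[where g="\<lambda>_. 1", OF refl]) auto
  have "maximizer \<rho> v z \<in> cbox a b \<longleftrightarrow> maximizer \<rho> w z \<in> cbox a b" for z
    using maximizer_in_box_perturb[OF v w eqG, of z] maximizer_in_box_perturb[OF w v eqG[symmetric], of z] by blast
  then have "(\<lambda>z. ?f (maximizer \<rho> v z)) = (\<lambda>z. ?f (maximizer \<rho> w z))" by auto
  moreover have "integral UNIV (\<lambda>z. ?f (maximizer \<rho> v z)) = integral (cbox a b) (\<lambda>y. det (- H y) * ?f y)"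
    by (rule gradient_image_integral(2)[OF \<rho> box v f]) auto
  moreover have "integral UNIV (\<lambda>z. ?f (maximizer \<rho> w z)) = integral (cbox a b) (\<lambda>y. det (- H' y) * ?f y)"
    by (rule gradient_image_integral(2)[OF \<rho> box w f]) auto
  moreover have "integral (cbox a b) (\<lambda>y. det (- H y) * ?f y) = integral (cbox a b) (\<lambda>y. det (- H y))"
    "integral (cbox a b) (\<lambda>y. det (- H' y) * ?f y) = integral (cbox a b) (\<lambda>y. det (- H' y))"
    by (rule integral_cong, simp)+
  ultimately show ?thesis by simp
qed

end

subsection \<open>Partial polarization and derivatives\<close>

lemma polar_cong:
  assumes "\<And>i. i < d \<Longrightarrow> x i = y i" shows "polar d p x = polar d p y"
  unfolding polar_def
proof (rule sum.cong[OF refl])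
  fix I assume "I \<in> Pow {..<d}"
  then have "(\<Sum>i\<in>I. x i j) = (\<Sum>i\<in>I. y i j)" for j using assms by (intro sum.cong) auto
  then show "(-1) ^ card ({..<d} - I) * p (\<lambda>j. \<Sum>i\<in>I. x i j) = (-1) ^ card ({..<d} - I) * p (\<lambda>j. \<Sum>i\<in>I. y i j)" by simp
qed

text \<open>With the coefficients of \<open>hform_eq_polar\<close>, which are symmetric in the word,
  all \<open>d!\<close> permutation sums coincide and cancel the normalization.\<close>

lemma polar_multilinear:
  assumes "hform d J p" "finite J"
  shows "polar d p x = (\<Sum>\<kappa>\<in>{..<d} \<rightarrow>\<^sub>E J. polar d p (\<lambda>i. unit_coord (\<kappa> i)) * (\<Prod>i<d. x i (\<kappa> i)))"
proof -
  let ?E = "{..<d} \<rightarrow>\<^sub>E J" and ?P = "{\<pi>. \<pi> permutes {..<d}}"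
  define C where "C = (\<lambda>\<kappa>. polar d p (\<lambda>i. unit_coord (\<kappa> i)))"
  have one: "(\<Sum>\<kappa>\<in>?E. C \<kappa> * (\<Prod>i<d. x (\<pi> i) (\<kappa> i))) = (\<Sum>\<kappa>\<in>?E. C \<kappa> * (\<Prod>i<d. x i (\<kappa> i)))" if \<pi>: "\<pi> permutes {..<d}" for \<pi>
  proof (rule sum.reindex_bij_witness[where j="\<lambda>\<kappa>. restrict (\<kappa> \<circ> inv \<pi>) {..<d}" and i="\<lambda>\<kappa>. restrict (\<kappa> \<circ> \<pi>) {..<d}"])
    have inv: "inv \<pi> permutes {..<d}" by (rule permutes_inv[OF \<pi>])
    have in1: "\<pi> i < d \<longleftrightarrow> i < d" "inv \<pi> i < d \<longleftrightarrow> i < d" for i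
      using permutes_in_image[OF \<pi>, of i] permutes_in_image[OF inv, of i] by simp_all
    fix \<kappa> assume \<kappa>: "\<kappa> \<in> ?E"
    show "restrict (restrict (\<kappa> \<circ> inv \<pi>) {..<d} \<circ> \<pi>) {..<d} = \<kappa>" "restrict (restrict (\<kappa> \<circ> \<pi>) {..<d} \<circ> inv \<pi>) {..<d} = \<kappa>"
      using \<kappa> by (auto simp: fun_eq_iff in1 permutes_inverses[OF \<pi>] PiE_def extensional_def)
    show "restrict (\<kappa> \<circ> inv \<pi>) {..<d} \<in> ?E" "restrict (\<kappa> \<circ> \<pi>) {..<d} \<in> ?E"
      using PiE_mem[OF \<kappa>] by (simp_all add: restrict_PiE_iff in1)
    have "C (restrict (\<kappa> \<circ> inv \<pi>) {..<d}) = polar d p ((\<lambda>i. unit_coord (\<kappa> i)) \<circ> inv \<pi>)"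
      unfolding C_def by (rule polar_cong) simp
    then have "C (restrict (\<kappa> \<circ> inv \<pi>) {..<d}) = C \<kappa>" by (simp add: polar_perm[OF inv] C_def)
    moreover have "(\<Prod>i<d. x i (restrict (\<kappa> \<circ> inv \<pi>) {..<d} i)) = (\<Prod>i<d. x (\<pi> i) (\<kappa> i))"
    proof -
      have "(\<Prod>i<d. x i (restrict (\<kappa> \<circ> inv \<pi>) {..<d} i)) = (\<Prod>i<d. x i (\<kappa> (inv \<pi> i)))" by (intro prod.cong) auto
      also have "\<dots> = (\<Prod>i<d. x (\<pi> i) (\<kappa> (inv \<pi> (\<pi> i))))" by (subst prod.permute[OF \<pi>]) (simp add: comp_def)
      finally show ?thesis by (simp add: permutes_inverses[OF \<pi>])
    qed
    ultimately show "C (restrict (\<kappa> \<circ> inv \<pi>) {..<d}) * (\<Prod>i<d. x i (restrict (\<kappa> \<circ> inv \<pi>) {..<d} i)) = C \<kappa> * (\<Prod>i<d. x (\<pi> i) (\<kappa> i))"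
      by simp
  qed
  have "polar d p x = (\<Sum>\<kappa>\<in>?E. C \<kappa> / fact d * (\<Sum>\<pi>\<in>?P. \<Prod>i<d. x (\<pi> i) (\<kappa> i)))"
    by (rule polar_eq_permutation_sum[OF assms(2)], unfold C_def, rule hform_eq_polar[OF assms])
  also have "\<dots> = (\<Sum>\<pi>\<in>?P. \<Sum>\<kappa>\<in>?E. C \<kappa> * (\<Prod>i<d. x (\<pi> i) (\<kappa> i))) / fact d"
    unfolding sum_distrib_left sum_divide_distrib by (subst sum.swap) simp
  also have "(\<Sum>\<pi>\<in>?P. \<Sum>\<kappa>\<in>?E. C \<kappa> * (\<Prod>i<d. x (\<pi> i) (\<kappa> i))) = (\<Sum>\<pi>\<in>?P. \<Sum>\<kappa>\<in>?E. C \<kappa> * (\<Prod>i<d. x i (\<kappa> i)))"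
    by (rule sum.cong[OF refl], rule one) simp
  also have "\<dots> = fact d * (\<Sum>\<kappa>\<in>?E. C \<kappa> * (\<Prod>i<d. x i (\<kappa> i)))" by (simp add: card_permutations)
  finally show ?thesis by (simp add: C_def)
qed

text \<open>Only the first \<open>m\<close> factors of each monomial depend on the free argument, so
  Ryser's formula applies to them; by symmetry each of the \<open>m!\<close> permutations gives the
  same value.\<close>

lemma partial_polar:
  assumes p: "hform d J p" "finite J" and "m \<le> d"
  shows "polar m (\<lambda>s. polar d p (\<lambda>k. if k < m then s else x k)) y = fact m * polar d p (\<lambda>k. if k < m then y k else x k)"
proof -
  let ?E = "{..<d} \<rightarrow>\<^sub>E J" and ?P = "{\<pi>. \<pi> permutes {..<m}}"
  define C where "C = (\<lambda>\<kappa>. polar d p (\<lambda>i. unit_coord (\<kappa> i)))"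
  define X where "X = (\<lambda>\<kappa>. \<Prod>i\<in>{m..<d}. x i (\<kappa> i))"
  have split: "(\<Prod>i<d. (if i < m then f i else x i) (\<kappa> i)) = (\<Prod>i<m. f i (\<kappa> i)) * X \<kappa>" for f \<kappa>
  proof -
    have e: "{..<d} = {..<m} \<union> {m..<d}" using \<open>m \<le> d\<close> by auto
    have "(\<Prod>i<d. (if i < m then f i else x i) (\<kappa> i)) = (\<Prod>i<m. (if i < m then f i else x i) (\<kappa> i)) * (\<Prod>i\<in>{m..<d}. (if i < m then f i else x i) (\<kappa> i))"
      by (subst e, rule prod.union_disjoint) auto
    moreover have "(\<Prod>i<m. (if i < m then f i else x i) (\<kappa> i)) = (\<Prod>i<m. f i (\<kappa> i))" by (intro prod.cong) auto
    moreover have "(\<Prod>i\<in>{m..<d}. (if i < m then f i else x i) (\<kappa> i)) = X \<kappa>" unfolding X_def by (intro prod.cong) auto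
    ultimately show ?thesis by simp
  qed
  have ml: "polar d p (\<lambda>k. if k < m then f k else x k) = (\<Sum>\<kappa>\<in>?E. C \<kappa> * ((\<Prod>i<m. f i (\<kappa> i)) * X \<kappa>))" for f
    unfolding polar_multilinear[OF p, of "\<lambda>k. if k < m then f k else x k"] C_def split ..
  have "polar m (\<lambda>s. polar d p (\<lambda>k. if k < m then s else x k)) y
    = (\<Sum>I\<in>Pow {..<m}. (-1) ^ card ({..<m} - I) * (\<Sum>\<kappa>\<in>?E. C \<kappa> * ((\<Prod>i<m. \<Sum>k\<in>I. y k (\<kappa> i)) * X \<kappa>)))"
    unfolding polar_def[of m] ml[of "\<lambda>_. _"] ..
  also have "\<dots> = (\<Sum>\<kappa>\<in>?E. C \<kappa> * ((\<Sum>I\<in>Pow {..<m}. (-1) ^ card ({..<m} - I) * (\<Prod>i<m. \<Sum>k\<in>I. y k (\<kappa> i))) * X \<kappa>))"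
    unfolding sum_distrib_left sum_distrib_right by (subst sum.swap) (simp add: mult_ac)
  also have "\<dots> = (\<Sum>\<kappa>\<in>?E. C \<kappa> * ((\<Sum>\<pi>\<in>?P. \<Prod>i<m. y (\<pi> i) (\<kappa> i)) * X \<kappa>))"
    by (subst ryser_formula) auto
  also have "\<dots> = (\<Sum>\<pi>\<in>?P. \<Sum>\<kappa>\<in>?E. C \<kappa> * ((\<Prod>i<m. y (\<pi> i) (\<kappa> i)) * X \<kappa>))"
    unfolding sum_distrib_left sum_distrib_right by (rule sum.swap)
  also have "\<dots> = (\<Sum>\<pi>\<in>?P. polar d p (\<lambda>k. if k < m then y k else x k))"
  proof (rule sum.cong[OF refl])
    fix \<pi> assume "\<pi> \<in> ?P"
    then have \<pi>: "\<pi> permutes {..<m}" by simp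
    then have \<pi>d: "\<pi> permutes {..<d}" by (rule permutes_subset) (use \<open>m \<le> d\<close> in auto)
    have "(\<lambda>k. if k < m then y (\<pi> k) else x k) = (\<lambda>k. if k < m then y k else x k) \<circ> \<pi>"
      using permutes_in_image[OF \<pi>] permutes_not_in[OF \<pi>] by (auto simp: fun_eq_iff)
    then show "(\<Sum>\<kappa>\<in>?E. C \<kappa> * ((\<Prod>i<m. y (\<pi> i) (\<kappa> i)) * X \<kappa>)) = polar d p (\<lambda>k. if k < m then y k else x k)"
      using ml[of "\<lambda>i. y (\<pi> i)"] polar_perm[OF \<pi>d, of p "\<lambda>k. if k < m then y k else x k"] by simp
  qed
  also have "\<dots> = fact m * polar d p (\<lambda>k. if k < m then y k else x k)" by (simp add: card_permutations)
  finally show ?thesis .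
qed

lemma polar_partial_scale:
  assumes p: "hform d J p" "finite J" and "m \<le> d"
  shows "polar d p (\<lambda>k. if k < m then (\<lambda>j. c * s j) else x k) = c ^ m * polar d p (\<lambda>k. if k < m then s else x k)"
proof -
  have "(\<Prod>i<d. (if i < m then (\<lambda>j. c * s j) else x i) (\<kappa> i)) = c ^ m * (\<Prod>i<d. (if i < m then s else x i) (\<kappa> i))" for \<kappa>
  proof -
    have "(\<Prod>i<d. (if i < m then (\<lambda>j. c * s j) else x i) (\<kappa> i)) = (\<Prod>i<d. (if i < m then c else 1) * (if i < m then s else x i) (\<kappa> i))"
      by (intro prod.cong) auto
    also have "\<dots> = (\<Prod>i<d. if i < m then c else 1) * (\<Prod>i<d. (if i < m then s else x i) (\<kappa> i))" by (rule prod.distrib)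
    also have "(\<Prod>i<d. if i < m then c else 1) = (\<Prod>i<m. c)"
      using \<open>m \<le> d\<close> by (intro prod.mono_neutral_cong_right) auto
    finally show ?thesis by simp
  qed
  then show ?thesis
    unfolding polar_multilinear[OF p, of "\<lambda>k. if k < m then _ else x k"] by (simp add: sum_distrib_left mult_ac)
qed

text \<open>The product rule yields one term for each of the \<open>Suc m\<close> moving slots; a
  transposition moves the differentiated slot to place \<open>m\<close>, so all these terms are
  equal.\<close>

lemma polar_partial_deriv:
  assumes p: "hform d J p" "finite J" and "Suc m \<le> d"
  shows "((\<lambda>r. polar d p (\<lambda>k. if k < Suc m then (\<lambda>j. s j + r * u j) else x k)) has_real_derivative
    real (Suc m) * polar d p (\<lambda>k. if k < m then (\<lambda>j. s j + r * u j) else if k = m then u else x k)) (at r)"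
proof -
  let ?E = "{..<d} \<rightarrow>\<^sub>E J"
  define C where "C = (\<lambda>\<kappa>. polar d p (\<lambda>i. unit_coord (\<kappa> i)))"
  define y where "y = (\<lambda>r k. if k < Suc m then (\<lambda>j. s j + r * u j) else x k)"
  have ml: "polar d p z = (\<Sum>\<kappa>\<in>?E. C \<kappa> * (\<Prod>i<d. z i (\<kappa> i)))" for z
    unfolding C_def by (rule polar_multilinear[OF p])
  have eq: "polar d p ((y r)(k := u)) = polar d p (\<lambda>k. if k < m then (\<lambda>j. s j + r * u j) else if k = m then u else x k)"
    if "k < Suc m" for k
  proof -
    have perm: "Transposition.transpose k m permutes {..<d}" using that \<open>Suc m \<le> d\<close> by (intro permutes_swap_id) auto
    have "(y r)(k := u) \<circ> Transposition.transpose k m = (\<lambda>k. if k < m then (\<lambda>j. s j + r * u j) else if k = m then u else x k)"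
      using that by (auto simp: fun_eq_iff y_def Transposition.transpose_def)
    then show ?thesis using polar_perm[OF perm, of p "(y r)(k := u)"] by simp
  qed
  have P: "((\<lambda>r. \<Prod>i<d. y r i (\<kappa> i)) has_real_derivative
      (\<Sum>k<d. (if k < Suc m then u (\<kappa> k) else 0) * (\<Prod>i\<in>{..<d} - {k}. y r i (\<kappa> i)))) (at r)" for \<kappa>
    by (rule has_field_derivative_prod) (auto simp: y_def intro!: derivative_eq_intros)
  have D: "((\<lambda>r. polar d p (y r)) has_real_derivative (\<Sum>\<kappa>\<in>?E. C \<kappa> *
      (\<Sum>k<d. (if k < Suc m then u (\<kappa> k) else 0) * (\<Prod>i\<in>{..<d} - {k}. y r i (\<kappa> i))))) (at r)"
    unfolding ml by (rule DERIV_sum, rule DERIV_cmult, rule P)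
  have "(\<Sum>\<kappa>\<in>?E. C \<kappa> * (\<Sum>k<d. (if k < Suc m then u (\<kappa> k) else 0) * (\<Prod>i\<in>{..<d} - {k}. y r i (\<kappa> i))))
      = (\<Sum>\<kappa>\<in>?E. C \<kappa> * (\<Sum>k<Suc m. u (\<kappa> k) * (\<Prod>i\<in>{..<d} - {k}. y r i (\<kappa> i))))"
  proof -
    have "(\<Sum>k<d. (if k < Suc m then f k else 0) * h k) = (\<Sum>k<Suc m. f k * h k)" for f h :: "nat \<Rightarrow> real"
      by (rule sum.mono_neutral_cong_right) (use \<open>Suc m \<le> d\<close> in auto)
    then show ?thesis by (simp only:)
  qed
  also have "\<dots> = (\<Sum>k<Suc m. \<Sum>\<kappa>\<in>?E. C \<kappa> * (u (\<kappa> k) * (\<Prod>i\<in>{..<d} - {k}. y r i (\<kappa> i))))"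
    unfolding sum_distrib_left by (rule sum.swap)
  also have "\<dots> = (\<Sum>k<Suc m. polar d p ((y r)(k := u)))"
  proof (rule sum.cong[OF refl])
    fix k assume "k \<in> {..<Suc m}"
    then have k: "k \<in> {..<d}" using \<open>Suc m \<le> d\<close> by auto
    have "(\<Prod>i<d. ((y r)(k := u)) i (\<kappa> i)) = u (\<kappa> k) * (\<Prod>i\<in>{..<d} - {k}. y r i (\<kappa> i))" for \<kappa>
      using k by (subst prod.remove[of _ k]) (auto intro!: arg_cong2[where f="(*)"] prod.cong)
    then show "(\<Sum>\<kappa>\<in>?E. C \<kappa> * (u (\<kappa> k) * (\<Prod>i\<in>{..<d} - {k}. y r i (\<kappa> i)))) = polar d p ((y r)(k := u))"
      unfolding ml by simp
  qed
  also have "\<dots> = (\<Sum>k<Suc m. polar d p (\<lambda>k. if k < m then (\<lambda>j. s j + r * u j) else if k = m then u else x k))"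
    by (intro sum.cong refl eq) simp
  also have "\<dots> = real (Suc m) * polar d p (\<lambda>k. if k < m then (\<lambda>j. s j + r * u j) else if k = m then u else x k)"
    by (simp only: sum_constant card_lessThan)
  finally show ?thesis using DERIV_cong[OF D] unfolding y_def by blast
qed

lemma hform_second_deriv:
  assumes p: "hform (Suc (Suc m)) J p" "finite J"
  shows "((\<lambda>r. p (\<lambda>j. s j + r * u j)) has_real_derivative polar (Suc (Suc m)) p (\<lambda>k. if k < Suc m then (\<lambda>j. s j + r * u j) else u) / fact (Suc m)) (at r)"
    and "((\<lambda>r. polar (Suc (Suc m)) p (\<lambda>k. if k < Suc m then (\<lambda>j. s j + r * u j) else u) / fact (Suc m)) has_real_derivative
      polar (Suc (Suc m)) p (\<lambda>k. if k < m then (\<lambda>j. s j + r * u j) else u) / fact m) (at r)"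
proof -
  let ?d = "Suc (Suc m)"
  \<comment> \<open>No slot lies beyond \<open>?d\<close>, so the \<open>else\<close> branch is
    never read; it only gives the expression the shape of
    \<open>polar_partial_deriv\<close>.\<close>
  have "p (\<lambda>j. s j + r * u j) = polar ?d p (\<lambda>k. if k < ?d then (\<lambda>j. s j + r * u j) else undefined k) / fact ?d" for r
    using polar_diag[OF p, of "\<lambda>j. s j + r * u j"]
      polar_cong[of ?d "\<lambda>k. if k < ?d then (\<lambda>j. s j + r * u j) else undefined k" "\<lambda>_. (\<lambda>j. s j + r * u j)" p] by (simp del: fact_Suc)
  moreover have "((\<lambda>r. polar ?d p (\<lambda>k. if k < ?d then (\<lambda>j. s j + r * u j) else undefined k) / fact ?d) has_real_derivative
    real ?d * polar ?d p (\<lambda>k. if k < Suc m then (\<lambda>j. s j + r * u j) else if k = Suc m then u else undefined k) / fact ?d) (at r)"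
    by (intro DERIV_cdivide polar_partial_deriv[OF p]) simp
  moreover have "polar ?d p (\<lambda>k. if k < Suc m then (\<lambda>j. s j + r * u j) else if k = Suc m then u else undefined k) = polar ?d p (\<lambda>k. if k < Suc m then (\<lambda>j. s j + r * u j) else u)"
    by (rule polar_cong) auto
  moreover have "real ?d * c / fact ?d = c / fact (Suc m)" for c
    using fact_Suc[of "Suc m", where ?'a=real] by (simp del: fact_Suc of_nat_Suc)
  ultimately show "((\<lambda>r. p (\<lambda>j. s j + r * u j)) has_real_derivative polar (Suc (Suc m)) p (\<lambda>k. if k < Suc m then (\<lambda>j. s j + r * u j) else u) / fact (Suc m)) (at r)"
    by (simp del: fact_Suc of_nat_Suc)
  have "((\<lambda>r. polar ?d p (\<lambda>k. if k < Suc m then (\<lambda>j. s j + r * u j) else u) / fact (Suc m)) has_real_derivative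
    real (Suc m) * polar ?d p (\<lambda>k. if k < m then (\<lambda>j. s j + r * u j) else if k = m then u else u) / fact (Suc m)) (at r)"
    by (intro DERIV_cdivide polar_partial_deriv[OF p]) simp
  moreover have "polar ?d p (\<lambda>k. if k < m then (\<lambda>j. s j + r * u j) else if k = m then u else u) = polar ?d p (\<lambda>k. if k < m then (\<lambda>j. s j + r * u j) else u)"
    by (rule polar_cong) auto
  moreover have "real (Suc m) * c / fact (Suc m) = c / fact m" for c
    using fact_Suc[of m, where ?'a=real] by (simp del: fact_Suc of_nat_Suc)
  ultimately show "((\<lambda>r. polar (Suc (Suc m)) p (\<lambda>k. if k < Suc m then (\<lambda>j. s j + r * u j) else u) / fact (Suc m)) has_real_derivative
      polar (Suc (Suc m)) p (\<lambda>k. if k < m then (\<lambda>j. s j + r * u j) else u) / fact m) (at r)"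
    by (simp del: fact_Suc of_nat_Suc)
qed

section \<open>The volume form of a family of smooth concave functions\<close>

lemma smooth_conc_hessian:
  fixes H :: "real^'n \<Rightarrow> real^'n^'n"
  assumes "smooth_conc \<kappa> L \<rho> v G H" shows "h \<bullet> (H x *v h) \<le> - \<kappa> * (h \<bullet> h)"
proof -
  have "psd (- H x - mat \<kappa>)" using assms unfolding smooth_conc_def by blast
  from psd_inner_nonneg[OF this, of h] show ?thesis
    by (simp add: matrix_vector_mult_diff_rdistrib minus_matrix_vector mat_vector inner_diff_right)
qed

lemma smooth_conc_strictly:
  fixes H :: "real^'n \<Rightarrow> real^'n^'n"
  assumes v: "smooth_conc \<kappa> L \<rho> v G H" and "\<kappa> > 0"
  shows "strictly_conc \<rho> v G H"
proof -
  have "h \<bullet> (H x *v h) < 0" if "h \<noteq> 0" for x h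
  proof -
    have "\<kappa> * (h \<bullet> h) > 0" using that \<open>\<kappa> > 0\<close> by simp
    then show ?thesis using smooth_conc_hessian[OF v, of h x] by linarith
  qed
  then show ?thesis using v unfolding strictly_conc_def smooth_conc_def by blast
qed

lemma strictly_conc_perturb:
  fixes H N :: "real^'n \<Rightarrow> real^'n^'n"
  assumes v: "smooth_conc \<kappa> L \<rho> v G H" and "\<kappa> > 0" and \<eta>: "C2_with \<eta> g N"
  shows "\<exists>r0>0. \<forall>r. \<bar>r\<bar> < r0 \<longrightarrow> strictly_conc \<rho> (\<lambda>x. v x + r * \<eta> x) (\<lambda>x. G x + r *\<^sub>R g x) (\<lambda>x. H x + r *\<^sub>R N x)"
proof -
  have "compact ((\<lambda>x. norm (N x)) ` cball 0 \<rho>)"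
    by (intro compact_continuous_image continuous_intros C2_withD(3)[OF \<eta>]) auto
  from compact_imp_bounded[OF this] obtain B where "\<forall>x\<in>(\<lambda>x. norm (N x)) ` cball 0 \<rho>. norm x \<le> B"
    unfolding bounded_iff by blast
  then have B: "norm (N x) \<le> B" if "x \<in> cball 0 \<rho>" for x using that by auto
  define B' where "B' = max B 0 + 1"
  \<comment> \<open>The quadratic form of \<open>N x\<close> has as many terms as matrix entries,
    each at most \<open>B' * (h \<bullet> h)\<close>; adding 1 in \<open>B'\<close> keeps
    \<open>D\<close> positive, so that \<open>\<kappa> / D\<close> is an admissible radius.\<close>
  define D where "D = real CARD('n) * real CARD('n) * B'"
  have quad: "\<bar>h \<bullet> (N x *v h)\<bar> \<le> D * (h \<bullet> h)" if "x \<in> cball 0 \<rho>" for x h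
  proof -
    have e: "\<bar>N x $ i $ j\<bar> \<le> B'" for i j
    proof -
      have "\<bar>N x $ i $ j\<bar> \<le> norm (N x $ i)" by (rule component_le_norm_cart)
      also have "\<dots> \<le> norm (N x)" by (rule Finite_Cartesian_Product.norm_nth_le)
      finally show ?thesis using B[OF that] by (simp add: B'_def)
    qed
    have "h \<bullet> (N x *v h) = (\<Sum>i\<in>UNIV. \<Sum>j\<in>UNIV. h $ i * (N x $ i $ j * h $ j))"
      by (simp add: inner_vec_def matrix_vector_mult_def sum_distrib_left)
    also have "\<bar>\<dots>\<bar> \<le> (\<Sum>i\<in>(UNIV::'n set). \<Sum>j\<in>(UNIV::'n set). B' * (h \<bullet> h))"
    proof (intro order_trans[OF sum_abs] sum_mono)
      fix i j
      have "\<bar>h $ i * (N x $ i $ j * h $ j)\<bar> = \<bar>h $ i\<bar> * (\<bar>N x $ i $ j\<bar> * \<bar>h $ j\<bar>)" by (simp add: abs_mult)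
      also have "\<dots> \<le> norm h * (B' * norm h)"
        using e[of i j] component_le_norm_cart[of h i] component_le_norm_cart[of h j]
        by (intro mult_mono) (auto simp: B'_def)
      also have "\<dots> = B' * (h \<bullet> h)" by (simp add: power2_norm_eq_inner[symmetric] power2_eq_square)
      finally show "\<bar>h $ i * (N x $ i $ j * h $ j)\<bar> \<le> B' * (h \<bullet> h)" .
    qed
    finally show ?thesis by (simp add: D_def)
  qed
  have "B' > 0" by (simp add: B'_def)
  then have "D > 0" by (simp add: D_def)
  have "strictly_conc \<rho> (\<lambda>x. v x + r * \<eta> x) (\<lambda>x. G x + r *\<^sub>R g x) (\<lambda>x. H x + r *\<^sub>R N x)" if r: "\<bar>r\<bar> < \<kappa> / D" for r
    unfolding strictly_conc_def
  proof (intro conjI ballI allI impI)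
    show "C2_with (\<lambda>x. v x + r * \<eta> x) (\<lambda>x. G x + r *\<^sub>R g x) (\<lambda>x. H x + r *\<^sub>R N x)"
      using v \<eta> unfolding smooth_conc_def by (intro C2_with_add C2_with_scale) auto
    fix x h :: "real^'n" assume x: "x \<in> cball 0 \<rho>" and h: "h \<noteq> 0"
    have "r * (h \<bullet> (N x *v h)) \<le> \<bar>r\<bar> * \<bar>h \<bullet> (N x *v h)\<bar>" by (metis abs_ge_self abs_mult)
    also have "\<dots> \<le> \<bar>r\<bar> * (D * (h \<bullet> h))" using quad[OF x] by (intro mult_left_mono) auto
    also have "\<dots> = (\<bar>r\<bar> * D) * (h \<bullet> h)" by simp
    also have "\<dots> < \<kappa> * (h \<bullet> h)"
      using r \<open>D > 0\<close> h by (intro mult_strict_right_mono) (auto simp: field_simps)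
    finally show "h \<bullet> ((H x + r *\<^sub>R N x) *v h) < 0"
      using smooth_conc_hessian[OF v, of h x]
      by (simp add: matrix_vector_mult_add_rdistrib scaleR_matrix_vector inner_add_right)
  qed
  then show ?thesis using \<open>\<kappa> > 0\<close> \<open>D > 0\<close> by (intro exI[of _ "\<kappa> / D"]) auto
qed

lemma smooth_conc_convex_comb:
  assumes "finite J" and s: "\<And>j. j \<in> J \<Longrightarrow> s j \<ge> 0" "sum s J = 1"
    and w: "\<And>j. j \<in> J \<Longrightarrow> smooth_conc \<kappa> L \<rho> (w j) (G j) (H j)"
  shows "smooth_conc \<kappa> L \<rho> (\<lambda>x. \<Sum>j\<in>J. s j * w j x) (\<lambda>x. \<Sum>j\<in>J. s j *\<^sub>R G j x) (\<lambda>x. \<Sum>j\<in>J. s j *\<^sub>R H j x)"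
  unfolding smooth_conc_def
proof (intro conjI allI ballI)
  show "C2_with (\<lambda>x. \<Sum>j\<in>J. s j * w j x) (\<lambda>x. \<Sum>j\<in>J. s j *\<^sub>R G j x) (\<lambda>x. \<Sum>j\<in>J. s j *\<^sub>R H j x)"
    using w unfolding smooth_conc_def by (intro C2_with_sum) auto
  fix x
  have "- (\<Sum>j\<in>J. s j *\<^sub>R H j x) - mat \<kappa> = (\<Sum>j\<in>J. s j *\<^sub>R (- H j x - mat \<kappa>))"
    using s(2) by (simp add: scaleR_diff_right sum_subtractf sum_negf flip: scaleR_sum_left)
  then show "psd (- (\<Sum>j\<in>J. s j *\<^sub>R H j x) - mat \<kappa>)"
    using w s unfolding smooth_conc_def by (auto intro!: psd_sum psd_scale)
  assume "x \<in> cball 0 \<rho>"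
  then have "norm (\<Sum>j\<in>J. s j *\<^sub>R G j x) \<le> (\<Sum>j\<in>J. s j * L)"
    using w s unfolding smooth_conc_def by (intro order_trans[OF norm_sum] sum_mono) (auto intro!: mult_left_mono)
  also have "\<dots> = L" using s(2) by (simp flip: sum_distrib_right)
  finally show "norm (\<Sum>j\<in>J. s j *\<^sub>R G j x) \<le> L" .
qed

lemma strictly_conc_segment:
  assumes "strictly_conc \<rho> v G H" "strictly_conc \<rho> w G' H'" "0 \<le> t" "t \<le> 1"
  shows "strictly_conc \<rho> (\<lambda>x. v x + t * (w x - v x)) (\<lambda>x. G x + t *\<^sub>R (G' x - G x)) (\<lambda>x. H x + t *\<^sub>R (H' x - H x))"
  unfolding strictly_conc_def
proof (intro conjI ballI allI impI)
  have "C2_with (\<lambda>x. w x - v x) (\<lambda>x. G' x - G x) (\<lambda>x. H' x - H x)"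
    using C2_with_add[of w G' H' "\<lambda>x. (-1) * v x" "\<lambda>x. (-1) *\<^sub>R G x" "\<lambda>x. (-1) *\<^sub>R H x"]
      C2_with_scale[of v G H "-1"] assms unfolding strictly_conc_def by simp
  then show "C2_with (\<lambda>x. v x + t * (w x - v x)) (\<lambda>x. G x + t *\<^sub>R (G' x - G x)) (\<lambda>x. H x + t *\<^sub>R (H' x - H x))"
    using assms unfolding strictly_conc_def by (intro C2_with_add C2_with_scale) auto
  fix x h :: "real^'a" assume x: "x \<in> cball 0 \<rho>" and h: "h \<noteq> 0"
  have neg: "h \<bullet> (H x *v h) < 0" "h \<bullet> (H' x *v h) < 0" using assms x h unfolding strictly_conc_def by auto
  have "h \<bullet> ((H x + t *\<^sub>R (H' x - H x)) *v h) = (1 - t) * (h \<bullet> (H x *v h)) + t * (h \<bullet> (H' x *v h))"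
    by (simp add: matrix_vector_mult_add_rdistrib matrix_vector_mult_diff_rdistrib scaleR_matrix_vector inner_add_right inner_diff_right algebra_simps)
  also have "\<dots> < 0"
  proof (cases "t = 0")
    case False
    then have "t * (h \<bullet> (H' x *v h)) < 0" using neg assms by (simp add: mult_pos_neg)
    moreover have "(1 - t) * (h \<bullet> (H x *v h)) \<le> 0" using neg assms by (intro mult_nonneg_nonpos) auto
    ultimately show ?thesis by linarith
  qed (use neg in simp)
  finally show "h \<bullet> ((H x + t *\<^sub>R (H' x - H x)) *v h) < 0" .
qed

lemma C2_with_diff:
  assumes "C2_with w G' H'" "C2_with v G H"
  shows "C2_with (\<lambda>x. w x - v x) (\<lambda>x. G' x - G x) (\<lambda>x. H' x - H x)"
  using C2_with_add[of w G' H' "\<lambda>x. (-1) * v x" "\<lambda>x. (-1) *\<^sub>R G x" "\<lambda>x. (-1) *\<^sub>R H x"]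
    C2_with_scale[of v G H "-1"] assms by simp

context
  fixes \<rho> :: real and a b :: "real^'n::{finite,wellorder}"
  assumes \<rho>: "\<rho> > 0" and box: "cbox a b \<subseteq> ball 0 \<rho>"
begin

text \<open>The integration by parts behind the theorem: the integral of the mixed Hessian measure of
  \<open>f\<^sup>2\<close> vanishes, as adding a multiple of \<open>f\<^sup>2\<close> to \<open>v\<close> leaves the volume of the gradient image fixed.\<close>

lemma integral_ddet_by_parts:
  assumes v: "smooth_conc \<kappa> L \<rho> v G H" and "\<kappa> > 0" and f: "C2_with f g F"
    and f0: "\<And>y. y \<in> cball 0 \<rho> - box a b \<Longrightarrow> f y = 0"
  shows "integral (cbox a b) (\<lambda>y. ddet (- H y) (- F y) * f y) = integral (cbox a b) (\<lambda>y. ddet (- H y) (outer (g y)))"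
proof -
  let ?N = "\<lambda>x. f x *\<^sub>R F x + outer (g x)"
  have vC: "C2_with v G H" using v by (simp add: smooth_conc_def)
  have \<eta>: "C2_with (\<lambda>x. (f x)\<^sup>2 / 2) (\<lambda>x. f x *\<^sub>R g x) ?N" by (rule C2_with_mult[OF f])
  obtain r0 where r0: "r0 > 0" and conc: "\<And>r. \<bar>r\<bar> < r0 \<Longrightarrow>
    strictly_conc \<rho> (\<lambda>x. v x + r * ((f x)\<^sup>2 / 2)) (\<lambda>x. G x + r *\<^sub>R (f x *\<^sub>R g x)) (\<lambda>x. H x + r *\<^sub>R ?N x)"
    using strictly_conc_perturb[OF v \<open>\<kappa> > 0\<close> \<eta>] by blast
  let ?M = "\<lambda>r. integral (cbox a b) (\<lambda>y. det (- H y + r *\<^sub>R (- ?N y)) * 1)"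
  have cH: "continuous_on S (\<lambda>y. - H y)" and cN: "continuous_on S (\<lambda>y. - ?N y)" and cF: "continuous_on S (\<lambda>y. - F y)"
    and cf: "continuous_on S f" and cg: "continuous_on S (\<lambda>y. outer (g y))" for S
    by (intro continuous_intros C2_withD[OF vC] C2_withD[OF \<eta>] C2_withD[OF f] continuous_on_outer)+
  have const: "?M r = ?M 0" if "\<bar>r\<bar> < r0" for r
  proof -
    have "strictly_conc \<rho> v G H" using smooth_conc_strictly[OF v \<open>\<kappa> > 0\<close>] .
    \<comment> \<open>The gradient of half the square of \<open>f\<close> carries the factor
      \<open>f\<close>, so it vanishes on the boundary of the box.\<close>
    moreover have "G y + r *\<^sub>R (f y *\<^sub>R g y) = G y" if "y \<in> cbox a b - box a b" for y
      using f0[of y] that box by (auto simp: subset_iff)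
    ultimately have "integral (cbox a b) (\<lambda>y. det (- H y)) = integral (cbox a b) (\<lambda>y. det (- (H y + r *\<^sub>R ?N y)))"
      by (rule integral_det_perturb[OF \<rho> box _ conc[OF that]])
    moreover have e: "- H y + r *\<^sub>R (- ?N y) = - (H y + r *\<^sub>R ?N y)" for y by (simp add: algebra_simps)
    ultimately show ?thesis unfolding e by simp
  qed
  have D: "(?M has_real_derivative integral (cbox a b) (\<lambda>y. ddet (- H y + 0 *\<^sub>R (- ?N y)) (- ?N y) * 1)) (at 0)"
    by (rule integral_det_deriv[OF cH cN]) simp
  have "integral (cbox a b) (\<lambda>y. ddet (- H y + 0 *\<^sub>R (- ?N y)) (- ?N y) * 1) = 0"
    by (rule DERIV_local_const[OF D r0]) (use const in auto)
  then have "integral (cbox a b) (\<lambda>y. ddet (- H y) (- ?N y)) = 0" by simp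
  moreover have "ddet (- H y) (- ?N y) = ddet (- H y) (- F y) * f y - ddet (- H y) (outer (g y))" for y
    unfolding ddet_minus ddet_add ddet_scale by simp
  moreover have "integral (cbox a b) (\<lambda>y. ddet (- H y) (- F y) * f y - ddet (- H y) (outer (g y)))
    = integral (cbox a b) (\<lambda>y. ddet (- H y) (- F y) * f y) - integral (cbox a b) (\<lambda>y. ddet (- H y) (outer (g y)))"
    by (intro integral_diff integrable_continuous continuous_intros continuous_on_ddet cH cF cf cg)
  ultimately show ?thesis by simp
qed

text \<open>Along the segment from \<open>w\<^sub>b\<close> to \<open>\<Sum>\<^sub>j s\<^sub>j w\<^sub>j\<close>, the derivative of the conjugate gap is a polynomial
  in \<open>s\<close>, homogeneous of degree \<open>n + 1\<close> once \<open>w\<^sub>b\<close> is written as \<open>\<Sum>\<^sub>j s\<^sub>j w\<^sub>b\<close>.\<close>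

lemma conj_gap_hform:
  fixes J :: "'j set"
  assumes J: "finite J" and b0: "C2_with wb Gb Hb"
    and w: "\<And>j. j \<in> J \<Longrightarrow> C2_with (w j) (G j) (H j)"
    and eq: "\<And>j y. j \<in> J \<Longrightarrow> y \<in> cball 0 \<rho> - box a b \<Longrightarrow> w j y = wb y"
    and cb: "strictly_conc \<rho> wb Gb Hb"
  obtains p where "hform (Suc CARD('n)) J p"
    and "\<And>s. sum s J = 1 \<Longrightarrow>
      strictly_conc \<rho> (\<lambda>x. \<Sum>j\<in>J. s j * w j x) (\<lambda>x. \<Sum>j\<in>J. s j *\<^sub>R G j x) (\<lambda>x. \<Sum>j\<in>J. s j *\<^sub>R H j x) \<Longrightarrow>
      p s = conj_gap \<rho> (\<lambda>x. \<Sum>j\<in>J. s j * w j x) wb"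
proof -
  define A where "A = (\<lambda>j t y. (- Hb y) + t *\<^sub>R (- (H j y - Hb y)))"
  define f where "f = (\<lambda>j y. w j y - wb y)"
  \<comment> \<open>Row \<open>r\<close> of the determinant comes from the Hessian with index
    \<open>\<kappa> r\<close>, the last factor from \<open>f j\<close>; integrating over
    \<open>t\<close> recovers the gap from its derivative along the segment.\<close>
  define c where "c = (\<lambda>(\<kappa>::'n \<Rightarrow> 'j) j. integral {0..1} (\<lambda>t. integral (cbox a b) (\<lambda>y. det (\<chi> r. A (\<kappa> r) t y $ r) * f j y)))"
  define K where "K = {\<kappa>::'n \<Rightarrow> 'j. \<forall>r. \<kappa> r \<in> J}"
  define p where "p = (\<lambda>s. \<Sum>\<kappa>\<in>K. \<Sum>j\<in>J. c \<kappa> j * ((\<Prod>r\<in>UNIV. s (\<kappa> r)) * s j))"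
  have finK: "finite K" unfolding K_def by (rule finite_funs_into[OF J])
  have hp: "hform (Suc CARD('n)) J p"
    unfolding p_def
  proof (intro hform_sum hform_cmult)
    fix \<kappa> j assume \<kappa>: "\<kappa> \<in> K" and j: "j \<in> J"
    \<comment> \<open>The variables of a monomial are indexed by \<open>'n option\<close>: one for
      each row of the determinant, and \<open>None\<close> for the factor
      \<open>f j\<close>.\<close>
    have "hform (Suc CARD('n)) J (\<lambda>s. \<Prod>r\<in>(UNIV :: 'n option set). s (case r of None \<Rightarrow> j | Some r \<Rightarrow> \<kappa> r))"
      using \<kappa> j J by (intro hformI_monomial) (auto simp: K_def split: option.splits)
    moreover have "(\<Prod>r\<in>(UNIV :: 'n option set). s (case r of None \<Rightarrow> j | Some r \<Rightarrow> \<kappa> r)) = (\<Prod>r\<in>UNIV. s (\<kappa> r)) * s j" for s :: "'j \<Rightarrow> real"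
      by (simp add: UNIV_option_conv prod.reindex mult.commute)
    ultimately show "hform (Suc CARD('n)) J (\<lambda>s. (\<Prod>r\<in>UNIV. s (\<kappa> r)) * s j)" by simp
  qed
  have cA: "continuous_on S (A j t)" if "j \<in> J" for j t S
    unfolding A_def by (intro continuous_intros C2_withD[OF b0] C2_withD[OF w[OF that]])
  have cf: "continuous_on S (f j)" if "j \<in> J" for j S
    unfolding f_def by (intro continuous_intros C2_withD[OF b0] C2_withD[OF w[OF that]])
  have cdet: "continuous_on S (\<lambda>y. det (\<chi> r. A (\<kappa> r) t y $ r) * f j y)" if "\<kappa> \<in> K" "j \<in> J" for \<kappa> j t S
    using that unfolding K_def by (intro continuous_intros continuous_on_det cf cA) auto
  have snd: "continuous_on (UNIV \<times> cbox a b) (\<lambda>x. h (snd x))" if "continuous_on (cbox a b) h" for h :: "_ \<Rightarrow> 'z::topological_space"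
    by (rule continuous_on_compose2[OF that]) (auto intro!: continuous_intros)
  have cint: "continuous_on S (\<lambda>t. integral (cbox a b) (\<lambda>y. det (\<chi> r. A (\<kappa> r) t y $ r) * f j y))" if \<kappa>: "\<kappa> \<in> K" and j: "j \<in> J" for \<kappa> j S
  proof (rule continuous_on_subset[OF _ subset_UNIV], rule integral_continuous_on_param)
    have "continuous_on (UNIV \<times> cbox a b) (\<lambda>x. H (\<kappa> r) (snd x))" "continuous_on (UNIV \<times> cbox a b) (\<lambda>x. f j (snd x))"
      "continuous_on (UNIV \<times> cbox a b) (\<lambda>x. Hb (snd x))" for r
      using \<kappa> unfolding K_def by (auto intro!: snd C2_withD[OF b0] C2_withD[OF w] cf[OF j])
    then show "continuous_on (UNIV \<times> cbox a b) (\<lambda>(t, y). det (\<chi> r. A (\<kappa> r) t y $ r) * f j y)"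
      unfolding A_def case_prod_unfold by (intro continuous_intros continuous_on_det) auto
  qed
  \<comment> \<open>Strict concavity of the combination is asked for in place of nonnegative
    weights: two-sided derivatives at boundary points of the simplex have to leave it.\<close>
  have "p s = conj_gap \<rho> (\<lambda>x. \<Sum>j\<in>J. s j * w j x) wb"
    if s: "sum s J = 1" and conc: "strictly_conc \<rho> (\<lambda>x. \<Sum>j\<in>J. s j * w j x) (\<lambda>x. \<Sum>j\<in>J. s j *\<^sub>R G j x) (\<lambda>x. \<Sum>j\<in>J. s j *\<^sub>R H j x)" for s
  proof -
    let ?v = "\<lambda>x. \<Sum>j\<in>J. s j * w j x" and ?Hv = "\<lambda>x. \<Sum>j\<in>J. s j *\<^sub>R H j x"
    let ?f = "\<lambda>x. ?v x - wb x" and ?F = "\<lambda>x. ?Hv x - Hb x"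
    let ?e = "\<lambda>t. conj_gap \<rho> (\<lambda>x. wb x + t * ?f x) (\<lambda>x. wb x + 0 * ?f x)"
    let ?I = "\<lambda>t. integral (cbox a b) (\<lambda>y. det (- Hb y + t *\<^sub>R (- ?F y)) * ?f y)"
    have C: "C2_with ?f (\<lambda>x. (\<Sum>j\<in>J. s j *\<^sub>R G j x) - Gb x) ?F"
      using conc by (intro C2_with_diff b0) (simp add: strictly_conc_def)
    have fsum: "?f y = (\<Sum>j\<in>J. s j * f j y)" for y
      using s by (simp add: f_def right_diff_distrib sum_subtractf flip: sum_distrib_right)
    have f0: "?f y = 0" if "y \<in> cball 0 \<rho> - cbox a b" for y
    proof -
      have "w j y = wb y" if "j \<in> J" for j
        using eq[OF that, of y] \<open>y \<in> cball 0 \<rho> - cbox a b\<close> box_subset_cbox[of a b] by blast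
      then show ?thesis unfolding fsum by (simp add: f_def)
    qed
    have der: "(?e has_real_derivative ?I t) (at t within {0..1})" if "t \<in> {0..1}" for t
      by (rule conj_gap_deriv[OF \<rho> box b0 C _ f0 that])
        (use strictly_conc_segment[OF cb conc] in auto)
    have "(?I has_integral (?e 1 - ?e 0)) {0..1}"
      by (rule fundamental_theorem_of_calculus)
        (use der in \<open>auto simp: has_real_derivative_iff_has_vector_derivative\<close>)
    moreover have "?e 0 = 0" by (simp add: conj_gap_def)
    moreover have "?e 1 = conj_gap \<rho> ?v wb" by simp
    ultimately have "conj_gap \<rho> ?v wb = integral {0..1} ?I" by (simp add: integral_unique)
    also have "?I = (\<lambda>t. \<Sum>\<kappa>\<in>K. \<Sum>j\<in>J. ((\<Prod>r\<in>UNIV. s (\<kappa> r)) * s j) * integral (cbox a b) (\<lambda>y. det (\<chi> r. A (\<kappa> r) t y $ r) * f j y))"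
    proof
      fix t
      have "- Hb y + t *\<^sub>R (- ?F y) = (\<Sum>j\<in>J. s j *\<^sub>R A j t y)" for y
      proof -
        have "(\<Sum>j\<in>J. s j *\<^sub>R A j t y) = (\<Sum>j\<in>J. s j *\<^sub>R (- Hb y + t *\<^sub>R Hb y)) - t *\<^sub>R (\<Sum>j\<in>J. s j *\<^sub>R H j y)"
          unfolding A_def scaleR_sum_right sum_subtractf[symmetric] by (intro sum.cong refl) (simp add: algebra_simps)
        also have "(\<Sum>j\<in>J. s j *\<^sub>R (- Hb y + t *\<^sub>R Hb y)) = - Hb y + t *\<^sub>R Hb y"
          using s by (simp flip: scaleR_sum_left)
        finally show ?thesis by (simp add: algebra_simps)
      qed
      moreover have "det (\<Sum>j\<in>J. s j *\<^sub>R A j t y) * (\<Sum>j\<in>J. s j * f j y)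
        = (\<Sum>\<kappa>\<in>K. \<Sum>j\<in>J. ((\<Prod>r\<in>UNIV. s (\<kappa> r)) * s j) * (det (\<chi> r. A (\<kappa> r) t y $ r) * f j y))" for y
        unfolding det_sum_expand[OF J] sum_product K_def by (intro sum.cong refl) (simp add: mult_ac)
      ultimately have "?I t = integral (cbox a b) (\<lambda>y. \<Sum>\<kappa>\<in>K. \<Sum>j\<in>J. ((\<Prod>r\<in>UNIV. s (\<kappa> r)) * s j) * (det (\<chi> r. A (\<kappa> r) t y $ r) * f j y))"
        unfolding fsum by (simp only:)
      also have "\<dots> = (\<Sum>\<kappa>\<in>K. \<Sum>j\<in>J. integral (cbox a b) (\<lambda>y. ((\<Prod>r\<in>UNIV. s (\<kappa> r)) * s j) * (det (\<chi> r. A (\<kappa> r) t y $ r) * f j y)))"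
        by (simp add: integral_sum finK J integrable_sum integrable_continuous continuous_on_mult_left cdet)
      finally show "?I t = (\<Sum>\<kappa>\<in>K. \<Sum>j\<in>J. ((\<Prod>r\<in>UNIV. s (\<kappa> r)) * s j) * integral (cbox a b) (\<lambda>y. det (\<chi> r. A (\<kappa> r) t y $ r) * f j y))"
        by simp
    qed
    also have "integral {0..1} \<dots> = (\<Sum>\<kappa>\<in>K. \<Sum>j\<in>J. integral {0..1} (\<lambda>t. ((\<Prod>r\<in>UNIV. s (\<kappa> r)) * s j) * integral (cbox a b) (\<lambda>y. det (\<chi> r. A (\<kappa> r) t y $ r) * f j y)))"
      by (simp add: integral_sum finK J integrable_sum integrable_continuous_interval continuous_on_mult_left cint)
    also have "\<dots> = p s" unfolding p_def c_def by (simp add: mult.commute)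
    finally show ?thesis by simp
  qed
  with hp show thesis by (rule that)
qed

end

section \<open>Positivity of the second variation\<close>

text \<open>Adjoin \<open>outer c\<close> as the last matrix. Subsets with and without it pair up to
  \<open>det (S + outer c) - det S\<close>, which is \<open>ddet S (outer c)\<close>, so this is the
  mixed discriminant with one rank one entry.\<close>

lemma alternating_ddet_nonneg:
  fixes B :: "nat \<Rightarrow> real^'n^'n"
  assumes psd: "\<And>k. k < m \<Longrightarrow> psd (B k)" and card: "CARD('n) = Suc m"
  shows "(\<Sum>I\<in>Pow {..<m}. (-1) ^ card ({..<m} - I) * ddet (\<Sum>k\<in>I. B k) (outer c)) \<ge> 0"
proof -
  define B' where "B' = B(m := outer c)"
  have eq: "(\<Sum>k\<in>I. B' k) = (\<Sum>k\<in>I. B k)" "(\<Sum>k\<in>insert m I. B' k) = (\<Sum>k\<in>I. B k) + outer c"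
    "card ({..<Suc m} - I) = Suc (card ({..<m} - I))" "{..<Suc m} - insert m I = {..<m} - I"
    if "I \<in> Pow {..<m}" for I
  proof -
    have fin: "finite I" "m \<notin> I" using that finite_subset by auto
    show 1: "(\<Sum>k\<in>I. B' k) = (\<Sum>k\<in>I. B k)" using fin by (intro sum.cong) (auto simp: B'_def)
    show "(\<Sum>k\<in>insert m I. B' k) = (\<Sum>k\<in>I. B k) + outer c" using fin 1 by (simp add: B'_def add.commute)
    have "{..<Suc m} - I = insert m ({..<m} - I)" using fin by auto
    then show "card ({..<Suc m} - I) = Suc (card ({..<m} - I))" by simp
    show "{..<Suc m} - insert m I = {..<m} - I" by auto
  qed
  have "0 \<le> (\<Sum>I\<in>Pow {..<Suc m}. (-1) ^ card ({..<Suc m} - I) * det (\<Sum>k\<in>I. B' k))"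
    using psd card by (intro alternating_det_nonneg) (auto simp: B'_def psd_outer less_Suc_eq)
  also have "Pow {..<Suc m} = Pow {..<m} \<union> insert m ` Pow {..<m}" by (simp add: lessThan_Suc Pow_insert)
  also have "(\<Sum>I\<in>\<dots>. (-1) ^ card ({..<Suc m} - I) * det (\<Sum>k\<in>I. B' k))
    = (\<Sum>I\<in>Pow {..<m}. (-1) ^ card ({..<Suc m} - I) * det (\<Sum>k\<in>I. B' k))
    + (\<Sum>I\<in>insert m ` Pow {..<m}. (-1) ^ card ({..<Suc m} - I) * det (\<Sum>k\<in>I. B' k))"
    by (rule sum.union_disjoint) auto
  also have "(\<Sum>I\<in>insert m ` Pow {..<m}. (-1) ^ card ({..<Suc m} - I) * det (\<Sum>k\<in>I. B' k))
    = (\<Sum>I\<in>Pow {..<m}. (-1) ^ card ({..<Suc m} - insert m I) * det (\<Sum>k\<in>insert m I. B' k))"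
    by (subst sum.reindex) (auto simp: inj_on_def)
  also have "(\<Sum>I\<in>Pow {..<m}. (-1) ^ card ({..<Suc m} - I) * det (\<Sum>k\<in>I. B' k)) + \<dots>
    = (\<Sum>I\<in>Pow {..<m}. (-1) ^ card ({..<m} - I) * ddet (\<Sum>k\<in>I. B k) (outer c))"
    unfolding sum.distrib[symmetric] by (intro sum.cong refl) (simp only: eq ddet_outer power_Suc, simp add: algebra_simps)
  finally show ?thesis .
qed

lemma unit_coord_sum_single:
  fixes X :: "'j \<Rightarrow> 'z::real_vector"
  assumes "finite J" "k \<in> J" shows "(\<Sum>l\<in>J. unit_coord k l *\<^sub>R X l) = X k"
proof -
  have "(\<Sum>l\<in>J. unit_coord k l *\<^sub>R X l) = (\<Sum>l\<in>J. if k = l then X l else 0)"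
    by (intro sum.cong) (auto simp: unit_coord_def)
  then show ?thesis using assms by (simp add: sum.delta')
qed

lemma unit_coord_sum:
  fixes X :: "'j \<Rightarrow> 'z::real_vector"
  assumes "finite J" "i \<in> J" "j \<in> J"
  shows "(\<Sum>l\<in>J. (s l + r * (unit_coord i l - unit_coord j l)) *\<^sub>R X l) = (\<Sum>l\<in>J. s l *\<^sub>R X l) + r *\<^sub>R (X i - X j)"
proof -
  note e = unit_coord_sum_single[OF assms(1)]
  have "(\<Sum>l\<in>J. (s l + r * (unit_coord i l - unit_coord j l)) *\<^sub>R X l)
    = (\<Sum>l\<in>J. s l *\<^sub>R X l) + r *\<^sub>R ((\<Sum>l\<in>J. unit_coord i l *\<^sub>R X l) - (\<Sum>l\<in>J. unit_coord j l *\<^sub>R X l))"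
    by (simp add: scaleR_add_left scaleR_diff_left right_diff_distrib sum.distrib sum_subtractf scaleR_sum_right scaleR_diff_right)
  then show ?thesis using assms by (simp add: e)
qed

context
  fixes \<rho> :: real and a b :: "real^'n::{finite,wellorder}"
  assumes \<rho>: "\<rho> > 0" and box: "cbox a b \<subseteq> ball 0 \<rho>"
begin

lemma conj_gap_add:
  assumes "strictly_conc \<rho> v G H" "strictly_conc \<rho> v' G' H'" "strictly_conc \<rho> v'' G'' H''"
    and "\<And>y. y \<in> cball 0 \<rho> - cbox a b \<Longrightarrow> v y = v' y" "\<And>y. y \<in> cball 0 \<rho> - cbox a b \<Longrightarrow> v' y = v'' y"
  shows "conj_gap \<rho> v v'' = conj_gap \<rho> v v' + conj_gap \<rho> v' v''"
proof -
  have "(\<lambda>z. conj_on \<rho> v z - conj_on \<rho> v' z) integrable_on UNIV"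
    using conj_diff_bounds(1)[OF \<rho> box assms(2,1,4)] by (auto simp: absolutely_integrable_on_def)
  moreover have "(\<lambda>z. conj_on \<rho> v' z - conj_on \<rho> v'' z) integrable_on UNIV"
    using conj_diff_bounds(1)[OF \<rho> box assms(3,2,5)] by (auto simp: absolutely_integrable_on_def)
  ultimately show ?thesis unfolding conj_gap_def by (subst integral_add[symmetric]) auto
qed

text \<open>Positivity: at a simplex point \<open>s\<close> the second derivative of
  \<open>p\<close> in the direction \<open>e_i - e_j\<close> is a partial polarization of
  \<open>p\<close>, and by parts also the integral of \<open>ddet\<close> of the negative Hessian
  against \<open>outer\<close> of the gradient of \<open>w i - w j\<close>. Both sides are
  homogeneous of degree \<open>m\<close> in \<open>s\<close>, so the identity extends to sums of
  unit vectors, where polarizing in \<open>s\<close> produces the alternating sum of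
  \<open>alternating_ddet_nonneg\<close>.\<close>

theorem smooth_volume_form:
  fixes J :: "'j set"
  assumes J: "finite J" and "\<kappa> > 0" and b0: "smooth_conc \<kappa> L \<rho> wb Gb Hb"
    and w: "\<And>j. j \<in> J \<Longrightarrow> smooth_conc \<kappa> L \<rho> (w j) (G j) (H j)"
    and eq: "\<And>j y. j \<in> J \<Longrightarrow> y \<in> cball 0 \<rho> - box a b \<Longrightarrow> w j y = wb y"
    and card: "CARD('n) = Suc m"
  obtains p where "hform (Suc (Suc m)) J p"
    and "\<And>s. (\<And>j. j \<in> J \<Longrightarrow> s j \<ge> 0) \<Longrightarrow> sum s J = 1 \<Longrightarrow> p s = conj_gap \<rho> (\<lambda>x. \<Sum>j\<in>J. s j * w j x) wb"
    and "\<And>i j \<mu>. i \<in> J \<Longrightarrow> j \<in> J \<Longrightarrow> (\<And>k. k < m \<Longrightarrow> \<mu> k \<in> J) \<Longrightarrow>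
       polar (Suc (Suc m)) p (\<lambda>k. if k < m then unit_coord (\<mu> k) else (\<lambda>l. unit_coord i l - unit_coord j l)) \<ge> 0"
proof -
  let ?d = "Suc (Suc m)"
  have C2: "C2_with (w j) (G j) (H j)" if "j \<in> J" for j using w[OF that] by (simp add: smooth_conc_def)
  have Cb: "C2_with wb Gb Hb" using b0 by (simp add: smooth_conc_def)
  have cb: "strictly_conc \<rho> wb Gb Hb" by (rule smooth_conc_strictly[OF b0 \<open>\<kappa> > 0\<close>])
  obtain p where p: "hform (Suc CARD('n)) J p"
    and pval: "\<And>s. sum s J = 1 \<Longrightarrow>
      strictly_conc \<rho> (\<lambda>x. \<Sum>j\<in>J. s j * w j x) (\<lambda>x. \<Sum>j\<in>J. s j *\<^sub>R G j x) (\<lambda>x. \<Sum>j\<in>J. s j *\<^sub>R H j x) \<Longrightarrow>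
      p s = conj_gap \<rho> (\<lambda>x. \<Sum>j\<in>J. s j * w j x) wb"
    by (rule conj_gap_hform[OF \<rho> box J Cb C2 eq cb]) blast+
  have p: "hform ?d J p" using p card by simp
  have val: "p s = conj_gap \<rho> (\<lambda>x. \<Sum>j\<in>J. s j * w j x) wb" if "\<And>j. j \<in> J \<Longrightarrow> s j \<ge> 0" "sum s J = 1" for s
    by (rule pval[OF that(2) smooth_conc_strictly[OF smooth_conc_convex_comb[OF J that w] \<open>\<kappa> > 0\<close>]])
  have pos: "polar ?d p (\<lambda>k. if k < m then unit_coord (\<mu> k) else (\<lambda>l. unit_coord i l - unit_coord j l)) \<ge> 0"
    if i: "i \<in> J" and j: "j \<in> J" and \<mu>: "\<And>k. k < m \<Longrightarrow> \<mu> k \<in> J" for i j \<mu>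
  proof -
    define u where "u = (\<lambda>l. unit_coord i l - unit_coord j l)"
    define A where "A = (\<lambda>k y. - H k y)"
    define g where "g = (\<lambda>y. G i y - G j y)"
    define Q where "Q = (\<lambda>s. integral (cbox a b) (\<lambda>y. ddet (\<Sum>k\<in>J. s k *\<^sub>R A k y) (outer (g y))))"
    define P where "P = (\<lambda>s. polar ?d p (\<lambda>k. if k < m then s else u))"
    let ?f = "\<lambda>x. w i x - w j x" and ?F = "\<lambda>x. H i x - H j x"
    have fC: "C2_with ?f g ?F" unfolding g_def by (intro C2_with_diff C2 i j)
    have f0: "?f y = 0" if "y \<in> cball 0 \<rho> - box a b" for y using eq[OF i that] eq[OF j that] by simp
    have f0': "?f y = 0" if "y \<in> cball 0 \<rho> - cbox a b" for y using f0[of y] that box_subset_cbox[of a b] by auto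
    have simplex: "P s = fact m * Q s" if s: "\<And>j. j \<in> J \<Longrightarrow> s j \<ge> 0" "sum s J = 1" for s
    proof -
      let ?v = "\<lambda>x. \<Sum>j\<in>J. s j * w j x" and ?Gv = "\<lambda>x. \<Sum>j\<in>J. s j *\<^sub>R G j x" and ?Hv = "\<lambda>x. \<Sum>j\<in>J. s j *\<^sub>R H j x"
      have v: "smooth_conc \<kappa> L \<rho> ?v ?Gv ?Hv" by (rule smooth_conc_convex_comb[OF J s w])
      have vC: "C2_with ?v ?Gv ?Hv" using v by (simp add: smooth_conc_def)
      have sv: "strictly_conc \<rho> ?v ?Gv ?Hv" by (rule smooth_conc_strictly[OF v \<open>\<kappa> > 0\<close>])
      obtain r0 where "r0 > 0" and conc: "\<And>r. \<bar>r\<bar> < r0 \<Longrightarrow> strictly_conc \<rho> (\<lambda>x. ?v x + r * ?f x) (\<lambda>x. ?Gv x + r *\<^sub>R g x) (\<lambda>x. ?Hv x + r *\<^sub>R ?F x)"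
        using strictly_conc_perturb[OF v \<open>\<kappa> > 0\<close> fC] by blast
      let ?A = "{-r0<..<r0}"
      let ?e = "\<lambda>r. conj_gap \<rho> (\<lambda>x. ?v x + r * ?f x) (\<lambda>x. ?v x + 0 * ?f x)"
      let ?I = "\<lambda>r. integral (cbox a b) (\<lambda>y. det (- ?Hv y + r *\<^sub>R (- ?F y)) * ?f y)"
      let ?\<Phi> = "\<lambda>r. polar ?d p (\<lambda>k. if k < Suc m then (\<lambda>j. s j + r * u j) else u) / fact (Suc m)"
      have pr: "p (\<lambda>l. s l + r * u l) = ?e r + conj_gap \<rho> ?v wb" if "r \<in> ?A" for r
      proof -
        have r: "\<bar>r\<bar> < r0" using that by auto
        have sum1: "(\<Sum>l\<in>J. s l + r * u l) = 1"
          using unit_coord_sum[OF J i j, of s r "\<lambda>_. 1::real"] s(2) by (simp add: u_def)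
        have comb: "(\<Sum>l\<in>J. (s l + r * u l) *\<^sub>R X l) = (\<Sum>l\<in>J. s l *\<^sub>R X l) + r *\<^sub>R (X i - X j)" for X :: "'j \<Rightarrow> 'z::real_vector"
          unfolding u_def by (rule unit_coord_sum[OF J i j])
        have e1: "(\<lambda>x. \<Sum>l\<in>J. (s l + r * u l) * w l x) = (\<lambda>x. ?v x + r * ?f x)"
          using comb[of "\<lambda>l. w l _"] by (simp add: fun_eq_iff)
        have e2: "(\<lambda>x. \<Sum>l\<in>J. (s l + r * u l) *\<^sub>R G l x) = (\<lambda>x. ?Gv x + r *\<^sub>R g x)"
          "(\<lambda>x. \<Sum>l\<in>J. (s l + r * u l) *\<^sub>R H l x) = (\<lambda>x. ?Hv x + r *\<^sub>R ?F x)"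
          by (simp_all only: comb g_def)
        have "p (\<lambda>l. s l + r * u l) = conj_gap \<rho> (\<lambda>x. ?v x + r * ?f x) wb"
          using pval[of "\<lambda>l. s l + r * u l", OF sum1] conc[OF r] unfolding e1 e2 by blast
        also have "\<dots> = conj_gap \<rho> (\<lambda>x. ?v x + r * ?f x) ?v + conj_gap \<rho> ?v wb"
        proof (rule conj_gap_add[OF conc[OF r] sv cb])
          fix y assume y: "y \<in> cball 0 \<rho> - cbox a b"
          then show "?v y + r * ?f y = ?v y" using f0'[of y] by simp
          have "w j y = wb y" if "j \<in> J" for j using eq[OF that, of y] y box_subset_cbox[of a b] by blast
          then show "?v y = wb y" using s(2) by (simp flip: sum_distrib_right)
        qed
        finally show ?thesis by simp
      qed
      have d1: "((\<lambda>r. p (\<lambda>l. s l + r * u l)) has_real_derivative ?I r) (at r)" if r: "r \<in> ?A" for r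
      proof -
        have "(?e has_real_derivative ?I r) (at r within ?A)"
          by (rule conj_gap_deriv[OF \<rho> box vC fC conc f0' r]) (use \<open>r0 > 0\<close> in auto)
        then have "(?e has_real_derivative ?I r) (at r)" using at_within_open[OF r] by simp
        then have "((\<lambda>r. ?e r + conj_gap \<rho> ?v wb) has_real_derivative ?I r) (at r)"
          by (auto intro: derivative_eq_intros)
        then show ?thesis
          by (rule has_field_derivative_transform_within_open[OF _ open_greaterThanLessThan r]) (use pr in auto)
      qed
      \<comment> \<open>The two first derivatives agree on a whole interval and not just at 0, so
        each may be differentiated again there.\<close>
      have eqI: "?\<Phi> r = ?I r" if "r \<in> ?A" for r
        by (rule DERIV_unique[OF hform_second_deriv(1)[OF p J, of s u] d1[OF that]])
      have "(?\<Phi> has_real_derivative polar ?d p (\<lambda>k. if k < m then (\<lambda>j. s j + 0 * u j) else u) / fact m) (at 0)"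
        by (rule hform_second_deriv(2)[OF p J])
      then have D1: "(?I has_real_derivative polar ?d p (\<lambda>k. if k < m then (\<lambda>j. s j + 0 * u j) else u) / fact m) (at 0)"
        by (rule has_field_derivative_transform_within_open[OF _ open_greaterThanLessThan[of "-r0" r0]])
          (use eqI \<open>r0 > 0\<close> in auto)
      have D2: "(?I has_real_derivative integral (cbox a b) (\<lambda>y. ddet (- ?Hv y + 0 *\<^sub>R (- ?F y)) (- ?F y) * ?f y)) (at 0)"
        by (rule integral_det_deriv) (intro continuous_intros C2_withD[OF vC] C2_withD[OF fC])+
      have "P s / fact m = integral (cbox a b) (\<lambda>y. ddet (- ?Hv y) (- ?F y) * ?f y)"
      proof -
        have e: "(\<lambda>j. s j + 0 * u j) = s" by simp
        show ?thesis using DERIV_unique[OF D1 D2] unfolding e P_def by simp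
      qed
      also have "\<dots> = integral (cbox a b) (\<lambda>y. ddet (- ?Hv y) (outer (g y)))"
        by (rule integral_ddet_by_parts[OF \<rho> box v \<open>\<kappa> > 0\<close> fC f0])
      also have "\<dots> = Q s" unfolding Q_def A_def by (simp add: sum_negf)
      finally show ?thesis by (simp add: field_simps)
    qed
    have scaled: "P (\<lambda>l. c * s l) = fact m * Q (\<lambda>l. c * s l)" if s: "\<And>j. j \<in> J \<Longrightarrow> s j \<ge> 0" "sum s J = 1" for s c
    proof -
      have "P (\<lambda>l. c * s l) = c ^ m * P s" unfolding P_def by (rule polar_partial_scale[OF p J]) simp
      moreover have "Q (\<lambda>l. c * s l) = c ^ m * Q s"
      proof -
        have "(\<Sum>k\<in>J. (c * s k) *\<^sub>R A k y) = c *\<^sub>R (\<Sum>k\<in>J. s k *\<^sub>R A k y)" for y by (simp add: scaleR_sum_right)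
        then show ?thesis unfolding Q_def by (simp add: ddet_scale_left card)
      qed
      ultimately show ?thesis using simplex[OF s] by simp
    qed
    have units: "P (\<lambda>l. \<Sum>k\<in>I. unit_coord (\<mu> k) l) = fact m * integral (cbox a b) (\<lambda>y. ddet (\<Sum>k\<in>I. A (\<mu> k) y) (outer (g y)))"
      if I: "I \<in> Pow {..<m}" for I
    proof -
      have fin: "finite I" using I finite_subset by auto
      have one: "(\<Sum>l\<in>J. unit_coord k l *\<^sub>R X l) = X k" if "k \<in> J" for k and X :: "'j \<Rightarrow> 'z::real_vector"
        by (rule unit_coord_sum_single[OF J that])
      have sumJ: "(\<Sum>l\<in>J. (\<Sum>k\<in>I. unit_coord (\<mu> k) l) *\<^sub>R X l) = (\<Sum>k\<in>I. X (\<mu> k))" for X :: "'j \<Rightarrow> 'z::real_vector"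
      proof -
        have "(\<Sum>l\<in>J. (\<Sum>k\<in>I. unit_coord (\<mu> k) l) *\<^sub>R X l) = (\<Sum>k\<in>I. \<Sum>l\<in>J. unit_coord (\<mu> k) l *\<^sub>R X l)"
          unfolding scaleR_sum_left by (rule sum.swap)
        also have "\<dots> = (\<Sum>k\<in>I. X (\<mu> k))" using I \<mu> by (intro sum.cong refl one) auto
        finally show ?thesis .
      qed
      define c where "c = real (card I)"
      \<comment> \<open>A sum of unit vectors over \<open>I\<close> is \<open>card I\<close> times a
        simplex point; for empty \<open>I\<close> the factor is 0 and any simplex point
        serves.\<close>
      define s where "s = (\<lambda>l. if I = {} then unit_coord i l else (\<Sum>k\<in>I. unit_coord (\<mu> k) l) / c)"
      have "(\<lambda>l. \<Sum>k\<in>I. unit_coord (\<mu> k) l) = (\<lambda>l. c * s l)"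
        using fin by (auto simp: s_def c_def fun_eq_iff)
      moreover have "sum s J = 1"
      proof (cases "I = {}")
        case True
        then show ?thesis using one[OF i, of "\<lambda>_. 1::real"] by (simp add: s_def)
      next
        case False
        then have "sum s J = (\<Sum>l\<in>J. \<Sum>k\<in>I. unit_coord (\<mu> k) l) / c" unfolding s_def sum_divide_distrib by simp
        then show ?thesis using sumJ[of "\<lambda>_. 1::real"] fin False by (simp add: c_def)
      qed
      moreover have "unit_coord k l \<ge> (0::real)" for k l :: 'j by (simp add: unit_coord_def)
      then have "s l \<ge> 0" for l unfolding s_def c_def by (simp add: divide_nonneg_nonneg sum_nonneg)
      ultimately have "P (\<lambda>l. \<Sum>k\<in>I. unit_coord (\<mu> k) l) = fact m * Q (\<lambda>l. \<Sum>k\<in>I. unit_coord (\<mu> k) l)"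
        using scaled[of s c] by simp
      then show ?thesis unfolding Q_def sumJ .
    qed
    let ?R = "\<lambda>y. \<Sum>I\<in>Pow {..<m}. (-1) ^ card ({..<m} - I) * ddet (\<Sum>k\<in>I. A (\<mu> k) y) (outer (g y))"
    have cA: "continuous_on S (\<lambda>y. \<Sum>k\<in>I. A (\<mu> k) y)" if "I \<in> Pow {..<m}" for I S
      unfolding A_def using that \<mu> by (intro continuous_intros C2_withD(3)[OF C2]) auto
    have cg: "continuous_on S (\<lambda>y. outer (g y))" for S by (intro continuous_on_outer C2_withD(4)[OF fC])
    have cR: "continuous_on (cbox a b) (\<lambda>y. (-1) ^ card ({..<m} - I) * ddet (\<Sum>k\<in>I. A (\<mu> k) y) (outer (g y)))" if "I \<in> Pow {..<m}" for I
      by (intro continuous_intros continuous_on_ddet cA[OF that] cg)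
    have "fact m * polar ?d p (\<lambda>k. if k < m then unit_coord (\<mu> k) else u) = polar m P (\<lambda>k. unit_coord (\<mu> k))"
      unfolding P_def by (rule partial_polar[OF p J, symmetric]) simp
    also have "\<dots> = (\<Sum>I\<in>Pow {..<m}. fact m * integral (cbox a b) (\<lambda>y. (-1) ^ card ({..<m} - I) * ddet (\<Sum>k\<in>I. A (\<mu> k) y) (outer (g y))))"
      unfolding polar_def[of m] by (intro sum.cong refl) (simp add: units)
    also have "\<dots> = fact m * integral (cbox a b) ?R"
    proof -
      have "integral (cbox a b) ?R = (\<Sum>I\<in>Pow {..<m}. integral (cbox a b) (\<lambda>y. (-1) ^ card ({..<m} - I) * ddet (\<Sum>k\<in>I. A (\<mu> k) y) (outer (g y))))"
        by (rule integral_sum[OF _ integrable_continuous[OF cR]]) simp_all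
      then show ?thesis by (simp only: sum_distrib_left)
    qed
    finally have "polar ?d p (\<lambda>k. if k < m then unit_coord (\<mu> k) else u) = integral (cbox a b) ?R" by simp
    also have "\<dots> \<ge> 0"
    proof (rule integral_nonneg)
      show "?R integrable_on cbox a b"
        using cR by (intro integrable_continuous continuous_on_sum) auto
      show "0 \<le> ?R y" for y
      proof (rule alternating_ddet_nonneg[OF _ card])
        fix k assume "k < m"
        then have "psd (- H (\<mu> k) y - mat \<kappa> + mat \<kappa>)"
          using w[OF \<mu>] \<open>\<kappa> > 0\<close> unfolding smooth_conc_def by (intro psd_add psd_mat) auto
        then show "psd (A (\<mu> k) y)" by (simp add: A_def)
      qed
    qed
    finally show ?thesis unfolding u_def .
  qed
  show thesis by (rule that[OF p val pos])
qed

end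

section \<open>Passage to the limit\<close>

lemma hform_zero_arg: "hform d J p \<Longrightarrow> d > 0 \<Longrightarrow> p (\<lambda>_. 0) = 0"
  using hform_scale[of d J p 0 "\<lambda>_. 0"] by (simp add: zero_power)

text \<open>The coefficients are alternating sums of values at sums of at most \<open>d\<close> unit
  vectors. These are multiples of simplex points, so convergence on the simplex forces convergence
  of every coefficient.\<close>

lemma hform_limit:
  fixes p :: "nat \<Rightarrow> ('j \<Rightarrow> real) \<Rightarrow> real"
  assumes J: "finite J" and d: "d > 0" and p: "\<And>N. hform d J (p N)"
    and lim: "\<And>s. (\<And>j. j \<in> J \<Longrightarrow> s j \<ge> 0) \<Longrightarrow> sum s J = 1 \<Longrightarrow> (\<lambda>N. p N s) \<longlonglongrightarrow> E s"
  obtains q where "hform d J q" "\<And>s. (\<lambda>N. p N s) \<longlonglongrightarrow> q s"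
    "\<And>s. (\<And>j. j \<in> J \<Longrightarrow> s j \<ge> 0) \<Longrightarrow> sum s J = 1 \<Longrightarrow> q s = E s"
proof -
  let ?E = "{..<d} \<rightarrow>\<^sub>E J"
  have conv: "convergent (\<lambda>N. polar d (p N) (\<lambda>i. unit_coord (\<kappa> i)))" if \<kappa>: "\<kappa> \<in> ?E" for \<kappa>
  proof -
    have "convergent (\<lambda>N. p N (\<lambda>j. \<Sum>i\<in>I. unit_coord (\<kappa> i) j))" if I: "I \<in> Pow {..<d}" for I
    proof (cases "I = {}")
      case True
      then show ?thesis using hform_zero_arg[OF p d] by (simp add: convergent_const)
    next
      case False
      have fin: "finite I" using I finite_subset by auto
      define c where "c = real (card I)"
      have "c > 0" using False fin by (simp add: c_def card_gt_0_iff)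
      define s where "s = (\<lambda>j. (\<Sum>i\<in>I. unit_coord (\<kappa> i) j) / c)"
      have "(\<Sum>j\<in>J. unit_coord (\<kappa> i) j) = (1::real)" if "i \<in> I" for i
        using unit_coord_sum_single[OF J, of "\<kappa> i" "\<lambda>_. 1::real"] PiE_mem[OF \<kappa>] I that by auto
      then have "(\<Sum>j\<in>J. \<Sum>i\<in>I. unit_coord (\<kappa> i) j) = c"
        by (subst sum.swap) (simp add: c_def)
      then have "sum s J = 1" using \<open>c > 0\<close> by (simp add: s_def flip: sum_divide_distrib)
      moreover have "s j \<ge> 0" for j
        unfolding s_def using \<open>c > 0\<close> by (intro divide_nonneg_nonneg sum_nonneg) (auto simp: unit_coord_def)
      ultimately have "(\<lambda>N. p N s) \<longlonglongrightarrow> E s" by (intro lim)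
      then have "(\<lambda>N. c ^ d * p N s) \<longlonglongrightarrow> c ^ d * E s" by (intro tendsto_mult_left)
      moreover have "c ^ d * p N s = p N (\<lambda>j. \<Sum>i\<in>I. unit_coord (\<kappa> i) j)" for N
        using hform_scale[OF p[of N], of c s] \<open>c > 0\<close> by (simp add: s_def)
      ultimately show ?thesis by (auto simp: convergent_def)
    qed
    then obtain l where "\<And>I. I \<in> Pow {..<d} \<Longrightarrow> (\<lambda>N. p N (\<lambda>j. \<Sum>i\<in>I. unit_coord (\<kappa> i) j)) \<longlonglongrightarrow> l I"
      unfolding convergent_def by metis
    then have "(\<lambda>N. polar d (p N) (\<lambda>i. unit_coord (\<kappa> i))) \<longlonglongrightarrow> (\<Sum>I\<in>Pow {..<d}. (-1) ^ card ({..<d} - I) * l I)"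
      unfolding polar_def by (intro tendsto_sum tendsto_mult_left)
    then show ?thesis by (auto simp: convergent_def)
  qed
  then obtain c where c: "\<And>\<kappa>. \<kappa> \<in> ?E \<Longrightarrow> (\<lambda>N. polar d (p N) (\<lambda>i. unit_coord (\<kappa> i))) \<longlonglongrightarrow> c \<kappa>"
    unfolding convergent_def by metis
  define q where "q = (\<lambda>s. \<Sum>\<kappa>\<in>?E. c \<kappa> / fact d * (\<Prod>i<d. s (\<kappa> i)))"
  have q: "hform d J q" unfolding q_def hform_def by (intro exI[of _ "\<lambda>\<kappa>. c \<kappa> / fact d"]) simp
  have limq: "(\<lambda>N. p N s) \<longlonglongrightarrow> q s" for s
  proof -
    have "(\<lambda>N. \<Sum>\<kappa>\<in>?E. polar d (p N) (\<lambda>i. unit_coord (\<kappa> i)) / fact d * (\<Prod>i<d. s (\<kappa> i))) \<longlonglongrightarrow> q s"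
      unfolding q_def by (intro tendsto_sum tendsto_mult_right tendsto_divide tendsto_const c) auto
    then show ?thesis using hform_eq_polar[OF p J, of _ s] by presburger
  qed
  show thesis
    by (rule that[OF q limq]) (metis LIMSEQ_unique lim limq)
qed

lemma supp_fun_Lipschitz:
  assumes S: "compact S" "S \<noteq> {}" and R: "\<And>z t. (z,t) \<in> S \<Longrightarrow> norm z \<le> R"
  shows "supp_fun S y \<le> supp_fun S y' + R * norm (y - y')"
proof -
  obtain z t where 1: "(z,t) \<in> S" "supp_fun S y' = t - z \<bullet> y'"
    by (rule supp_fun_attained[OF S, of y'], rule that, assumption, assumption)
  obtain z0 t0 where 2: "supp_fun S y = t0 - z0 \<bullet> y" "\<And>z' t'. (z',t') \<in> S \<Longrightarrow> t0 - z0 \<bullet> y \<le> t' - z' \<bullet> y"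
    by (rule supp_fun_attained[OF S, of y], rule that, assumption, blast)
  have "supp_fun S y \<le> t - z \<bullet> y" using 2(2)[OF 1(1)] 2(1) by simp
  also have "\<dots> = supp_fun S y' - z \<bullet> (y - y')" by (simp add: 1(2) inner_diff_right)
  finally have "supp_fun S y \<le> supp_fun S y' - z \<bullet> (y - y')" .
  moreover have "norm z * norm (y - y') \<le> R * norm (y - y')" using R[OF 1(1)] by (intro mult_right_mono) auto
  ultimately show ?thesis using Cauchy_Schwarz_ineq2[of z "y - y'"] by linarith
qed

lemma continuous_supp_fun:
  assumes S: "compact S" "S \<noteq> {}" and R: "\<And>z t. (z,t) \<in> S \<Longrightarrow> norm z \<le> R"
  shows "continuous_on A (supp_fun S)"
proof (rule continuous_on_subset[OF _ subset_UNIV], rule lipschitz_on_continuous_on, rule lipschitz_onI)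
  have L: "supp_fun S x \<le> supp_fun S y + R * norm (x - y)" for x y
    by (rule supp_fun_Lipschitz[OF S]) (rule R)
  show "dist (supp_fun S x) (supp_fun S y) \<le> R * dist x y" for x y
    using L[of x y] L[of y x]
    by (simp add: dist_real_def dist_norm norm_minus_commute abs_le_iff)
  obtain z t where "(z,t) \<in> S" using S by auto
  then show "0 \<le> R" using R[of z t] norm_ge_zero[of z] by linarith
qed

lemma integrable_on_compact:
  fixes f :: "'a::euclidean_space \<Rightarrow> real"
  assumes "compact S" "continuous_on S f" shows "f integrable_on S"
proof (rule set_borel_integral_eq_integral(1))
  show "set_integrable lborel S f"
    unfolding set_integrable_def by (rule borel_integrable_compact[OF assms])
qed

lemma conj_on_close:
  assumes "\<rho> > 0" "continuous_on (cball 0 \<rho>) v" "continuous_on (cball 0 \<rho>) w"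
    and close: "\<And>y. y \<in> cball 0 \<rho> \<Longrightarrow> \<bar>v y - w y\<bar> \<le> e"
  shows "\<bar>conj_on \<rho> v z - conj_on \<rho> w z\<bar> \<le> e"
proof -
  have "conj_on \<rho> v z \<le> conj_on \<rho> w z + e" if "continuous_on (cball 0 \<rho>) v" "continuous_on (cball 0 \<rho>) w"
    and close: "\<And>y. y \<in> cball 0 \<rho> \<Longrightarrow> \<bar>v y - w y\<bar> \<le> e" for v w
  proof -
    let ?y = "maximizer \<rho> v z"
    have y: "?y \<in> cball 0 \<rho>" using maximizer_props(1)[OF that(1)] assms(1) by auto
    have "conj_on \<rho> v z = z \<bullet> ?y + v ?y" using maximizer_props(3)[OF that(1)] assms(1) by auto
    also have "\<dots> \<le> z \<bullet> ?y + w ?y + e" using close[OF y] by linarith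
    also have "\<dots> \<le> conj_on \<rho> w z + e" using maximizer_props(4)[OF that(2) _ y] assms(1) by auto
    finally show ?thesis .
  qed
  from this[of v w] this[of w v] show ?thesis using assms by (simp add: abs_le_iff abs_minus_commute)
qed

context
  fixes \<rho> :: real and a b :: "real^'n::{finite,wellorder}"
  assumes \<rho>: "\<rho> > 0" and box: "cbox a b \<subseteq> ball 0 \<rho>"
begin

text \<open>An interior maximizer would give \<open>z = - G y\<close>, of norm at most
  \<open>L\<close>. Hence for larger \<open>z\<close> the maximizer lies on the sphere, where both
  functions agree.\<close>

lemma conj_on_eq_far:
  assumes v: "smooth_conc \<kappa> L \<rho> v G H" and w: "smooth_conc \<kappa> L \<rho> w G' H'"
    and eq: "\<And>y. y \<in> cball 0 \<rho> - cbox a b \<Longrightarrow> v y = w y" and z: "norm z > L"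
  shows "conj_on \<rho> v z = conj_on \<rho> w z"
proof -
  have le: "conj_on \<rho> v z \<le> conj_on \<rho> w z" if v: "smooth_conc \<kappa> L \<rho> v G H" and w: "smooth_conc \<kappa> L \<rho> w G' H'"
    and eq: "\<And>y. y \<in> cball 0 \<rho> - cbox a b \<Longrightarrow> v y = w y" for v w G H G' H'
  proof -
    have C: "C2_with v G H" "C2_with w G' H'" using v w by (auto simp: smooth_conc_def)
    note c = C2_withD(5)[OF C(1), of "cball 0 \<rho>"] C2_withD(5)[OF C(2), of "cball 0 \<rho>"]
    let ?y = "maximizer \<rho> v z"
    have y: "?y \<in> cball 0 \<rho>" using maximizer_props(1)[OF c(1)] \<rho> by auto
    have "?y \<notin> ball 0 \<rho>"
    proof
      assume "?y \<in> ball 0 \<rho>"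
      then have "z = - G ?y" using maximizer_interior[OF C(1)] \<rho> by auto
      then have "norm z \<le> L" using v y unfolding smooth_conc_def by (metis norm_minus_cancel)
      with z show False by simp
    qed
    then have "v ?y = w ?y" using eq y box by blast
    then show ?thesis using maximizer_props(3)[OF c(1), of z] maximizer_props(4)[OF c(2) _ y, of z] \<rho> by auto
  qed
  show ?thesis using le[OF v w eq] le[OF w v eq[symmetric]] by simp
qed

lemma conj_gap_cball:
  assumes v: "smooth_conc \<kappa> L \<rho> v G H" and w: "smooth_conc \<kappa> L \<rho> w G' H'"
    and eq: "\<And>y. y \<in> cball 0 \<rho> - cbox a b \<Longrightarrow> v y = w y" and "L \<le> L'"
  shows "conj_gap \<rho> v w = integral (cball 0 L') (\<lambda>z. conj_on \<rho> v z - conj_on \<rho> w z)"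
proof -
  have "(if z \<in> cball 0 L' then conj_on \<rho> v z - conj_on \<rho> w z else 0) = conj_on \<rho> v z - conj_on \<rho> w z" for z
    using conj_on_eq_far[OF v w eq, of z] \<open>L \<le> L'\<close> by auto
  then show ?thesis unfolding conj_gap_def
    using integral_restrict_UNIV[of "cball 0 L'" "\<lambda>z. conj_on \<rho> v z - conj_on \<rho> w z"] by simp
qed

text \<open>The forms of smooth approximations converge on the simplex to the integral
  \<open>E\<close>, hence everywhere, and a limit of nonnegative polar values is
  nonnegative.\<close>

theorem supp_fun_volume_form:
  fixes J :: "'j set" and S :: "'j \<Rightarrow> ((real,'n) vec \<times> real) set"
  assumes J: "finite J"
    and S: "\<And>j. j \<in> J \<Longrightarrow> compact (S j)" "\<And>j. j \<in> J \<Longrightarrow> S j \<noteq> {}"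
    and R: "\<And>j z t. j \<in> J \<Longrightarrow> (z,t) \<in> S j \<Longrightarrow> norm z \<le> R"
    and Sb: "compact Sb" "Sb \<noteq> {}" and Rb: "\<And>z t. (z,t) \<in> Sb \<Longrightarrow> norm z \<le> R"
    and le: "\<And>j y. j \<in> J \<Longrightarrow> supp_fun (S j) y \<le> supp_fun Sb y"
    and eq: "\<And>j y. j \<in> J \<Longrightarrow> y \<in> cball 0 \<rho> - box a b \<Longrightarrow> supp_fun (S j) y = supp_fun Sb y"
    and card: "CARD('n) = Suc m"
  obtains p where "hform (Suc (Suc m)) J p"
    and "\<And>s. (\<And>j. j \<in> J \<Longrightarrow> s j \<ge> 0) \<Longrightarrow> sum s J = 1 \<Longrightarrow>
      p s = integral (cball 0 (R + 1)) (\<lambda>z. conj_on \<rho> (\<lambda>y. \<Sum>j\<in>J. s j * supp_fun (S j) y) z - conj_on \<rho> (supp_fun Sb) z)"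
    and "\<And>i j \<mu>. i \<in> J \<Longrightarrow> j \<in> J \<Longrightarrow> (\<And>k. k < m \<Longrightarrow> \<mu> k \<in> J) \<Longrightarrow>
       polar (Suc (Suc m)) p (\<lambda>k. if k < m then unit_coord (\<mu> k) else (\<lambda>l. unit_coord i l - unit_coord j l)) \<ge> 0"
proof -
  let ?d = "Suc (Suc m)" and ?V = "measure lebesgue (cball (0::(real,'n) vec) (R + 1))"
  define E where "E = (\<lambda>s. integral (cball 0 (R + 1)) (\<lambda>z. conj_on \<rho> (\<lambda>y. \<Sum>j\<in>J. s j * supp_fun (S j) y) z - conj_on \<rho> (supp_fun Sb) z))"
  have cu: "continuous_on A (supp_fun (S j))" if "j \<in> J" for j A
    by (rule continuous_supp_fun[OF S(1)[OF that] S(2)[OF that]]) (rule R[OF that])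
  have cub: "continuous_on A (supp_fun Sb)" for A by (rule continuous_supp_fun[OF Sb]) (rule Rb)
  have approx: "\<exists>p. hform ?d J p \<and>
      (\<forall>s. (\<forall>j\<in>J. s j \<ge> 0) \<and> sum s J = 1 \<longrightarrow> \<bar>p s - E s\<bar> \<le> 3 * \<delta> * ?V) \<and>
      (\<forall>i\<in>J. \<forall>j\<in>J. \<forall>\<mu>. (\<forall>k<m. \<mu> k \<in> J) \<longrightarrow>
        polar ?d p (\<lambda>k. if k < m then unit_coord (\<mu> k) else (\<lambda>l. unit_coord i l - unit_coord j l)) \<ge> 0)"
    if \<delta>: "\<delta> > 0" for \<delta>
  proof -
    \<comment> \<open>Off the box \<open>f j + \<delta> - wb\<close> is at least
      \<open>\<delta> - 4 * \<epsilon>\<close> and has to reach the width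
      \<open>2 * \<epsilon>\<close> of the smoothed minimum.\<close>
    define \<epsilon> where "\<epsilon> = \<delta> / 8"
    \<comment> \<open>The first bound keeps the quadratic term below \<open>\<epsilon>\<close> on
      the ball, the second keeps all gradients below \<open>R + 1\<close>, the radius of
      integration.\<close>
    define \<kappa> where "\<kappa> = min (\<epsilon> / \<rho>\<^sup>2) (1 / \<rho>)"
    have \<epsilon>: "\<epsilon> > 0" using \<delta> by (simp add: \<epsilon>_def)
    have \<kappa>: "\<kappa> > 0" using \<epsilon> \<rho> by (simp add: \<kappa>_def)
    have "\<kappa> \<le> \<epsilon> / \<rho>\<^sup>2" "\<kappa> \<le> 1 / \<rho>" by (simp_all add: \<kappa>_def)
    then have \<kappa>1: "\<kappa> * \<rho>\<^sup>2 \<le> \<epsilon>" "\<kappa> * \<rho> \<le> 1" using \<rho> by (simp_all add: pos_le_divide_eq)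
    let ?L = "R + \<kappa> * \<rho>"
    have "\<forall>j\<in>J. \<exists>f G H. smooth_conc \<kappa> ?L \<rho> f G H \<and> (\<forall>y\<in>cball 0 \<rho>. \<bar>f y - supp_fun (S j) y\<bar> \<le> 2 * \<epsilon>)"
      using \<epsilon> \<kappa> \<kappa>1 \<rho> by (intro ballI smooth_approx_supp_fun S) (auto intro: R)
    then obtain f Gf Hf where f: "\<And>j. j \<in> J \<Longrightarrow> smooth_conc \<kappa> ?L \<rho> (f j) (Gf j) (Hf j)"
      and fc: "\<And>j y. j \<in> J \<Longrightarrow> y \<in> cball 0 \<rho> \<Longrightarrow> \<bar>f j y - supp_fun (S j) y\<bar> \<le> 2 * \<epsilon>"
      by metis
    have "\<exists>f G H. smooth_conc \<kappa> ?L \<rho> f G H \<and> (\<forall>y\<in>cball 0 \<rho>. \<bar>f y - supp_fun Sb y\<bar> \<le> 2 * \<epsilon>)"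
      using \<epsilon> \<kappa> \<kappa>1 \<rho> by (intro smooth_approx_supp_fun Sb) (auto intro: Rb)
    then obtain wb Gb Hb where b: "smooth_conc \<kappa> ?L \<rho> wb Gb Hb"
      and bc: "\<And>y. y \<in> cball 0 \<rho> \<Longrightarrow> \<bar>wb y - supp_fun Sb y\<bar> \<le> 2 * \<epsilon>"
      by blast
    \<comment> \<open>The lift by \<open>\<delta>\<close> lets \<open>wb\<close> win off the box, so
      \<open>w j\<close> equals it there. Inside, the cut costs little since
      \<open>supp_fun (S j)\<close> never exceeds \<open>supp_fun Sb\<close>.\<close>
    define w where "w = (\<lambda>j y. softmin (2 * \<epsilon>) (f j y + \<delta>) (wb y))"
    have "\<forall>j\<in>J. \<exists>G H. smooth_conc \<kappa> ?L \<rho> (w j) G H"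
      unfolding w_def using smooth_conc_softmin[OF smooth_conc_shift[OF f] b] \<epsilon> by simp
    then obtain G H where w: "\<And>j. j \<in> J \<Longrightarrow> smooth_conc \<kappa> ?L \<rho> (w j) (G j) (H j)" by metis
    have weq: "w j y = wb y" if j: "j \<in> J" and y: "y \<in> cball 0 \<rho> - box a b" for j y
    proof -
      have "f j y + \<delta> - wb y \<ge> 2 * \<epsilon>"
        using fc[OF j, of y] bc[of y] eq[OF j y] y unfolding \<epsilon>_def abs_le_iff by auto
      then show ?thesis unfolding w_def using \<epsilon> by (intro softmin_eq_right) auto
    qed
    have wclose: "\<bar>w j y - supp_fun (S j) y\<bar> \<le> 2 * \<delta>" if j: "j \<in> J" and y: "y \<in> cball 0 \<rho>" for j y
      using softmin_bounds[of "2 * \<epsilon>" "f j y + \<delta>" "wb y"] fc[OF j y] bc[OF y] le[OF j, of y] \<epsilon> \<delta>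
      unfolding w_def \<epsilon>_def abs_le_iff by (auto simp: min_def split: if_splits)
    obtain p where p: "hform ?d J p"
      and pval: "\<And>s. (\<And>j. j \<in> J \<Longrightarrow> s j \<ge> 0) \<Longrightarrow> sum s J = 1 \<Longrightarrow> p s = conj_gap \<rho> (\<lambda>x. \<Sum>j\<in>J. s j * w j x) wb"
      and ppos: "\<And>i j \<mu>. i \<in> J \<Longrightarrow> j \<in> J \<Longrightarrow> (\<And>k. k < m \<Longrightarrow> \<mu> k \<in> J) \<Longrightarrow>
       polar ?d p (\<lambda>k. if k < m then unit_coord (\<mu> k) else (\<lambda>l. unit_coord i l - unit_coord j l)) \<ge> 0"
      by (rule smooth_volume_form[OF \<rho> box J \<kappa> b w weq card]) blast+
    have "\<bar>p s - E s\<bar> \<le> 3 * \<delta> * ?V" if s: "\<And>j. j \<in> J \<Longrightarrow> s j \<ge> 0" "sum s J = 1" for s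
    proof -
      let ?v = "\<lambda>x. \<Sum>j\<in>J. s j * w j x" and ?u = "\<lambda>y. \<Sum>j\<in>J. s j * supp_fun (S j) y"
      have v: "smooth_conc \<kappa> ?L \<rho> ?v (\<lambda>x. \<Sum>j\<in>J. s j *\<^sub>R G j x) (\<lambda>x. \<Sum>j\<in>J. s j *\<^sub>R H j x)"
        by (rule smooth_conc_convex_comb[OF J s w])
      have veq: "?v y = wb y" if y: "y \<in> cball 0 \<rho> - cbox a b" for y
      proof -
        have "w j y = wb y" if "j \<in> J" for j using weq[OF that, of y] y box_subset_cbox[of a b] by blast
        then show ?thesis using s(2) by (simp flip: sum_distrib_right)
      qed
      have cv: "continuous_on (cball 0 \<rho>) ?v" and cwb: "continuous_on (cball 0 \<rho>) wb"
        using v b C2_withD(5) unfolding smooth_conc_def by blast+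
      have cus: "continuous_on (cball 0 \<rho>) ?u" by (intro continuous_intros cu)
      have "\<bar>?v y - ?u y\<bar> \<le> 2 * \<delta>" if y: "y \<in> cball 0 \<rho>" for y
      proof -
        have "?v y - ?u y = (\<Sum>j\<in>J. s j * (w j y - supp_fun (S j) y))"
          by (simp add: right_diff_distrib sum_subtractf)
        also have "\<bar>\<dots>\<bar> \<le> (\<Sum>j\<in>J. s j * (2 * \<delta>))"
          using s wclose[OF _ y] by (intro order_trans[OF sum_abs] sum_mono) (auto simp: abs_mult intro!: mult_left_mono)
        also have "\<dots> = 2 * \<delta>" using s(2) by (simp flip: sum_distrib_right)
        finally show ?thesis .
      qed
      then have c1: "\<bar>conj_on \<rho> ?v z - conj_on \<rho> ?u z\<bar> \<le> 2 * \<delta>" for z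
        by (intro conj_on_close[OF \<rho> cv cus])
      have "\<bar>wb y - supp_fun Sb y\<bar> \<le> \<delta>" if "y \<in> cball 0 \<rho>" for y
        using bc[OF that] \<delta> by (simp add: \<epsilon>_def)
      then have c2: "\<bar>conj_on \<rho> wb z - conj_on \<rho> (supp_fun Sb) z\<bar> \<le> \<delta>" for z
        by (intro conj_on_close[OF \<rho> cwb cub])
      let ?g = "\<lambda>z. conj_on \<rho> ?v z - conj_on \<rho> wb z" and ?h = "\<lambda>z. conj_on \<rho> ?u z - conj_on \<rho> (supp_fun Sb) z"
      have int: "?g integrable_on cball 0 (R+1)" "?h integrable_on cball 0 (R+1)"
        by (intro integrable_diff integrable_on_compact compact_cball continuous_conj_on[OF \<rho> box] cv cwb cus cub)+
      have "p s = conj_gap \<rho> ?v wb" by (rule pval) (use s in auto)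
      also have "\<dots> = integral (cball 0 (R+1)) ?g"
        using \<kappa>1 by (intro conj_gap_cball[OF v b] veq) auto
      finally have "p s = integral (cball 0 (R+1)) ?g" .
      then have "p s - E s = integral (cball 0 (R+1)) (\<lambda>z. ?g z - ?h z)"
        unfolding E_def using int by (simp add: integral_diff)
      moreover have "norm (integral (cball 0 (R+1)) (\<lambda>z. ?g z - ?h z)) \<le> integral (cball (0::(real,'n) vec) (R+1)) (\<lambda>z. 3 * \<delta>)"
      proof (rule integral_norm_bound_integral)
        show "(\<lambda>z. ?g z - ?h z) integrable_on cball 0 (R+1)" using int by (rule integrable_diff)
        show "(\<lambda>z::(real,'n) vec. 3 * \<delta>) integrable_on cball 0 (R+1)" by (rule integrable_on_const) auto
        show "norm (?g z - ?h z) \<le> 3 * \<delta>" for z using c1[of z] c2[of z] unfolding real_norm_def by linarith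
      qed
      moreover have "integral (cball (0::(real,'n) vec) (R+1)) (\<lambda>z. 3 * \<delta>) = 3 * \<delta> * ?V"
        using lmeasure_integral[of "cball (0::(real,'n) vec) (R+1)"] integral_mult_right[of "cball (0::(real,'n) vec) (R+1)" "3 * \<delta>" "\<lambda>_. 1"] by simp
      ultimately show ?thesis by (simp only: real_norm_def)
    qed
    then show ?thesis using p ppos by (intro exI[of _ p]) auto
  qed
  have "\<forall>N::nat. \<exists>p. hform ?d J p \<and>
      (\<forall>s. (\<forall>j\<in>J. s j \<ge> 0) \<and> sum s J = 1 \<longrightarrow> \<bar>p s - E s\<bar> \<le> 3 * inverse (real (Suc N)) * ?V) \<and>
      (\<forall>i\<in>J. \<forall>j\<in>J. \<forall>\<mu>. (\<forall>k<m. \<mu> k \<in> J) \<longrightarrow>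
        polar ?d p (\<lambda>k. if k < m then unit_coord (\<mu> k) else (\<lambda>l. unit_coord i l - unit_coord j l)) \<ge> 0)"
    by (intro allI approx) simp
  from choice[OF this] obtain pN where *: "\<And>N::nat. hform ?d J (pN N) \<and>
      (\<forall>s. (\<forall>j\<in>J. s j \<ge> 0) \<and> sum s J = 1 \<longrightarrow> \<bar>pN N s - E s\<bar> \<le> 3 * inverse (real (Suc N)) * ?V) \<and>
      (\<forall>i\<in>J. \<forall>j\<in>J. \<forall>\<mu>. (\<forall>k<m. \<mu> k \<in> J) \<longrightarrow>
        polar ?d (pN N) (\<lambda>k. if k < m then unit_coord (\<mu> k) else (\<lambda>l. unit_coord i l - unit_coord j l)) \<ge> 0)"
    by blast
  have pN: "hform ?d J (pN N)" for N using * by blast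
  have bound: "\<bar>pN N s - E s\<bar> \<le> 3 * inverse (real (Suc N)) * ?V" if "\<And>j. j \<in> J \<Longrightarrow> s j \<ge> 0" "sum s J = 1" for N s
    using *[of N] that by blast
  have lim: "(\<lambda>N. pN N s) \<longlonglongrightarrow> E s" if "\<And>j. j \<in> J \<Longrightarrow> s j \<ge> 0" "sum s J = 1" for s
  proof -
    have "(\<lambda>N. 3 * inverse (real (Suc N)) * ?V) \<longlonglongrightarrow> 3 * 0 * ?V"
      by (intro tendsto_mult_right tendsto_mult_left LIMSEQ_inverse_real_of_nat)
    then have "(\<lambda>N. 3 * inverse (real (Suc N)) * ?V) \<longlonglongrightarrow> 0" by (simp only: mult_zero_left mult_zero_right)
    then have "(\<lambda>N. pN N s - E s) \<longlonglongrightarrow> 0"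
      by (intro Lim_null_comparison[of "\<lambda>N. pN N s - E s" "\<lambda>N. 3 * inverse (real (Suc N)) * ?V"] always_eventually allI)
        (use bound[OF that] in simp)
    then show ?thesis by (rule LIM_zero_cancel)
  qed
  obtain q where q: "hform ?d J q" "\<And>s. (\<lambda>N. pN N s) \<longlonglongrightarrow> q s"
    "\<And>s. (\<And>j. j \<in> J \<Longrightarrow> s j \<ge> 0) \<Longrightarrow> sum s J = 1 \<Longrightarrow> q s = E s"
    by (rule hform_limit[OF J _ pN lim]) auto
  have "polar ?d q (\<lambda>k. if k < m then unit_coord (\<mu> k) else (\<lambda>l. unit_coord i l - unit_coord j l)) \<ge> 0"
    if "i \<in> J" "j \<in> J" "\<And>k. k < m \<Longrightarrow> \<mu> k \<in> J" for i j \<mu>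
  proof (rule LIMSEQ_le_const)
    show "(\<lambda>N. polar ?d (pN N) (\<lambda>k. if k < m then unit_coord (\<mu> k) else (\<lambda>l. unit_coord i l - unit_coord j l)))
      \<longlonglongrightarrow> polar ?d q (\<lambda>k. if k < m then unit_coord (\<mu> k) else (\<lambda>l. unit_coord i l - unit_coord j l))"
      unfolding polar_def by (intro tendsto_sum tendsto_mult_left q(2))
  qed (use * that in blast)
  with q(1,3) show thesis unfolding E_def by (intro that[of q]) auto
qed

end

section \<open>Cones and cofinite convex subsets in epigraph coordinates\<close>

text \<open>The outer cone of slope \<open>c\<close> makes parts of bounded height bounded; the
  inner cone of slope \<open>L\<close> makes \<open>L\<close> a Lipschitz constant for all lower
  boundaries.\<close>

definition std_cone :: "real \<Rightarrow> real \<Rightarrow> ('b::euclidean_space \<times> real) set \<Rightarrow> bool" where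
  "std_cone c L C \<longleftrightarrow> closed C \<and> convex C \<and> cone C \<and> c > 0 \<and> L > 0 \<and>
     (\<forall>x\<in>C. c * norm (fst x) \<le> snd x) \<and> (\<forall>x. L * norm (fst x) \<le> snd x \<longrightarrow> x \<in> C)"

definition body :: "('b::euclidean_space \<times> real) set \<Rightarrow> real \<Rightarrow> ('b \<times> real) set \<Rightarrow> bool" where
  "body C h B \<longleftrightarrow> closed B \<and> convex B \<and> B \<subseteq> C \<and> (\<forall>x\<in>C. h \<le> snd x \<longrightarrow> x \<in> B)"

definition msum :: "'j set \<Rightarrow> ('j \<Rightarrow> real) \<Rightarrow> ('j \<Rightarrow> 'b::real_vector set) \<Rightarrow> 'b set" where
  "msum J s B = {\<Sum>j\<in>J. s j *\<^sub>R x j | x. \<forall>j\<in>J. x j \<in> B j}"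

definition lower :: "('b \<times> real) set \<Rightarrow> 'b \<Rightarrow> real" where
  "lower B z = Inf {t. (z, t) \<in> B}"

lemma std_coneD:
  assumes "std_cone c L C"
  shows "closed C" "convex C" "c > 0" "L > 0" "\<And>x. x \<in> C \<Longrightarrow> c * norm (fst x) \<le> snd x"
    "\<And>x. L * norm (fst x) \<le> snd x \<Longrightarrow> x \<in> C" "\<And>x r. x \<in> C \<Longrightarrow> r \<ge> 0 \<Longrightarrow> r *\<^sub>R x \<in> C"
    "\<And>x y. x \<in> C \<Longrightarrow> y \<in> C \<Longrightarrow> x + y \<in> C" "\<And>x. x \<in> C \<Longrightarrow> snd x \<ge> 0"
proof -
  have C: "closed C" "convex C" "cone C" "c > 0" "L > 0" using assms by (auto simp: std_cone_def)
  show "closed C" "convex C" "c > 0" "L > 0" using C by auto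
  show ht: "c * norm (fst x) \<le> snd x" if "x \<in> C" for x using assms that by (auto simp: std_cone_def)
  show "x \<in> C" if "L * norm (fst x) \<le> snd x" for x using assms that unfolding std_cone_def by blast
  show "r *\<^sub>R x \<in> C" if "x \<in> C" "r \<ge> 0" for x r using C(3) that by (auto simp: cone_def)
  show "x + y \<in> C" if "x \<in> C" "y \<in> C" for x y using C(2,3) that convex_cone[of C] by auto
  show "snd x \<ge> 0" if "x \<in> C" for x
  proof -
    have "0 \<le> c * norm (fst x)" using C by simp
    then show ?thesis using ht[OF that] by linarith
  qed
qed

text \<open>\<open>C\<close> consists of recession directions of \<open>B\<close>: the point
  \<open>x + y\<close> is the limit of \<open>(1 - e) x + e (y / e)\<close> as \<open>e\<close>
  tends to 0, and \<open>y / e\<close> is eventually above height \<open>h\<close>, hence in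
  \<open>B\<close>.\<close>

lemma body_add:
  assumes C: "std_cone c L C" and B: "body C h B" and x: "x \<in> B" and y: "y \<in> C"
  shows "x + y \<in> B"
proof (cases "y = 0")
  case False
  note D = std_coneD[OF C]
  have "snd y > 0"
  proof (rule ccontr)
    assume "\<not> snd y > 0"
    then have "c * norm (fst y) \<le> 0" "snd y = 0" using D(5,9)[OF y] by auto
    then have "fst y = 0" using \<open>c > 0\<close> by (simp add: mult_le_0_iff)
    with \<open>snd y = 0\<close> False show False by (simp add: prod_eq_iff)
  qed
  define e where "e = (\<lambda>N. inverse (real (Suc N)))"
  have e0: "e N > 0" "e N \<le> 1" for N by (auto simp: e_def field_simps)
  have lim: "e \<longlonglongrightarrow> 0" unfolding e_def by (rule LIMSEQ_inverse_real_of_nat)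
  have "(\<lambda>N. (1 - e N) *\<^sub>R x + y) \<longlonglongrightarrow> (1 - 0) *\<^sub>R x + y" by (intro tendsto_intros lim)
  moreover have "\<forall>\<^sub>F N in sequentially. (1 - e N) *\<^sub>R x + y \<in> B"
  proof -
    have "(\<lambda>N. e N * h) \<longlonglongrightarrow> 0 * h" by (intro tendsto_intros lim)
    then have "\<forall>\<^sub>F N in sequentially. e N * h < snd y" using \<open>snd y > 0\<close> by (intro order_tendstoD) auto
    then show ?thesis
    proof eventually_elim
      case (elim N)
      let ?w = "(1 / e N) *\<^sub>R y"
      have "h \<le> snd ?w" using elim e0(1)[of N] by (simp add: field_simps)
      moreover have "?w \<in> C" using D(7)[OF y, of "1 / e N"] e0(1)[of N] by simp
      ultimately have "?w \<in> B" using B by (auto simp: body_def)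
      then have "(1 - e N) *\<^sub>R x + e N *\<^sub>R ?w \<in> B"
        using B x e0[of N] unfolding body_def by (intro convexD_alt) auto
      then show ?case using e0(1)[of N] by simp
    qed
  qed
  moreover have "closed B" using B by (simp add: body_def)
  ultimately have "(1 - 0) *\<^sub>R x + y \<in> B" by (intro Lim_in_closed_set[of B]) auto
  then show ?thesis by simp
qed (use x in simp)

lemma body_lower:
  assumes C: "std_cone c L C" and B: "body C h B"
  shows "(z, t) \<in> B \<longleftrightarrow> lower B z \<le> t" and "lower B z \<le> max h (L * norm z)" and "c * norm z \<le> lower B z"
proof -
  note D = std_coneD[OF C]
  let ?S = "{t. (z, t) \<in> B}"
  have "(z, max h (L * norm z)) \<in> C" by (rule D(6)) simp
  then have m: "max h (L * norm z) \<in> ?S" using B by (auto simp: body_def)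
  have bound: "c * norm z \<le> t" if "t \<in> ?S" for t using that B D(5)[of "(z,t)"] by (auto simp: body_def)
  then have bdd: "bdd_below ?S" by (auto simp: bdd_below_def)
  have "closed ?S"
  proof -
    have "closed ((\<lambda>t. (z, t)) -` B)" using B unfolding body_def
      by (intro closed_vimage) (auto intro!: continuous_intros)
    then show ?thesis by (simp add: vimage_def)
  qed
  then have "lower B z \<in> ?S" unfolding lower_def using m bdd by (intro closed_contains_Inf) auto
  moreover have "(z, t) \<in> B" if "(z, t') \<in> B" "t' \<le> t" for t t'
  proof -
    have "(0, t - t') \<in> C" using that by (intro D(6)) simp
    from body_add[OF C B that(1) this] show ?thesis by simp
  qed
  ultimately show "(z, t) \<in> B \<longleftrightarrow> lower B z \<le> t"
    using cInf_lower[OF _ bdd, of t] unfolding lower_def[symmetric] by auto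
  show "lower B z \<le> max h (L * norm z)" unfolding lower_def using m bdd by (intro cInf_lower)
  show "c * norm z \<le> lower B z" unfolding lower_def using m bound by (intro cInf_greatest) auto
qed

lemma body_top:
  assumes C: "std_cone c L C" shows "body C h (C \<inter> {x. h \<le> snd x})"
  unfolding body_def
proof (intro conjI)
  have s: "closed {x :: 'a \<times> real. h \<le> snd x}" by (intro closed_Collect_le continuous_intros)
  then show "closed (C \<inter> {x. h \<le> snd x})" using std_coneD(1)[OF C] by auto
  have "convex {x :: 'a \<times> real. h \<le> snd x}"
  proof -
    have "{x :: 'a \<times> real. h \<le> snd x} = snd -` {h..}" by auto
    also have "convex \<dots>" by (intro convex_linear_vimage linear_snd) simp
    finally show ?thesis .
  qed
  then show "convex (C \<inter> {x. h \<le> snd x})" using std_coneD(2)[OF C] by (intro convex_Int) auto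
qed auto

text \<open>Summands above height \<open>h\<close> are shrunk to height \<open>h\<close> and the excess is added to all summands.\<close>

lemma msum_bounded_summands:
  assumes C: "std_cone c L C" and J: "finite J" and B: "\<And>j. j \<in> J \<Longrightarrow> body C h (B j)" and "h > 0"
    and s: "\<And>j. j \<in> J \<Longrightarrow> s j \<ge> 0" "sum s J = 1" and x: "x \<in> msum J s B"
  obtains y where "\<And>j. j \<in> J \<Longrightarrow> y j \<in> B j" "x = (\<Sum>j\<in>J. s j *\<^sub>R y j)" "\<And>j. j \<in> J \<Longrightarrow> snd (y j) \<le> h + snd x"
proof -
  note D = std_coneD[OF C]
  obtain u where u: "\<And>j. j \<in> J \<Longrightarrow> u j \<in> B j" "x = (\<Sum>j\<in>J. s j *\<^sub>R u j)" using x by (auto simp: msum_def)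
  have uC: "u j \<in> C" if "j \<in> J" for j using u(1)[OF that] B[OF that] by (auto simp: body_def)
  define r where "r = (\<lambda>j. if snd (u j) \<le> h then 1 else h / snd (u j))"
  have r: "0 \<le> r j" "r j \<le> 1" for j using \<open>h > 0\<close> by (auto simp: r_def)
  define e where "e = (\<Sum>j\<in>J. s j *\<^sub>R ((1 - r j) *\<^sub>R u j))"
  have ru: "r j *\<^sub>R u j \<in> B j" "snd (r j *\<^sub>R u j) \<le> h" if "j \<in> J" for j
  proof -
    have "snd (r j *\<^sub>R u j) = h" "r j *\<^sub>R u j \<in> C" if "\<not> snd (u j) \<le> h"
      using that \<open>h > 0\<close> D(7)[OF uC[OF \<open>j \<in> J\<close>] r(1)[of j]] by (auto simp: r_def)
    then show "r j *\<^sub>R u j \<in> B j" "snd (r j *\<^sub>R u j) \<le> h"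
      using u(1)[OF that] B[OF that] by (cases "snd (u j) \<le> h"; auto simp: body_def r_def)+
  qed
  have sumC: "(\<Sum>j\<in>J. f j) \<in> C" if "\<And>j. j \<in> J \<Longrightarrow> f j \<in> C" for f
  proof -
    have "(0 :: 'a \<times> real) \<in> C" by (rule D(6)) simp
    with J that show ?thesis by (induction J rule: finite_induct) (auto intro: D(8))
  qed
  have eC: "e \<in> C" unfolding e_def using s(1) r uC by (intro sumC D(7)) auto
  show thesis
  proof (rule that)
    show "r j *\<^sub>R u j + e \<in> B j" if "j \<in> J" for j using body_add[OF C B[OF that] ru(1)[OF that] eC] .
    have "(\<Sum>j\<in>J. s j *\<^sub>R (r j *\<^sub>R u j + e)) = (\<Sum>j\<in>J. s j *\<^sub>R r j *\<^sub>R u j) + e"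
      using s(2) by (simp add: scaleR_add_right sum.distrib flip: scaleR_sum_left)
    also have "\<dots> = x"
      unfolding e_def u(2) sum.distrib[symmetric] scaleR_add_right[symmetric] scaleR_add_left[symmetric] by simp
    finally show "x = (\<Sum>j\<in>J. s j *\<^sub>R (r j *\<^sub>R u j + e))" ..
    have "snd x = snd e + snd (\<Sum>j\<in>J. s j *\<^sub>R r j *\<^sub>R u j)"
      using \<open>_ = x\<close> by (metis add.commute snd_add)
    moreover have "snd (\<Sum>j\<in>J. s j *\<^sub>R r j *\<^sub>R u j) \<ge> 0"
      using s(1) r uC by (intro D(9) sumC D(7)) auto
    ultimately have "snd e \<le> snd x" by linarith
    then show "snd (r j *\<^sub>R u j + e) \<le> h + snd x" if "j \<in> J" for j using ru(2)[OF that] by simp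
  qed
qed

lemma std_cone_truncation_compact:
  assumes C: "std_cone c L C" and "closed B" "B \<subseteq> C"
  shows "compact (B \<inter> {x. snd x \<le> T})"
proof -
  have "closed {x :: 'a \<times> real. snd x \<le> T}" by (intro closed_Collect_le continuous_intros)
  then have "closed (B \<inter> {x. snd x \<le> T})" using assms by auto
  moreover have "B \<inter> {x. snd x \<le> T} \<subseteq> cball 0 (T / c) \<times> {0..T}"
  proof
    fix x assume "x \<in> B \<inter> {x. snd x \<le> T}"
    then have x: "x \<in> C" "snd x \<le> T" using assms by auto
    have "c * norm (fst x) \<le> T" using std_coneD(5)[OF C x(1)] x(2) by linarith
    then have "norm (fst x) \<le> T / c" using std_coneD(3)[OF C] by (simp add: pos_le_divide_eq mult.commute)
    then show "x \<in> cball 0 (T / c) \<times> {0..T}" using x std_coneD(9)[OF C x(1)] by (cases x) auto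
  qed
  then have "bounded (B \<inter> {x. snd x \<le> T})"
    by (rule bounded_subset[rotated]) (intro bounded_Times bounded_cball bounded_closed_interval)
  ultimately show ?thesis by (simp add: compact_eq_bounded_closed)
qed

lemma compact_msum:
  fixes B :: "'j \<Rightarrow> 'b::real_normed_vector set"
  assumes "finite J" "\<And>j. j \<in> J \<Longrightarrow> compact (B j)" shows "compact (msum J s B)"
  using assms
proof (induction J rule: finite_induct)
  case empty
  have "msum {} s B = {0}" by (auto simp: msum_def)
  then show ?case by simp
next
  case (insert j J)
  have "msum (insert j J) s B = {a + b | a b. a \<in> (\<lambda>x. s j *\<^sub>R x) ` B j \<and> b \<in> msum J s B}"
  proof (intro equalityI subsetI)
    fix x assume "x \<in> msum (insert j J) s B"
    then obtain u where "\<forall>i\<in>insert j J. u i \<in> B i" "x = (\<Sum>i\<in>insert j J. s i *\<^sub>R u i)" by (auto simp: msum_def)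
    then show "x \<in> {a + b | a b. a \<in> (\<lambda>x. s j *\<^sub>R x) ` B j \<and> b \<in> msum J s B}"
      using insert.hyps by (auto simp: msum_def)
  next
    fix x assume "x \<in> {a + b | a b. a \<in> (\<lambda>x. s j *\<^sub>R x) ` B j \<and> b \<in> msum J s B}"
    then obtain v u where v: "v \<in> B j" "\<forall>i\<in>J. u i \<in> B i" "x = s j *\<^sub>R v + (\<Sum>i\<in>J. s i *\<^sub>R u i)" by (auto simp: msum_def)
    have "(\<Sum>i\<in>J. s i *\<^sub>R u i) = (\<Sum>i\<in>J. s i *\<^sub>R (u(j := v)) i)" using insert.hyps by (intro sum.cong) auto
    then have "x = (\<Sum>i\<in>insert j J. s i *\<^sub>R (u(j := v)) i)" using v insert.hyps by simp
    moreover have "\<forall>i\<in>insert j J. (u(j := v)) i \<in> B i" using v by auto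
    ultimately show "x \<in> msum (insert j J) s B" unfolding msum_def by blast
  qed
  moreover have "compact \<dots>" using insert by (intro compact_sums compact_scaling) auto
  ultimately show ?case by simp
qed

text \<open>Closedness is the issue, as sums of unbounded closed sets need not be closed. For a
  convergent sequence the summands can be chosen of bounded height, which places the limit in a sum
  of compact sets.\<close>

lemma body_msum:
  assumes C: "std_cone c L C" and J: "finite J" and B: "\<And>j. j \<in> J \<Longrightarrow> body C h (B j)" and "h > 0"
    and s: "\<And>j. j \<in> J \<Longrightarrow> s j \<ge> 0" "sum s J = 1"
  shows "body C h (msum J s B)"
  unfolding body_def
proof (intro conjI)
  note D = std_coneD[OF C]
  have sumC: "(\<Sum>j\<in>J. f j) \<in> C" if "\<And>j. j \<in> J \<Longrightarrow> f j \<in> C" for f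
  proof -
    have "(0 :: 'a \<times> real) \<in> C" by (rule D(6)) simp
    with J that show ?thesis by (induction J rule: finite_induct) (auto intro: D(8))
  qed
  show sub: "msum J s B \<subseteq> C"
  proof
    fix x assume "x \<in> msum J s B"
    then obtain u where u: "\<And>j. j \<in> J \<Longrightarrow> u j \<in> B j" "x = (\<Sum>j\<in>J. s j *\<^sub>R u j)" by (auto simp: msum_def)
    then show "x \<in> C" unfolding u(2) using s B by (intro sumC D(7)) (auto simp: body_def)
  qed
  show "closed (msum J s B)"
    unfolding closed_sequential_limits
  proof (intro allI impI, elim conjE)
    fix X l assume X: "\<forall>n. X n \<in> msum J s B" and l: "X \<longlonglongrightarrow> l"
    define T where "T = snd l + 1"
    let ?K = "msum J s (\<lambda>j. B j \<inter> {x. snd x \<le> h + T})"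
    have "(\<lambda>n. snd (X n)) \<longlonglongrightarrow> snd l" by (intro tendsto_snd l)
    then have "\<forall>\<^sub>F n in sequentially. snd (X n) < T" by (rule order_tendstoD) (simp add: T_def)
    then have "\<forall>\<^sub>F n in sequentially. X n \<in> ?K"
    proof eventually_elim
      case (elim n)
      obtain y where y: "\<And>j. j \<in> J \<Longrightarrow> y j \<in> B j" "X n = (\<Sum>j\<in>J. s j *\<^sub>R y j)" "\<And>j. j \<in> J \<Longrightarrow> snd (y j) \<le> h + snd (X n)"
        by (rule msum_bounded_summands[OF C J B \<open>h > 0\<close> s X[rule_format, of n]]) (auto intro: that)
      have "y j \<in> B j \<inter> {x. snd x \<le> h + T}" if "j \<in> J" for j using y(1,3)[OF that] elim by auto
      then show ?case unfolding msum_def using y(2) by blast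
    qed
    moreover have "compact ?K"
      by (intro compact_msum J std_cone_truncation_compact[OF C]) (use B in \<open>auto simp: body_def\<close>)
    ultimately have "l \<in> ?K" using l by (intro Lim_in_closed_set[OF compact_imp_closed]) auto
    then show "l \<in> msum J s B" unfolding msum_def by blast
  qed
  show "convex (msum J s B)"
    unfolding convex_alt
  proof (intro ballI allI impI)
    fix x y u assume x: "x \<in> msum J s B" and y: "y \<in> msum J s B" and u: "0 \<le> u \<and> (u::real) \<le> 1"
    obtain a where a: "\<And>j. j \<in> J \<Longrightarrow> a j \<in> B j" "x = (\<Sum>j\<in>J. s j *\<^sub>R a j)" using x by (auto simp: msum_def)
    obtain b where b: "\<And>j. j \<in> J \<Longrightarrow> b j \<in> B j" "y = (\<Sum>j\<in>J. s j *\<^sub>R b j)" using y by (auto simp: msum_def)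
    have "(1 - u) *\<^sub>R x + u *\<^sub>R y = (\<Sum>j\<in>J. s j *\<^sub>R ((1 - u) *\<^sub>R a j + u *\<^sub>R b j))"
      by (simp add: a(2) b(2) scaleR_sum_right sum.distrib scaleR_add_right mult.commute)
    moreover have "(1 - u) *\<^sub>R a j + u *\<^sub>R b j \<in> B j" if "j \<in> J" for j
      using a(1)[OF that] b(1)[OF that] u B[OF that] unfolding body_def convex_alt by auto
    ultimately show "(1 - u) *\<^sub>R x + u *\<^sub>R y \<in> msum J s B"
      unfolding msum_def by (intro CollectI exI[of _ "\<lambda>j. (1 - u) *\<^sub>R a j + u *\<^sub>R b j"]) auto
  qed
  show "\<forall>x\<in>C. h \<le> snd x \<longrightarrow> x \<in> msum J s B"
  proof (intro ballI impI)
    fix x assume x: "x \<in> C" "h \<le> snd x"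
    have "x = (\<Sum>j\<in>J. s j *\<^sub>R x)" using s(2) by (simp flip: scaleR_sum_left)
    moreover have "x \<in> B j" if "j \<in> J" for j using B[OF that] x by (auto simp: body_def)
    ultimately show "x \<in> msum J s B" unfolding msum_def by (intro CollectI exI[of _ "\<lambda>_. x"]) auto
  qed
qed

section \<open>Covolumes in epigraph coordinates\<close>

text \<open>Biconjugation with bounded slopes. A hyperplane separating a point just below the lower
  boundary from \<open>B\<close> is nonnegative on \<open>C\<close>; the inner cone bounds its slope
  by \<open>L\<close>, so the slope is found in the ball.\<close>

lemma conj_on_eq_lower:
  fixes B :: "((real^'n) \<times> real) set"
  assumes C: "std_cone c L C" and B: "body C h B" and \<rho>: "L \<le> \<rho>" and v: "continuous_on (cball 0 \<rho>) v"
    and att: "\<And>y. \<exists>x\<in>B. v y = snd x - fst x \<bullet> y"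
    and up: "\<And>y. v y \<le> lower B z - z \<bullet> y"
  shows "conj_on \<rho> v z = lower B z"
proof (rule antisym)
  note D = std_coneD[OF C]
  have "\<rho> \<ge> 0" using D(4) \<rho> by simp
  note m = maximizer_props[OF v this]
  show "conj_on \<rho> v z \<le> lower B z" using m(3)[of z] up[of "maximizer \<rho> v z"] by simp
  show "lower B z \<le> conj_on \<rho> v z"
  proof (rule field_le_epsilon)
    fix e :: real assume e: "e > 0"
    let ?p = "(z, lower B z - e)"
    have "?p \<notin> B" using body_lower(1)[OF C B, of z "lower B z - e"] e by simp
    moreover have "convex B" "closed B" using B by (auto simp: body_def)
    ultimately obtain a b where ab: "a \<bullet> ?p < b" "\<And>x. x \<in> B \<Longrightarrow> b < a \<bullet> x"
      using separating_hyperplane_closed_point[of B ?p] by blast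
    obtain \<alpha> \<beta> where a: "a = (\<alpha>, \<beta>)" by (cases a)
    have inB: "(z, lower B z) \<in> B" using body_lower(1)[OF C B] by simp
    have "a \<bullet> ?p < a \<bullet> (z, lower B z)" using ab(1) ab(2)[OF inB] by simp
    then have "\<beta> * e > 0" by (simp add: a inner_Pair right_diff_distrib)
    then have \<beta>: "\<beta> > 0" using e by (simp add: zero_less_mult_iff)
    \<comment> \<open>Otherwise a ray in direction \<open>w\<close>, which stays in
      \<open>B\<close>, would reach the hyperplane at parameter \<open>r\<close>.\<close>
    have pos: "a \<bullet> w \<ge> 0" if w: "w \<in> C" for w
    proof (rule ccontr)
      assume neg: "\<not> ?thesis"
      define r where "r = (b - a \<bullet> (z, lower B z)) / (a \<bullet> w)"
      have "b - a \<bullet> (z, lower B z) < 0" using ab(2)[OF inB] by simp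
      then have "r \<ge> 0" unfolding r_def using neg by (intro divide_nonpos_nonpos) auto
      then have "(z, lower B z) + r *\<^sub>R w \<in> B" by (intro body_add[OF C B inB] D(7) w)
      from ab(2)[OF this] have "b < a \<bullet> (z, lower B z) + r * (a \<bullet> w)" by (simp add: inner_add_right)
      then show False using neg by (simp add: r_def)
    qed
    \<comment> \<open>The direction of the inner cone that is least favourable to the slope
      \<open>\<alpha>\<close>.\<close>
    have "(- \<alpha>, L * norm \<alpha>) \<in> C" by (rule D(6)) simp
    from pos[OF this] have "norm \<alpha> * norm \<alpha> \<le> (\<beta> * L) * norm \<alpha>"
      by (simp add: a inner_Pair power2_norm_eq_inner[symmetric] power2_eq_square mult_ac)
    then have \<alpha>: "norm \<alpha> \<le> \<beta> * L"
      using \<beta> D(4) by (cases "\<alpha> = 0") auto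
    define y where "y = - ((1 / \<beta>) *\<^sub>R \<alpha>)"
    have "norm y \<le> L" using \<alpha> \<beta> by (simp add: y_def field_simps)
    then have y: "y \<in> cball 0 \<rho>" using \<rho> by simp
    obtain x where x: "x \<in> B" "v y = snd x - fst x \<bullet> y" using att by blast
    have "a \<bullet> ?p < a \<bullet> x" using ab(1) ab(2)[OF x(1)] by simp
    then have "\<alpha> \<bullet> z + \<beta> * (lower B z - e) < \<alpha> \<bullet> fst x + \<beta> * snd x" by (cases x) (simp add: a inner_Pair)
    moreover have "\<alpha> = - (\<beta> *\<^sub>R y)" using \<beta> by (simp add: y_def)
    ultimately have "\<beta> * (lower B z - e - z \<bullet> y) < \<beta> * (snd x - fst x \<bullet> y)"
      by (simp add: inner_commute algebra_simps)
    then have "lower B z - e - z \<bullet> y < v y" using \<beta> x by simp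
    then show "lower B z \<le> conj_on \<rho> v z + e" using m(4)[OF y, of z] by linarith
  qed
qed

text \<open>Counterpart of \<open>conj_on_eq_far\<close> without gradients: a step along
  \<open>z\<close> gains \<open>norm z\<close> per unit length and loses at most \<open>R\<close>,
  so no maximizer is interior.\<close>

lemma conj_on_eq_far_Lipschitz:
  fixes v w :: "real^'n \<Rightarrow> real"
  assumes \<rho>: "\<rho> > 0" and K: "K \<subseteq> ball 0 \<rho>"
    and v: "\<And>x y. v x \<le> v y + R * norm (x - y)" "continuous_on (cball 0 \<rho>) v"
    and w: "\<And>x y. w x \<le> w y + R * norm (x - y)" "continuous_on (cball 0 \<rho>) w"
    and eq: "\<And>y. y \<in> cball 0 \<rho> - K \<Longrightarrow> v y = w y" and z: "norm z > R"
  shows "conj_on \<rho> v z = conj_on \<rho> w z"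
proof -
  have le: "conj_on \<rho> v z \<le> conj_on \<rho> w z"
    if v: "\<And>x y. v x \<le> v y + R * norm (x - y)" "continuous_on (cball 0 \<rho>) v" and w: "continuous_on (cball 0 \<rho>) w"
      and eq: "\<And>y. y \<in> cball 0 \<rho> - K \<Longrightarrow> v y = w y" for v w
  proof -
    let ?y = "maximizer \<rho> v z"
    have y: "?y \<in> cball 0 \<rho>" using maximizer_props(1)[OF v(2)] \<rho> by auto
    have "?y \<notin> ball 0 \<rho>"
    proof
      assume "?y \<in> ball 0 \<rho>"
      then have e: "\<rho> - norm ?y > 0" by simp
      show False
      proof (cases "z = 0")
        case True
        \<comment> \<open>Here \<open>R\<close> would be negative, and the Lipschitz bounds between
          two distinct points exclude this.\<close>
        have "v (axis undefined 1) \<le> v 0 + R * norm (axis undefined 1 - 0 :: real^'n)"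
          "v 0 \<le> v (axis undefined 1) + R * norm (0 - axis undefined 1 :: real^'n)" by (rule v(1))+
        then have "R \<ge> 0" by (simp add: norm_axis_1)
        with True z show False by simp
      next
        case False
        define t where "t = (\<rho> - norm ?y) / norm z"
        have t: "t > 0" using e False by (simp add: t_def)
        let ?x = "?y + t *\<^sub>R z"
        have "norm ?x \<le> norm ?y + t * norm z" using norm_triangle_ineq[of ?y "t *\<^sub>R z"] t by simp
        also have "\<dots> = \<rho>" using False by (simp add: t_def)
        finally have "?x \<in> cball 0 \<rho>" by simp
        then have "z \<bullet> ?x + v ?x \<le> z \<bullet> ?y + v ?y" using maximizer_props(2)[OF v(2)] \<rho> by auto
        moreover have "v ?y \<le> v ?x + R * (t * norm z)" using v(1)[of ?y ?x] t by simp
        moreover have "z \<bullet> ?x = z \<bullet> ?y + t * norm z * norm z"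
          by (simp add: inner_add_right power2_norm_eq_inner[symmetric] power2_eq_square)
        ultimately have "(t * norm z) * norm z \<le> (t * norm z) * R" by (simp add: mult_ac)
        then show False using t False z by simp
      qed
    qed
    then have "v ?y = w ?y" using eq y K by blast
    then show ?thesis using maximizer_props(3)[OF v(2), of z] maximizer_props(4)[OF w _ y, of z] \<rho> by auto
  qed
  show ?thesis using le[OF v w(2) eq] le[OF w v(2) eq[symmetric]] by simp
qed

text \<open>Fubini: the vertical slice of \<open>B1 - B2\<close> over \<open>z\<close> is the
  half-open interval from \<open>lower B1 z\<close> to \<open>lower B2 z\<close>.\<close>

lemma measure_between_bodies:
  fixes B1 B2 :: "('b::euclidean_space \<times> real) set"
  assumes C: "std_cone c L C" and B1: "body C h1 B1" and B2: "body C h2 B2"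
    and g: "continuous_on (cball 0 R) g" and eq: "\<And>z. z \<in> cball 0 R \<Longrightarrow> lower B2 z - lower B1 z = g z"
    and out: "\<And>z. z \<notin> cball 0 R \<Longrightarrow> lower B1 z = lower B2 z"
    and nonneg: "\<And>z. z \<in> cball 0 R \<Longrightarrow> g z \<ge> 0"
  shows "measure lebesgue (B1 - B2) = integral (cball 0 R) g"
proof -
  have cl: "closed B1" "closed B2" using B1 B2 by (auto simp: body_def)
  then have meas: "B1 - B2 \<in> sets borel" by auto
  have le: "lower B1 z \<le> lower B2 z" for z
    using eq[of z] out[of z] nonneg[of z] by (cases "z \<in> cball 0 R") auto
  have slice: "Pair z -` (B1 - B2) = {lower B1 z..<lower B2 z}" for z
    using body_lower(1)[OF C B1] body_lower(1)[OF C B2] by auto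
  have int: "integrable lborel (\<lambda>z. indicator (cball 0 R) z *\<^sub>R g z)"
    by (rule borel_integrable_compact[OF compact_cball g])
  have "emeasure lborel (B1 - B2) = emeasure (lborel \<Otimes>\<^sub>M lborel) (B1 - B2)" by (simp add: lborel_prod)
  also have "\<dots> = (\<integral>\<^sup>+ z. emeasure lborel (Pair z -` (B1 - B2)) \<partial>lborel)"
    by (rule lborel.emeasure_pair_measure_alt)
      (use meas in \<open>simp only: sets_pair_measure_cong[OF sets_lborel sets_lborel] borel_prod\<close>)
  also have "\<dots> = (\<integral>\<^sup>+ z. ennreal (indicator (cball 0 R) z *\<^sub>R g z) \<partial>lborel)"
    unfolding slice using le eq out by (intro nn_integral_cong) (auto simp: indicator_def)
  also have "\<dots> = ennreal (LINT z|lborel. indicator (cball 0 R) z *\<^sub>R g z)"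
    by (rule nn_integral_eq_integral[OF int]) (auto simp: indicator_def nonneg)
  also have "(LINT z|lborel. indicator (cball 0 R) z *\<^sub>R g z) = integral (cball 0 R) g"
    using set_borel_integral_eq_integral(2)[of "cball 0 R" g] int
    unfolding set_integrable_def set_lebesgue_integral_def by simp
  finally have "emeasure lborel (B1 - B2) = ennreal (integral (cball 0 R) g)" .
  moreover have "integral (cball 0 R) g \<ge> 0"
    by (intro integral_nonneg integrable_on_compact g nonneg) auto
  moreover have "measure lebesgue (B1 - B2) = measure lborel (B1 - B2)"
    using meas by (simp add: measure_completion)
  ultimately show ?thesis by (simp add: measure_def)
qed

text \<open>The form that is 1 on the simplex; it makes an additive constant homogeneous.\<close>

lemma hform_power_sum:
  assumes "finite J" shows "hform d J (\<lambda>s. (sum s J) ^ d)"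
proof -
  have "(sum s J) ^ d = (\<Sum>\<kappa>\<in>{..<d} \<rightarrow>\<^sub>E J. 1 * (\<Prod>i<d. s (\<kappa> i)))" for s :: "'a \<Rightarrow> real"
    using prod_sum_PiE[of "{..<d}" "\<lambda>_. J" "\<lambda>_ j. s j"] assms by simp
  then show ?thesis unfolding hform_def by (intro exI[of _ "\<lambda>_. 1"]) auto
qed

lemma polar_power_sum: "polar d (\<lambda>s. (sum s J) ^ d) x = fact d * (\<Prod>i<d. sum (x i) J)"
proof -
  have "polar d (\<lambda>s. (sum s J) ^ d) x = (\<Sum>I\<in>Pow {..<d}. (-1) ^ card ({..<d} - I) * (\<Prod>i\<in>{..<d}. \<Sum>k\<in>I. sum (x k) J))"
    unfolding polar_def by (subst sum.swap) simp
  also have "\<dots> = (\<Sum>\<pi> | \<pi> permutes {..<d}. \<Prod>i<d. sum (x (\<pi> i)) J)" by (rule ryser_formula) simp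
  also have "\<dots> = (\<Sum>\<pi> | \<pi> permutes {..<d}. \<Prod>i<d. sum (x i) J)"
  proof (rule sum.cong[OF refl])
    fix \<pi> assume "\<pi> \<in> {\<pi>. \<pi> permutes {..<d}}"
    then show "(\<Prod>i<d. sum (x (\<pi> i)) J) = (\<Prod>i<d. sum (x i) J)"
      using prod.permute[of \<pi> "{..<d}" "\<lambda>i. sum (x i) J"] by (simp add: comp_def)
  qed
  finally show ?thesis by (simp add: card_permutations)
qed

lemma sum_unit_coord: "finite J \<Longrightarrow> k \<in> J \<Longrightarrow> sum (unit_coord k) J = 1"
  using unit_coord_sum_single[of J k "\<lambda>_. 1::real"] by simp

theorem body_volume_form:
  fixes C :: "((real^'n::{finite,wellorder}) \<times> real) set" and J :: "'j set"
  assumes C: "std_cone c L C" and J: "finite J" and B: "\<And>j. j \<in> J \<Longrightarrow> body C h (B j)" and h: "h > 0"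
    and card: "CARD('n) = Suc m"
  obtains p where "hform (Suc (Suc m)) J p"
    and "\<And>s. (\<And>j. j \<in> J \<Longrightarrow> s j \<ge> 0) \<Longrightarrow> sum s J = 1 \<Longrightarrow> p s = measure lebesgue (C - msum J s B)"
    and "\<And>i j \<mu>. i \<in> J \<Longrightarrow> j \<in> J \<Longrightarrow> (\<And>k. k < m \<Longrightarrow> \<mu> k \<in> J) \<Longrightarrow>
       polar (Suc (Suc m)) p (\<lambda>k. if k < m then unit_coord (\<mu> k) else (\<lambda>l. unit_coord i l - unit_coord j l)) \<ge> 0"
proof -
  note D = std_coneD[OF C]
  let ?d = "Suc (Suc m)"
  define Bt where "Bt = C \<inter> {x. h \<le> snd x}"
  have Bt: "body C h Bt" unfolding Bt_def by (rule body_top[OF C])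
  \<comment> \<open>Beyond radius \<open>R0\<close> every point of \<open>C\<close> has height at
    least \<open>h\<close>, so all bodies equal \<open>C\<close> there. Lower boundaries over the
    ball of radius \<open>R0\<close> stay below \<open>T0\<close>; the summands from
    \<open>msum_bounded_summands\<close> then have height at most \<open>h + T0\<close> and radius
    at most \<open>R\<close>. \<open>T\<close> dominates these heights and all lower boundaries over
    radius \<open>R\<close>.\<close>
  define R0 where "R0 = h / c"
  define T0 where "T0 = max h (L * R0)"
  define R where "R = max R0 ((h + T0) / c)"
  define T where "T = max (h + T0) (max h (L * R))"
  have R0: "R0 > 0" using h D(3) by (simp add: R0_def)
  have far: "x \<in> Bt" if "x \<in> C" "norm (fst x) \<ge> R0" for x
  proof -
    have "h \<le> c * norm (fst x)" using that(2) D(3) by (simp add: R0_def pos_divide_le_eq mult.commute)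
    then show ?thesis using D(5)[OF that(1)] that(1) by (simp add: Bt_def)
  qed
  have Tle: "max h (L * norm z) \<le> T" if "norm z \<le> R" for z :: "(real,'n) vec"
  proof -
    have "L * norm z \<le> L * R" using that D(4) by (intro mult_left_mono) auto
    then show ?thesis by (auto simp: T_def)
  qed
  \<comment> \<open>Truncation makes the support functions finite and attained for every slope, and
    leaves the lower boundaries over radius \<open>R\<close> unchanged.\<close>
  define S where "S = (\<lambda>A. (A \<inter> {x. snd x \<le> T}) \<inter> (cball (0::(real,'n) vec) R \<times> UNIV))"
  have S: "compact (S A)" "S A \<noteq> {}" "(z, t) \<in> S A \<Longrightarrow> norm z \<le> R" "S A \<subseteq> A" "Bt \<subseteq> A"
      "\<And>z t. (z, t) \<in> S A \<longleftrightarrow> (z, t) \<in> A \<and> t \<le> T \<and> norm z \<le> R"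
    if A: "body C h A" for A z t
  proof -
    have "closed (cball (0::(real,'n) vec) R \<times> (UNIV :: real set))" by (intro closed_Times) auto
    then show "compact (S A)" unfolding S_def
      using A by (intro compact_Int_closed std_cone_truncation_compact[OF C]) (auto simp: body_def)
    show sub: "Bt \<subseteq> A" using A by (auto simp: body_def Bt_def)
    have "(0, h) \<in> C" by (rule D(6)) (use h in simp)
    then have "(0, h) \<in> A" using sub by (auto simp: Bt_def)
    moreover have "h \<le> T" "0 \<le> R" using R0 by (auto simp: T_def R_def)
    ultimately show "S A \<noteq> {}" by (auto simp: S_def)
    show "(z, t) \<in> S A \<longleftrightarrow> (z, t) \<in> A \<and> t \<le> T \<and> norm z \<le> R" for z t by (auto simp: S_def)
    then show "(z, t) \<in> S A \<Longrightarrow> norm z \<le> R" by blast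
    show "S A \<subseteq> A" by (auto simp: S_def)
  qed
  have mono: "S Bt \<subseteq> S A" if "body C h A" for A using S(5)[OF that] by (auto simp: S_def)
  have le: "supp_fun (S A) y \<le> supp_fun (S Bt) y" if A: "body C h A" for A y
  proof -
    obtain z t where zt: "(z, t) \<in> S Bt" "supp_fun (S Bt) y = t - z \<bullet> y"
      by (rule supp_fun_attained[OF S(1,2)[OF Bt], of y], rule that, assumption, assumption)
    obtain z' t' where "supp_fun (S A) y = t' - z' \<bullet> y" "\<And>z'' t''. (z'', t'') \<in> S A \<Longrightarrow> t' - z' \<bullet> y \<le> t'' - z'' \<bullet> y"
      by (rule supp_fun_attained[OF S(1,2)[OF A], of y], rule that, assumption, blast)
    then show ?thesis using zt mono[OF A] by auto
  qed
  \<comment> \<open>Pushing a point of \<open>A\<close> by \<open>r\<close> in the direction of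
    \<open>y\<close> raises its height by \<open>L * r\<close> and increases
    \<open>z \<bullet> y\<close> by \<open>r * norm y\<close>, which is no less. At radius
    \<open>R\<close> the point has entered \<open>Bt\<close>, so the infimum over \<open>Bt\<close>
    is no larger.\<close>
  have eqfar: "supp_fun (S A) y = supp_fun (S Bt) y" if A: "body C h A" and y: "norm y > L" for A y
  proof (rule antisym[OF le[OF A]])
    obtain z t where zt: "(z, t) \<in> S A" "supp_fun (S A) y = t - z \<bullet> y"
      by (rule supp_fun_attained[OF S(1,2)[OF A], of y], rule that, assumption, assumption)
    define \<tau> where "\<tau> = (R - z \<bullet> (y /\<^sub>R norm y))"
    obtain r where r: "r \<ge> 0" "norm (z + r *\<^sub>R (y /\<^sub>R norm y)) = R"
    proof -
      have y0: "norm y > 0" using y D(4) by linarith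
      have zR: "norm z \<le> R" using S(3)[OF A zt(1)] .
      let ?f = "\<lambda>r. norm (z + r *\<^sub>R (y /\<^sub>R norm y))"
      have "norm ((2 * R) *\<^sub>R (y /\<^sub>R norm y)) \<le> norm (z + (2 * R) *\<^sub>R (y /\<^sub>R norm y)) + norm z"
        using norm_triangle_ineq4[of "z + (2 * R) *\<^sub>R (y /\<^sub>R norm y)" z] by simp
      moreover have "norm ((2 * R) *\<^sub>R (y /\<^sub>R norm y)) = 2 * R"
        using y0 order_trans[OF norm_ge_zero zR] by (simp add: abs_mult)
      ultimately have "?f (2 * R) \<ge> R" using zR by linarith
      moreover have "?f 0 \<le> R" using zR by simp
      moreover have "0 \<le> 2 * R" using zR norm_ge_zero[of z] by linarith
      moreover have "continuous_on {0..2 * R} ?f" by (intro continuous_intros)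
      ultimately obtain r where "0 \<le> r" "?f r = R"
        using IVT'[of ?f 0 R "2 * R"] by blast
      then show thesis by (rule that)
    qed
    let ?z = "z + r *\<^sub>R (y /\<^sub>R norm y)"
    have y0: "norm y > 0" using y D(4) by linarith
    have "(r *\<^sub>R (y /\<^sub>R norm y), L * r) \<in> C" using r(1) y0 by (intro D(6)) (simp add: mult.assoc)
    then have "(?z, t + L * r) \<in> A" using body_add[OF C A, of "(z, t)" "(r *\<^sub>R (y /\<^sub>R norm y), L * r)"] zt(1) S(4)[OF A] by auto
    then have inC: "(?z, t + L * r) \<in> C" using A by (auto simp: body_def)
    have RR0: "R \<ge> R0" by (simp add: R_def)
    have in1: "(?z, t + L * r) \<in> Bt" using far[OF inC] r(2) RR0 by simp
    then have low: "lower Bt ?z \<le> t + L * r" using body_lower(1)[OF C Bt] by simp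
    have "(?z, lower Bt ?z) \<in> Bt" using body_lower(1)[OF C Bt] by simp
    moreover have "lower Bt ?z \<le> T" by (rule order_trans[OF body_lower(2)[OF C Bt] Tle]) (use r(2) in simp)
    ultimately have inS: "(?z, lower Bt ?z) \<in> S Bt" using r(2) by (simp add: S(6)[OF Bt])
    obtain z' t' where "supp_fun (S Bt) y = t' - z' \<bullet> y" "\<And>z'' t''. (z'', t'') \<in> S Bt \<Longrightarrow> t' - z' \<bullet> y \<le> t'' - z'' \<bullet> y"
      by (rule supp_fun_attained[OF S(1,2)[OF Bt], of y], rule that, assumption, blast)
    then have "supp_fun (S Bt) y \<le> lower Bt ?z - ?z \<bullet> y" using inS by simp
    also have "\<dots> \<le> t + L * r - ?z \<bullet> y" using low by simp
    also have "?z \<bullet> y = z \<bullet> y + r * norm y"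
      using y0 by (simp add: inner_add_left power2_norm_eq_inner[symmetric] power2_eq_square)
    also have "t + L * r - (z \<bullet> y + r * norm y) \<le> t - z \<bullet> y"
      using mult_left_mono[of L "norm y" r] y r(1) by (simp add: mult.commute)
    finally show "supp_fun (S Bt) y \<le> supp_fun (S A) y" using zt(2) by simp
  qed
  \<comment> \<open>Half-width \<open>L + 1\<close> puts all slopes of norm at most \<open>L\<close>
    into the open box.\<close>
  define a b :: "(real,'n) vec" where "a = (\<chi> i. - (L + 1))" and "b = (\<chi> i. L + 1)"
  have inbox: "y \<in> box a b" if "norm y \<le> L" for y
  proof -
    have "- (L + 1) < y $ i \<and> y $ i < L + 1" for i
      using component_le_norm_cart[of y i] that by (auto simp: abs_le_iff)
    then show ?thesis by (simp add: mem_box_cart a_def b_def)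
  qed
  obtain \<rho>0 where \<rho>0: "cbox a b \<subseteq> ball 0 \<rho>0"
    using bounded_cbox[of a b] bounded_subset_ballD[of "cbox a b" 0] by auto
  define \<rho> where "\<rho> = max \<rho>0 L"
  have \<rho>: "\<rho> > 0" "L \<le> \<rho>" "cbox a b \<subseteq> ball 0 \<rho>"
    using D(4) \<rho>0 by (auto simp: \<rho>_def)
  let ?E = "\<lambda>s. integral (cball 0 (R + 1)) (\<lambda>z. conj_on \<rho> (\<lambda>y. \<Sum>j\<in>J. s j * supp_fun (S (B j)) y) z - conj_on \<rho> (supp_fun (S Bt)) z)"
  have eqbox: "supp_fun (S (B j)) y = supp_fun (S Bt) y" if "j \<in> J" "y \<in> cball 0 \<rho> - box a b" for j y
    using eqfar[OF B[OF that(1)], of y] inbox[of y] that(2) by (cases "norm y > L") auto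
  obtain q where q: "hform ?d J q"
    and qval: "\<And>s. (\<And>j. j \<in> J \<Longrightarrow> s j \<ge> 0) \<Longrightarrow> sum s J = 1 \<Longrightarrow> q s = ?E s"
    and qpos: "\<And>i j \<mu>. i \<in> J \<Longrightarrow> j \<in> J \<Longrightarrow> (\<And>k. k < m \<Longrightarrow> \<mu> k \<in> J) \<Longrightarrow>
       polar ?d q (\<lambda>k. if k < m then unit_coord (\<mu> k) else (\<lambda>l. unit_coord i l - unit_coord j l)) \<ge> 0"
    by (rule supp_fun_volume_form[OF \<rho>(1,3) J, of "\<lambda>j. S (B j)" R "S Bt" m])
      (use S(1,2,3)[OF B] S(1,2,3)[OF Bt] le[OF B] eqbox card in blast)+
  have contS: "continuous_on A (supp_fun (S X))" and lipS: "supp_fun (S X) y \<le> supp_fun (S X) y' + R * norm (y - y')"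
    if X: "body C h X" for X A y y'
  proof -
    show "continuous_on A (supp_fun (S X))" by (rule continuous_supp_fun[OF S(1,2)[OF X]]) (rule S(3)[OF X])
    show "supp_fun (S X) y \<le> supp_fun (S X) y' + R * norm (y - y')" by (rule supp_fun_Lipschitz[OF S(1,2)[OF X]]) (rule S(3)[OF X])
  qed
  have top: "conj_on \<rho> (supp_fun (S Bt)) z = lower Bt z" if z: "norm z \<le> R" for z
  proof (rule conj_on_eq_lower[OF C Bt \<rho>(2) contS[OF Bt]])
    fix y
    obtain z' t' where zt: "(z', t') \<in> S Bt" "supp_fun (S Bt) y = t' - z' \<bullet> y" "\<And>z'' t''. (z'', t'') \<in> S Bt \<Longrightarrow> t' - z' \<bullet> y \<le> t'' - z'' \<bullet> y"
      by (rule supp_fun_attained[OF S(1,2)[OF Bt], of y], rule that, assumption, assumption, blast)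
    show "\<exists>x\<in>Bt. supp_fun (S Bt) y = snd x - fst x \<bullet> y"
      using zt S(4)[OF Bt] by (intro bexI[of _ "(z', t')"]) auto
    have "(z, lower Bt z) \<in> Bt" using body_lower(1)[OF C Bt] by simp
    then have "(z, lower Bt z) \<in> S Bt" using order_trans[OF body_lower(2)[OF C Bt] Tle[OF z]] z by (simp add: S(6)[OF Bt])
    then show "supp_fun (S Bt) y \<le> lower Bt z - z \<bullet> y" using zt by simp
  qed
  have vol: "q s = measure lebesgue (C - msum J s B) - measure lebesgue (C - Bt)"
    if s: "\<And>j. j \<in> J \<Longrightarrow> s j \<ge> 0" "sum s J = 1" for s
  proof -
    let ?M = "msum J s B" and ?u = "\<lambda>y. \<Sum>j\<in>J. s j * supp_fun (S (B j)) y"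
    have M: "body C h ?M" by (rule body_msum[OF C J B h s])
    have contu: "continuous_on A ?u" for A by (intro continuous_intros contS B)
    have sub: "Bt \<subseteq> ?M" by (rule S(5)[OF M])
    have lowle: "lower ?M z \<le> lower Bt z" for z
      using body_lower(1)[OF C M, of z "lower Bt z"] body_lower(1)[OF C Bt, of z "lower Bt z"] sub by auto
    have loweq: "lower Bt z \<le> lower ?M z" if "norm z \<ge> R0" for z
    proof -
      have "(z, lower ?M z) \<in> ?M" using body_lower(1)[OF C M] by simp
      then have "(z, lower ?M z) \<in> C" using M by (auto simp: body_def)
      then have "(z, lower ?M z) \<in> Bt" using far that by simp
      then show ?thesis using body_lower(1)[OF C Bt] by simp
    qed
    have conju: "conj_on \<rho> ?u z = lower ?M z" if z: "norm z \<le> R" for z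
    proof (rule conj_on_eq_lower[OF C M \<rho>(2) contu])
      fix y
      have "\<exists>x. x \<in> S (B j) \<and> supp_fun (S (B j)) y = snd x - fst x \<bullet> y \<and> (\<forall>x'\<in>S (B j). snd x - fst x \<bullet> y \<le> snd x' - fst x' \<bullet> y)" if j: "j \<in> J" for j
      proof -
        obtain z' t' where zt: "(z', t') \<in> S (B j)" "supp_fun (S (B j)) y = t' - z' \<bullet> y" "\<And>z'' t''. (z'', t'') \<in> S (B j) \<Longrightarrow> t' - z' \<bullet> y \<le> t'' - z'' \<bullet> y"
          by (rule supp_fun_attained[OF S(1,2)[OF B[OF j]], of y], rule that, assumption, assumption, blast)
        then show ?thesis by (intro exI[of _ "(z', t')"]) auto
      qed
      then obtain X where X: "\<And>j. j \<in> J \<Longrightarrow> X j \<in> S (B j)" "\<And>j. j \<in> J \<Longrightarrow> supp_fun (S (B j)) y = snd (X j) - fst (X j) \<bullet> y"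
        "\<And>j x'. j \<in> J \<Longrightarrow> x' \<in> S (B j) \<Longrightarrow> supp_fun (S (B j)) y \<le> snd x' - fst x' \<bullet> y"
        by metis
      have lin: "(\<Sum>j\<in>J. s j * (snd (Y j) - fst (Y j) \<bullet> y)) = snd (\<Sum>j\<in>J. s j *\<^sub>R Y j) - fst (\<Sum>j\<in>J. s j *\<^sub>R Y j) \<bullet> y" for Y
        by (simp add: fst_sum snd_sum inner_sum_left right_diff_distrib sum_subtractf)
      have "(\<Sum>j\<in>J. s j *\<^sub>R X j) \<in> ?M" unfolding msum_def using X(1) S(4)[OF B] by blast
      moreover have "?u y = snd (\<Sum>j\<in>J. s j *\<^sub>R X j) - fst (\<Sum>j\<in>J. s j *\<^sub>R X j) \<bullet> y"
        unfolding lin[symmetric] using X(2) by (intro sum.cong) auto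
      ultimately show "\<exists>x\<in>?M. ?u y = snd x - fst x \<bullet> y" by blast
      \<comment> \<open>The summands must lie in the truncated sets. From radius \<open>R0\<close>
        on, the point itself lies in every body and can be repeated; closer to the axis the summands
        of bounded height fit.\<close>
      obtain Y where Y: "\<And>j. j \<in> J \<Longrightarrow> Y j \<in> S (B j)" "(z, lower ?M z) = (\<Sum>j\<in>J. s j *\<^sub>R Y j)"
      proof (cases "norm z \<ge> R0")
        case True
        have "(z, lower ?M z) \<in> S (B j)" if "j \<in> J" for j
        proof -
          have "lower ?M z = lower Bt z" using lowle[of z] loweq[OF True] by simp
          moreover have "(z, lower Bt z) \<in> Bt" using body_lower(1)[OF C Bt] by simp
          then have "(z, lower Bt z) \<in> S Bt" using order_trans[OF body_lower(2)[OF C Bt] Tle[OF z]] z by (simp add: S(6)[OF Bt])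
          ultimately show ?thesis using mono[OF B[OF that]] by auto
        qed
        moreover have "(z, lower ?M z) = (\<Sum>j\<in>J. s j *\<^sub>R (z, lower ?M z))" using s(2) by (simp flip: scaleR_sum_left del: scaleR_Pair)
        ultimately show thesis by (intro that[of "\<lambda>_. (z, lower ?M z)"])
      next
        case False
        have Min: "(z, lower ?M z) \<in> ?M" using body_lower(1)[OF C M] by simp
        obtain Y where Y: "\<And>j. j \<in> J \<Longrightarrow> Y j \<in> B j" "(z, lower ?M z) = (\<Sum>j\<in>J. s j *\<^sub>R Y j)" "\<And>j. j \<in> J \<Longrightarrow> snd (Y j) \<le> h + snd (z, lower ?M z)"
          by (rule msum_bounded_summands[OF C J B h s Min]) blast+
        have "L * norm z \<le> L * R0" using False D(4) by (intro mult_left_mono) auto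
        then have "lower ?M z \<le> T0" using body_lower(2)[OF C M, of z] by (auto simp: T0_def)
        then have ht: "snd (Y j) \<le> h + T0" if "j \<in> J" for j using Y(3)[OF that] by simp
        have "Y j \<in> S (B j)" if j: "j \<in> J" for j
        proof -
          have "Y j \<in> C" using Y(1)[OF j] B[OF j] by (auto simp: body_def)
          then have "c * norm (fst (Y j)) \<le> h + T0" using D(5) ht[OF j] by fastforce
          then have "norm (fst (Y j)) \<le> R" using D(3) by (simp add: R_def pos_le_divide_eq mult.commute le_max_iff_disj)
          moreover have "snd (Y j) \<le> T" using ht[OF j] by (simp add: T_def)
          ultimately show ?thesis using Y(1)[OF j] by (cases "Y j") (simp add: S(6)[OF B[OF j]])
        qed
        with Y(2) show thesis by (intro that[of Y])
      qed
      have "?u y \<le> (\<Sum>j\<in>J. s j * (snd (Y j) - fst (Y j) \<bullet> y))"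
        using s X(3) Y(1) by (intro sum_mono mult_left_mono) auto
      also have "\<dots> = lower ?M z - z \<bullet> y" unfolding lin Y(2)[symmetric] by simp
      finally show "?u y \<le> lower ?M z - z \<bullet> y" .
    qed
    let ?g = "\<lambda>z. conj_on \<rho> (supp_fun (S Bt)) z - conj_on \<rho> ?u z"
    have g: "continuous_on A ?g" for A by (intro continuous_intros continuous_conj_on[OF \<rho>(1,3)] contu contS[OF Bt])
    have geq: "lower Bt z - lower ?M z = ?g z" for z
    proof (cases "norm z \<le> R")
      case True then show ?thesis by (simp add: top conju)
    next
      case False
      have lipu: "?u x \<le> ?u y + R * norm (x - y)" for x y
      proof -
        have "?u x \<le> (\<Sum>j\<in>J. s j * (supp_fun (S (B j)) y + R * norm (x - y)))"
          using s lipS[OF B] by (intro sum_mono mult_left_mono) auto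
        also have "\<dots> = ?u y + R * norm (x - y)"
          using s(2) by (simp add: distrib_left sum.distrib flip: sum_distrib_right)
        finally show ?thesis .
      qed
      have "?u y = supp_fun (S Bt) y" if y: "y \<in> cball 0 \<rho> - cbox a b" for y
      proof -
        have "supp_fun (S (B j)) y = supp_fun (S Bt) y" if "j \<in> J" for j
          using eqbox[OF that, of y] y box_subset_cbox[of a b] by blast
        then show ?thesis using s(2) by (simp flip: sum_distrib_right)
      qed
      then have "conj_on \<rho> ?u z = conj_on \<rho> (supp_fun (S Bt)) z"
        using False by (intro conj_on_eq_far_Lipschitz[OF \<rho>(1,3) lipu contu lipS[OF Bt] contS[OF Bt]]) auto
      moreover have "norm z \<ge> R0" using False by (auto simp: R_def)
      ultimately show ?thesis using lowle[of z] loweq[of z] by simp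
    qed
    have "measure lebesgue (?M - Bt) = integral (cball 0 (R + 1)) ?g"
    proof (rule measure_between_bodies[OF C M Bt g])
      show "lower Bt z - lower ?M z = ?g z" for z by (rule geq)
      show "0 \<le> ?g z" for z using geq[of z] lowle[of z] by linarith
      show "lower ?M z = lower Bt z" if "z \<notin> cball 0 (R + 1)" for z
        using that lowle[of z] loweq[of z] by (auto simp: R_def)
    qed
    also have "\<dots> = - ?E s"
      by (subst integral_neg[symmetric]) simp
    finally have E: "?E s = - measure lebesgue (?M - Bt)" by simp
    have MC: "?M \<subseteq> C" using M by (auto simp: body_def)
    have bd: "bounded (C - Bt)"
    proof (rule bounded_subset)
      show "bounded (C \<inter> {x. snd x \<le> h})"
        using std_cone_truncation_compact[OF C D(1) subset_refl] by (rule compact_imp_bounded)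
      show "C - Bt \<subseteq> C \<inter> {x. snd x \<le> h}" by (auto simp: Bt_def)
    qed
    have cl: "closed C" "closed ?M" "closed Bt" using D(1) M Bt by (auto simp: body_def)
    have lm: "C - ?M \<in> lmeasurable" "?M - Bt \<in> lmeasurable"
      by (rule bounded_set_imp_lmeasurable[OF bounded_subset[OF bd]]; use sub MC cl in auto)+
    have split: "C - Bt = (C - ?M) \<union> (?M - Bt)" using sub MC by auto
    have "measure lebesgue (C - Bt) = measure lebesgue (C - ?M) + measure lebesgue (?M - Bt)"
      unfolding split measure_Un2[OF lm] by (rule arg_cong2[where f="(+)"]) (auto intro!: arg_cong[where f="measure lebesgue"])
    moreover have "q s = ?E s" by (rule qval) (use s in auto)
    ultimately show ?thesis using E by simp
  qed
  \<comment> \<open>This restores the covolume of \<open>Bt\<close>, homogenized by the power of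
    \<open>sum s J\<close>. Polar values along \<open>e_i - e_j\<close> do not change, since the
    coordinates of that vector sum to 0.\<close>
  define p where "p = (\<lambda>s. q s + measure lebesgue (C - Bt) * (sum s J) ^ ?d)"
  show thesis
  proof (rule that)
    show "hform ?d J p" unfolding p_def by (intro hform_add hform_cmult hform_power_sum J q)
    show "p s = measure lebesgue (C - msum J s B)" if "\<And>j. j \<in> J \<Longrightarrow> s j \<ge> 0" "sum s J = 1" for s
      using vol[OF that] that(2) by (simp add: p_def)
    fix i j \<mu> assume ij: "i \<in> J" "j \<in> J" "\<And>k. k < m \<Longrightarrow> \<mu> k \<in> J"
    let ?x = "\<lambda>k. if k < m then unit_coord (\<mu> k) else (\<lambda>l. unit_coord i l - unit_coord j l)"
    have "polar ?d p ?x = polar ?d q ?x + measure lebesgue (C - Bt) * polar ?d (\<lambda>s. (sum s J) ^ ?d) ?x"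
      unfolding polar_def p_def by (simp add: distrib_left sum.distrib sum_distrib_left mult_ac)
    also have "polar ?d (\<lambda>s. (sum s J) ^ ?d) ?x = 0"
    proof -
      have "sum (?x m) J = 0" using sum_unit_coord[OF J] ij by (simp add: sum_subtractf)
      then have "(\<Prod>i<?d. sum (?x i) J) = 0" by (intro prod_zero bexI[of _ m]) auto
      then show ?thesis by (simp only: polar_power_sum mult_zero_right)
    qed
    finally show "polar ?d p ?x \<ge> 0" using qpos[OF ij] by simp
  qed
qed

section \<open>Straightening a pointed cone by a linear map\<close>

text \<open>The transformation formulas for Lebesgue measure need coordinate spaces with a well-ordered
  finite index type. The maximum only serves to make the type inhabited in dimension one.\<close>

typedef (overloaded) ('a::euclidean_space) hyperplane_index = "{i::nat. i < max 1 (DIM('a) - 1)}"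
  by (rule exI[of _ 0]) simp

lemma card_hyperplane_index: "CARD(('a::euclidean_space) hyperplane_index) = max 1 (DIM('a) - 1)"
  using type_definition.card[OF type_definition_hyperplane_index[where 'a='a]] by simp

instance hyperplane_index :: (euclidean_space) finite
proof
  show "finite (UNIV :: 'a hyperplane_index set)"
    using card_hyperplane_index[where 'a='a] by (intro card_ge_0_finite) simp
qed

instantiation hyperplane_index :: (euclidean_space) linorder
begin

definition less_eq_hyperplane_index :: "'a hyperplane_index \<Rightarrow> 'a hyperplane_index \<Rightarrow> bool" where
  "less_eq_hyperplane_index x y \<longleftrightarrow> Rep_hyperplane_index x \<le> Rep_hyperplane_index y"

definition less_hyperplane_index :: "'a hyperplane_index \<Rightarrow> 'a hyperplane_index \<Rightarrow> bool" where
  "less_hyperplane_index x y \<longleftrightarrow> Rep_hyperplane_index x < Rep_hyperplane_index y"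

instance
  by standard (auto simp: less_eq_hyperplane_index_def less_hyperplane_index_def Rep_hyperplane_index_inject)

end

instance hyperplane_index :: (euclidean_space) wellorder
proof
  fix P :: "'a hyperplane_index \<Rightarrow> bool" and a
  assume step: "\<And>x. (\<And>y. y < x \<Longrightarrow> P y) \<Longrightarrow> P x"
  show "P a"
    by (induction a rule: measure_induct_rule[of Rep_hyperplane_index], rule step)
      (simp add: less_hyperplane_index_def)
qed

text \<open>Matching two bases carries boxes to boxes with the same side lengths, and boxes
  determine Lebesgue measure.\<close>

lemma basis_map_measure:
  assumes "DIM('a::euclidean_space) = DIM('b::euclidean_space)"
  obtains E :: "'a::euclidean_space \<Rightarrow> 'b::euclidean_space" and E' :: "'b \<Rightarrow> 'a" where "linear E" "linear E'" "\<And>x. E' (E x) = x" "\<And>y. E (E' y) = y"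
    "\<And>X. X \<in> sets borel \<Longrightarrow> E ` X \<in> sets borel"
    "\<And>X. X \<in> sets borel \<Longrightarrow> measure lebesgue (E ` X) = measure lebesgue X"
proof -
  obtain \<phi> :: "'a \<Rightarrow> 'b" where \<phi>: "bij_betw \<phi> Basis Basis"
    using assms finite_same_card_bij[of "Basis :: 'a set" "Basis :: 'b set"] by auto
  define E where "E = (\<lambda>x::'a. \<Sum>i\<in>Basis. (x \<bullet> i) *\<^sub>R \<phi> i)"
  define E' where "E' = (\<lambda>y::'b. \<Sum>i\<in>Basis. (y \<bullet> \<phi> i) *\<^sub>R (i::'a))"
  have lin: "linear E" "linear E'"
    by (auto simp: E_def E'_def linear_iff inner_add_left scaleR_add_left sum.distrib scaleR_sum_right)
  have inj: "\<phi> i = \<phi> j \<longleftrightarrow> i = j" if "i \<in> Basis" "j \<in> Basis" for i j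
    using \<phi> that by (auto simp: bij_betw_def inj_on_def)
  have img: "\<phi> i \<in> Basis" if "i \<in> Basis" for i using \<phi> that by (auto simp: bij_betw_def)
  have Ei: "E x \<bullet> \<phi> i = x \<bullet> i" if "i \<in> Basis" for x i
    unfolding E_def inner_sum_left inner_scaleR_left using that img inj
    by (subst sum.remove[of _ i]) (auto simp: inner_Basis intro!: sum.neutral)
  have E'i: "E' y \<bullet> i = y \<bullet> \<phi> i" if "i \<in> Basis" for y i
    unfolding E'_def inner_sum_left inner_scaleR_left using that
    by (subst sum.remove[of _ i]) (auto simp: inner_Basis intro!: sum.neutral)
  have E'E: "E' (E x) = x" for x by (rule euclidean_eqI) (simp add: E'i Ei)
  have EE': "E (E' y) = y" for y
  proof (rule euclidean_eqI)
    fix b :: 'b assume "b \<in> Basis"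
    then obtain i where "i \<in> Basis" "b = \<phi> i" using \<phi> by (auto simp: bij_betw_def)
    then show "E (E' y) \<bullet> b = y \<bullet> b" by (simp add: E'i Ei)
  qed
  have "continuous_on UNIV E'" using lin(2) by (simp add: linear_continuous_on linear_conv_bounded_linear)
  then have mE': "E' \<in> borel_measurable borel" by (rule borel_measurable_continuous_onI)
  have img_eq: "E ` X = E' -` X" for X
    using E'E EE' by (auto simp: image_iff) (metis EE')
  have bor: "E ` X \<in> sets borel" if "X \<in> sets borel" for X
    unfolding img_eq using measurable_sets[OF mE' that] by simp
  have "lborel = distr lborel borel E'"
  proof (rule lborel_eqI)
    fix l u :: 'a assume lu: "\<And>b. b \<in> Basis \<Longrightarrow> l \<bullet> b \<le> u \<bullet> b"
    have "E' -` box l u = box (E l) (E u)"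
    proof -
      have "(\<forall>b\<in>Basis. E l \<bullet> b < y \<bullet> b \<and> y \<bullet> b < E u \<bullet> b) \<longleftrightarrow> (\<forall>i\<in>Basis. l \<bullet> i < y \<bullet> \<phi> i \<and> y \<bullet> \<phi> i < u \<bullet> i)" for y
      proof -
        have "(\<forall>b\<in>Basis. E l \<bullet> b < y \<bullet> b \<and> y \<bullet> b < E u \<bullet> b) \<longleftrightarrow> (\<forall>b\<in>\<phi> ` Basis. E l \<bullet> b < y \<bullet> b \<and> y \<bullet> b < E u \<bullet> b)"
          using \<phi> by (simp add: bij_betw_def)
        also have "\<dots> \<longleftrightarrow> (\<forall>i\<in>Basis. l \<bullet> i < y \<bullet> \<phi> i \<and> y \<bullet> \<phi> i < u \<bullet> i)" by (simp add: Ei)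
        finally show ?thesis .
      qed
      then show ?thesis by (auto simp: mem_box E'i)
    qed
    moreover have "emeasure lborel (box (E l) (E u)) = (\<Prod>b\<in>Basis. (E u - E l) \<bullet> b)"
    proof (rule emeasure_lborel_box)
      fix b :: 'b assume "b \<in> Basis"
      then obtain i where "i \<in> Basis" "b = \<phi> i" using \<phi> by (auto simp: bij_betw_def)
      then show "E l \<bullet> b \<le> E u \<bullet> b" using lu by (simp add: Ei)
    qed
    moreover have "(\<Prod>b\<in>Basis. (E u - E l) \<bullet> b) = (\<Prod>i\<in>Basis. (u - l) \<bullet> i)"
      by (subst prod.reindex_bij_betw[OF \<phi>, symmetric]) (simp add: inner_diff_left Ei)
    ultimately show "emeasure (distr lborel borel E') (box l u) = ennreal (\<Prod>b\<in>Basis. (u - l) \<bullet> b)"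
      using mE' by (subst emeasure_distr) auto
  qed simp
  then have "emeasure lborel X = emeasure lborel (E ` X)" if "X \<in> sets borel" for X
    using emeasure_distr[of E' lborel borel X] mE' that by (simp add: img_eq)
  then have "measure lebesgue (E ` X) = measure lebesgue X" if "X \<in> sets borel" for X
    using that bor[OF that] by (simp add: measure_def)
  then show thesis using that[OF lin E'E EE' bor] by blast
qed

text \<open>Basis maps turn \<open>G\<close> into an endomorphism of a coordinate space in which
  \<open>option\<close> supplies the axis missing from the hyperplane; the factor is the absolute
  value of its determinant.\<close>

lemma linear_image_measure:
  fixes G :: "'b::euclidean_space \<Rightarrow> 'a::euclidean_space"
  assumes G: "linear G" and dim: "DIM('b) = DIM('a)" "DIM('a) \<ge> 2"
  obtains \<kappa> where "\<kappa> \<ge> 0"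
    "\<And>X. bounded X \<Longrightarrow> X \<in> sets borel \<Longrightarrow> G ` X \<in> sets borel \<Longrightarrow> measure lebesgue (G ` X) = \<kappa> * measure lebesgue X"
proof -

  have card: "DIM(real^('a hyperplane_index option)) = DIM('a)"
    using dim(2) by (simp add: card_hyperplane_index card_UNIV_option)
  obtain E1 :: "'b \<Rightarrow> real^('a hyperplane_index option)" and E1' where E1: "linear E1" "linear E1'" "\<And>x. E1' (E1 x) = x" "\<And>y. E1 (E1' y) = y"
    "\<And>X. X \<in> sets borel \<Longrightarrow> E1 ` X \<in> sets borel" "\<And>X. X \<in> sets borel \<Longrightarrow> measure lebesgue (E1 ` X) = measure lebesgue X"
    by (rule basis_map_measure[where 'a='b and 'b="real^('a hyperplane_index option)"]) (use card dim in auto)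
  obtain E2 :: "'a \<Rightarrow> real^('a hyperplane_index option)" and E2' where E2: "linear E2" "linear E2'" "\<And>x. E2' (E2 x) = x" "\<And>y. E2 (E2' y) = y"
    "\<And>X. X \<in> sets borel \<Longrightarrow> E2 ` X \<in> sets borel" "\<And>X. X \<in> sets borel \<Longrightarrow> measure lebesgue (E2 ` X) = measure lebesgue X"
    by (rule basis_map_measure[where 'a='a and 'b="real^('a hyperplane_index option)"]) (use card dim in auto)
  define M where "M = E2 \<circ> G \<circ> E1'"
  have M: "linear M" unfolding M_def by (intro linear_compose E1 E2 G)
  show thesis
  proof (rule that[of "\<bar>det (matrix M)\<bar>"])
    fix X :: "'b set" assume X: "bounded X" "X \<in> sets borel" "G ` X \<in> sets borel"
    have "bounded (E1 ` X)" using bounded_linear_image[OF X(1)] E1(1) by (simp add: linear_conv_bounded_linear)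
    then have lm: "E1 ` X \<in> lmeasurable" using E1(5)[OF X(2)] by (intro bounded_set_imp_lmeasurable) auto
    have "measure lebesgue (G ` X) = measure lebesgue (E2 ` G ` X)" using E2(6)[OF X(3)] by simp
    also have "E2 ` G ` X = M ` E1 ` X" by (simp add: M_def image_comp o_def E1(3))
    also have "measure lebesgue \<dots> = \<bar>det (matrix M)\<bar> * measure lebesgue (E1 ` X)" by (rule measure_linear_image[OF M lm])
    finally show "measure lebesgue (G ` X) = \<bar>det (matrix M)\<bar> * measure lebesgue X" using E1(6)[OF X(2)] by simp
  qed simp
qed

definition pointed_cone :: "'a::euclidean_space set \<Rightarrow> bool" where
  "pointed_cone C \<longleftrightarrow> closed C \<and> convex C \<and> cone C \<and> interior C \<noteq> {} \<and> (\<forall>x\<in>C. - x \<in> C \<longrightarrow> x = 0)"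

lemma pointed_coneD:
  assumes "pointed_cone C"
  shows "closed C" "convex C" "cone C" "interior C \<noteq> {}" "\<And>x. x \<in> C \<Longrightarrow> - x \<in> C \<Longrightarrow> x = 0"
    "\<And>x r. x \<in> C \<Longrightarrow> r \<ge> 0 \<Longrightarrow> r *\<^sub>R x \<in> C" "\<And>x y. x \<in> C \<Longrightarrow> y \<in> C \<Longrightarrow> x + y \<in> C" "0 \<in> C"
proof -
  show c: "closed C" "convex C" "cone C" "interior C \<noteq> {}" "\<And>x. x \<in> C \<Longrightarrow> - x \<in> C \<Longrightarrow> x = 0"
    using assms by (auto simp: pointed_cone_def)
  show s: "r *\<^sub>R x \<in> C" if "x \<in> C" "r \<ge> 0" for x r using c(3) that by (auto simp: cone_def)
  show "x + y \<in> C" if "x \<in> C" "y \<in> C" for x y using c(2,3) that convex_cone[of C] by auto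
  show "0 \<in> C" using s[of _ 0] c(4) interior_subset[of C] by fastforce
qed

lemma pointed_cone_strictly_convex:
  assumes "closed C" "strictly_convex_cone C" "interior C \<noteq> {}"
  shows "pointed_cone C"
proof -
  have cone: "r *\<^sub>R x \<in> C" if "x \<in> C" "r \<ge> 0" for x r
    using assms(2) that by (auto simp: strictly_convex_cone_def cone_def)
  have "x = 0" if x: "x \<in> C" "- x \<in> C" for x
  proof (rule ccontr)
    assume "x \<noteq> 0"
    have "0 + t *\<^sub>R x \<in> C" for t
      using cone[OF x(1), of t] cone[OF x(2), of "- t"] by (cases "t \<ge> 0") auto
    then show False using assms(2) \<open>x \<noteq> 0\<close> unfolding strictly_convex_cone_def contains_line_def by blast
  qed
  then show ?thesis using assms by (auto simp: pointed_cone_def strictly_convex_cone_def)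
qed

text \<open>Pointedness makes \<open>C - {0}\<close> convex, so the convex hull of the unit vectors
  of \<open>C\<close> is compact and misses 0. A functional separating it from 0 is positive on
  \<open>C\<close>, with a linear lower bound by homogeneity.\<close>

lemma pointed_cone_positive_functional:
  fixes C :: "'a::euclidean_space set"
  assumes "pointed_cone C"
  obtains \<epsilon> a where "\<epsilon> > 0" "\<And>x. x \<in> C \<Longrightarrow> \<epsilon> * norm x \<le> a \<bullet> x"
proof -
  note D = pointed_coneD[OF assms]
  let ?K = "convex hull (C \<inter> sphere 0 1)"
  have "convex (C - {0})"
    unfolding convex_alt
  proof (intro ballI allI impI)
    fix x y u assume xy: "x \<in> C - {0}" "y \<in> C - {0}" and u: "0 \<le> u \<and> u \<le> (1::real)"
    have "(1 - u) *\<^sub>R x + u *\<^sub>R y \<in> C" using xy u by (intro D(6,7)) auto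
    moreover have "(1 - u) *\<^sub>R x + u *\<^sub>R y \<noteq> 0"
    proof
      assume eq: "(1 - u) *\<^sub>R x + u *\<^sub>R y = 0"
      then have "- ((1 - u) *\<^sub>R x) = u *\<^sub>R y" by (rule minus_unique)
      moreover have "u *\<^sub>R y \<in> C" "(1 - u) *\<^sub>R x \<in> C" using xy u by (auto intro: D(6))
      ultimately have "(1 - u) *\<^sub>R x = 0" using D(5) by metis
      then have "u = 1" using xy by simp
      then show False using eq xy by simp
    qed
    ultimately show "(1 - u) *\<^sub>R x + u *\<^sub>R y \<in> C - {0}" by simp
  qed
  then have "?K \<subseteq> C - {0}" by (intro hull_minimal) auto
  then have "0 \<notin> ?K" by auto
  moreover have "closed ?K"
    by (intro compact_imp_closed compact_convex_hull closed_Int_compact D(1)) simp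
  ultimately obtain a \<epsilon> where a: "\<epsilon> > 0" "\<And>x. x \<in> ?K \<Longrightarrow> a \<bullet> x > \<epsilon>"
    using separating_hyperplane_closed_0[of ?K] by (auto simp: convex_convex_hull)
  show thesis
  proof (rule that[OF a(1)])
    fix x assume x: "x \<in> C"
    show "\<epsilon> * norm x \<le> a \<bullet> x"
    proof (cases "x = 0")
      case False
      then have "(1 / norm x) *\<^sub>R x \<in> C \<inter> sphere 0 1" using x by (auto intro: D(6))
      then have "a \<bullet> ((1 / norm x) *\<^sub>R x) > \<epsilon>" by (intro a(2) hull_inc)
      then show ?thesis using False by (simp add: field_simps)
    qed simp
  qed
qed

text \<open>The height is a positive functional normalized to 1 at an interior point
  \<open>e\<close>; the other coordinates come from the projection along \<open>e\<close> to its
  kernel. Positivity gives the outer round cone, a ball around \<open>e\<close> the inner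
  one.\<close>

lemma pointed_cone_normal_form:
  fixes C :: "'a::euclidean_space set"
  assumes C: "pointed_cone C" and dim: "DIM('a) = Suc (Suc m)"
  obtains T :: "'a \<Rightarrow> (real^('a hyperplane_index)) \<times> real" and G c L \<kappa>
  where "linear T" "linear G" "\<And>x. G (T x) = x" "\<And>y. T (G y) = y" "std_cone c L (T ` C)" "\<kappa> \<ge> 0"
    "\<And>X. bounded X \<Longrightarrow> X \<in> sets borel \<Longrightarrow> measure lebesgue X = \<kappa> * measure lebesgue (T ` X)"
proof -
  note D = pointed_coneD[OF C]
  obtain \<epsilon> a where a: "\<epsilon> > 0" "\<And>x. x \<in> C \<Longrightarrow> \<epsilon> * norm x \<le> a \<bullet> x"
    by (rule pointed_cone_positive_functional[OF C]) blast
  obtain e where e: "e \<in> interior C" using D(4) by auto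
  obtain r where r: "r > 0" "ball e r \<subseteq> C" using e by (meson mem_interior)
  have "e \<noteq> 0"
  proof
    assume "e = 0"
    obtain b :: 'a where b: "b \<in> Basis" using nonempty_Basis by blast
    then have "(r / 2) *\<^sub>R b \<in> ball e r" "- ((r / 2) *\<^sub>R b) \<in> ball e r" using \<open>e = 0\<close> r(1) by (auto simp: dist_norm)
    then have "(r / 2) *\<^sub>R b = 0" using r(2) D(5) by blast
    then show False using b r(1) by auto
  qed
  moreover have eC: "e \<in> C" using e interior_subset by auto
  ultimately have ae: "a \<bullet> e > 0" using less_le_trans[OF mult_pos_pos[OF a(1), of "norm e"] a(2)[of e]] by simp
  then have "a \<noteq> 0" by auto
  define f where "f = (\<lambda>x. (a \<bullet> x) / (a \<bullet> e))"
  have fe: "f e = 1" and fadd: "f (x + y) = f x + f y" and fscale: "f (s *\<^sub>R x) = s * f x" for x y s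
    using ae by (auto simp: f_def inner_add_right add_divide_distrib)
  let ?H = "{x. a \<bullet> x = 0}"
  have dimH: "dim ?H = dim (UNIV :: (real^('a hyperplane_index)) set)"
    using dim_hyperplane[OF \<open>a \<noteq> 0\<close>] dim by (simp add: card_hyperplane_index)
  obtain F :: "'a \<Rightarrow> real^('a hyperplane_index)" and F' where F: "linear F" "linear F'" "F' ` UNIV = ?H"
      "\<And>z. norm (F' z) = norm z" "\<And>x. x \<in> ?H \<Longrightarrow> F' (F x) = x" "\<And>z. F (F' z) = z"
    by (rule isometries_subspaces[OF subspace_hyperplane subspace_UNIV dimH], rule that) (assumption | simp)+
  interpret F: linear F by (rule F(1))
  interpret F': linear F' by (rule F(2))
  define A where "A = (\<lambda>x. F (x - f x *\<^sub>R e))"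
  define T where "T = (\<lambda>x. (A x, f x))"
  define G where "G = (\<lambda>y. F' (fst y) + snd y *\<^sub>R e)"
  have T: "linear T" unfolding T_def A_def
    by (auto simp: linear_iff fadd fscale F.add F.diff F.scale scaleR_add_left scaleR_diff_right)
  have A: "linear A" using linear_compose[OF T linear_fst] by (simp add: T_def o_def)
  have G: "linear G" unfolding G_def by (auto simp: linear_iff F'.add F'.scale scaleR_add_left scaleR_add_right)
  have GT: "G (T x) = x" for x
    using F(5)[of "x - f x *\<^sub>R e"] ae by (simp add: G_def T_def A_def f_def inner_diff_right)
  have TG: "T (G y) = y" for y
  proof -
    have "a \<bullet> F' (fst y) = 0" using F(3) by auto
    then have "f (G y) = snd y" using ae by (simp add: f_def G_def inner_add_right)
    then show ?thesis by (simp add: T_def A_def G_def F(6))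
  qed
  have injT: "inj T" using GT by (metis injI)
  obtain K where K: "K > 0" "\<And>x. norm (A x) \<le> norm x * K"
    using bounded_linear.pos_bounded[of A] A by (auto simp: linear_conv_bounded_linear)
  show thesis
  proof -
    \<comment> \<open>The first slope combines \<open>norm (A x) \<le> norm x * K\<close> with
      \<open>\<epsilon> * norm x \<le> a \<bullet> x\<close>. The 2 in the second makes an
      inequality strict, as the ball around \<open>e\<close> is open.\<close>
    have std: "std_cone (\<epsilon> / ((a \<bullet> e) * K)) (2 / r) (T ` C)"
      unfolding std_cone_def
    proof (intro conjI ballI allI impI)
      show "closed (T ` C)" by (rule closed_injective_linear_image[OF D(1) T injT])
      show "convex (T ` C)" by (rule convex_linear_image[OF T D(2)])
      show "cone (T ` C)" unfolding cone_def using D(6) linear_scale[OF T] by (metis (no_types, lifting) image_iff)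
      show "\<epsilon> / ((a \<bullet> e) * K) > 0" "2 / r > 0" using a ae K r by auto
      fix y assume "y \<in> T ` C"
      then obtain x where x: "x \<in> C" "y = T x" by auto
      have "\<epsilon> * norm (A x) \<le> \<epsilon> * (norm x * K)" using a(1) K(2) by (intro mult_left_mono) auto
      also have "\<dots> \<le> (a \<bullet> x) * K" using mult_right_mono[OF a(2)[OF x(1)], of K] K(1) by (simp add: mult_ac)
      finally show "\<epsilon> / ((a \<bullet> e) * K) * norm (fst y) \<le> snd y"
        using ae K(1) by (simp add: x(2) T_def f_def field_simps)
    next
      fix y :: "(real^('a hyperplane_index)) \<times> real" assume y: "2 / r * norm (fst y) \<le> snd y"
      have y': "2 * norm (fst y) \<le> r * snd y" using y r(1) by (simp add: field_simps)
      have y0: "snd y \<ge> 0" using order_trans[OF _ y, of 0] r(1) by simp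
      have "G y \<in> C"
      proof (cases "snd y = 0")
        case True
        then have "y = 0" using y' by (simp add: prod_eq_iff)
        then show ?thesis using D(8) linear_0[OF G] by simp
      next
        case False
        have "norm (F' (fst y)) < r * snd y" using y' F(4)[of "fst y"] y0 False r(1) mult_pos_pos[of r "snd y"] by linarith
        then have "norm ((1 / snd y) *\<^sub>R F' (fst y)) < r" using y0 False by (simp add: field_simps)
        then have "e + (1 / snd y) *\<^sub>R F' (fst y) \<in> C" using r(2) by (auto simp: dist_norm subset_iff)
        then have "snd y *\<^sub>R (e + (1 / snd y) *\<^sub>R F' (fst y)) \<in> C" using y0 by (rule D(6))
        then show ?thesis using False by (simp add: G_def scaleR_add_right add.commute)
      qed
      then show "y \<in> T ` C" using TG by (metis image_eqI)
    qed
    have "DIM((real^('a hyperplane_index)) \<times> real) = DIM('a)" "DIM('a) \<ge> 2"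
      using dim by (auto simp: card_hyperplane_index)
    then obtain \<kappa> where \<kappa>: "\<kappa> \<ge> 0" "\<And>X. bounded X \<Longrightarrow> X \<in> sets borel \<Longrightarrow> G ` X \<in> sets borel \<Longrightarrow> measure lebesgue (G ` X) = \<kappa> * measure lebesgue X"
      by (rule linear_image_measure[OF G]) blast
    have "continuous_on UNIV G" using G by (simp add: linear_continuous_on linear_conv_bounded_linear)
    then have mG: "G \<in> borel_measurable borel" by (rule borel_measurable_continuous_onI)
    have "measure lebesgue X = \<kappa> * measure lebesgue (T ` X)" if X: "bounded X" "X \<in> sets borel" for X
    proof -
      have "T ` X = G -` X" using GT TG by (auto simp: image_iff) (metis TG)
      then have "T ` X \<in> sets borel" using measurable_sets[OF mG X(2)] by simp
      moreover have "bounded (T ` X)" using bounded_linear_image[OF X(1)] T by (simp add: linear_conv_bounded_linear)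
      moreover have "G ` T ` X = X" by (simp add: image_comp o_def GT)
      ultimately show ?thesis using \<kappa>(2)[of "T ` X"] X(2) by simp
    qed
    then show thesis by (rule that[OF T G GT TG std \<kappa>(1)])
  qed
qed

section \<open>Covolumes of Minkowski sums\<close>

text \<open>The case \<open>D = C\<close> is allowed here; \<open>coconvex_set\<close> excludes it
  through the apex.\<close>

definition cofinite_convex :: "'a::euclidean_space set \<Rightarrow> 'a set \<Rightarrow> bool" where
  "cofinite_convex C D \<longleftrightarrow> closed D \<and> convex D \<and> D \<subseteq> C \<and> bounded (C - D)"

lemma msum_linear_image:
  assumes "linear T" shows "T ` msum J s B = msum J s (\<lambda>j. T ` B j)"
proof (intro subset_antisym subsetI)
  interpret T: linear T by (rule assms)
  fix y assume "y \<in> T ` msum J s B"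
  then obtain x where "\<forall>j\<in>J. x j \<in> B j" "y = T (\<Sum>j\<in>J. s j *\<^sub>R x j)" by (auto simp: msum_def)
  then have "\<forall>j\<in>J. T (x j) \<in> T ` B j" "y = (\<Sum>j\<in>J. s j *\<^sub>R T (x j))" by (auto simp: T.sum T.scale)
  then show "y \<in> msum J s (\<lambda>j. T ` B j)" unfolding msum_def by (auto intro!: exI[of _ "\<lambda>j. T (x j)"])
next
  interpret T: linear T by (rule assms)
  fix y assume "y \<in> msum J s (\<lambda>j. T ` B j)"
  then obtain u where u: "\<forall>j\<in>J. u j \<in> T ` B j" "y = (\<Sum>j\<in>J. s j *\<^sub>R u j)" by (auto simp: msum_def)
  then have "\<forall>j\<in>J. \<exists>x. x \<in> B j \<and> u j = T x" by auto
  then obtain x where x: "\<And>j. j \<in> J \<Longrightarrow> x j \<in> B j \<and> u j = T (x j)" by metis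
  then have "y = T (\<Sum>j\<in>J. s j *\<^sub>R x j)" using u(2) by (simp add: T.sum T.scale)
  then show "y \<in> T ` msum J s B" using x unfolding msum_def by blast
qed

lemma msum_scale:
  fixes B :: "'j \<Rightarrow> 'b::real_vector set"
  shows "msum J (\<lambda>j. r * s j) B = (\<lambda>x. r *\<^sub>R x) ` msum J s B"
proof -
  have "(\<Sum>j\<in>J. (r * s j) *\<^sub>R x j) = r *\<^sub>R (\<Sum>j\<in>J. s j *\<^sub>R x j)" for x :: "'j \<Rightarrow> 'b"
    by (simp add: scaleR_sum_right)
  then show ?thesis unfolding msum_def by auto
qed

lemma pointed_cone_scale:
  assumes "pointed_cone C" "r > 0"
  shows "(\<lambda>x. r *\<^sub>R x) ` (C - X) = C - (\<lambda>x. r *\<^sub>R x) ` X"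
proof -
  have "(\<lambda>x. r *\<^sub>R x) ` C = C"
  proof
    show "(\<lambda>x. r *\<^sub>R x) ` C \<subseteq> C" using pointed_coneD(6)[OF assms(1)] assms(2) by auto
    have "x = r *\<^sub>R ((1 / r) *\<^sub>R x)" "(1 / r) *\<^sub>R x \<in> C" if "x \<in> C" for x
      using pointed_coneD(6)[OF assms(1) that, of "1 / r"] assms(2) by auto
    then show "C \<subseteq> (\<lambda>x. r *\<^sub>R x) ` C" by blast
  qed
  moreover have "inj_on (\<lambda>x. r *\<^sub>R x) (C \<union> X)" using assms(2) by (auto simp: inj_on_def)
  ultimately show ?thesis
    using inj_on_image_set_diff[of "\<lambda>x. r *\<^sub>R x" "C \<union> X" C X] by auto
qed

lemma cofinite_convex_scale:
  assumes C: "pointed_cone C" and D: "cofinite_convex C D" and "r > 0"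
  shows "cofinite_convex C ((\<lambda>x. r *\<^sub>R x) ` D)"
proof -
  have "closed ((\<lambda>x. r *\<^sub>R x) ` D)" "convex ((\<lambda>x. r *\<^sub>R x) ` D)"
    using D by (auto simp: cofinite_convex_def closed_scaling convex_scaling)
  moreover have "(\<lambda>x. r *\<^sub>R x) ` D \<subseteq> C"
    using D pointed_coneD(6)[OF C] \<open>r > 0\<close> by (auto simp: cofinite_convex_def)
  moreover have "bounded (C - (\<lambda>x. r *\<^sub>R x) ` D)"
    using D bounded_scaling[of "C - D" r] by (simp add: cofinite_convex_def flip: pointed_cone_scale[OF C \<open>r > 0\<close>])
  ultimately show ?thesis by (simp add: cofinite_convex_def)
qed

lemma common_body_bound:
  assumes C: "std_cone c L (T ` C)" and T: "linear T" "inj T" and J: "finite J"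
    and D: "\<And>j. j \<in> J \<Longrightarrow> cofinite_convex C (D j)"
  obtains h where "h > 0" "\<And>j. j \<in> J \<Longrightarrow> body (T ` C) h (T ` D j)"
proof -
  have "bounded (\<Union>j\<in>J. T ` (C - D j))"
    using J D T(1) by (auto intro!: bounded_linear_image simp: linear_conv_bounded_linear cofinite_convex_def)
  then obtain K where K: "K > 0" "\<And>j x. j \<in> J \<Longrightarrow> x \<in> C - D j \<Longrightarrow> norm (T x) \<le> K"
    unfolding bounded_pos by blast
  show thesis
  proof (rule that[of "K + 1"])
    fix j assume j: "j \<in> J"
    note Dj = D[OF j, unfolded cofinite_convex_def]
    show "body (T ` C) (K + 1) (T ` D j)"
      unfolding body_def
    proof (intro conjI ballI impI)
      show "closed (T ` D j)" using Dj T by (intro closed_injective_linear_image) auto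
      show "convex (T ` D j)" using Dj T by (intro convex_linear_image) auto
      show "T ` D j \<subseteq> T ` C" using Dj by auto
      fix y assume y: "y \<in> T ` C" "K + 1 \<le> snd y"
      then obtain x where x: "x \<in> C" "y = T x" by auto
      have "K + 1 \<le> norm y" using y(2) norm_snd_le[of "snd y" "fst y"] by simp
      then have "x \<in> D j" using K(2)[OF j, of x] x by auto
      then show "y \<in> T ` D j" using x by auto
    qed
  qed (use K in simp)
qed

lemma cofinite_convex_msum:
  fixes C :: "'a::euclidean_space set"
  assumes C: "pointed_cone C" and dim: "DIM('a) \<ge> 2" and J: "finite J"
    and D: "\<And>j. j \<in> J \<Longrightarrow> cofinite_convex C (D j)" and s: "\<And>j. j \<in> J \<Longrightarrow> s j \<ge> 0" "sum s J > 0"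
  shows "cofinite_convex C (msum J s D)"
proof -
  obtain m where m: "DIM('a) = Suc (Suc m)" using dim by (metis Suc_le_D numeral_2_eq_2 Suc_le_mono)
  obtain T :: "'a \<Rightarrow> (real^('a hyperplane_index)) \<times> real" and G c L
    where T: "linear T" "linear G" "\<And>x. G (T x) = x" "\<And>y. T (G y) = y" "std_cone c L (T ` C)"
    by (rule pointed_cone_normal_form[OF C m]) blast
  have inj: "inj T" "inj G" using T(3,4) by (metis injI)+
  obtain h where h: "h > 0" "\<And>j. j \<in> J \<Longrightarrow> body (T ` C) h (T ` D j)"
    by (rule common_body_bound[OF T(5,1) inj(1) J D]) blast+
  define s' where "s' = (\<lambda>j. s j / sum s J)"
  have s': "\<And>j. j \<in> J \<Longrightarrow> s' j \<ge> 0" "sum s' J = 1" using s by (auto simp: s'_def sum_divide_distrib[symmetric])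
  let ?M = "msum J s' D"
  have M: "body (T ` C) h (T ` ?M)"
    unfolding msum_linear_image[OF T(1)] by (rule body_msum[OF T(5) J h(2) h(1) s'])
  have GT: "G ` T ` X = X" for X by (simp add: image_comp o_def T(3))
  have "cofinite_convex C ?M"
    unfolding cofinite_convex_def
  proof (intro conjI)
    have "closed (G ` T ` ?M)" using M closed_injective_linear_image[OF _ T(2) inj(2)] by (simp add: body_def)
    then show "closed ?M" by (simp add: GT)
    have "convex (G ` T ` ?M)" using M convex_linear_image[OF T(2)] by (simp add: body_def)
    then show "convex ?M" by (simp add: GT)
    have "T ` ?M \<subseteq> T ` C" using M by (simp add: body_def)
    then show "?M \<subseteq> C" using inj(1) by (simp add: inj_image_subset_iff)
    have "T ` (C - ?M) \<subseteq> T ` C \<inter> {x. snd x \<le> h}" using M by (auto simp: body_def image_set_diff[OF inj(1)])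
    then have "bounded (T ` (C - ?M))"
      using compact_imp_bounded[OF std_cone_truncation_compact[OF T(5) std_coneD(1)[OF T(5)] subset_refl]] bounded_subset by blast
    then have "bounded (G ` T ` (C - ?M))" using T(2) by (simp add: bounded_linear_image linear_conv_bounded_linear)
    then show "bounded (C - ?M)" by (simp add: GT)
  qed
  moreover have "msum J s D = (\<lambda>x. sum s J *\<^sub>R x) ` ?M"
    using s(2) by (simp add: s'_def flip: msum_scale)
  ultimately show ?thesis using cofinite_convex_scale[OF C _ s(2)] by simp
qed

text \<open>The map \<open>T\<close> changes volumes by a constant nonnegative factor, and both
  sides scale by the power \<open>DIM('a)\<close> of the total weight, so weights of sum 1
  suffice.\<close>

theorem covolume_form:
  fixes C :: "'a::euclidean_space set"
  assumes C: "pointed_cone C" and dim: "DIM('a) = Suc (Suc m)" and J: "finite J"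
    and D: "\<And>j. j \<in> J \<Longrightarrow> cofinite_convex C (D j)"
  obtains p where "hform (Suc (Suc m)) J p"
    and "\<And>s. (\<And>j. j \<in> J \<Longrightarrow> s j \<ge> 0) \<Longrightarrow> sum s J > 0 \<Longrightarrow> p s = measure lebesgue (C - msum J s D)"
    and "\<And>i j \<mu>. i \<in> J \<Longrightarrow> j \<in> J \<Longrightarrow> (\<And>k. k < m \<Longrightarrow> \<mu> k \<in> J) \<Longrightarrow>
       polar (Suc (Suc m)) p (\<lambda>k. if k < m then unit_coord (\<mu> k) else (\<lambda>l. unit_coord i l - unit_coord j l)) \<ge> 0"
proof -
  obtain T :: "'a \<Rightarrow> (real^('a hyperplane_index)) \<times> real" and G c L \<kappa>
    where T: "linear T" "linear G" "\<And>x. G (T x) = x" "\<And>y. T (G y) = y" "std_cone c L (T ` C)"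
    and \<kappa>: "\<kappa> \<ge> 0" "\<And>X. bounded X \<Longrightarrow> X \<in> sets borel \<Longrightarrow> measure lebesgue X = \<kappa> * measure lebesgue (T ` X)"
    by (rule pointed_cone_normal_form[OF C dim]) blast
  have inj: "inj T" using T(3) by (metis injI)
  obtain h where h: "h > 0" "\<And>j. j \<in> J \<Longrightarrow> body (T ` C) h (T ` D j)"
    by (rule common_body_bound[OF T(5,1) inj J D]) blast+
  have card: "CARD('a hyperplane_index) = Suc m" using dim by (simp add: card_hyperplane_index)
  obtain q where q: "hform (Suc (Suc m)) J q"
    "\<And>s. (\<And>j. j \<in> J \<Longrightarrow> s j \<ge> 0) \<Longrightarrow> sum s J = 1 \<Longrightarrow> q s = measure lebesgue (T ` C - msum J s (\<lambda>j. T ` D j))"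
    "\<And>i j \<mu>. i \<in> J \<Longrightarrow> j \<in> J \<Longrightarrow> (\<And>k. k < m \<Longrightarrow> \<mu> k \<in> J) \<Longrightarrow>
       polar (Suc (Suc m)) q (\<lambda>k. if k < m then unit_coord (\<mu> k) else (\<lambda>l. unit_coord i l - unit_coord j l)) \<ge> 0"
    by (rule body_volume_form[OF T(5) J h(2) h(1) card]) blast+
  have q1: "\<kappa> * q s = measure lebesgue (C - msum J s D)" if s: "\<And>j. j \<in> J \<Longrightarrow> s j \<ge> 0" "sum s J = 1" for s
  proof -
    have M: "cofinite_convex C (msum J s D)" by (rule cofinite_convex_msum[OF C _ J D]) (use s dim in auto)
    have "T ` C - msum J s (\<lambda>j. T ` D j) = T ` (C - msum J s D)"
      by (simp add: msum_linear_image[OF T(1), symmetric] image_set_diff[OF inj])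
    moreover have "bounded (C - msum J s D)" "C - msum J s D \<in> sets borel"
      using M pointed_coneD(1)[OF C] by (auto simp: cofinite_convex_def)
    ultimately show ?thesis using \<kappa>(2) q(2)[of s] s by simp
  qed
  show thesis
  proof (rule that[of "\<lambda>s. \<kappa> * q s"])
    show "hform (Suc (Suc m)) J (\<lambda>s. \<kappa> * q s)" by (intro hform_cmult q)
    show "\<kappa> * q s = measure lebesgue (C - msum J s D)" if s: "\<And>j. j \<in> J \<Longrightarrow> s j \<ge> 0" "sum s J > 0" for s
    proof -
      define s' where "s' = (\<lambda>j. s j / sum s J)"
      have s': "\<And>j. j \<in> J \<Longrightarrow> s' j \<ge> 0" "sum s' J = 1" using s by (auto simp: s'_def sum_divide_distrib[symmetric])
      have ss': "s = (\<lambda>j. sum s J * s' j)" using s(2) by (auto simp: s'_def)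
      have "C - msum J s D = (\<lambda>x. sum s J *\<^sub>R x + 0) ` (C - msum J s' D)"
        using pointed_cone_scale[OF C s(2)] msum_scale[of J "sum s J" s' D] ss' by simp
      then have "measure lebesgue (C - msum J s D) = sum s J ^ DIM('a) * measure lebesgue (C - msum J s' D)"
        using s(2) by (simp only: measure_lebesgue_affine abs_of_pos)
      also have "\<dots> = \<kappa> * (sum s J ^ DIM('a) * q s')" using q1[OF s'] by simp
      also have "sum s J ^ DIM('a) * q s' = q s" using hform_scale[OF q(1), of "sum s J" s'] ss' dim by simp
      finally show ?thesis by simp
    qed
    show "polar (Suc (Suc m)) (\<lambda>s. \<kappa> * q s) (\<lambda>k. if k < m then unit_coord (\<mu> k) else (\<lambda>l. unit_coord i l - unit_coord j l)) \<ge> 0"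
      if "i \<in> J" "j \<in> J" "\<And>k. k < m \<Longrightarrow> \<mu> k \<in> J" for i j \<mu>
    proof -
      have "polar (Suc (Suc m)) (\<lambda>s. \<kappa> * q s) x = \<kappa> * polar (Suc (Suc m)) q x" for x
        unfolding polar_def by (simp add: sum_distrib_left mult_ac)
      then show ?thesis using q(3)[of i j \<mu>] that \<kappa>(1) by simp
    qed
  qed
qed

section \<open>Coconvex bodies and their unbounded components\<close>

definition coconvex_set :: "'a::euclidean_space set \<Rightarrow> 'a set \<Rightarrow> bool" where
  "coconvex_set C D \<longleftrightarrow> cofinite_convex C D \<and> 0 \<notin> D"

text \<open>A convex set that contains the apex and the far part of every ray of \<open>C\<close> is
  all of \<open>C\<close>; so the complement is nonempty precisely when the apex belongs to
  it.\<close>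

lemma coconvex_body_iff:
  assumes C: "pointed_cone C"
  shows "coconvex_body C A \<longleftrightarrow> (\<exists>D. coconvex_set C D \<and> A = C - (D \<union> {0}))"
proof -
  have "0 \<notin> D \<longleftrightarrow> C - D \<noteq> {}" if D: "cofinite_convex C D" for D
  proof
    show "C - D \<noteq> {}" if "0 \<notin> D" using that pointed_coneD(8)[OF C] by auto
    assume ne: "C - D \<noteq> {}"
    show "0 \<notin> D"
    proof
      assume "0 \<in> D"
      obtain x where x: "x \<in> C" "x \<notin> D" using ne by auto
      obtain K where K: "\<And>y. y \<in> C - D \<Longrightarrow> norm y \<le> K" using D by (auto simp: cofinite_convex_def bounded_iff)
      have x0: "norm x > 0" using \<open>0 \<in> D\<close> x by auto
      \<comment> \<open>Stretching by \<open>r\<close> gives norm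
        \<open>norm x + \<bar>K\<bar>\<close>, beyond the bounded complement.\<close>
      define r where "r = 1 + \<bar>K\<bar> / norm x"
      have r: "r \<ge> 1" using x0 by (simp add: r_def)
      have "norm (r *\<^sub>R x) = norm x + \<bar>K\<bar>" using r x0 by (simp add: r_def field_simps)
      then have "norm (r *\<^sub>R x) > K" using x0 abs_ge_self[of K] by linarith
      moreover have "r *\<^sub>R x \<in> C" using r by (intro pointed_coneD(6)[OF C x(1)]) simp
      ultimately have "r *\<^sub>R x \<in> D" using K[of "r *\<^sub>R x"] by auto
      then have "(1 - 1 / r) *\<^sub>R 0 + (1 / r) *\<^sub>R (r *\<^sub>R x) \<in> D"
        using D \<open>0 \<in> D\<close> r by (intro convexD) (auto simp: cofinite_convex_def)
      then show False using x r by simp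
    qed
  qed
  then show ?thesis unfolding coconvex_body_def coconvex_set_def cofinite_convex_def by metis
qed

lemma pointed_cone_unbounded:
  fixes C :: "'a::euclidean_space set"
  assumes C: "pointed_cone C" shows "\<not> bounded C"
proof
  assume "bounded C"
  then obtain K where K: "\<And>y. y \<in> C \<Longrightarrow> norm y \<le> K" by (auto simp: bounded_iff)
  have "\<not> C \<subseteq> {0}"
    using pointed_coneD(4)[OF C] interior_mono[of C "{0}"] by auto
  then obtain x where x: "x \<in> C" "x \<noteq> 0" by auto
  have "norm (((\<bar>K\<bar> + 1) / norm x) *\<^sub>R x) \<le> K" by (intro K pointed_coneD(6)[OF C] x) simp
  then show False using x(2) by simp
qed

text \<open>The complement of the body in \<open>C\<close> is \<open>D\<close> together with the
  apex. As \<open>D\<close> is closed, connected and misses 0, the components are \<open>D\<close>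
  and \<open>{0}\<close>, and only \<open>D\<close> is unbounded.\<close>

lemma coconvex_delta_eq:
  assumes C: "pointed_cone C" and D: "coconvex_set C D"
  shows "coconvex_delta C (C - (D \<union> {0})) = D"
proof -
  have cD: "closed D" "convex D" "D \<subseteq> C" "bounded (C - D)" "0 \<notin> D"
    using D by (auto simp: coconvex_set_def cofinite_convex_def)
  have eq: "C - (C - (D \<union> {0})) = insert 0 D" using cD(3) pointed_coneD(8)[OF C] by auto
  have ub: "\<not> bounded D"
  proof
    assume "bounded D"
    then have "bounded C" using bounded_Un[of "C - D" D] cD(3,4) by (simp add: Un_absorb2)
    then show False using pointed_cone_unbounded[OF C] by simp
  qed
  then have ne: "D \<noteq> {}" by auto
  have comp: "D \<in> components (insert 0 D)"
    unfolding in_components_maximal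
  proof (intro conjI allI impI)
    fix E assume E: "E \<noteq> {} \<and> D \<subseteq> E \<and> E \<subseteq> insert 0 D \<and> connected E"
    show "E = D"
    proof (rule ccontr)
      assume "E \<noteq> D"
      then have "E = insert 0 D" using E by auto
      moreover have "\<not> connected (insert 0 D)"
        unfolding connected_closed not_not
        by (rule exI[of _ D], rule exI[of _ "{0}"]) (use cD(1,5) ne in auto)
      ultimately show False using E by simp
    qed
  qed (use ne convex_connected[OF cD(2)] in auto)
  show ?thesis
    unfolding coconvex_delta_def eq
  proof (rule the_equality)
    fix E assume E: "E \<in> components (insert 0 D) \<and> \<not> bounded E"
    show "E = D"
    proof (rule ccontr)
      assume "E \<noteq> D"
      then have "E \<inter> D = {}" using components_eq[OF conjunct1[OF E] comp] by blast
      moreover have "E \<subseteq> insert 0 D" using E in_components_subset by blast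
      ultimately have "E \<subseteq> {0}" by auto
      then show False using E bounded_subset[of "{0}" E] by simp
    qed
  qed (use comp ub in simp)
qed

section \<open>Homogeneous polynomials on vector spaces\<close>

text \<open>Unlike in \<open>homogeneous_polynomial\<close>, the finite family may be dependent, so
  it can simply collect all vectors that occur in an argument.\<close>

definition polynomial_form :: "nat \<Rightarrow> ('v::real_vector \<Rightarrow> real) \<Rightarrow> bool" where
  "polynomial_form d P \<longleftrightarrow> (\<forall>X. finite X \<longrightarrow> (\<exists>q. hform d X q \<and> (\<forall>t. P (\<Sum>x\<in>X. t x *\<^sub>R x) = q t)))"

lemma hform_compose:
  assumes p: "hform d J p" and X: "finite X" "finite J"
  shows "hform d X (\<lambda>t. p (\<lambda>j. \<Sum>x\<in>X. t x * a x j))"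
proof -
  obtain c where c: "\<And>s. p s = (\<Sum>\<kappa>\<in>{..<d} \<rightarrow>\<^sub>E J. c \<kappa> * (\<Prod>i<d. s (\<kappa> i)))"
    using p unfolding hform_def by auto
  have "p (\<lambda>j. \<Sum>x\<in>X. t x * a x j) = (\<Sum>\<nu>\<in>{..<d} \<rightarrow>\<^sub>E X. (\<Sum>\<kappa>\<in>{..<d} \<rightarrow>\<^sub>E J. c \<kappa> * (\<Prod>i<d. a (\<nu> i) (\<kappa> i))) * (\<Prod>i<d. t (\<nu> i)))" for t
  proof -
    have "(\<Prod>i<d. \<Sum>x\<in>X. t x * a x (\<kappa> i)) = (\<Sum>\<nu>\<in>{..<d} \<rightarrow>\<^sub>E X. (\<Prod>i<d. a (\<nu> i) (\<kappa> i)) * (\<Prod>i<d. t (\<nu> i)))" for \<kappa>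
      using prod_sum_PiE[of "{..<d}" "\<lambda>_. X" "\<lambda>i x. t x * a x (\<kappa> i)"] X by (simp add: prod.distrib mult.commute)
    then have "p (\<lambda>j. \<Sum>x\<in>X. t x * a x j) = (\<Sum>\<kappa>\<in>{..<d} \<rightarrow>\<^sub>E J. \<Sum>\<nu>\<in>{..<d} \<rightarrow>\<^sub>E X. c \<kappa> * (\<Prod>i<d. a (\<nu> i) (\<kappa> i)) * (\<Prod>i<d. t (\<nu> i)))"
      unfolding c by (simp add: sum_distrib_left mult.assoc)
    also have "\<dots> = (\<Sum>\<nu>\<in>{..<d} \<rightarrow>\<^sub>E X. \<Sum>\<kappa>\<in>{..<d} \<rightarrow>\<^sub>E J. c \<kappa> * (\<Prod>i<d. a (\<nu> i) (\<kappa> i)) * (\<Prod>i<d. t (\<nu> i)))"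
      by (rule sum.swap)
    finally show ?thesis by (simp add: sum_distrib_right)
  qed
  then show ?thesis unfolding hform_def
    by (intro exI[of _ "\<lambda>\<nu>. \<Sum>\<kappa>\<in>{..<d} \<rightarrow>\<^sub>E J. c \<kappa> * (\<Prod>i<d. a (\<nu> i) (\<kappa> i))"]) simp
qed

lemma hform_line:
  assumes "hform d J p"
  shows "\<exists>q. \<forall>r. p (\<lambda>j. r * e j + s j) = poly q r"
proof -
  obtain c where c: "\<And>s. p s = (\<Sum>\<kappa>\<in>{..<d} \<rightarrow>\<^sub>E J. c \<kappa> * (\<Prod>i<d. s (\<kappa> i)))"
    using assms unfolding hform_def by auto
  show ?thesis
  proof (intro exI allI)
    show "p (\<lambda>j. r * e j + s j) = poly (\<Sum>\<kappa>\<in>{..<d} \<rightarrow>\<^sub>E J. smult (c \<kappa>) (\<Prod>i<d. [:s (\<kappa> i), e (\<kappa> i):])) r" for r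
      unfolding c by (simp add: poly_sum poly_prod add.commute)
  qed
qed

lemma poly_eq_if_eq_large:
  fixes p q :: "real poly"
  assumes "\<And>r. r > K \<Longrightarrow> poly p r = poly q r"
  shows "p = q"
proof -
  have "{K<..} \<subseteq> {r. poly (p - q) r = 0}"
  proof
    fix r assume "r \<in> {K<..}"
    then show "r \<in> {r. poly (p - q) r = 0}" using assms[of r] by simp
  qed
  then have "infinite {r. poly (p - q) r = 0}" using infinite_Ioi[of K] finite_subset by metis
  then have "p - q = 0" using poly_roots_finite[of "p - q"] by metis
  then show ?thesis by simp
qed

lemma sum_unit_coord_scaleR:
  fixes x :: "'v::real_vector"
  assumes "finite X" "x \<in> X" shows "(\<Sum>y\<in>X. unit_coord x y *\<^sub>R y) = x"
  using unit_coord_sum_single[OF assms, of "\<lambda>y. y"] .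

lemma polynomial_form_scale:
  assumes "polynomial_form d P" shows "P (c *\<^sub>R x) = c ^ d * P x"
proof -
  obtain q where q: "hform d {x} q" "\<And>t. P (\<Sum>x\<in>{x}. t x *\<^sub>R x) = q t"
    using assms unfolding polynomial_form_def by blast
  show ?thesis using q(2)[of "\<lambda>_. c * 1"] q(2)[of "\<lambda>_. 1"] hform_scale[OF q(1), of c "\<lambda>_. 1"] by simp
qed

lemma polynomial_form_line:
  assumes "polynomial_form d P"
  shows "\<exists>p. \<forall>r. P (r *\<^sub>R w + x) = poly p r"
proof -
  define X where "X = {w, x}"
  have X: "finite X" "w \<in> X" "x \<in> X" by (auto simp: X_def)
  obtain q where q: "hform d X q" "\<And>t. P (\<Sum>x\<in>X. t x *\<^sub>R x) = q t"
    using assms X(1) unfolding polynomial_form_def by blast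
  obtain p where p: "\<And>r. q (\<lambda>j. r * unit_coord w j + unit_coord x j) = poly p r"
    using hform_line[OF q(1), of "unit_coord w" "unit_coord x"] by auto
  have "(\<Sum>y\<in>X. (r * unit_coord w y + unit_coord x y) *\<^sub>R y) = r *\<^sub>R w + x" for r
  proof -
    have "(\<Sum>y\<in>X. (r * unit_coord w y + unit_coord x y) *\<^sub>R y)
        = r *\<^sub>R (\<Sum>y\<in>X. unit_coord w y *\<^sub>R y) + (\<Sum>y\<in>X. unit_coord x y *\<^sub>R y)"
      by (simp only: scaleR_add_left sum.distrib scaleR_sum_right scaleR_scaleR)
    then show ?thesis by (simp only: sum_unit_coord_scaleR[OF X(1,2)] sum_unit_coord_scaleR[OF X(1,3)])
  qed
  then have "P (r *\<^sub>R w + x) = poly p r" for r using q(2)[of "\<lambda>j. r * unit_coord w j + unit_coord x j"] p[of r] by simp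
  then show ?thesis by blast
qed

lemma polynomial_form_homogeneous_polynomial:
  assumes "polynomial_form d P" shows "homogeneous_polynomial d P"
  unfolding homogeneous_polynomial_def
proof (intro allI impI)
  fix B :: "'a set" assume B: "finite B \<and> independent B"
  then obtain q where q: "hform d B q" "\<And>t. P (\<Sum>x\<in>B. t x *\<^sub>R x) = q t"
    using assms unfolding polynomial_form_def by blast
  obtain c where c: "\<And>s. q s = (\<Sum>\<kappa>\<in>{..<d} \<rightarrow>\<^sub>E B. c \<kappa> * (\<Prod>i<d. s (\<kappa> i)))"
    using q(1) unfolding hform_def by auto
  let ?A = "{\<alpha>. \<alpha> \<in> B \<rightarrow>\<^sub>E {..d} \<and> sum \<alpha> B = d}" and ?E = "{..<d} \<rightarrow>\<^sub>E B"
  \<comment> \<open>Counts how often each letter occurs; words with equal counts have the same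
    monomial, so their coefficients are added up.\<close>
  define mult where "mult = (\<lambda>\<kappa>. restrict (\<lambda>b. card {i \<in> {..<d}. \<kappa> i = b}) B)"
  define a where "a = (\<lambda>\<alpha>. \<Sum>\<kappa>\<in>{\<kappa> \<in> ?E. mult \<kappa> = \<alpha>}. c \<kappa>)"
  have finE: "finite ?E" using B by (intro finite_PiE) auto
  have finA: "finite ?A" using B by (intro finite_subset[OF _ finite_PiE[of B "\<lambda>_. {..d}"]]) auto
  have multA: "mult \<kappa> \<in> ?A" if "\<kappa> \<in> ?E" for \<kappa>
  proof -
    have "card {i \<in> {..<d}. \<kappa> i = b} \<le> d" for b using card_mono[of "{..<d}" "{i \<in> {..<d}. \<kappa> i = b}"] by auto
    moreover have "(\<Sum>b\<in>B. \<Sum>i\<in>{i \<in> {..<d}. \<kappa> i = b}. 1::nat) = (\<Sum>i<d. 1)"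
      using that B by (intro sum.group) auto
    ultimately show ?thesis by (auto simp: mult_def)
  qed
  have mon: "(\<Prod>i<d. t (\<kappa> i)) = (\<Prod>b\<in>B. t b ^ mult \<kappa> b)" if "\<kappa> \<in> ?E" for \<kappa> and t :: "'a \<Rightarrow> real"
  proof -
    have "(\<Prod>i<d. t (\<kappa> i)) = (\<Prod>b\<in>B. \<Prod>i\<in>{i \<in> {..<d}. \<kappa> i = b}. t (\<kappa> i))"
      using that B by (intro prod.group[symmetric]) auto
    also have "\<dots> = (\<Prod>b\<in>B. t b ^ mult \<kappa> b)" by (intro prod.cong) (auto simp: mult_def)
    finally show ?thesis .
  qed
  have "P (\<Sum>b\<in>B. t b *\<^sub>R b) = (\<Sum>\<alpha> | \<alpha> \<in> B \<rightarrow>\<^sub>E {..d} \<and> sum \<alpha> B = d. a \<alpha> * (\<Prod>b\<in>B. t b ^ \<alpha> b))" for t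
  proof -
    have "P (\<Sum>b\<in>B. t b *\<^sub>R b) = (\<Sum>\<kappa>\<in>?E. c \<kappa> * (\<Prod>b\<in>B. t b ^ mult \<kappa> b))"
      unfolding q(2) c by (intro sum.cong refl) (simp add: mon)
    also have "\<dots> = (\<Sum>\<alpha>\<in>?A. \<Sum>\<kappa>\<in>{\<kappa> \<in> ?E. mult \<kappa> = \<alpha>}. c \<kappa> * (\<Prod>b\<in>B. t b ^ mult \<kappa> b))"
      using finE finA multA by (intro sum.group[symmetric]) auto
    also have "\<dots> = (\<Sum>\<alpha>\<in>?A. a \<alpha> * (\<Prod>b\<in>B. t b ^ \<alpha> b))"
      unfolding a_def sum_distrib_right by (intro sum.cong) auto
    finally show ?thesis .
  qed
  then show "\<exists>a :: ('a \<Rightarrow> nat) \<Rightarrow> real. \<forall>t. P (\<Sum>b\<in>B. t b *\<^sub>R b) =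
      (\<Sum>\<alpha> | \<alpha> \<in> B \<rightarrow>\<^sub>E {..d} \<and> sum \<alpha> B = d. a \<alpha> * (\<Prod>b\<in>B. t b ^ \<alpha> b))" by blast
qed

lemma homogeneous_polynomial_form:
  assumes "homogeneous_polynomial d P" shows "polynomial_form d P"
  unfolding polynomial_form_def
proof (intro allI impI)
  fix X :: "'a set" assume X: "finite X"
  obtain B where B: "B \<subseteq> X" "independent B" "X \<subseteq> span B" using maximal_independent_subset[of X] by blast
  have finB: "finite B" using B X finite_subset by auto
  obtain a where a: "\<And>t. P (\<Sum>b\<in>B. t b *\<^sub>R b) =
      (\<Sum>\<alpha> | \<alpha> \<in> B \<rightarrow>\<^sub>E {..d} \<and> sum \<alpha> B = d. a \<alpha> * (\<Prod>b\<in>B. t b ^ \<alpha> b))"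
    using assms finB B(2) unfolding homogeneous_polynomial_def by blast
  define p where "p = (\<lambda>t. \<Sum>\<alpha> | \<alpha> \<in> B \<rightarrow>\<^sub>E {..d} \<and> sum \<alpha> B = d. a \<alpha> * (\<Prod>b\<in>B. t b ^ \<alpha> b))"
  have mon: "hform d B (\<lambda>t. \<Prod>b\<in>B. t b ^ \<alpha> b)" if "sum \<alpha> B = d" for \<alpha> :: "'a \<Rightarrow> nat"
  proof -
    \<comment> \<open>Exponents are unfolded into words: the letter \<open>b\<close> is repeated
      once for each index below \<open>\<alpha> b\<close>.\<close>
    have "hform d B (\<lambda>t. \<Prod>r\<in>Sigma B (\<lambda>b. {..<\<alpha> b}). t (fst r))"
      by (rule hformI_monomial) (use finB that in auto)
    moreover have "(\<Prod>r\<in>Sigma B (\<lambda>b. {..<\<alpha> b}). t (fst r)) = (\<Prod>b\<in>B. t b ^ \<alpha> b)" for t :: "'a \<Rightarrow> real"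
      using prod.Sigma[of B "\<lambda>b. {..<\<alpha> b}" "\<lambda>b _. t b"] finB by (simp add: case_prod_unfold)
    ultimately show ?thesis by simp
  qed
  have p: "hform d B p" unfolding p_def by (intro hform_sum hform_cmult mon) auto
  have "\<exists>r. x = (\<Sum>b\<in>B. r b *\<^sub>R b)" if "x \<in> X" for x
    using that B(3) span_finite[OF finB] by auto
  then obtain r where r: "\<And>x. x \<in> X \<Longrightarrow> x = (\<Sum>b\<in>B. r x b *\<^sub>R b)" by metis
  have "P (\<Sum>x\<in>X. t x *\<^sub>R x) = p (\<lambda>b. \<Sum>x\<in>X. t x * r x b)" for t
  proof -
    have "(\<Sum>x\<in>X. t x *\<^sub>R x) = (\<Sum>x\<in>X. \<Sum>b\<in>B. (t x * r x b) *\<^sub>R b)"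
      by (intro sum.cong refl) (subst r, auto simp: scaleR_sum_right)
    also have "\<dots> = (\<Sum>b\<in>B. (\<Sum>x\<in>X. t x * r x b) *\<^sub>R b)"
      by (subst sum.swap) (simp add: scaleR_sum_left)
    finally show ?thesis unfolding p_def using a by simp
  qed
  then show "\<exists>q. hform d X q \<and> (\<forall>t. P (\<Sum>x\<in>X. t x *\<^sub>R x) = q t)"
    using hform_compose[OF p X finB] by blast
qed

subsection \<open>Polarization and derivatives\<close>

text \<open>\<open>polar\<close> without coordinates; its rules are transported by expressing all
  arguments over one finite set of vectors.\<close>

definition vpolar :: "nat \<Rightarrow> ('v::real_vector \<Rightarrow> real) \<Rightarrow> (nat \<Rightarrow> 'v) \<Rightarrow> real" where
  "vpolar d P x = (\<Sum>I\<in>Pow {..<d}. (-1) ^ card ({..<d} - I) * P (\<Sum>i\<in>I. x i))"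

lemma vpolar_coordinates:
  assumes q: "\<And>t. P (\<Sum>y\<in>X. t y *\<^sub>R y) = q t" and x: "\<And>i. i < d \<Longrightarrow> x i = (\<Sum>y\<in>X. a i y *\<^sub>R y)"
  shows "vpolar d P x = polar d q a"
  unfolding vpolar_def polar_def
proof (intro sum.cong refl arg_cong2[where f="(*)"])
  fix I assume "I \<in> Pow {..<d}"
  then have "(\<Sum>i\<in>I. x i) = (\<Sum>i\<in>I. \<Sum>y\<in>X. a i y *\<^sub>R y)" using x by (intro sum.cong) auto
  also have "\<dots> = (\<Sum>y\<in>X. (\<Sum>i\<in>I. a i y) *\<^sub>R y)" by (subst sum.swap) (simp add: scaleR_sum_left)
  finally show "P (\<Sum>i\<in>I. x i) = q (\<lambda>j. \<Sum>i\<in>I. a i j)" by (simp add: q)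
qed

lemma vpolar_unit_coordinates:
  assumes q: "\<And>t. P (\<Sum>y\<in>X. t y *\<^sub>R y) = q t" and X: "finite X" "\<And>i. i < d \<Longrightarrow> x i \<in> X"
  shows "vpolar d P x = polar d q (\<lambda>i. unit_coord (x i))"
  by (rule vpolar_coordinates[where P=P and X=X, OF q]) (use X in \<open>simp add: sum_unit_coord_scaleR\<close>)

lemma vpolar_perm:
  assumes "polynomial_form d P" "\<pi> permutes {..<d}"
  shows "vpolar d P (x \<circ> \<pi>) = vpolar d P x"
proof -
  obtain q where q: "hform d (x ` {..<d}) q" "\<And>t. P (\<Sum>y\<in>x ` {..<d}. t y *\<^sub>R y) = q t"
    using assms unfolding polynomial_form_def by blast
  have "vpolar d P (x \<circ> \<pi>) = polar d q (\<lambda>i. unit_coord ((x \<circ> \<pi>) i))"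
    by (rule vpolar_unit_coordinates[where P=P and X="x ` {..<d}", OF q(2)]) (use permutes_in_image[OF assms(2)] in auto)
  also have "\<dots> = polar d q ((\<lambda>i. unit_coord (x i)) \<circ> \<pi>)" by (simp add: o_def)
  also have "\<dots> = polar d q (\<lambda>i. unit_coord (x i))" by (rule polar_perm[OF assms(2)])
  also have "\<dots> = vpolar d P x" by (rule vpolar_unit_coordinates[where P=P and X="x ` {..<d}", OF q(2), symmetric]) auto
  finally show ?thesis .
qed

lemma vpolar_linear:
  assumes P: "polynomial_form d P" and k: "k < d"
  shows "vpolar d P (x(k := \<alpha> *\<^sub>R y + \<beta> *\<^sub>R z)) = \<alpha> * vpolar d P (x(k := y)) + \<beta> * vpolar d P (x(k := z))"
proof -
  define X where "X = x ` {..<d} \<union> {y, z}"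
  have X: "finite X" "y \<in> X" "z \<in> X" "\<And>i. i < d \<Longrightarrow> x i \<in> X" by (auto simp: X_def)
  obtain q where q: "hform d X q" "\<And>t. P (\<Sum>y\<in>X. t y *\<^sub>R y) = q t"
    using P X(1) unfolding polynomial_form_def by blast
  define a where "a = (\<lambda>i. unit_coord (x i))"
  have "vpolar d P (x(k := \<alpha> *\<^sub>R y + \<beta> *\<^sub>R z)) = polar d q (a(k := (\<lambda>j. \<Sum>b\<in>UNIV. (if b then \<alpha> else \<beta>) * unit_coord (if b then y else z) j)))"
  proof (rule vpolar_coordinates[where P=P and X=X, OF q(2)])
    fix i assume "i < d"
    moreover have "\<alpha> *\<^sub>R y + \<beta> *\<^sub>R z = (\<Sum>w\<in>X. (\<alpha> * unit_coord y w + \<beta> * unit_coord z w) *\<^sub>R w)"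
      using sum_unit_coord_scaleR[OF X(1,2)] sum_unit_coord_scaleR[OF X(1,3)]
      by (simp only: scaleR_add_left sum.distrib flip: scaleR_scaleR scaleR_sum_right)
    ultimately show "(x(k := \<alpha> *\<^sub>R y + \<beta> *\<^sub>R z)) i = (\<Sum>w\<in>X. (a(k := (\<lambda>j. \<Sum>b\<in>UNIV. (if b then \<alpha> else \<beta>) * unit_coord (if b then y else z) j))) i w *\<^sub>R w)"
      using sum_unit_coord_scaleR[OF X(1) X(4)[of i]] by (auto simp: UNIV_bool a_def add.commute)
  qed
  also have "\<dots> = (\<Sum>b\<in>UNIV. (if b then \<alpha> else \<beta>) * polar d q (a(k := unit_coord (if b then y else z))))"
    by (rule polar_linear_slot[OF q(1) X(1) k]) simp
  finally have lin: "vpolar d P (x(k := \<alpha> *\<^sub>R y + \<beta> *\<^sub>R z)) = \<dots>" .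
  have "polar d q (a(k := unit_coord w)) = vpolar d P (x(k := w))" if "w \<in> X" for w
  proof -
    have "a(k := unit_coord w) = (\<lambda>i. unit_coord ((x(k := w)) i))" by (auto simp: a_def)
    then show ?thesis using vpolar_unit_coordinates[where P=P and X=X, OF q(2) X(1), of d "x(k := w)"] X(4) that by simp
  qed
  then have "(\<Sum>b\<in>UNIV. (if b then \<alpha> else \<beta>) * polar d q (a(k := unit_coord (if b then y else z))))
      = \<alpha> * vpolar d P (x(k := y)) + \<beta> * vpolar d P (x(k := z))"
    using X by (simp add: UNIV_bool)
  with lin show ?thesis by simp
qed

lemma vpolar_deriv:
  assumes P: "polynomial_form d P" and m: "Suc m \<le> d"
  shows "((\<lambda>r. vpolar d P (\<lambda>k. if k < Suc m then s + r *\<^sub>R u else x k)) has_real_derivative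
    real (Suc m) * vpolar d P (\<lambda>k. if k < m then s else if k = m then u else x k)) (at 0)"
proof -
  define X where "X = x ` {..<d} \<union> {s, u}"
  have X: "finite X" "s \<in> X" "u \<in> X" "\<And>i. i < d \<Longrightarrow> x i \<in> X" by (auto simp: X_def)
  obtain q where q: "hform d X q" "\<And>t. P (\<Sum>y\<in>X. t y *\<^sub>R y) = q t"
    using P X(1) unfolding polynomial_form_def by blast
  note coord = sum_unit_coord_scaleR[OF X(1,2)] sum_unit_coord_scaleR[OF X(1,3)] sum_unit_coord_scaleR[OF X(1) X(4)]
  have su: "s + r *\<^sub>R u = (\<Sum>w\<in>X. (unit_coord s w + r * unit_coord u w) *\<^sub>R w)" for r
    using coord(1,2) by (simp only: scaleR_add_left sum.distrib flip: scaleR_scaleR scaleR_sum_right)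
  have 1: "vpolar d P (\<lambda>k. if k < Suc m then s + r *\<^sub>R u else x k)
      = polar d q (\<lambda>k. if k < Suc m then (\<lambda>j. unit_coord s j + r * unit_coord u j) else unit_coord (x k))" for r
    by (rule vpolar_coordinates[where P=P and X=X, OF q(2)]) (auto simp: su coord)
  have 2: "vpolar d P (\<lambda>k. if k < m then s else if k = m then u else x k)
      = polar d q (\<lambda>k. if k < m then (\<lambda>j. unit_coord s j + 0 * unit_coord u j) else if k = m then unit_coord u else unit_coord (x k))"
    by (rule vpolar_coordinates[where P=P and X=X, OF q(2)]) (auto simp: coord)
  show ?thesis unfolding 1 2 by (rule polar_partial_deriv[OF q(1) X(1) m])
qed

lemma vpolar_diag:
  assumes "polynomial_form d P" shows "vpolar d P (\<lambda>_. y) = fact d * P y"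
proof -
  obtain q where q: "hform d {y} q" "\<And>t. P (\<Sum>y\<in>{y}. t y *\<^sub>R y) = q t"
    using assms unfolding polynomial_form_def by blast
  have "vpolar d P (\<lambda>_. y) = polar d q (\<lambda>_. unit_coord y)" by (rule vpolar_unit_coordinates[where P=P and X="{y}", OF q(2)]) auto
  also have "\<dots> = fact d * q (unit_coord y)" by (rule polar_diag[OF q(1)]) simp
  also have "q (unit_coord y) = P y" using q(2)[of "unit_coord y"] by (simp add: unit_coord_def)
  finally show ?thesis .
qed

text \<open>\<open>foldr\<close> applies the last direction first, so the directions occupy the last
  slots in their order and each new one takes the slot just before them. With \<open>d\<close>
  directions the base point has disappeared.\<close>

lemma iterated_dir_deriv:
  assumes P: "polynomial_form d P" and "length xs \<le> d"
  shows "foldr dir_deriv xs P y = vpolar d P (\<lambda>i. if i < d - length xs then y else xs ! (i - (d - length xs))) / fact (d - length xs)"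
  using assms(2)
proof (induction xs arbitrary: y)
  case Nil
  have "vpolar d P (\<lambda>i. if i < d - length ([] :: 'a list) then y else [] ! (i - (d - length ([] :: 'a list)))) = vpolar d P (\<lambda>_. y)"
    unfolding vpolar_def by (intro sum.cong refl arg_cong2[where f="(*)"] arg_cong[where f=P]) auto
  then show ?case using vpolar_diag[OF P, of y] by simp
next
  case (Cons u xs)
  define m where "m = d - Suc (length xs)"
  have m: "d - length xs = Suc m" "Suc m \<le> d" using Cons.prems by (auto simp: m_def)
  let ?x = "\<lambda>i. xs ! (i - Suc m)"
  have IH: "foldr dir_deriv xs P z = vpolar d P (\<lambda>i. if i < Suc m then z else ?x i) / fact (Suc m)" for z
    using Cons.IH[of z] Cons.prems unfolding m(1) by simp
  have "foldr dir_deriv (u # xs) P y = deriv (\<lambda>r. vpolar d P (\<lambda>i. if i < Suc m then y + r *\<^sub>R u else ?x i) / fact (Suc m)) 0"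
    by (simp only: foldr.simps comp_def dir_deriv_def IH)
  also have "\<dots> = real (Suc m) * vpolar d P (\<lambda>k. if k < m then y else if k = m then u else ?x k) / fact (Suc m)"
    by (rule DERIV_imp_deriv, rule DERIV_cdivide, rule vpolar_deriv[OF P m(2)])
  also have "\<dots> = vpolar d P (\<lambda>k. if k < m then y else if k = m then u else ?x k) / fact m"
    by (simp add: field_simps del: of_nat_Suc)
  also have "(\<lambda>k. if k < m then y else if k = m then u else ?x k) = (\<lambda>k. if k < m then y else (u # xs) ! (k - m))"
  proof
    fix k
    have "k - m = Suc (k - Suc m)" if "k > m" using that by simp
    then show "(if k < m then y else if k = m then u else ?x k) = (if k < m then y else (u # xs) ! (k - m))"
      by (cases k m rule: linorder_cases) auto
  qed
  finally show ?case unfolding m_def length_Cons .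
qed

section \<open>Polynomial extension from a finitely open set\<close>

lemma finitely_open_line:
  assumes op: "finitely_open \<Omega>" and w: "w \<in> \<Omega>"
  shows "\<exists>\<epsilon>>0. \<forall>r. \<bar>r\<bar> < \<epsilon> \<longrightarrow> w + r *\<^sub>R x \<in> \<Omega>"
proof (cases "x = 0")
  case True
  then show ?thesis using w by (intro exI[of _ 1]) simp
next
  case False
  let ?T = "product_topology (\<lambda>_. euclideanreal) {x}"
  have "finite {x} \<and> independent {x}" using False by (simp add: dependent_single)
  then have "openin ?T {t \<in> {x} \<rightarrow>\<^sub>E UNIV. w + (\<Sum>b\<in>{x}. t b *\<^sub>R b) \<in> \<Omega>}"
    by (rule op[unfolded finitely_open_def, THEN spec, THEN spec, THEN mp])
  moreover have "continuous_map euclideanreal ?T (\<lambda>r. restrict (\<lambda>_. r) {x})"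
    unfolding continuous_map_componentwise by (simp add: image_subset_iff)
  ultimately have "openin euclideanreal {r \<in> topspace euclideanreal. restrict (\<lambda>_. r) {x} \<in> {t \<in> {x} \<rightarrow>\<^sub>E UNIV. w + (\<Sum>b\<in>{x}. t b *\<^sub>R b) \<in> \<Omega>}}"
    by (rule openin_continuous_map_preimage[rotated])
  then have op': "open {r. w + r *\<^sub>R x \<in> \<Omega>}" by simp
  have "0 \<in> {r. w + r *\<^sub>R x \<in> \<Omega>}" using w by simp
  then obtain \<epsilon> where \<epsilon>: "\<epsilon> > 0" "ball 0 \<epsilon> \<subseteq> {r. w + r *\<^sub>R x \<in> \<Omega>}" by (rule openE[OF op'])
  have "w + r *\<^sub>R x \<in> \<Omega>" if "\<bar>r\<bar> < \<epsilon>" for r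
    using subsetD[OF \<epsilon>(2), of r] that by (simp add: dist_norm)
  then show ?thesis using \<epsilon>(1) by blast
qed

text \<open>Agreement is asked only where the family law speaks: nonnegative weights, not all zero,
  with the combination in \<open>\<Omega>\<close>. Other values of the form are then forced by
  continuation along lines.\<close>

definition interpolates :: "'v::real_vector set \<Rightarrow> ('v \<Rightarrow> real) \<Rightarrow> nat \<Rightarrow> 'v set \<Rightarrow> (('v \<Rightarrow> real) \<Rightarrow> real) \<Rightarrow> bool" where
  "interpolates \<Omega> f d J p \<longleftrightarrow> hform d J p \<and>
     (\<forall>s. (\<forall>j\<in>J. s j \<ge> 0) \<and> sum s J > 0 \<and> (\<Sum>j\<in>J. s j *\<^sub>R j) \<in> \<Omega> \<longrightarrow> p s = f (\<Sum>j\<in>J. s j *\<^sub>R j))"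

text \<open>Dividing by \<open>r\<close> leaves the weights \<open>e j + s j / r\<close>,
  nonnegative for large \<open>r\<close> because \<open>e j > 0\<close> wherever \<open>s j\<close>
  is nonzero, and the point \<open>y + (1 / r) *\<^sub>R x\<close>, which is in
  \<open>\<Omega>\<close> by openness.\<close>

lemma interpolates_line:
  assumes op: "finitely_open \<Omega>" and p: "interpolates \<Omega> f d J p" and J: "finite J"
    and y: "y = (\<Sum>j\<in>J. e j *\<^sub>R j)" "y \<in> \<Omega>" and x: "x = (\<Sum>j\<in>J. s j *\<^sub>R j)"
    and e: "\<And>j. j \<in> J \<Longrightarrow> e j \<ge> 0 \<and> (s j \<noteq> 0 \<longrightarrow> e j > 0)" "sum e J > 0"
  shows "\<exists>K. \<forall>r>K. p (\<lambda>j. r * e j + s j) = r ^ d * f (y + (1 / r) *\<^sub>R x)"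
proof -
  obtain \<epsilon> where \<epsilon>: "\<epsilon> > 0" "\<And>r. \<bar>r\<bar> < \<epsilon> \<Longrightarrow> y + r *\<^sub>R x \<in> \<Omega>" using finitely_open_line[OF op y(2), of x] by auto
  have "\<forall>\<^sub>F r in at_right 0. \<forall>j\<in>J. e j + r * s j \<ge> 0"
  proof (intro eventually_ball_finite J ballI)
    fix j assume j: "j \<in> J"
    show "\<forall>\<^sub>F r in at_right 0. e j + r * s j \<ge> 0"
    proof (cases "s j = 0")
      case False
      have "((\<lambda>r. e j + r * s j) \<longlongrightarrow> e j + 0 * s j) (at_right 0)" by (intro tendsto_intros)
      then have "\<forall>\<^sub>F r in at_right 0. e j + r * s j > 0" using e(1)[OF j] False by (intro order_tendstoD(1)) auto
      then show ?thesis by eventually_elim simp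
    qed (use e(1)[OF j] in simp)
  qed
  moreover have "((\<lambda>r. \<Sum>j\<in>J. e j + r * s j) \<longlongrightarrow> (\<Sum>j\<in>J. e j + 0 * s j)) (at_right 0)" by (intro tendsto_intros)
  then have "\<forall>\<^sub>F r in at_right 0. (\<Sum>j\<in>J. e j + r * s j) > 0" using e(2) by (intro order_tendstoD(1)) auto
  moreover have "\<forall>\<^sub>F r in at_right 0. r < \<epsilon>" using \<epsilon>(1) unfolding eventually_at_right_field by blast
  ultimately have "\<forall>\<^sub>F r in at_right 0. (\<forall>j\<in>J. e j + r * s j \<ge> 0) \<and> (\<Sum>j\<in>J. e j + r * s j) > 0 \<and> r < \<epsilon>"
    by (intro eventually_conj)
  then obtain b where b: "b > 0" "\<And>r. 0 < r \<Longrightarrow> r < b \<Longrightarrow> (\<forall>j\<in>J. e j + r * s j \<ge> 0) \<and> (\<Sum>j\<in>J. e j + r * s j) > 0 \<and> r < \<epsilon>"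
    unfolding eventually_at_right_field by blast
  show ?thesis
  proof (intro exI[of _ "1 / b"] allI impI)
    fix r assume r: "r > 1 / b"
    then have r0: "r > 0" using b(1) order_less_trans[of 0 "1 / b" r] by simp
    then have "0 < 1 / r" "1 / r < b" using r b(1) by (auto simp: field_simps)
    note small = b(2)[OF this]
    have eq: "(\<Sum>j\<in>J. (e j + (1 / r) * s j) *\<^sub>R j) = y + (1 / r) *\<^sub>R x"
      by (simp only: y(1) x scaleR_add_left sum.distrib scaleR_sum_right scaleR_scaleR)
    have "y + (1 / r) *\<^sub>R x \<in> \<Omega>" using small r0 by (intro \<epsilon>(2)) simp
    then have "p (\<lambda>j. e j + (1 / r) * s j) = f (\<Sum>j\<in>J. (e j + (1 / r) * s j) *\<^sub>R j)"
      using small eq by (intro p[unfolded interpolates_def, THEN conjunct2, THEN spec, THEN mp] conjI) auto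
    then have "p (\<lambda>j. e j + (1 / r) * s j) = f (y + (1 / r) *\<^sub>R x)" by (simp only: eq)
    moreover have "p (\<lambda>j. r * (e j + (1 / r) * s j)) = r ^ d * p (\<lambda>j. e j + (1 / r) * s j)"
      using p hform_scale[of d J p r "\<lambda>j. e j + (1 / r) * s j"] unfolding interpolates_def by blast
    moreover have "(\<lambda>j. r * (e j + (1 / r) * s j)) = (\<lambda>j. r * e j + s j)" using r0 by (auto simp: field_simps)
    ultimately show "p (\<lambda>j. r * e j + s j) = r ^ d * f (y + (1 / r) *\<^sub>R x)" by simp
  qed
qed

text \<open>Both values are those of the polynomials \<open>p (r e + s)\<close> and \<open>p' (r e' + s')\<close> in \<open>r\<close> at \<open>0\<close>, which
  agree for large \<open>r\<close>, where the argument is a positive multiple of a point of \<open>\<Omega>\<close>.\<close>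

lemma interpolates_agree:
  assumes op: "finitely_open \<Omega>" and p: "interpolates \<Omega> f d J p" "interpolates \<Omega> f d J' p'" and J: "finite J" "finite J'"
    and y: "(\<Sum>j\<in>J. e j *\<^sub>R j) \<in> \<Omega>" "(\<Sum>j\<in>J'. e' j *\<^sub>R j) = (\<Sum>j\<in>J. e j *\<^sub>R j)"
    and x: "(\<Sum>j\<in>J'. s' j *\<^sub>R j) = (\<Sum>j\<in>J. s j *\<^sub>R j)"
    and e: "\<And>j. j \<in> J \<Longrightarrow> e j \<ge> 0 \<and> (s j \<noteq> 0 \<longrightarrow> e j > 0)" "sum e J > 0"
    and e': "\<And>j. j \<in> J' \<Longrightarrow> e' j \<ge> 0 \<and> (s' j \<noteq> 0 \<longrightarrow> e' j > 0)" "sum e' J' > 0"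
  shows "p s = p' s'"
proof -
  obtain K where K: "\<And>r. r > K \<Longrightarrow> p (\<lambda>j. r * e j + s j) = r ^ d * f ((\<Sum>j\<in>J. e j *\<^sub>R j) + (1 / r) *\<^sub>R (\<Sum>j\<in>J. s j *\<^sub>R j))"
    using interpolates_line[OF op p(1) J(1) refl y(1) refl e] by blast
  obtain K' where K': "\<And>r. r > K' \<Longrightarrow> p' (\<lambda>j. r * e' j + s' j) = r ^ d * f ((\<Sum>j\<in>J. e j *\<^sub>R j) + (1 / r) *\<^sub>R (\<Sum>j\<in>J. s j *\<^sub>R j))"
    using interpolates_line[OF op p(2) J(2) y(2)[symmetric] y(1) x[symmetric] e'] by blast
  obtain q where q: "\<And>r. p (\<lambda>j. r * e j + s j) = poly q r"
    using hform_line[of d J p e s] p(1) unfolding interpolates_def by auto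
  obtain q' where q': "\<And>r. p' (\<lambda>j. r * e' j + s' j) = poly q' r"
    using hform_line[of d J' p' e' s'] p(2) unfolding interpolates_def by auto
  have "q = q'" by (rule poly_eq_if_eq_large[of "max K K'"]) (simp add: K K' flip: q q')
  then show ?thesis using q[of 0] q'[of 0] by simp
qed

lemma interior_coefficients:
  assumes op: "finitely_open \<Omega>" and J: "finite J" "w \<in> J" "J \<subseteq> \<Omega>"
  shows "\<exists>e. (\<forall>j\<in>J. e j > 0) \<and> (\<Sum>j\<in>J. e j *\<^sub>R j) \<in> \<Omega>"
proof -
  obtain \<epsilon> where \<epsilon>: "\<epsilon> > 0" "\<And>r. \<bar>r\<bar> < \<epsilon> \<Longrightarrow> w + r *\<^sub>R (\<Sum>j\<in>J. j) \<in> \<Omega>"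
    using finitely_open_line[OF op, of w "\<Sum>j\<in>J. j"] J by auto
  show ?thesis
  proof (intro exI[of _ "\<lambda>j. unit_coord w j + \<epsilon> / 2"] conjI ballI)
    show "unit_coord w j + \<epsilon> / 2 > 0" for j using \<epsilon>(1) by (simp add: unit_coord_def)
    have "(\<Sum>j\<in>J. (unit_coord w j + \<epsilon> / 2) *\<^sub>R j) = w + (\<epsilon> / 2) *\<^sub>R (\<Sum>j\<in>J. j)"
      using sum_unit_coord_scaleR[OF J(1,2)] by (simp add: scaleR_add_left sum.distrib scaleR_sum_right)
    then show "(\<Sum>j\<in>J. (unit_coord w j + \<epsilon> / 2) *\<^sub>R j) \<in> \<Omega>" using \<epsilon> by simp
  qed
qed

text \<open>Both forms are compared with \<open>r\<close> on the union after extending weights by 0,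
  and two weight vectors of the same point are compared within \<open>r\<close>. Extension by 0 is
  the reason why \<open>e\<close> has to be positive only where \<open>s\<close> is nonzero.\<close>

lemma interpolates_consistent:
  assumes op: "finitely_open \<Omega>" and J: "finite J" "w \<in> J" "J \<subseteq> \<Omega>" and J': "finite J'" "w \<in> J'" "J' \<subseteq> \<Omega>"
    and p: "interpolates \<Omega> f d J p" "interpolates \<Omega> f d J' p'" and r: "interpolates \<Omega> f d (J \<union> J') r"
    and x: "(\<Sum>j\<in>J. s j *\<^sub>R j) = (\<Sum>j\<in>J'. s' j *\<^sub>R j)"
  shows "p s = p' s'"
proof -
  let ?K = "J \<union> J'"
  have ext_sum: "(\<Sum>j\<in>?K. (if j \<in> I then t j else 0) *\<^sub>R j) = (\<Sum>j\<in>I. t j *\<^sub>R j)"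
      "(\<Sum>j\<in>?K. (if j \<in> I then t j else 0)) = sum t I" if "I \<subseteq> ?K" for I t
    using that J(1) J'(1) by (auto intro!: sum.mono_neutral_cong_right)
  have ext: "q t = r (\<lambda>j. if j \<in> I then t j else 0)"
    if I: "finite I" "w \<in> I" "I \<subseteq> \<Omega>" "I \<subseteq> ?K" and q: "interpolates \<Omega> f d I q" for I q t
  proof -
    obtain e where e: "\<And>j. j \<in> I \<Longrightarrow> e j > 0" "(\<Sum>j\<in>I. e j *\<^sub>R j) \<in> \<Omega>" using interior_coefficients[OF op I(1-3)] by blast
    have "sum e I > 0" using I e by (intro sum_pos) auto
    then show ?thesis
      using I J(1) J'(1) e
      by (intro interpolates_agree[OF op q r, of e "\<lambda>j. if j \<in> I then e j else 0"])
        (auto simp: ext_sum less_imp_le)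
  qed
  obtain e where e: "\<And>j. j \<in> ?K \<Longrightarrow> e j > 0" "(\<Sum>j\<in>?K. e j *\<^sub>R j) \<in> \<Omega>"
    using interior_coefficients[OF op, of ?K w] J J' by blast
  have "sum e ?K > 0" using J J' e by (intro sum_pos) auto
  then have "r (\<lambda>j. if j \<in> J then s j else 0) = r (\<lambda>j. if j \<in> J' then s' j else 0)"
    using J J' e x by (intro interpolates_agree[OF op r r, of e e]) (auto simp: ext_sum less_imp_le)
  then show ?thesis using ext[OF J _ p(1), of s] ext[OF J' _ p(2), of s'] by simp
qed

text \<open>The value at a point is read off any form over a finite part of \<open>\<Omega>\<close>
  that contains \<open>w\<close> and spans the point; consistency removes the choice. The last
  conclusion keeps the local forms tied to \<open>P\<close>, so that positivity can be carried
  over.\<close>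

theorem polynomial_extension:
  fixes \<Omega> :: "'v::real_vector set"
  assumes op: "finitely_open \<Omega>" and w: "w \<in> \<Omega>"
    and forms: "\<And>J. finite J \<Longrightarrow> J \<subseteq> \<Omega> \<Longrightarrow> \<exists>p. interpolates \<Omega> f d J p"
  obtains P where "polynomial_form d P" "\<And>v. v \<in> \<Omega> \<Longrightarrow> P v = f v"
    "\<And>J p t. finite J \<Longrightarrow> w \<in> J \<Longrightarrow> J \<subseteq> \<Omega> \<Longrightarrow> interpolates \<Omega> f d J p \<Longrightarrow> P (\<Sum>j\<in>J. t j *\<^sub>R j) = p t"
proof -
  let ?rep = "\<lambda>x J s p. finite J \<and> w \<in> J \<and> J \<subseteq> \<Omega> \<and> interpolates \<Omega> f d J p \<and> x = (\<Sum>j\<in>J. s j *\<^sub>R j)"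
  define P where "P = (\<lambda>x. SOME r. \<exists>J s p. ?rep x J s p \<and> r = p s)"
  have P: "P (\<Sum>j\<in>J. t j *\<^sub>R j) = p t" if J: "finite J" "w \<in> J" "J \<subseteq> \<Omega>" and p: "interpolates \<Omega> f d J p" for J p t
    unfolding P_def
  proof (rule some_equality)
    show "\<exists>J' s p'. ?rep (\<Sum>j\<in>J. t j *\<^sub>R j) J' s p' \<and> p t = p' s" using J p by blast
    fix r assume "\<exists>J' s p'. ?rep (\<Sum>j\<in>J. t j *\<^sub>R j) J' s p' \<and> r = p' s"
    then obtain J' s p' where J': "finite J'" "w \<in> J'" "J' \<subseteq> \<Omega>" and p': "interpolates \<Omega> f d J' p'"
      and eq: "(\<Sum>j\<in>J. t j *\<^sub>R j) = (\<Sum>j\<in>J'. s j *\<^sub>R j)" and r: "r = p' s" by blast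
    obtain q where "interpolates \<Omega> f d (J \<union> J') q" using forms[of "J \<union> J'"] J J' by auto
    then show "r = p t" using interpolates_consistent[OF op J J' p p' _ eq] r by simp
  qed
  have "polynomial_form d P"
    unfolding polynomial_form_def
  proof (intro allI impI)
    fix X :: "'v set" assume X: "finite X"
    have "\<exists>\<epsilon>. \<epsilon> > 0 \<and> w + \<epsilon> *\<^sub>R x \<in> \<Omega>" for x
    proof -
      obtain \<epsilon> where "\<epsilon> > 0" "\<And>r. \<bar>r\<bar> < \<epsilon> \<Longrightarrow> w + r *\<^sub>R x \<in> \<Omega>" using finitely_open_line[OF op w, of x] by blast
      then show ?thesis by (intro exI[of _ "\<epsilon> / 2"]) auto
    qed
    then obtain \<epsilon> where "\<forall>x. \<epsilon> x > 0 \<and> w + \<epsilon> x *\<^sub>R x \<in> \<Omega>"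
      using choice[of "\<lambda>x \<epsilon>. \<epsilon> > 0 \<and> w + \<epsilon> *\<^sub>R x \<in> \<Omega>"] by blast
    then have \<epsilon>: "\<And>x. \<epsilon> x > 0" "\<And>x. w + \<epsilon> x *\<^sub>R x \<in> \<Omega>" by auto
    define J where "J = insert w ((\<lambda>x. w + \<epsilon> x *\<^sub>R x) ` X)"
    have J: "finite J" "w \<in> J" "J \<subseteq> \<Omega>" using X w \<epsilon>(2) by (auto simp: J_def)
    obtain p where p: "interpolates \<Omega> f d J p" using forms J by blast
    \<comment> \<open>Coordinates of \<open>x\<close> over \<open>J\<close>: the difference of the
      two members \<open>w + \<epsilon> x *\<^sub>R x\<close> and \<open>w\<close>, divided by
      \<open>\<epsilon> x\<close>.\<close>
    define a where "a = (\<lambda>x j. (1 / \<epsilon> x) * (unit_coord (w + \<epsilon> x *\<^sub>R x) j - unit_coord w j))"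
    have a: "(\<Sum>j\<in>J. a x j *\<^sub>R j) = x" if "x \<in> X" for x
    proof -
      have "w + \<epsilon> x *\<^sub>R x \<in> J" using that by (auto simp: J_def)
      then have "(\<Sum>j\<in>J. (unit_coord (w + \<epsilon> x *\<^sub>R x) j - unit_coord w j) *\<^sub>R j) = \<epsilon> x *\<^sub>R x"
        by (simp add: scaleR_diff_left sum_subtractf sum_unit_coord_scaleR[OF J(1)] J(2))
      then have "(\<Sum>j\<in>J. a x j *\<^sub>R j) = (1 / \<epsilon> x) *\<^sub>R (\<epsilon> x *\<^sub>R x)"
        unfolding a_def by (simp only: flip: scaleR_scaleR scaleR_sum_right)
      then show ?thesis using \<epsilon>(1)[of x] by simp
    qed
    have "P (\<Sum>x\<in>X. t x *\<^sub>R x) = p (\<lambda>j. \<Sum>x\<in>X. t x * a x j)" for t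
    proof -
      have "(\<Sum>x\<in>X. t x *\<^sub>R x) = (\<Sum>x\<in>X. t x *\<^sub>R (\<Sum>j\<in>J. a x j *\<^sub>R j))" by (intro sum.cong refl) (simp add: a)
      also have "\<dots> = (\<Sum>x\<in>X. \<Sum>j\<in>J. (t x * a x j) *\<^sub>R j)" by (simp add: scaleR_sum_right)
      also have "\<dots> = (\<Sum>j\<in>J. (\<Sum>x\<in>X. t x * a x j) *\<^sub>R j)" by (subst sum.swap) (simp add: scaleR_sum_left)
      finally show ?thesis using P[OF J p] by simp
    qed
    moreover have "hform d X (\<lambda>t. p (\<lambda>j. \<Sum>x\<in>X. t x * a x j))"
      using p J X by (intro hform_compose) (auto simp: interpolates_def)
    ultimately show "\<exists>q. hform d X q \<and> (\<forall>t. P (\<Sum>x\<in>X. t x *\<^sub>R x) = q t)" by blast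
  qed
  moreover have "P v = f v" if v: "v \<in> \<Omega>" for v
  proof -
    obtain p where p: "interpolates \<Omega> f d {w, v} p" using forms[of "{w, v}"] v w by auto
    have eq: "(\<Sum>j\<in>{w, v}. unit_coord v j *\<^sub>R j) = v" by (rule sum_unit_coord_scaleR) auto
    have "sum (unit_coord v) {w, v} = 1" by (rule sum_unit_coord) auto
    moreover have "unit_coord v j \<ge> 0" for j by (simp add: unit_coord_def)
    ultimately have "p (unit_coord v) = f (\<Sum>j\<in>{w, v}. unit_coord v j *\<^sub>R j)"
      using eq v by (intro p[unfolded interpolates_def, THEN conjunct2, THEN spec, THEN mp] conjI ballI) simp_all
    then have "p (unit_coord v) = f v" by (simp only: eq)
    moreover have "P (\<Sum>j\<in>{w, v}. unit_coord v j *\<^sub>R j) = p (unit_coord v)" by (rule P) (use p v w in auto)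
    ultimately show ?thesis by (simp only: eq)
  qed
  ultimately show thesis using P by (intro that[of P])
qed

text \<open>For large \<open>r\<close> the point \<open>r *\<^sub>R w + x\<close> is a positive
  multiple of a point of \<open>\<Omega>\<close>, so two polynomials in \<open>r\<close> agree for
  large \<open>r\<close> and hence at 0.\<close>

lemma polynomial_form_unique:
  assumes op: "finitely_open \<Omega>" and w: "w \<in> \<Omega>" and P: "polynomial_form d P" "polynomial_form d P'"
    and eq: "\<And>v. v \<in> \<Omega> \<Longrightarrow> P v = P' v"
  shows "P = P'"
proof
  fix x
  obtain \<epsilon> where \<epsilon>: "\<epsilon> > 0" "\<And>r. \<bar>r\<bar> < \<epsilon> \<Longrightarrow> w + r *\<^sub>R x \<in> \<Omega>" using finitely_open_line[OF op w, of x] by blast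
  obtain q where q: "\<And>r. P (r *\<^sub>R w + x) = poly q r" using polynomial_form_line[OF P(1), of w x] by auto
  obtain q' where q': "\<And>r. P' (r *\<^sub>R w + x) = poly q' r" using polynomial_form_line[OF P(2), of w x] by auto
  have "q = q'"
  proof (rule poly_eq_if_eq_large)
    fix r assume r: "r > 1 / \<epsilon>"
    then have r0: "r > 0" using \<epsilon>(1) order_less_trans[of 0 "1 / \<epsilon>" r] by simp
    then have "1 / r < \<epsilon>" using r \<epsilon>(1) by (auto simp: field_simps)
    then have "w + (1 / r) *\<^sub>R x \<in> \<Omega>" using r0 by (intro \<epsilon>(2)) simp
    moreover have "r *\<^sub>R w + x = r *\<^sub>R (w + (1 / r) *\<^sub>R x)" using r0 by (simp add: scaleR_add_right)
    ultimately have "P (r *\<^sub>R w + x) = P' (r *\<^sub>R w + x)" using eq P by (simp add: polynomial_form_scale)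
    then show "poly q r = poly q' r" by (simp add: q q')
  qed
  then show "P x = P' x" using q[of 0] q'[of 0] by simp
qed

section \<open>Linear families of coconvex bodies\<close>

lemma coconvex_set_nonempty:
  assumes "pointed_cone C" "coconvex_set C D" shows "D \<noteq> {}"
  using pointed_cone_unbounded[OF assms(1)] assms(2) by (auto simp: coconvex_set_def cofinite_convex_def)

text \<open>The apex stays outside: if elements of a pointed cone add up to 0, each of them is 0, so
  a summand with positive weight would be the apex.\<close>

lemma coconvex_set_msum:
  fixes C :: "'a::euclidean_space set"
  assumes C: "pointed_cone C" and dim: "DIM('a) \<ge> 2" and J: "finite J"
    and D: "\<And>j. j \<in> J \<Longrightarrow> coconvex_set C (D j)" and s: "\<And>j. j \<in> J \<Longrightarrow> s j \<ge> 0" "sum s J > 0"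
  shows "coconvex_set C (msum J s D)"
proof -
  have "0 \<notin> msum J s D"
  proof
    assume "0 \<in> msum J s D"
    then obtain x where x: "\<And>j. j \<in> J \<Longrightarrow> x j \<in> D j" "(\<Sum>j\<in>J. s j *\<^sub>R x j) = 0" by (auto simp: msum_def)
    have "\<exists>k\<in>J. s k \<noteq> 0" using s(2) by (metis sum.neutral less_irrefl)
    then obtain k where k: "k \<in> J" "s k \<noteq> 0" by blast
    have inC: "s j *\<^sub>R x j \<in> C" if "j \<in> J" for j
      using x(1)[OF that] D[OF that] s(1)[OF that] by (intro pointed_coneD(6)[OF C]) (auto simp: coconvex_set_def cofinite_convex_def)
    have "(\<Sum>j\<in>I. s j *\<^sub>R x j) \<in> C" if "I \<subseteq> J" for I
      using finite_subset[OF that J] that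
      by (induction I rule: finite_induct) (auto intro: pointed_coneD(7,8)[OF C] inC)
    then have "(\<Sum>j\<in>J - {k}. s j *\<^sub>R x j) \<in> C" by blast
    moreover have "s k *\<^sub>R x k + (\<Sum>j\<in>J - {k}. s j *\<^sub>R x j) = 0" using x(2) sum.remove[OF J k(1), of "\<lambda>j. s j *\<^sub>R x j"] by simp
    then have "- (s k *\<^sub>R x k) = (\<Sum>j\<in>J - {k}. s j *\<^sub>R x j)" by (rule minus_unique)
    ultimately have "- (s k *\<^sub>R x k) \<in> C" by simp
    then have "s k *\<^sub>R x k = 0" by (intro pointed_coneD(5)[OF C] inC k)
    then have "0 \<in> D k" using k x(1)[OF k(1)] by simp
    then show False using D[OF k(1)] by (simp add: coconvex_set_def)
  qed
  moreover have "cofinite_convex C (msum J s D)"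
    by (rule cofinite_convex_msum[OF C dim J]) (use D s in \<open>auto simp: coconvex_set_def\<close>)
  ultimately show ?thesis by (simp add: coconvex_set_def)
qed

lemma coconvex_set_scale:
  assumes "pointed_cone C" "coconvex_set C D" "r > 0"
  shows "coconvex_set C ((\<lambda>x. r *\<^sub>R x) ` D)"
    and "(\<lambda>x. r *\<^sub>R x) ` (C - (D \<union> {0})) = C - ((\<lambda>x. r *\<^sub>R x) ` D \<union> {0})"
  using assms cofinite_convex_scale[OF assms(1) _ assms(3)] pointed_cone_scale[OF assms(1,3), of "D \<union> {0}"]
  by (auto simp: coconvex_set_def image_Un)

lemma msumI: "y = (\<Sum>j\<in>J. s j *\<^sub>R x j) \<Longrightarrow> \<forall>j\<in>J. x j \<in> B j \<Longrightarrow> y \<in> msum J s B"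
  unfolding msum_def by blast

lemma msum_insert:
  assumes "finite J" "k \<notin> J"
  shows "msum (insert k J) s B = msum J s B + (\<lambda>x. s k *\<^sub>R x) ` B k"
proof (intro subset_antisym subsetI)
  fix y assume "y \<in> msum (insert k J) s B"
  then obtain x where x: "\<forall>j\<in>insert k J. x j \<in> B j" "y = (\<Sum>j\<in>insert k J. s j *\<^sub>R x j)" by (auto simp: msum_def)
  then have "y = (\<Sum>j\<in>J. s j *\<^sub>R x j) + s k *\<^sub>R x k" using assms by (simp add: add.commute)
  moreover have "(\<Sum>j\<in>J. s j *\<^sub>R x j) \<in> msum J s B" using x(1) by (auto simp: msum_def)
  ultimately show "y \<in> msum J s B + (\<lambda>x. s k *\<^sub>R x) ` B k" using x(1) by auto
next
  fix y assume "y \<in> msum J s B + (\<lambda>x. s k *\<^sub>R x) ` B k"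
  then obtain x z where x: "\<forall>j\<in>J. x j \<in> B j" "z \<in> B k" "y = (\<Sum>j\<in>J. s j *\<^sub>R x j) + s k *\<^sub>R z"
    by (auto simp: msum_def elim!: set_plus_elim)
  have "(\<Sum>j\<in>J. s j *\<^sub>R (x(k := z)) j) = (\<Sum>j\<in>J. s j *\<^sub>R x j)" using assms(2) by (intro sum.cong) auto
  then have "y = (\<Sum>j\<in>insert k J. s j *\<^sub>R (x(k := z)) j)" using assms x(3) by (simp add: add.commute)
  moreover have "\<forall>j\<in>insert k J. (x(k := z)) j \<in> B j" using x(1,2) by auto
  ultimately show "y \<in> msum (insert k J) s B" unfolding msum_def by blast
qed

text \<open>Each partial sum is again coconvex, so \<open>coconvex_delta\<close> recovers its
  Minkowski sum and the next summand can be added.\<close>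

lemma coconvex_sum_eq:
  fixes C :: "'a::euclidean_space set"
  assumes C: "pointed_cone C" and dim: "DIM('a) \<ge> 2"
    and E: "\<And>i. i \<le> n \<Longrightarrow> coconvex_set C (E i)" "\<And>i. i \<le> n \<Longrightarrow> F i = C - (E i \<union> {0})"
  shows "coconvex_sum C F n = C - (msum {..n} (\<lambda>_. 1) E \<union> {0})"
  using E
proof (induction n)
  case 0
  have "msum {..0::nat} (\<lambda>_. 1) E = E 0" by (auto simp: msum_def intro!: exI[of _ "\<lambda>_. _"])
  then show ?case using 0 by simp
next
  case (Suc n)
  have set: "coconvex_set C (msum {..n} (\<lambda>_. 1) E)"
    by (rule coconvex_set_msum[OF C dim]) (use Suc.prems(1) in auto)
  have "coconvex_sum C F n = C - (msum {..n} (\<lambda>_. 1) E \<union> {0})" using Suc by simp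
  moreover have "F (Suc n) = C - (E (Suc n) \<union> {0})" using Suc.prems by simp
  moreover have "coconvex_delta C (C - (E (Suc n) \<union> {0})) = E (Suc n)"
    by (intro coconvex_delta_eq C Suc.prems(1)) simp
  moreover have "msum {..Suc n} (\<lambda>_. 1) E = msum {..n} (\<lambda>_. 1) E + E (Suc n)"
    using msum_insert[of "{..n}" "Suc n" "\<lambda>_. 1" E] by (simp add: atMost_Suc)
  ultimately show ?case using coconvex_delta_eq[OF C set] by (simp add: coconvex_add_def)
qed

lemma msum_reindex:
  assumes h: "bij_betw h I J"
  shows "msum I (\<lambda>_. 1) (\<lambda>i. (\<lambda>x. s (h i) *\<^sub>R x) ` B (h i)) = msum J s B"
proof (intro subset_antisym subsetI)
  fix y assume "y \<in> msum I (\<lambda>_. 1) (\<lambda>i. (\<lambda>x. s (h i) *\<^sub>R x) ` B (h i))"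
  then obtain x where x: "\<forall>i\<in>I. x i \<in> (\<lambda>x. s (h i) *\<^sub>R x) ` B (h i)" "y = (\<Sum>i\<in>I. x i)" by (auto simp: msum_def)
  from x(1) have "\<forall>i\<in>I. \<exists>z. z \<in> B (h i) \<and> x i = s (h i) *\<^sub>R z" by blast
  then obtain z where z: "\<forall>i\<in>I. z i \<in> B (h i) \<and> x i = s (h i) *\<^sub>R z i" by (rule bchoice[THEN exE])
  let ?z = "\<lambda>j. z (inv_into I h j)"
  have inv: "inv_into I h (h i) = i" if "i \<in> I" for i using h that by (simp add: bij_betw_def)
  have "(\<Sum>j\<in>J. s j *\<^sub>R ?z j) = (\<Sum>i\<in>I. s (h i) *\<^sub>R ?z (h i))" by (rule sum.reindex_bij_betw[OF h, symmetric])
  also have "\<dots> = y" unfolding x(2) using z inv by (intro sum.cong) auto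
  finally have "y = (\<Sum>j\<in>J. s j *\<^sub>R ?z j)" ..
  moreover have "\<forall>j\<in>J. ?z j \<in> B j" using z inv h by (auto simp: bij_betw_def)
  ultimately show "y \<in> msum J s B" by (rule msumI)
next
  fix y assume "y \<in> msum J s B"
  then obtain z where z: "\<forall>j\<in>J. z j \<in> B j" "y = (\<Sum>j\<in>J. s j *\<^sub>R z j)" by (auto simp: msum_def)
  have "y = (\<Sum>i\<in>I. 1 *\<^sub>R (s (h i) *\<^sub>R z (h i)))" unfolding z(2) by (simp add: sum.reindex_bij_betw[OF h, symmetric])
  moreover have "\<forall>i\<in>I. s (h i) *\<^sub>R z (h i) \<in> (\<lambda>x. s (h i) *\<^sub>R x) ` B (h i)" using z(1) h by (auto simp: bij_betw_def)
  ultimately show "y \<in> msum I (\<lambda>_. 1) (\<lambda>i. (\<lambda>x. s (h i) *\<^sub>R x) ` B (h i))"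
    unfolding msum_def by (auto intro!: exI[of _ "\<lambda>i. s (h i) *\<^sub>R z (h i)"])
qed

text \<open>A nonempty set with weight 0 contributes only the zero vector.\<close>

lemma msum_support:
  assumes J: "finite J" "I \<subseteq> J" and s: "\<And>j. j \<in> J - I \<Longrightarrow> s j = 0" and B: "\<And>j. j \<in> J \<Longrightarrow> B j \<noteq> {}"
  shows "msum I s B = msum J s B"
proof (intro subset_antisym subsetI)
  have eq: "(\<Sum>j\<in>J. s j *\<^sub>R x j) = (\<Sum>j\<in>I. s j *\<^sub>R x j)" for x :: "'a \<Rightarrow> 'b"
    using J s by (intro sum.mono_neutral_right) auto
  fix y
  {
    assume "y \<in> msum I s B"
    then obtain x where x: "\<forall>j\<in>I. x j \<in> B j" "y = (\<Sum>j\<in>I. s j *\<^sub>R x j)" by (auto simp: msum_def)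
    have "\<forall>j\<in>J. \<exists>z. z \<in> B j" using B by blast
    then obtain b where b: "\<forall>j\<in>J. b j \<in> B j" by (rule bchoice[THEN exE])
    let ?x = "\<lambda>j. if j \<in> I then x j else b j"
    have "y = (\<Sum>j\<in>J. s j *\<^sub>R ?x j)" unfolding eq x(2) by (intro sum.cong) auto
    moreover have "\<forall>j\<in>J. ?x j \<in> B j" using x(1) b by auto
    ultimately show "y \<in> msum J s B" by (rule msumI)
  next
    assume "y \<in> msum J s B"
    then obtain x where "\<forall>j\<in>J. x j \<in> B j" "y = (\<Sum>j\<in>J. s j *\<^sub>R x j)" by (auto simp: msum_def)
    then show "y \<in> msum I s B" using J(2) unfolding eq msum_def by blast
  }
qed

lemma linear_family_delta:
  assumes "pointed_cone C" "linear_family C \<Omega> g" "v \<in> \<Omega>"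
  shows "coconvex_set C (coconvex_delta C (g v))" "g v = C - (coconvex_delta C (g v) \<union> {0})"
proof -
  have "coconvex_body C (g v)" using assms by (simp add: linear_family_def)
  then obtain D where D: "coconvex_set C D" "g v = C - (D \<union> {0})" using coconvex_body_iff[OF assms(1)] by blast
  moreover have "coconvex_delta C (g v) = D" unfolding D(2) by (rule coconvex_delta_eq[OF assms(1) D(1)])
  ultimately show "coconvex_set C (coconvex_delta C (g v))" "g v = C - (coconvex_delta C (g v) \<union> {0})" by simp_all
qed

text \<open>The family law speaks of strictly positive weights numbered from 0 to \<open>n\<close>;
  so the zero weights are dropped, the remaining points numbered, and the dropped ones put back at
  the end.\<close>

lemma linear_family_msum:
  fixes C :: "'a::euclidean_space set" and \<Omega> :: "'v::real_vector set"
  assumes C: "pointed_cone C" and dim: "DIM('a) \<ge> 2" and fam: "linear_family C \<Omega> g"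
    and J: "finite J" "J \<subseteq> \<Omega>" and s: "\<And>j. j \<in> J \<Longrightarrow> s j \<ge> 0" "sum s J > 0" and x: "(\<Sum>j\<in>J. s j *\<^sub>R j) \<in> \<Omega>"
  shows "coconvex_delta C (g (\<Sum>j\<in>J. s j *\<^sub>R j)) = msum J s (\<lambda>v. coconvex_delta C (g v))"
proof -
  let ?D = "\<lambda>v. coconvex_delta C (g v)"
  note D = linear_family_delta[OF C fam]
  define I where "I = {j \<in> J. s j > 0}"
  have I: "finite I" "I \<subseteq> J" "I \<noteq> {}"
  proof -
    show "finite I" "I \<subseteq> J" using J by (auto simp: I_def)
    show "I \<noteq> {}"
    proof
      assume "I = {}"
      then have "s j \<le> 0" if "j \<in> J" for j using that by (force simp: I_def not_less[symmetric])
      then have "sum s J \<le> 0" by (rule sum_nonpos)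
      then show False using s(2) by simp
    qed
  qed
  have s0: "s j = 0" if "j \<in> J - I" for j using that s(1)[of j] by (auto simp: I_def)
  obtain n where n: "card I = Suc n" using I by (metis card_0_eq not0_implies_Suc)
  obtain h where "bij_betw h {0..<card I} I" using ex_bij_betw_nat_finite[OF I(1)] by blast
  then have h: "bij_betw h {..n} I" by (simp add: n atLeast0LessThan lessThan_Suc_atMost)
  have hI: "h i \<in> \<Omega>" "s (h i) > 0" if "i \<le> n" for i
    using bij_betwE[OF h] that J(2) by (auto simp: I_def)
  have xs: "(\<Sum>j\<in>J. s j *\<^sub>R j) = (\<Sum>i\<le>n. s (h i) *\<^sub>R h i)"
  proof -
    have "(\<Sum>j\<in>J. s j *\<^sub>R j) = (\<Sum>j\<in>I. s j *\<^sub>R j)" using J I s0 by (intro sum.mono_neutral_right) auto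
    also have "\<dots> = (\<Sum>i\<le>n. s (h i) *\<^sub>R h i)" by (rule sum.reindex_bij_betw[OF h, symmetric])
    finally show ?thesis .
  qed
  let ?E = "\<lambda>i. (\<lambda>x. s (h i) *\<^sub>R x) ` ?D (h i)"
  have E: "coconvex_set C (?E i)" if "i \<le> n" for i by (rule coconvex_set_scale(1)[OF C D(1)]) (use hI[OF that] in auto)
  have gE: "(\<lambda>x. s (h i) *\<^sub>R x) ` g (h i) = C - (?E i \<union> {0})" if "i \<le> n" for i
    by (subst D(2)[OF hI(1)[OF that]], rule coconvex_set_scale(2)[OF C D(1)]) (use hI[OF that] in auto)
  have law: "\<forall>n v c. (\<forall>i\<le>n. v i \<in> \<Omega> \<and> c i > 0) \<and> (\<Sum>i\<le>n. c i *\<^sub>R v i) \<in> \<Omega> \<longrightarrow>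
        g (\<Sum>i\<le>n. c i *\<^sub>R v i) = coconvex_sum C (\<lambda>i. (\<lambda>x. c i *\<^sub>R x) ` g (v i)) n"
    using fam by (simp add: linear_family_def)
  have "g (\<Sum>j\<in>J. s j *\<^sub>R j) = coconvex_sum C (\<lambda>i. (\<lambda>x. s (h i) *\<^sub>R x) ` g (h i)) n"
    unfolding xs using law[rule_format, of n h "\<lambda>i. s (h i)"] hI x xs by simp
  also have "\<dots> = C - (msum {..n} (\<lambda>_. 1) ?E \<union> {0})" by (rule coconvex_sum_eq[OF C dim E gE])
  finally have "coconvex_delta C (g (\<Sum>j\<in>J. s j *\<^sub>R j)) = coconvex_delta C (C - (msum {..n} (\<lambda>_. 1) ?E \<union> {0}))" by simp
  also have "\<dots> = msum {..n} (\<lambda>_. 1) ?E"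
    by (intro coconvex_delta_eq coconvex_set_msum C dim E) auto
  also have "\<dots> = msum I s ?D" by (rule msum_reindex[OF h])
  also have "\<dots> = msum J s ?D"
    by (rule msum_support[OF J(1) I(2) s0]) (use coconvex_set_nonempty[OF C D(1)] J(2) in auto)
  finally show ?thesis .
qed

lemma linear_family_covolume_form:
  fixes C :: "'a::euclidean_space set" and \<Omega> :: "'v::real_vector set"
  assumes C: "pointed_cone C" and dim: "DIM('a) = Suc (Suc m)" and fam: "linear_family C \<Omega> g"
    and J: "finite J" "J \<subseteq> \<Omega>"
  obtains p where "interpolates \<Omega> (\<lambda>v. measure lebesgue (g v)) (Suc (Suc m)) J p"
    and "\<And>i j \<mu>. i \<in> J \<Longrightarrow> j \<in> J \<Longrightarrow> (\<And>k. k < m \<Longrightarrow> \<mu> k \<in> J) \<Longrightarrow>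
       polar (Suc (Suc m)) p (\<lambda>k. if k < m then unit_coord (\<mu> k) else (\<lambda>l. unit_coord i l - unit_coord j l)) \<ge> 0"
proof -
  let ?D = "\<lambda>v. coconvex_delta C (g v)"
  note D = linear_family_delta[OF C fam]
  obtain p where p: "hform (Suc (Suc m)) J p"
    "\<And>s. (\<And>j. j \<in> J \<Longrightarrow> s j \<ge> 0) \<Longrightarrow> sum s J > 0 \<Longrightarrow> p s = measure lebesgue (C - msum J s ?D)"
    "\<And>i j \<mu>. i \<in> J \<Longrightarrow> j \<in> J \<Longrightarrow> (\<And>k. k < m \<Longrightarrow> \<mu> k \<in> J) \<Longrightarrow>
       polar (Suc (Suc m)) p (\<lambda>k. if k < m then unit_coord (\<mu> k) else (\<lambda>l. unit_coord i l - unit_coord j l)) \<ge> 0"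
    by (rule covolume_form[OF C dim J(1), of ?D]) (use D(1) J(2) in \<open>auto simp: coconvex_set_def\<close>)
  \<comment> \<open>The body omits the apex, which is a null set.\<close>
  have vol: "measure lebesgue (C - ?D v) = measure lebesgue (g v)" if v: "v \<in> \<Omega>" for v
  proof -
    have "C - ?D v \<in> sets borel"
      using D(1)[OF v] pointed_coneD(1)[OF C] by (auto simp: coconvex_set_def cofinite_convex_def)
    then have "measure lebesgue ((C - ?D v) - {0}) = measure lebesgue (C - ?D v)"
      by (intro measure_Diff_null_set) (auto simp flip: negligible_iff_null_sets)
    moreover have "(C - ?D v) - {0} = g v" using D(2)[OF v] by auto
    ultimately show ?thesis by simp
  qed
  have "p s = measure lebesgue (g (\<Sum>j\<in>J. s j *\<^sub>R j))"
    if s: "\<And>j. j \<in> J \<Longrightarrow> s j \<ge> 0" "sum s J > 0" and x: "(\<Sum>j\<in>J. s j *\<^sub>R j) \<in> \<Omega>" for s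
  proof -
    have "msum J s ?D = ?D (\<Sum>j\<in>J. s j *\<^sub>R j)"
      by (rule linear_family_msum[OF C _ fam J s x, symmetric]) (use dim in auto)
    moreover have "p s = measure lebesgue (C - msum J s ?D)" by (rule p(2)) (use s in auto)
    ultimately show ?thesis using vol[OF x] by simp
  qed
  then have "interpolates \<Omega> (\<lambda>v. measure lebesgue (g v)) (Suc (Suc m)) J p"
    using p(1) unfolding interpolates_def by blast
  then show thesis using p(3) by (rule that)
qed

section \<open>The quadratic form on the parameter space\<close>

lemma semidefinite_Cauchy_Schwarz:
  fixes B :: "'v::real_vector \<Rightarrow> 'v \<Rightarrow> real"
  assumes lin: "\<And>\<alpha> \<beta> x y z. B (\<alpha> *\<^sub>R x + \<beta> *\<^sub>R y) z = \<alpha> * B x z + \<beta> * B y z"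
    and sym: "\<And>x y. B x y = B y x" and nonneg: "\<And>x. B x x \<ge> 0"
  shows "(B x y)\<^sup>2 \<le> B x x * B y y"
proof -
  have q: "0 \<le> s\<^sup>2 * B x x + 2 * s * t * B x y + t\<^sup>2 * B y y" for s t
  proof -
    have "B (s *\<^sub>R x + t *\<^sub>R y) (s *\<^sub>R x + t *\<^sub>R y) = s * B (s *\<^sub>R x + t *\<^sub>R y) x + t * B (s *\<^sub>R x + t *\<^sub>R y) y"
      using lin[of s x t y "s *\<^sub>R x + t *\<^sub>R y"] sym[of x "s *\<^sub>R x + t *\<^sub>R y"] sym[of y "s *\<^sub>R x + t *\<^sub>R y"] by simp
    also have "\<dots> = s\<^sup>2 * B x x + 2 * s * t * B x y + t\<^sup>2 * B y y"
      unfolding lin sym[of y x] by (simp add: power2_eq_square algebra_simps)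
    finally show ?thesis using nonneg[of "s *\<^sub>R x + t *\<^sub>R y"] by simp
  qed
  show ?thesis
  proof (cases "B y y = 0")
    case True
    have "B x y = 0"
    proof (rule ccontr)
      assume "B x y \<noteq> 0"
      \<comment> \<open>With \<open>B y y = 0\<close> the form is affine in the second coefficient,
        and here it takes the value -1.\<close>
      then show False using q[of 1 "- (B x x + 1) / (2 * B x y)"] True by (simp add: field_simps)
    qed
    then show ?thesis using True by simp
  next
    case False
    have "0 \<le> B y y * (B x x * B y y - (B x y)\<^sup>2)"
      using q[of "B y y" "- B x y"] by (simp add: power2_eq_square algebra_simps)
    then show ?thesis using False nonneg[of y] by (simp add: zero_le_mult_iff)
  qed
qed

theorem theoremA:
  fixes C :: "'a::euclidean_space set"
    and \<Omega> :: "'v::real_vector set"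
    and g :: "'v \<Rightarrow> 'a set"
    and vs :: "'v list"
  assumes "DIM('a) \<ge> 2"
    and "closed C" and "strictly_convex_cone C" and "interior C \<noteq> {}"
    and "linear_family C \<Omega> g" and "\<Omega> \<noteq> {}"
    and "length vs = DIM('a) - 2" and "set vs \<subseteq> \<Omega>"
  shows "(\<forall>u. coconvex_Q \<Omega> g vs u \<ge> 0) \<and>
         (\<forall>u\<^sub>1 u\<^sub>2. (coconvex_B \<Omega> g vs u\<^sub>1 u\<^sub>2)\<^sup>2
                  \<le> coconvex_B \<Omega> g vs u\<^sub>1 u\<^sub>1 * coconvex_B \<Omega> g vs u\<^sub>2 u\<^sub>2)"
proof -
  define m where "m = length vs"
  let ?d = "Suc (Suc m)"
  have dim: "DIM('a) = ?d" using assms(1,7) by (simp add: m_def)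
  have C: "pointed_cone C" by (rule pointed_cone_strictly_convex[OF assms(2-4)])
  note fam = assms(5)
  have op: "finitely_open \<Omega>" using fam by (simp add: linear_family_def)
  obtain w where w: "w \<in> \<Omega>" using assms(6) by blast
  have forms: "\<exists>p. interpolates \<Omega> (\<lambda>v. measure lebesgue (g v)) ?d J p" if "finite J" "J \<subseteq> \<Omega>" for J
    by (rule linear_family_covolume_form[OF C dim fam that]) blast
  obtain P where P: "polynomial_form ?d P" "\<And>v. v \<in> \<Omega> \<Longrightarrow> P v = measure lebesgue (g v)"
    "\<And>J p t. finite J \<Longrightarrow> w \<in> J \<Longrightarrow> J \<subseteq> \<Omega> \<Longrightarrow> interpolates \<Omega> (\<lambda>v. measure lebesgue (g v)) ?d J p \<Longrightarrow> P (\<Sum>j\<in>J. t j *\<^sub>R j) = p t"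
    by (rule polynomial_extension[OF op w forms]) blast+
  have vol: "vol_poly \<Omega> g = P"
    unfolding vol_poly_def dim
  proof (rule the_equality)
    show "homogeneous_polynomial ?d P \<and> (\<forall>v\<in>\<Omega>. P v = measure lebesgue (g v))"
      using P polynomial_form_homogeneous_polynomial by blast
    fix P' assume P': "homogeneous_polynomial ?d P' \<and> (\<forall>v\<in>\<Omega>. P' v = measure lebesgue (g v))"
    then show "P' = P"
      by (intro polynomial_form_unique[OF op w _ P(1)] homogeneous_polynomial_form) (auto simp: P(2))
  qed
  \<comment> \<open>The list fills all \<open>d\<close> slots, so the iterated derivative is the
    full polarization and does not depend on the base point; it is \<open>d!\<close> times the form
    in question.\<close>
  define B where "B = (\<lambda>x y. vpolar ?d P (\<lambda>i. (x # y # vs) ! i))"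
  have B_eq: "coconvex_B \<Omega> g vs x y = B x y / fact ?d" for x y
  proof -
    have "foldr dir_deriv (x # y # vs) P 0 = B x y"
      using iterated_dir_deriv[OF P(1), of "x # y # vs" 0] by (simp add: m_def B_def del: foldr.simps)
    then show ?thesis by (simp add: coconvex_B_def vol dim del: fact_Suc)
  qed
  have lin: "B (\<alpha> *\<^sub>R x + \<beta> *\<^sub>R y) z = \<alpha> * B x z + \<beta> * B y z" for \<alpha> \<beta> x y z
  proof -
    have eq: "(\<lambda>i. (t # z # vs) ! i) = (\<lambda>i. (0 # z # vs) ! i)(0 := t)" for t
      by (auto simp: fun_eq_iff nth_Cons split: nat.split)
    show ?thesis
      unfolding B_def eq[of "\<alpha> *\<^sub>R x + \<beta> *\<^sub>R y"] eq[of x] eq[of y] by (rule vpolar_linear[OF P(1)]) simp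
  qed
  have sym: "B x y = B y x" for x y
  proof -
    have "(\<lambda>i. (x # y # vs) ! i) \<circ> Transposition.transpose 0 1 = (\<lambda>i. (y # x # vs) ! i)"
      by (auto simp: fun_eq_iff Transposition.transpose_def nth_Cons split: nat.split)
    moreover have "Transposition.transpose 0 (1::nat) permutes {..<?d}" by (rule permutes_swap_id) auto
    ultimately show ?thesis
      unfolding B_def using vpolar_perm[OF P(1), of "Transposition.transpose 0 1" "\<lambda>i. (x # y # vs) ! i"] by simp
  qed
  have nonneg: "B u u \<ge> 0" for u
  proof -
    obtain \<epsilon> where "\<epsilon> > 0" "\<forall>r. \<bar>r\<bar> < \<epsilon> \<longrightarrow> w + r *\<^sub>R u \<in> \<Omega>" using finitely_open_line[OF op w, of u] by blast
    then obtain r where r: "r > 0" "w + r *\<^sub>R u \<in> \<Omega>" by (intro that[of "\<epsilon> / 2"]) auto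
    define v where "v = w + r *\<^sub>R u"
    define J where "J = {w, v} \<union> set vs"
    have J: "finite J" "w \<in> J" "v \<in> J" "J \<subseteq> \<Omega>" using w r assms(8) by (auto simp: J_def v_def)
    have vsJ: "vs ! k \<in> J" if "k < m" for k using that by (auto simp: J_def m_def)
    obtain p where p: "interpolates \<Omega> (\<lambda>v. measure lebesgue (g v)) ?d J p"
      "\<And>i j \<mu>. i \<in> J \<Longrightarrow> j \<in> J \<Longrightarrow> (\<And>k. k < m \<Longrightarrow> \<mu> k \<in> J) \<Longrightarrow>
       polar ?d p (\<lambda>k. if k < m then unit_coord (\<mu> k) else (\<lambda>l. unit_coord i l - unit_coord j l)) \<ge> 0"
      by (rule linear_family_covolume_form[OF C dim fam J(1,4)]) blast
    have "0 \<le> polar ?d p (\<lambda>k. if k < m then unit_coord (vs ! k) else (\<lambda>l. unit_coord v l - unit_coord w l))"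
      by (rule p(2)[OF J(3,2) vsJ])
    also have "\<dots> = vpolar ?d P (\<lambda>k. if k < m then vs ! k else r *\<^sub>R u)"
    proof (rule vpolar_coordinates[where P=P and X=J, symmetric])
      show "P (\<Sum>j\<in>J. t j *\<^sub>R j) = p t" for t by (rule P(3)[OF J(1,2,4) p(1)])
      fix k
      have "(\<Sum>l\<in>J. (unit_coord v l - unit_coord w l) *\<^sub>R l) = r *\<^sub>R u"
        by (simp add: scaleR_diff_left sum_subtractf sum_unit_coord_scaleR[OF J(1)] J(2,3)) (simp add: v_def)
      then show "(if k < m then vs ! k else r *\<^sub>R u)
          = (\<Sum>y\<in>J. (if k < m then unit_coord (vs ! k) else (\<lambda>l. unit_coord v l - unit_coord w l)) y *\<^sub>R y)"
        using sum_unit_coord_scaleR[OF J(1) vsJ] by simp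
    qed
    also have "\<dots> = B (r *\<^sub>R u) (r *\<^sub>R u)"
    proof -
      let ?u = "r *\<^sub>R u"
      \<comment> \<open>Moves the marked points from slots 2 onward to the first \<open>m\<close>
        slots, where the covolume form expects them, and the two copies of \<open>?u\<close> to the
        end.\<close>
      define \<pi> where "\<pi> = (\<lambda>i. if i < m then i + 2 else if i < ?d then i - m else i)"
      have "bij_betw \<pi> {..<?d} {..<?d}"
        by (rule bij_betw_byWitness[where f'="\<lambda>i. if i < 2 then i + m else if i < ?d then i - 2 else i"]) (auto simp: \<pi>_def)
      then have "\<pi> permutes {..<?d}" by (rule bij_imp_permutes) (auto simp: \<pi>_def)
      then have "B ?u ?u = vpolar ?d P ((\<lambda>i. (?u # ?u # vs) ! i) \<circ> \<pi>)" unfolding B_def by (rule vpolar_perm[OF P(1), symmetric])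
      also have "\<dots> = vpolar ?d P (\<lambda>k. if k < m then vs ! k else ?u)"
        unfolding vpolar_def
      proof (intro sum.cong refl arg_cong2[where f="(*)"] arg_cong[where f=P])
        fix I i assume I: "I \<in> Pow {..<?d}" "i \<in> I"
        then have "i < ?d" by auto
        then consider "i < m" | "i = m" | "i = Suc m" by linarith
        then show "((\<lambda>i. (?u # ?u # vs) ! i) \<circ> \<pi>) i = (if i < m then vs ! i else ?u)"
          by cases (auto simp: \<pi>_def)
      qed
      finally show ?thesis ..
    qed
    also have "\<dots> = r\<^sup>2 * B u u"
    proof -
      have "B (r *\<^sub>R x) y = r * B x y" for x y using lin[of r x 0 0 y] by simp
      then show ?thesis using sym[of u "r *\<^sub>R u"] by (simp add: power2_eq_square)
    qed
    finally show ?thesis using r(1) by (simp add: zero_le_mult_iff)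
  qed
  have "(B x y / fact ?d)\<^sup>2 \<le> B x x / fact ?d * (B y y / fact ?d)" for x y
    using semidefinite_Cauchy_Schwarz[OF lin sym nonneg, of x y]
    by (simp add: power_divide power2_eq_square divide_right_mono del: fact_Suc)
  then show ?thesis using nonneg unfolding coconvex_Q_def B_eq by simp
qed

end
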